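(* Let $(R,\mathfrak m)$ be a commutative Noetherian local ring of dimension $d$, let $M$ be a finitely generated $R$-module with $\operatorname{pd}_R(M)<\infty$, and let $N$ be a finitely generated $R$-module that is torsion-free and locally free on the punctured spectrum. Then $\operatorname{Ext}^d_R(M,N)$ has finite length.
   Context: The punctured spectrum is $\operatorname{Spec}(R)\setminus\{\mathfrak m\}$; $N$ is locally free on it if $N_{\mathfrak p}$ is a free $R_{\mathfrak p}$-module for every prime $\mathfrak p\ne\mathfrak m$. A module is torsion-free if every nonzerodivisor of $R$ acts injectively on it. *)

theory Defs
  imports "HOL-Algebra.Module" "HOL-Algebra.Ring_Divisibility" "HOL-Library.Extended_Nat"
begin

text \<open>
  Rings and modules are the carrier-based structures of HOL-Algebra. The record type of modules
  extends that of rings; the fields \<open>mult\<close> and \<open>one\<close> of a module are irrelevant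
  and are filled with \<open>undefined\<close> below.
\<close>

section \<open>Local rings and Krull dimension\<close>

definition local_ring :: "('r, 'x) ring_scheme \<Rightarrow> 'r set \<Rightarrow> bool" where
  "local_ring R \<mm> \<longleftrightarrow> cring R \<and> maximalideal \<mm> R \<and> (\<forall>J. maximalideal J R \<longrightarrow> J = \<mm>)"

definition prime_chain :: "('r, 'x) ring_scheme \<Rightarrow> nat \<Rightarrow> (nat \<Rightarrow> 'r set) \<Rightarrow> bool" where
  "prime_chain R n C \<longleftrightarrow> (\<forall>i\<le>n. primeideal (C i) R) \<and> (\<forall>i<n. C i \<subset> C (Suc i))"

definition krull_dim :: "('r, 'x) ring_scheme \<Rightarrow> enat" where
  "krull_dim R = Sup {enat n | n. \<exists>C. prime_chain R n C}"

section \<open>Modules\<close>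

definition lin_span :: "('r, 'x) ring_scheme \<Rightarrow> ('r, 'm, 'y) module_scheme \<Rightarrow> 'm set \<Rightarrow> 'm set" where
  "lin_span R M B =
     {(\<Oplus>\<^bsub>M\<^esub>v\<in>A. a v \<odot>\<^bsub>M\<^esub> v) | A a. finite A \<and> A \<subseteq> B \<and> a \<in> A \<rightarrow> carrier R}"

definition lin_indep :: "('r, 'x) ring_scheme \<Rightarrow> ('r, 'm, 'y) module_scheme \<Rightarrow> 'm set \<Rightarrow> bool" where
  "lin_indep R M B \<longleftrightarrow>
     (\<forall>A a. finite A \<and> A \<subseteq> B \<and> a \<in> A \<rightarrow> carrier R \<and> (\<Oplus>\<^bsub>M\<^esub>v\<in>A. a v \<odot>\<^bsub>M\<^esub> v) = \<zero>\<^bsub>M\<^esub>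
        \<longrightarrow> (\<forall>v\<in>A. a v = \<zero>\<^bsub>R\<^esub>))"

definition fin_gen_module :: "('r, 'x) ring_scheme \<Rightarrow> ('r, 'm, 'y) module_scheme \<Rightarrow> bool" where
  "fin_gen_module R M \<longleftrightarrow>
     module R M \<and> (\<exists>B\<subseteq>carrier M. finite B \<and> lin_span R M B = carrier M)"

definition free_module :: "('r, 'x) ring_scheme \<Rightarrow> ('r, 'm, 'y) module_scheme \<Rightarrow> bool" where
  "free_module R M \<longleftrightarrow>
     module R M \<and> (\<exists>B\<subseteq>carrier M. lin_span R M B = carrier M \<and> lin_indep R M B)"

definition nonzerodivisor :: "('r, 'x) ring_scheme \<Rightarrow> 'r \<Rightarrow> bool" where
  "nonzerodivisor R r \<longleftrightarrow> r \<in> carrier R \<and> (\<forall>s\<in>carrier R. r \<otimes>\<^bsub>R\<^esub> s = \<zero>\<^bsub>R\<^esub> \<longrightarrow> s = \<zero>\<^bsub>R\<^esub>)"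

definition torsion_free_module :: "('r, 'x) ring_scheme \<Rightarrow> ('r, 'm, 'y) module_scheme \<Rightarrow> bool" where
  "torsion_free_module R M \<longleftrightarrow>
     (\<forall>r. nonzerodivisor R r \<longrightarrow> inj_on (\<lambda>x. r \<odot>\<^bsub>M\<^esub> x) (carrier M))"

text \<open>Existence of a composition series.\<close>

definition finite_length :: "('r, 'x) ring_scheme \<Rightarrow> ('r, 'm, 'y) module_scheme \<Rightarrow> bool" where
  "finite_length R M \<longleftrightarrow>
     (\<exists>n C. C 0 = {\<zero>\<^bsub>M\<^esub>} \<and> C n = carrier M \<and> (\<forall>i\<le>n. submodule (C i) R M) \<and>
        (\<forall>i<n. C i \<subset> C (Suc i) \<and>
           \<not> (\<exists>K. submodule K R M \<and> C i \<subset> K \<and> K \<subset> C (Suc i))))"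

definition lin_maps ::
  "('r, 'x) ring_scheme \<Rightarrow> ('r, 'm, 'y) module_scheme \<Rightarrow> ('r, 'n, 'z) module_scheme \<Rightarrow>
   ('m \<Rightarrow> 'n) set" where
  "lin_maps R M N =
     {f \<in> carrier M \<rightarrow> carrier N.
        (\<forall>x\<in>carrier M. \<forall>y\<in>carrier M. f (x \<oplus>\<^bsub>M\<^esub> y) = f x \<oplus>\<^bsub>N\<^esub> f y) \<and>
        (\<forall>r\<in>carrier R. \<forall>x\<in>carrier M. f (r \<odot>\<^bsub>M\<^esub> x) = r \<odot>\<^bsub>N\<^esub> f x)}"

text \<open>\<open>M / K\<close>, as a set of cosets; \<open>r\<close> acts by \<open>x + K \<mapsto> r x + K\<close>.\<close>

definition quot_module :: "('r, 'm, 'y) module_scheme \<Rightarrow> 'm set \<Rightarrow> ('r, 'm set) module" where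
  "quot_module M K =
     \<lparr>carrier = a_rcosets\<^bsub>M\<^esub> K, monoid.mult = undefined, one = undefined,
      zero = K, add = set_add M,
      smult = (\<lambda>r A. \<Union>x\<in>A. a_r_coset M K (r \<odot>\<^bsub>M\<^esub> x))\<rparr>"

text \<open>Maps are made extensional outside the carrier, so that equality of elements is equality of maps.\<close>

definition hom_module ::
  "('r, 'x) ring_scheme \<Rightarrow> ('r, 'm, 'y) module_scheme \<Rightarrow> ('r, 'n, 'z) module_scheme \<Rightarrow>
   ('r, 'm \<Rightarrow> 'n) module" where
  "hom_module R M N =
     \<lparr>carrier = lin_maps R M N \<inter> extensional (carrier M), monoid.mult = undefined, one = undefined,
      zero = (\<lambda>x\<in>carrier M. \<zero>\<^bsub>N\<^esub>),
      add = (\<lambda>f g. \<lambda>x\<in>carrier M. f x \<oplus>\<^bsub>N\<^esub> g x),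
      smult = (\<lambda>r f. \<lambda>x\<in>carrier M. r \<odot>\<^bsub>N\<^esub> f x)\<rparr>"

section \<open>Localization\<close>

text \<open>
  For a multiplicative set \<open>S\<close>, the fraction \<open>x / s\<close> is the class of \<open>(x, s)\<close> under
  \<open>(x, s) \<sim> (y, t)\<close> iff \<open>u t x = u s y\<close> for some \<open>u \<in> S\<close>. Operations on classes are given
  by unions over representatives; these are unions of equal sets, as in
  \<^theory>\<open>HOL.Equiv_Relations\<close>.
\<close>

definition ring_fraction :: "('r, 'x) ring_scheme \<Rightarrow> 'r set \<Rightarrow> 'r \<Rightarrow> 'r \<Rightarrow> ('r \<times> 'r) set" where
  "ring_fraction R S r s =
     {(q, t). q \<in> carrier R \<and> t \<in> S \<and>
        (\<exists>u\<in>S. u \<otimes>\<^bsub>R\<^esub> (t \<otimes>\<^bsub>R\<^esub> r) = u \<otimes>\<^bsub>R\<^esub> (s \<otimes>\<^bsub>R\<^esub> q))}"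

definition ring_localization :: "('r, 'x) ring_scheme \<Rightarrow> 'r set \<Rightarrow> ('r \<times> 'r) set ring" where
  "ring_localization R S =
     \<lparr>carrier = {ring_fraction R S r s | r s. r \<in> carrier R \<and> s \<in> S},
      monoid.mult = (\<lambda>A B. \<Union>(r, s)\<in>A. \<Union>(q, t)\<in>B. ring_fraction R S (r \<otimes>\<^bsub>R\<^esub> q) (s \<otimes>\<^bsub>R\<^esub> t)),
      one = ring_fraction R S \<one>\<^bsub>R\<^esub> \<one>\<^bsub>R\<^esub>,
      zero = ring_fraction R S \<zero>\<^bsub>R\<^esub> \<one>\<^bsub>R\<^esub>,
      add = (\<lambda>A B. \<Union>(r, s)\<in>A. \<Union>(q, t)\<in>B.
               ring_fraction R S (t \<otimes>\<^bsub>R\<^esub> r \<oplus>\<^bsub>R\<^esub> s \<otimes>\<^bsub>R\<^esub> q) (s \<otimes>\<^bsub>R\<^esub> t))\<rparr>"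

definition module_fraction ::
  "('r, 'm, 'y) module_scheme \<Rightarrow> 'r set \<Rightarrow> 'm \<Rightarrow> 'r \<Rightarrow> ('m \<times> 'r) set" where
  "module_fraction M S x s =
     {(y, t). y \<in> carrier M \<and> t \<in> S \<and>
        (\<exists>u\<in>S. u \<odot>\<^bsub>M\<^esub> (t \<odot>\<^bsub>M\<^esub> x) = u \<odot>\<^bsub>M\<^esub> (s \<odot>\<^bsub>M\<^esub> y))}"

definition module_localization ::
  "('r, 'x) ring_scheme \<Rightarrow> ('r, 'm, 'y) module_scheme \<Rightarrow> 'r set \<Rightarrow>
   (('r \<times> 'r) set, ('m \<times> 'r) set) module"
  where
  "module_localization R M S =
     \<lparr>carrier = {module_fraction M S x s | x s. x \<in> carrier M \<and> s \<in> S},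
      monoid.mult = undefined, one = undefined,
      zero = module_fraction M S \<zero>\<^bsub>M\<^esub> \<one>\<^bsub>R\<^esub>,
      add = (\<lambda>A B. \<Union>(x, s)\<in>A. \<Union>(y, t)\<in>B.
               module_fraction M S (t \<odot>\<^bsub>M\<^esub> x \<oplus>\<^bsub>M\<^esub> s \<odot>\<^bsub>M\<^esub> y) (s \<otimes>\<^bsub>R\<^esub> t)),
      smult = (\<lambda>A B. \<Union>(r, s)\<in>A. \<Union>(y, t)\<in>B.
               module_fraction M S (r \<odot>\<^bsub>M\<^esub> y) (s \<otimes>\<^bsub>R\<^esub> t))\<rparr>"

definition locally_free_at :: "('r, 'x) ring_scheme \<Rightarrow> ('r, 'm, 'y) module_scheme \<Rightarrow> 'r set \<Rightarrow> bool" where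
  "locally_free_at R N \<pp> \<longleftrightarrow>
     free_module (ring_localization R (carrier R - \<pp>))
       (module_localization R N (carrier R - \<pp>))"

definition locally_free_on_punctured_spectrum ::
  "('r, 'x) ring_scheme \<Rightarrow> 'r set \<Rightarrow> ('r, 'm, 'y) module_scheme \<Rightarrow> bool" where
  "locally_free_on_punctured_spectrum R \<mm> N \<longleftrightarrow>
     (\<forall>\<pp>. primeideal \<pp> R \<and> \<pp> \<noteq> \<mm> \<longrightarrow> locally_free_at R N \<pp>)"

section \<open>Projective resolutions, projective dimension and Ext\<close>

text \<open>
  A projective module is a direct summand (equivalently, a retract) of a free module. The type of the
  free module is no restriction: if \<open>P\<close> is a retract of any free module, then it is a
  retract of the free module of finitely supported functions \<open>carrier P \<rightarrow> R\<close>.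
\<close>

definition projective_module :: "('r, 'x) ring_scheme \<Rightarrow> ('r, 'p, 'w) module_scheme \<Rightarrow> bool" where
  "projective_module R P \<longleftrightarrow>
     module R P \<and>
     (\<exists>(F :: ('r, 'p \<Rightarrow> 'r) module) \<iota> \<pi>.
        free_module R F \<and> \<iota> \<in> lin_maps R P F \<and> \<pi> \<in> lin_maps R F P \<and>
        (\<forall>x\<in>carrier P. \<pi> (\<iota> x) = x))"

text \<open>Exactness of \<open>\<dots> \<rightarrow> P\<^sub>2 \<rightarrow> P\<^sub>1 \<rightarrow> P\<^sub>0 \<rightarrow> M \<rightarrow> 0\<close>, where \<open>\<delta> i\<close> maps \<open>P (i + 1)\<close> to \<open>P i\<close>.\<close>

definition projective_resolution ::
  "('r, 'x) ring_scheme \<Rightarrow> ('r, 'm, 'y) module_scheme \<Rightarrow>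
   (nat \<Rightarrow> ('r, 'p, 'w) module_scheme) \<Rightarrow> (nat \<Rightarrow> 'p \<Rightarrow> 'p) \<Rightarrow> ('p \<Rightarrow> 'm) \<Rightarrow> bool" where
  "projective_resolution R M P \<delta> \<epsilon> \<longleftrightarrow>
     (\<forall>i. projective_module R (P i)) \<and>
     (\<forall>i. \<delta> i \<in> lin_maps R (P (Suc i)) (P i)) \<and>
     \<epsilon> \<in> lin_maps R (P 0) M \<and>
     \<epsilon> ` carrier (P 0) = carrier M \<and>
     \<delta> 0 ` carrier (P (Suc 0)) = a_kernel (P 0) M \<epsilon> \<and>
     (\<forall>i. \<delta> (Suc i) ` carrier (P (Suc (Suc i))) = a_kernel (P (Suc i)) (P i) (\<delta> i))"

text \<open>
  A type of elements that is large enough for resolutions of arbitrary \<open>R\<close>-modules \<open>M\<close>, where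
  \<open>'r\<close> and \<open>'m\<close> are the types of elements of \<open>R\<close> and \<open>M\<close>. Let \<open>X\<close> be the infinite type
  \<open>'m + 'r + nat\<close>. There are at most \<open>|X|\<close> finitely supported functions \<open>X \<rightarrow> R\<close>, so
  \<open>M\<close> and all kernels that arise successively are quotients of the free modules on subsets of \<open>X\<close>.
  Stopping at the \<open>n\<close>-th kernel gives, by Schanuel's lemma, a projective resolution of
  length \<open>n\<close> whenever one exists over any type.
\<close>

type_synonym ('r, 'm) res_elem = "'m + 'r + nat \<Rightarrow> 'r"

text \<open>The infimum of the empty set is \<open>\<infinity>\<close>.\<close>

definition proj_dim :: "('r, 'x) ring_scheme \<Rightarrow> ('r, 'm, 'y) module_scheme \<Rightarrow> enat" where
  "proj_dim R M =
     Inf {enat n | n.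
       \<exists>(P :: nat \<Rightarrow> ('r, ('r, 'm) res_elem) module) \<delta> \<epsilon>.
         projective_resolution R M P \<delta> \<epsilon> \<and> (\<forall>i>n. carrier (P i) = {\<zero>\<^bsub>P i\<^esub>})}"

text \<open>
  The cochain complex \<open>Hom(P, N)\<close>: its \<open>i\<close>-th coboundary \<open>Hom(P i, N) \<rightarrow> Hom(P (i + 1), N)\<close>
  is composition with \<open>\<delta> i\<close>.
\<close>

definition hom_coboundary ::
  "(nat \<Rightarrow> ('r, 'p, 'w) module_scheme) \<Rightarrow> (nat \<Rightarrow> 'p \<Rightarrow> 'p) \<Rightarrow> nat \<Rightarrow> ('p \<Rightarrow> 'n) \<Rightarrow> ('p \<Rightarrow> 'n)" where
  "hom_coboundary P \<delta> i f = compose (carrier (P (Suc i))) f (\<delta> i)"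

definition hom_cocycles ::
  "('r, 'x) ring_scheme \<Rightarrow> (nat \<Rightarrow> ('r, 'p, 'w) module_scheme) \<Rightarrow> (nat \<Rightarrow> 'p \<Rightarrow> 'p) \<Rightarrow>
   ('r, 'n, 'z) module_scheme \<Rightarrow> nat \<Rightarrow> ('p \<Rightarrow> 'n) set" where
  "hom_cocycles R P \<delta> N i =
     a_kernel (hom_module R (P i) N) (hom_module R (P (Suc i)) N) (hom_coboundary P \<delta> i)"

definition hom_coboundaries ::
  "('r, 'x) ring_scheme \<Rightarrow> (nat \<Rightarrow> ('r, 'p, 'w) module_scheme) \<Rightarrow> (nat \<Rightarrow> 'p \<Rightarrow> 'p) \<Rightarrow>
   ('r, 'n, 'z) module_scheme \<Rightarrow> nat \<Rightarrow> ('p \<Rightarrow> 'n) set" where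
  "hom_coboundaries R P \<delta> N i =
     (case i of
        0 \<Rightarrow> {\<zero>\<^bsub>hom_module R (P 0) N\<^esub>}
      | Suc j \<Rightarrow> hom_coboundary P \<delta> j ` carrier (hom_module R (P j) N))"

definition hom_cohomology ::
  "('r, 'x) ring_scheme \<Rightarrow> (nat \<Rightarrow> ('r, 'p, 'w) module_scheme) \<Rightarrow> (nat \<Rightarrow> 'p \<Rightarrow> 'p) \<Rightarrow>
   ('r, 'n, 'z) module_scheme \<Rightarrow> nat \<Rightarrow> ('r, ('p \<Rightarrow> 'n) set) module" where
  "hom_cohomology R P \<delta> N i =
     quot_module ((hom_module R (P i) N)\<lparr>carrier := hom_cocycles R P \<delta> N i\<rparr>)
       (hom_coboundaries R P \<delta> N i)"

text \<open>
  \<open>Ext\<close> is the cohomology of \<open>Hom(P, N)\<close> for a chosen projective resolution \<open>P\<close> of \<open>M\<close>; up to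
  isomorphism it does not depend on the choice.
\<close>

definition Ext ::
  "('r, 'x) ring_scheme \<Rightarrow> nat \<Rightarrow> ('r, 'm, 'y) module_scheme \<Rightarrow> ('r, 'n, 'z) module_scheme \<Rightarrow>
   ('r, (('r, 'm) res_elem \<Rightarrow> 'n) set) module" where
  "Ext R i M N =
     (let (P, \<delta>) = (SOME (P :: nat \<Rightarrow> ('r, ('r, 'm) res_elem) module, \<delta>).
            \<exists>\<epsilon>. projective_resolution R M P \<delta> \<epsilon>)
      in hom_cohomology R P \<delta> N i)"

end

theory Submission
  imports Defs
begin

text \<open>
  Let \<open>d \<ge> 1\<close> (for \<open>d = 0\<close> the maximal ideal is the only prime) and let \<open>p\<close> be a prime other
  than the maximal ideal, so that \<open>R\<^sub>p\<close> has dimension less than \<open>d\<close>. A finite free resolution of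
  \<open>M\<close>, localized at \<open>p\<close>, splits eventually because \<open>M\<close> has finite projective dimension, and the
  argument of Auslander and Buchsbaum shows that its dual has no cohomology at the place \<open>d\<close>:
  if the maximal ideal of \<open>R\<^sub>p\<close> is associated to \<open>R\<^sub>p\<close>, the complex splits altogether, and otherwise
  one passes to \<open>R\<^sub>p / x\<close> for a regular element \<open>x\<close>, which lowers the dimension, shifts the exactness
  by one place, and loses nothing by Nakayama's lemma. As \<open>N\<^sub>p\<close> is free, \<open>Ext\<^sup>d(M, N)\<close>
  vanishes at \<open>p\<close>. Being Noetherian and locally zero outside the maximal ideal, it has finite length.

  Neither localizations nor quotients of \<open>R\<close> enter the core of the proof: \<open>(R / J)\<^sub>p\<close> is replaced by
  congruences modulo an ideal \<open>J\<close> that is saturated with respect to the complement of \<open>p\<close>.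
\<close>

text \<open>Locally, degree \<open>d\<close> exceeds the depth of the ring, so vanishing would
  follow from the Auslander-Buchsbaum formula. Depth is never introduced; vanishing itself is the
  induction statement: if a complex of finite free modules splits arbitrarily far out and is exact
  modulo \<open>J\<close> at all places above \<open>c\<close>, then its dual has no cohomology at
  the places \<open>c + n\<close> and above, once the dimension of the localized quotient is below
  \<open>n\<close>. Both \<open>J\<close> and \<open>c\<close> have to vary, because dividing by a
  regular element enlarges the ideal and destroys exactness at one place; the sum
  \<open>c + n\<close> survives this. A second obstacle is that \<open>Ext\<close> is computed from
  an unspecified projective resolution, possibly neither finitely generated nor bounded. Three
  resolutions are therefore related by chain maps: the one behind \<open>Ext\<close>, a finite free
  one on which rows, columns and common denominators make sense, and a bounded one witnessing the
  finite projective dimension, which serves to contract the free one far out.\<close>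

section \<open>Submodules and finite sums\<close>

lemma (in module) submoduleI':
  assumes "H \<subseteq> carrier M" "\<zero>\<^bsub>M\<^esub> \<in> H"
    and add: "\<And>a b. \<lbrakk>a \<in> H; b \<in> H\<rbrakk> \<Longrightarrow> a \<oplus>\<^bsub>M\<^esub> b \<in> H"
    and smult: "\<And>a x. \<lbrakk>a \<in> carrier R; x \<in> H\<rbrakk> \<Longrightarrow> a \<odot>\<^bsub>M\<^esub> x \<in> H"
  shows "submodule H R M"
proof (rule submoduleI)
  fix a assume a: "a \<in> H"
  then have "(\<ominus> \<one>) \<odot>\<^bsub>M\<^esub> a \<in> H" by (intro smult) auto
  moreover have "(\<ominus> \<one>) \<odot>\<^bsub>M\<^esub> a = \<ominus>\<^bsub>M\<^esub> a"
    using a assms(1) by (subst smult_l_minus) auto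
  ultimately show "\<ominus>\<^bsub>M\<^esub> a \<in> H" by simp
qed (use assms in auto)

lemma (in module) submodule_zero: "submodule H R M \<Longrightarrow> \<zero>\<^bsub>M\<^esub> \<in> H"
  using subgroup.one_closed[OF submodule.axioms(1)] by fastforce

lemma (in module) submodule_finsum:
  assumes H: "submodule H R M" and f: "f \<in> A \<rightarrow> H"
  shows "(\<Oplus>\<^bsub>M\<^esub>i\<in>A. f i) \<in> H"
proof (cases "finite A")
  case True
  then show ?thesis using f
  proof (induction A)
    case empty
    then show ?case using submodule_zero[OF H] by simp
  next
    case (insert a A)
    have "f a \<in> carrier M" "f \<in> A \<rightarrow> carrier M"
      using insert.prems submoduleE(1)[OF H] by auto
    then show ?case using insert submoduleE(5)[OF H] by simp
  qed
next
  case False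
  then show ?thesis using submodule_zero[OF H] by simp
qed

lemma (in module) smult_minus_distr:
  assumes "a \<in> carrier R" "b \<in> carrier R" "x \<in> carrier M"
  shows "(a \<ominus> b) \<odot>\<^bsub>M\<^esub> x = a \<odot>\<^bsub>M\<^esub> x \<ominus>\<^bsub>M\<^esub> b \<odot>\<^bsub>M\<^esub> x"
  using assms by (simp add: a_minus_def smult_l_distr smult_l_minus)

lemma (in module) minus_eq_zero_iff:
  assumes "x \<in> carrier M" "y \<in> carrier M"
  shows "x \<ominus>\<^bsub>M\<^esub> y = \<zero>\<^bsub>M\<^esub> \<longleftrightarrow> x = y"
proof
  assume "x \<ominus>\<^bsub>M\<^esub> y = \<zero>\<^bsub>M\<^esub>"
  then have "(x \<oplus>\<^bsub>M\<^esub> \<ominus>\<^bsub>M\<^esub> y) \<oplus>\<^bsub>M\<^esub> y = y" using assms by (simp add: a_minus_def)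
  then show "x = y" using assms by (simp add: M.a_assoc M.l_neg)
qed (use assms in \<open>simp add: a_minus_def M.r_neg\<close>)

lemma (in module) submodule_minus:
  assumes "submodule H R M" "a \<in> H" "b \<in> H" shows "a \<ominus>\<^bsub>M\<^esub> b \<in> H"
  unfolding a_minus_def using submoduleE(3,5)[OF assms(1)] assms(2,3) by blast

subsection \<open>Linear maps\<close>

lemma lin_mapsI:
  assumes "\<And>x. x \<in> carrier M \<Longrightarrow> f x \<in> carrier N"
    and "\<And>x y. x \<in> carrier M \<Longrightarrow> y \<in> carrier M \<Longrightarrow> f (x \<oplus>\<^bsub>M\<^esub> y) = f x \<oplus>\<^bsub>N\<^esub> f y"
    and "\<And>r x. r \<in> carrier R \<Longrightarrow> x \<in> carrier M \<Longrightarrow> f (r \<odot>\<^bsub>M\<^esub> x) = r \<odot>\<^bsub>N\<^esub> f x"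
  shows "f \<in> lin_maps R M N"
  using assms by (auto simp: lin_maps_def)

lemma lin_mapsD:
  assumes "f \<in> lin_maps R M N"
  shows lin_closed: "x \<in> carrier M \<Longrightarrow> f x \<in> carrier N"
    and lin_add: "x \<in> carrier M \<Longrightarrow> y \<in> carrier M \<Longrightarrow> f (x \<oplus>\<^bsub>M\<^esub> y) = f x \<oplus>\<^bsub>N\<^esub> f y"
    and lin_smult: "r \<in> carrier R \<Longrightarrow> x \<in> carrier M \<Longrightarrow> f (r \<odot>\<^bsub>M\<^esub> x) = r \<odot>\<^bsub>N\<^esub> f x"
  using assms by (auto simp: lin_maps_def)

lemma lin_zero:
  assumes "module R M" "module R N" "f \<in> lin_maps R M N"
  shows "f \<zero>\<^bsub>M\<^esub> = \<zero>\<^bsub>N\<^esub>"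
proof -
  interpret M: module R M by fact
  interpret N: module R N by fact
  have "f (\<zero>\<^bsub>R\<^esub> \<odot>\<^bsub>M\<^esub> \<zero>\<^bsub>M\<^esub>) = \<zero>\<^bsub>R\<^esub> \<odot>\<^bsub>N\<^esub> f \<zero>\<^bsub>M\<^esub>"
    using assms(3) by (intro lin_smult) auto
  then show ?thesis using lin_closed[OF assms(3)] by simp
qed

lemma lin_neg:
  assumes "module R M" "module R N" "f \<in> lin_maps R M N" "x \<in> carrier M"
  shows "f (\<ominus>\<^bsub>M\<^esub> x) = \<ominus>\<^bsub>N\<^esub> f x"
proof -
  interpret M: module R M by fact
  interpret N: module R N by fact
  have "f ((\<ominus>\<^bsub>R\<^esub> \<one>\<^bsub>R\<^esub>) \<odot>\<^bsub>M\<^esub> x) = (\<ominus>\<^bsub>R\<^esub> \<one>\<^bsub>R\<^esub>) \<odot>\<^bsub>N\<^esub> f x"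
    using assms by (intro lin_smult) auto
  then show ?thesis using lin_closed[OF assms(3)] assms(4)
    by (simp add: M.smult_l_minus N.smult_l_minus)
qed

lemma lin_minus:
  assumes "module R M" "module R N" "f \<in> lin_maps R M N" "x \<in> carrier M" "y \<in> carrier M"
  shows "f (x \<ominus>\<^bsub>M\<^esub> y) = f x \<ominus>\<^bsub>N\<^esub> f y"
proof -
  interpret M: module R M by fact
  show ?thesis using assms by (simp add: a_minus_def lin_add lin_neg)
qed

lemma lin_finsum:
  assumes "module R M" "module R N" "f \<in> lin_maps R M N" "g \<in> A \<rightarrow> carrier M"
  shows "f (\<Oplus>\<^bsub>M\<^esub>i\<in>A. g i) = (\<Oplus>\<^bsub>N\<^esub>i\<in>A. f (g i))"
proof -
  interpret M: module R M by fact
  interpret N: module R N by fact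
  show ?thesis
  proof (cases "finite A")
    case True
    then show ?thesis using assms(4)
    proof (induction A)
      case empty
      then show ?case using lin_zero[OF assms(1-3)] by simp
    next
      case (insert a A)
      then have "g a \<in> carrier M" "g \<in> A \<rightarrow> carrier M" by auto
      moreover from this have "f (g a) \<in> carrier N" "(\<lambda>i. f (g i)) \<in> A \<rightarrow> carrier N"
        using lin_closed[OF assms(3)] by auto
      ultimately show ?case using insert lin_add[OF assms(3)] by simp
    qed
  next
    case False
    then show ?thesis using lin_zero[OF assms(1-3)] by simp
  qed
qed

lemma lin_id: "(\<lambda>x. x) \<in> lin_maps R M M"
  by (rule lin_mapsI) auto

lemma lin_comp:
  assumes "f \<in> lin_maps R M N" "g \<in> lin_maps R L M"
  shows "(\<lambda>x. f (g x)) \<in> lin_maps R L N"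
  using assms by (intro lin_mapsI) (auto simp: lin_mapsD)

lemma lin_maps_add:
  assumes "module R N" "f \<in> lin_maps R M N" "g \<in> lin_maps R M N"
  shows "(\<lambda>x. f x \<oplus>\<^bsub>N\<^esub> g x) \<in> lin_maps R M N"
proof -
  interpret N: module R N by fact
  show ?thesis using assms(2,3)
    by (intro lin_mapsI) (auto simp: lin_mapsD N.smult_r_distr N.M.add.m_ac)
qed

lemma lin_maps_smult:
  assumes "module R N" "f \<in> lin_maps R M N" "a \<in> carrier R"
  shows "(\<lambda>x. a \<odot>\<^bsub>N\<^esub> f x) \<in> lin_maps R M N"
proof -
  interpret N: module R N by fact
  show ?thesis using assms(2,3)
    by (intro lin_mapsI) (auto simp: lin_mapsD N.smult_r_distr N.smult_assoc1[symmetric] N.R.m_comm)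
qed

lemma lin_maps_minus:
  assumes "module R N" "f \<in> lin_maps R M N" "g \<in> lin_maps R M N"
  shows "(\<lambda>x. f x \<ominus>\<^bsub>N\<^esub> g x) \<in> lin_maps R M N"
proof -
  interpret N: module R N by fact
  have "(\<lambda>x. f x \<oplus>\<^bsub>N\<^esub> (\<ominus>\<^bsub>R\<^esub> \<one>\<^bsub>R\<^esub>) \<odot>\<^bsub>N\<^esub> g x) \<in> lin_maps R M N"
    using assms by (intro lin_maps_add lin_maps_smult) auto
  from lin_mapsD[OF this] show ?thesis
    using lin_closed[OF assms(2)] lin_closed[OF assms(3)] lin_add[OF assms(3)] lin_smult[OF assms(3)]
      N.smult_l_minus[OF N.R.one_closed]
    by (intro lin_mapsI) (auto simp: a_minus_def)
qed

lemma lin_maps_zero: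
  assumes "module R N"
  shows "(\<lambda>x. \<zero>\<^bsub>N\<^esub>) \<in> lin_maps R M N"
proof -
  interpret N: module R N by fact
  show ?thesis by (intro lin_mapsI) auto
qed

lemma lin_image_submodule:
  assumes "module R M" "module R N" "f \<in> lin_maps R M N"
  shows "submodule (f ` carrier M) R N"
proof -
  interpret M: module R M by fact
  interpret N: module R N by fact
  show ?thesis
  proof (rule N.submoduleI')
    show "\<zero>\<^bsub>N\<^esub> \<in> f ` carrier M" using lin_zero[OF assms] by force
    show "\<And>a b. a \<in> f ` carrier M \<Longrightarrow> b \<in> f ` carrier M \<Longrightarrow> a \<oplus>\<^bsub>N\<^esub> b \<in> f ` carrier M"
      using lin_add[OF assms(3)] by (auto simp: image_iff) (metis M.M.a_closed)
    show "\<And>a x. a \<in> carrier R \<Longrightarrow> x \<in> f ` carrier M \<Longrightarrow> a \<odot>\<^bsub>N\<^esub> x \<in> f ` carrier M"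
      using lin_smult[OF assms(3)] by (auto simp: image_iff) (metis M.smult_closed)
  qed (use lin_closed[OF assms(3)] in auto)
qed

lemma lin_preimage_submodule:
  assumes "module R M" "module R N" "f \<in> lin_maps R M N" "submodule K R N"
  shows "submodule {x \<in> carrier M. f x \<in> K} R M"
proof -
  interpret M: module R M by fact
  interpret N: module R N by fact
  show ?thesis using N.submoduleE[OF assms(4)] N.submodule_zero[OF assms(4)] lin_zero[OF assms(1-3)]
    by (intro M.submoduleI') (auto simp: lin_mapsD[OF assms(3)])
qed

subsection \<open>Coordinate vectors\<close>

text \<open>Vectors vanish outside \<open>I\<close> instead of being \<open>undefined\<close> there:
  every coordinate lies in the carrier without a side condition, equality is equality of functions,
  and for \<open>I \<subseteq> I'\<close> the inclusion of the free modules is the identity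
  map.\<close>

definition fvec :: "('r, 'x) ring_scheme \<Rightarrow> 'i set \<Rightarrow> ('r, 'i \<Rightarrow> 'r) module" where
  "fvec R I = \<lparr>carrier = {v. (\<forall>i. v i \<in> carrier R) \<and> (\<forall>i. i \<notin> I \<longrightarrow> v i = \<zero>\<^bsub>R\<^esub>)},
     monoid.mult = undefined, one = undefined, zero = (\<lambda>_. \<zero>\<^bsub>R\<^esub>),
     add = (\<lambda>v w i. v i \<oplus>\<^bsub>R\<^esub> w i), smult = (\<lambda>r v i. r \<otimes>\<^bsub>R\<^esub> v i)\<rparr>"

text \<open>The target of linear functionals. Its submodules are the ideals, so facts about modules
  also serve for ideals and for fractions of ring elements.\<close>

definition ring_module :: "('r, 'x) ring_scheme \<Rightarrow> ('r, 'r) module" where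
  "ring_module R = \<lparr>carrier = carrier R, monoid.mult = mult R, one = one R, zero = zero R,
     add = add R, smult = mult R\<rparr>"

definition unit_vec :: "('r, 'x) ring_scheme \<Rightarrow> 'i \<Rightarrow> 'i \<Rightarrow> 'r" where
  "unit_vec R k = (\<lambda>i. if i = k then \<one>\<^bsub>R\<^esub> else \<zero>\<^bsub>R\<^esub>)"

definition vec_map :: "('r, 'm, 'y) module_scheme \<Rightarrow> 'i set \<Rightarrow> ('i \<Rightarrow> 'm) \<Rightarrow> ('i \<Rightarrow> 'r) \<Rightarrow> 'm" where
  "vec_map M I g = (\<lambda>c. \<Oplus>\<^bsub>M\<^esub>i\<in>I. c i \<odot>\<^bsub>M\<^esub> g i)"

definition dot :: "('r, 'x) ring_scheme \<Rightarrow> 'i set \<Rightarrow> ('i \<Rightarrow> 'r) \<Rightarrow> ('i \<Rightarrow> 'r) \<Rightarrow> 'r" where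
  "dot R I f v = (\<Oplus>\<^bsub>R\<^esub>i\<in>I. f i \<otimes>\<^bsub>R\<^esub> v i)"

lemma fvec_simps [simp]:
  "\<zero>\<^bsub>fvec R I\<^esub> = (\<lambda>_. \<zero>\<^bsub>R\<^esub>)"
  "v \<oplus>\<^bsub>fvec R I\<^esub> w = (\<lambda>i. v i \<oplus>\<^bsub>R\<^esub> w i)"
  "r \<odot>\<^bsub>fvec R I\<^esub> v = (\<lambda>i. r \<otimes>\<^bsub>R\<^esub> v i)"
  by (simp_all add: fvec_def)

lemma fvec_carrier:
  "v \<in> carrier (fvec R I) \<longleftrightarrow> (\<forall>i. v i \<in> carrier R) \<and> (\<forall>i. i \<notin> I \<longrightarrow> v i = \<zero>\<^bsub>R\<^esub>)"
  by (simp add: fvec_def)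

lemma fvec_coord [simp]: "v \<in> carrier (fvec R I) \<Longrightarrow> v i \<in> carrier R"
  by (simp add: fvec_carrier)

lemma fvec_outside: "v \<in> carrier (fvec R I) \<Longrightarrow> i \<notin> I \<Longrightarrow> v i = \<zero>\<^bsub>R\<^esub>"
  by (simp add: fvec_carrier)

lemma ring_module_simps [simp]:
  "carrier (ring_module R) = carrier R" "\<zero>\<^bsub>ring_module R\<^esub> = \<zero>\<^bsub>R\<^esub>"
  "a \<oplus>\<^bsub>ring_module R\<^esub> b = a \<oplus>\<^bsub>R\<^esub> b" "a \<odot>\<^bsub>ring_module R\<^esub> b = a \<otimes>\<^bsub>R\<^esub> b"
  by (simp_all add: ring_module_def)

context cring
begin

lemma module_ring_module: "module R (ring_module R)"
proof (intro moduleI abelian_groupI)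
  show "cring R" by (rule is_cring)
  show "\<And>x. x \<in> carrier (ring_module R) \<Longrightarrow> \<exists>y\<in>carrier (ring_module R). y \<oplus>\<^bsub>ring_module R\<^esub> x = \<zero>\<^bsub>ring_module R\<^esub>"
    using l_neg by auto
qed (auto simp: a_ac m_ac l_distr r_distr)

lemma ring_module_minus [simp]:
  assumes "a \<in> carrier R" "b \<in> carrier R"
  shows "a \<ominus>\<^bsub>ring_module R\<^esub> b = a \<ominus> b"
proof -
  interpret F: module R "ring_module R" by (rule module_ring_module)
  have "\<ominus>\<^bsub>ring_module R\<^esub> b = \<ominus> b"
    using assms by (intro F.M.minus_equality) (auto simp: l_neg)
  then show ?thesis by (simp add: a_minus_def)
qed

lemma ring_module_finsum:
  assumes "f \<in> A \<rightarrow> carrier R"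
  shows "finsum (ring_module R) f A = finsum R f A"
proof -
  interpret F: module R "ring_module R" by (rule module_ring_module)
  show ?thesis
  proof (cases "finite A")
    case True
    then show ?thesis using assms by (induction A) auto
  qed simp
qed

lemma module_fvec: "module R (fvec R I)"
proof (intro moduleI abelian_groupI)
  show "cring R" by (rule is_cring)
  show "\<exists>y\<in>carrier (fvec R I). y \<oplus>\<^bsub>fvec R I\<^esub> x = \<zero>\<^bsub>fvec R I\<^esub>" if "x \<in> carrier (fvec R I)" for x
    using that by (intro bexI[of _ "\<lambda>i. \<ominus> x i"]) (auto simp: fvec_carrier l_neg)
qed (auto simp: fvec_carrier a_ac m_ac l_distr r_distr fun_eq_iff)

lemma fvec_minus:
  assumes "v \<in> carrier (fvec R I)" "w \<in> carrier (fvec R I)"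
  shows "v \<ominus>\<^bsub>fvec R I\<^esub> w = (\<lambda>i. v i \<ominus> w i)"
proof -
  interpret F: module R "fvec R I" by (rule module_fvec)
  have *: "\<ominus>\<^bsub>fvec R I\<^esub> w = (\<lambda>i. \<ominus> w i)"
    using assms(2) by (intro F.M.minus_equality) (auto simp: fvec_carrier l_neg)
  show ?thesis by (simp add: a_minus_def *)
qed

lemma unit_vec_closed: "k \<in> I \<Longrightarrow> unit_vec R k \<in> carrier (fvec R I)"
  by (auto simp: fvec_carrier unit_vec_def)

text \<open>Induction on a set containing the support: clearing one coordinate leaves a vector over
  the smaller set, and what was cleared is a multiple of a unit vector.\<close>

lemma fvec_induct [consumes 2, case_names zero add unit]:
  assumes "finite I" and v: "v \<in> carrier (fvec R I)"
    and zero: "P (\<lambda>_. \<zero>)"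
    and add: "\<And>v w. v \<in> carrier (fvec R I) \<Longrightarrow> w \<in> carrier (fvec R I) \<Longrightarrow> P v \<Longrightarrow> P w \<Longrightarrow> P (\<lambda>i. v i \<oplus> w i)"
    and unit: "\<And>r k. r \<in> carrier R \<Longrightarrow> k \<in> I \<Longrightarrow> P (\<lambda>i. r \<otimes> unit_vec R k i)"
  shows "P v"
proof -
  have "P v" if "finite A" "A \<subseteq> I" "v \<in> carrier (fvec R A)" for A v
    using that
  proof (induction A arbitrary: v)
    case empty
    then have "v = (\<lambda>_. \<zero>)" by (auto simp: fvec_carrier)
    then show ?case using zero by simp
  next
    case (insert a A)
    let ?w = "\<lambda>i. if i = a then \<zero> else v i"
    have w: "?w \<in> carrier (fvec R A)" using insert.prems by (auto simp: fvec_carrier)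
    then have w': "?w \<in> carrier (fvec R I)" using insert.prems by (auto simp: fvec_carrier)
    have "P ?w" using insert w by auto
    moreover have "P (\<lambda>i. v a \<otimes> unit_vec R a i)" using insert.prems by (intro unit) auto
    moreover have "(\<lambda>i. v a \<otimes> unit_vec R a i) \<in> carrier (fvec R I)"
      using insert.prems by (auto simp: fvec_carrier unit_vec_def)
    ultimately have "P (\<lambda>i. v a \<otimes> unit_vec R a i \<oplus> ?w i)"
      using w' add by blast
    moreover have "(\<lambda>i. v a \<otimes> unit_vec R a i \<oplus> ?w i) = v"
      using insert.prems by (auto simp: unit_vec_def fun_eq_iff fvec_carrier)
    ultimately show ?case by simp
  qed
  then show ?thesis using assms(1,2) by blast
qed

lemma lin_vec_map:
  assumes "module R M" "finite I" "g \<in> I \<rightarrow> carrier M"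
  shows "vec_map M I g \<in> lin_maps R (fvec R I) M"
proof -
  interpret M: module R M by fact
  have g: "g i \<in> carrier M" if "i \<in> I" for i using that assms(3) by auto
  have cl: "(\<lambda>i. v i \<odot>\<^bsub>M\<^esub> g i) \<in> I \<rightarrow> carrier M" if "v \<in> carrier (fvec R I)" for v
    using that g by auto
  show ?thesis
  proof (rule lin_mapsI)
    fix v assume v: "v \<in> carrier (fvec R I)"
    show "vec_map M I g v \<in> carrier M"
      unfolding vec_map_def using cl[OF v] by simp
    fix r assume r: "r \<in> carrier R"
    have "vec_map M I g (r \<odot>\<^bsub>fvec R I\<^esub> v) = (\<Oplus>\<^bsub>M\<^esub>i\<in>I. r \<odot>\<^bsub>M\<^esub> (v i \<odot>\<^bsub>M\<^esub> g i))"
      unfolding vec_map_def using v r g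
      by (intro M.M.finsum_cong') (auto simp: M.smult_assoc1)
    then show "vec_map M I g (r \<odot>\<^bsub>fvec R I\<^esub> v) = r \<odot>\<^bsub>M\<^esub> vec_map M I g v"
      unfolding vec_map_def using M.finsum_smult_ldistr[OF assms(2) r cl[OF v]] by simp
  next
    fix v w assume v: "v \<in> carrier (fvec R I)" and w: "w \<in> carrier (fvec R I)"
    have "vec_map M I g (v \<oplus>\<^bsub>fvec R I\<^esub> w) = (\<Oplus>\<^bsub>M\<^esub>i\<in>I. v i \<odot>\<^bsub>M\<^esub> g i \<oplus>\<^bsub>M\<^esub> w i \<odot>\<^bsub>M\<^esub> g i)"
      unfolding vec_map_def using v w g
      by (intro M.M.finsum_cong') (auto simp: M.smult_l_distr)
    then show "vec_map M I g (v \<oplus>\<^bsub>fvec R I\<^esub> w) = vec_map M I g v \<oplus>\<^bsub>M\<^esub> vec_map M I g w"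
      unfolding vec_map_def using M.M.finsum_addf[OF cl[OF v] cl[OF w]] by simp
  qed
qed

lemma vec_map_unit:
  assumes "module R M" "finite I" "g \<in> I \<rightarrow> carrier M" "k \<in> I"
  shows "vec_map M I g (unit_vec R k) = g k"
proof -
  interpret M: module R M by fact
  have "vec_map M I g (unit_vec R k) = (\<Oplus>\<^bsub>M\<^esub>i\<in>I. if k = i then g i else \<zero>\<^bsub>M\<^esub>)"
    unfolding vec_map_def using assms by (intro M.M.finsum_cong') (auto simp: unit_vec_def Pi_iff)
  also have "\<dots> = g k" using assms M.M.finsum_singleton[of k I g] by simp
  finally show ?thesis .
qed

text \<open>A submodule \<open>K\<close> stands in place of zero so that one induction gives two
  tools: \<open>K = {\<zero>}\<close> yields equality of linear maps that agree on unit vectors, an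
  ideal yields their congruence.\<close>

lemma lin_maps_fvec_in:
  assumes "module R N" "f \<in> lin_maps R (fvec R I) N" "finite I" "submodule K R N"
    and "\<And>k. k \<in> I \<Longrightarrow> f (unit_vec R k) \<in> K" and "v \<in> carrier (fvec R I)"
  shows "f v \<in> K"
proof -
  interpret N: module R N by fact
  have add: "f (\<lambda>i. v i \<oplus> w i) = f v \<oplus>\<^bsub>N\<^esub> f w"
    if "v \<in> carrier (fvec R I)" "w \<in> carrier (fvec R I)" for v w
    using lin_add[OF assms(2) that] by simp
  have sm: "f (\<lambda>i. r \<otimes> v i) = r \<odot>\<^bsub>N\<^esub> f v"
    if "r \<in> carrier R" "v \<in> carrier (fvec R I)" for r v
    using lin_smult[OF assms(2) that] by simp
  show ?thesis using assms(3,6)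
  proof (induction rule: fvec_induct)
    case zero
    then show ?case
      using lin_zero[OF module_fvec assms(1,2)] N.submodule_zero[OF assms(4)] by simp
  next
    case (add v w)
    then show ?case
      using N.submoduleE(5)[OF assms(4)] by (simp add: \<open>\<And>v w. _ \<Longrightarrow> _ \<Longrightarrow> f (\<lambda>i. v i \<oplus> w i) = _\<close>)
  next
    case (unit r k)
    then show ?case
      using assms(5) N.submoduleE(4)[OF assms(4)] by (simp add: sm unit_vec_closed)
  qed
qed

lemma submodule_singleton_zero:
  assumes "module R N" shows "submodule {\<zero>\<^bsub>N\<^esub>} R N"
proof -
  interpret N: module R N by fact
  show ?thesis by (rule N.submoduleI') auto
qed

lemma lin_maps_fvec_eq:
  assumes "module R N" "f \<in> lin_maps R (fvec R I) N" "g \<in> lin_maps R (fvec R I) N" "finite I"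
    and "\<And>k. k \<in> I \<Longrightarrow> f (unit_vec R k) = g (unit_vec R k)" and "v \<in> carrier (fvec R I)"
  shows "f v = g v"
proof -
  interpret N: module R N by fact
  have "f (unit_vec R k) \<ominus>\<^bsub>N\<^esub> g (unit_vec R k) \<in> {\<zero>\<^bsub>N\<^esub>}" if "k \<in> I" for k
    using assms(5)[OF that] lin_closed[OF assms(3) unit_vec_closed[OF that]]
    by (simp add: a_minus_def N.M.r_neg)
  from lin_maps_fvec_in[OF assms(1) lin_maps_minus[OF assms(1-3)] assms(4)
      submodule_singleton_zero[OF assms(1)] this assms(6)]
  have "f v \<ominus>\<^bsub>N\<^esub> g v \<in> {\<zero>\<^bsub>N\<^esub>}" .
  then show ?thesis
    using lin_closed[OF assms(2,6)] lin_closed[OF assms(3,6)] N.minus_eq_zero_iff by blast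
qed

subsection \<open>The pairing of rows and columns\<close>

lemma dot_vec_map:
  assumes "f \<in> carrier (fvec R I)" "v \<in> carrier (fvec R I)"
  shows "dot R I f v = vec_map (ring_module R) I f v"
  using assms unfolding dot_def vec_map_def
  by (subst ring_module_finsum) (auto intro!: finsum_cong' simp: m_comm)

lemma dot_comm:
  assumes "f \<in> carrier (fvec R I)" "v \<in> carrier (fvec R I)"
  shows "dot R I f v = dot R I v f"
  using assms unfolding dot_def by (auto intro!: finsum_cong' simp: m_comm)

lemma lin_dot:
  assumes "finite I" "f \<in> carrier (fvec R I)"
  shows "dot R I f \<in> lin_maps R (fvec R I) (ring_module R)"
proof -
  interpret F: module R "fvec R I" by (rule module_fvec)
  have 1: "vec_map (ring_module R) I f \<in> lin_maps R (fvec R I) (ring_module R)"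
    using assms by (intro lin_vec_map module_ring_module) auto
  show ?thesis
    using lin_mapsD[OF 1] dot_vec_map[OF assms(2)] F.M.a_closed F.smult_closed
    by (intro lin_mapsI) (simp_all del: fvec_simps)
qed

lemma dot_closed [simp]:
  "f \<in> carrier (fvec R I) \<Longrightarrow> v \<in> carrier (fvec R I) \<Longrightarrow> dot R I f v \<in> carrier R"
  unfolding dot_def by (intro finsum_closed) auto

lemma lin_dot_left:
  assumes "finite I" "v \<in> carrier (fvec R I)"
  shows "(\<lambda>f. dot R I f v) \<in> lin_maps R (fvec R I) (ring_module R)"
proof -
  interpret F: module R "fvec R I" by (rule module_fvec)
  show ?thesis
    using lin_mapsD[OF lin_dot[OF assms]] dot_comm[OF _ assms(2)] F.M.a_closed F.smult_closed
    by (intro lin_mapsI) (simp_all del: fvec_simps)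
qed

lemma dot_unit:
  assumes "finite I" "f \<in> carrier (fvec R I)" "k \<in> I"
  shows "dot R I f (unit_vec R k) = f k"
  using assms by (subst dot_vec_map) (auto intro: unit_vec_closed vec_map_unit module_ring_module)

lemma dot_unit_left:
  assumes "finite I" "f \<in> carrier (fvec R I)" "k \<in> I"
  shows "dot R I (unit_vec R k) f = f k"
  using assms by (subst dot_comm) (auto intro: unit_vec_closed simp: dot_unit)

lemma row_of_functional:
  assumes "l \<in> lin_maps R (fvec R I) (ring_module R)" "finite I"
  obtains f where "f \<in> carrier (fvec R I)" "\<And>v. v \<in> carrier (fvec R I) \<Longrightarrow> dot R I f v = l v"
proof
  let ?f = "\<lambda>k. if k \<in> I then l (unit_vec R k) else \<zero>"
  show f: "?f \<in> carrier (fvec R I)"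
    using lin_closed[OF assms(1) unit_vec_closed] by (auto simp: fvec_carrier)
  have "dot R I ?f (unit_vec R k) = l (unit_vec R k)" if "k \<in> I" for k
    using dot_unit[OF assms(2) f that] that by simp
  from lin_maps_fvec_eq[OF module_ring_module lin_dot[OF assms(2) f] assms this]
  show "dot R I ?f v = l v" if "v \<in> carrier (fvec R I)" for v
    using that by blast
qed

lemma lin_coord: "(\<lambda>v. v k) \<in> lin_maps R (fvec R I) (ring_module R)"
  by (intro lin_mapsI) (auto simp: fvec_carrier)

lemma lin_into_fvec:
  assumes "\<And>k. k \<in> I \<Longrightarrow> l k \<in> lin_maps R M (ring_module R)"
  shows "(\<lambda>x k. if k \<in> I then l k x else \<zero>) \<in> lin_maps R M (fvec R I)"
  using lin_closed[OF assms] lin_add[OF assms] lin_smult[OF assms]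
  by (intro lin_mapsI) (auto simp: fvec_carrier fun_eq_iff)

end

subsection \<open>Noetherian modules\<close>

text \<open>The maximal condition is preferred to finite generation because every use selects a
  maximal member of some family, and because it can be pulled back along any assignment of
  submodules that preserves and reflects inclusion.\<close>

definition noetherian_module :: "('r, 'x) ring_scheme \<Rightarrow> ('r, 'm, 'y) module_scheme \<Rightarrow> bool" where
  "noetherian_module R M \<longleftrightarrow>
     (\<forall>S. S \<noteq> {} \<and> (\<forall>K\<in>S. submodule K R M) \<longrightarrow> (\<exists>K\<in>S. \<forall>K'\<in>S. K \<subseteq> K' \<longrightarrow> K' = K))"

text \<open>The index map \<open>h\<close> allows a member to be chosen by the size of its image or
  preimage; \<open>h\<close> may identify different members.\<close>

lemma noetherian_module_maximal:
  assumes "noetherian_module R M" "K0 \<in> S" "\<And>K. K \<in> S \<Longrightarrow> submodule (h K) R M"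
  obtains K where "K \<in> S" "\<And>K'. K' \<in> S \<Longrightarrow> h K \<subseteq> h K' \<Longrightarrow> h K' = h K"
proof -
  have "h ` S \<noteq> {} \<and> (\<forall>L\<in>h ` S. submodule L R M)" using assms(2,3) by auto
  then have "\<exists>L\<in>h ` S. \<forall>L'\<in>h ` S. L \<subseteq> L' \<longrightarrow> L' = L"
    by (rule assms(1)[unfolded noetherian_module_def, THEN spec, THEN mp])
  then show ?thesis using that by auto
qed

text \<open>A nonempty chain of ideals contains its own union, so Zorn's lemma applies inside an
  arbitrary nonempty family of ideals.\<close>

lemma (in noetherian_ring) maximal_ideal_exists:
  assumes "I0 \<in> S" "\<And>I. I \<in> S \<Longrightarrow> ideal I R"
  obtains I where "I \<in> S" "\<And>I'. I' \<in> S \<Longrightarrow> I \<subseteq> I' \<Longrightarrow> I' = I"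
proof -
  have "\<exists>I\<in>S. \<forall>I'\<in>S. I \<subseteq> I' \<longrightarrow> I' = I"
  proof (rule subset_Zorn)
    fix C assume C: "subset.chain S C"
    show "\<exists>U\<in>S. \<forall>X\<in>C. X \<subseteq> U"
    proof (cases "C = {}")
      case False
      have "subset.chain {I. ideal I R} C"
        using C assms(2) unfolding pred_on.chain_def by auto
      then have "\<Union>C \<in> C" using ideal_chain_is_trivial[OF False] by blast
      then show ?thesis using C unfolding pred_on.chain_def by auto
    qed (use assms in auto)
  qed
  then show ?thesis using that by blast
qed

lemma (in cring) ideal_of_submodule:
  assumes I: "submodule I R (ring_module R)" shows "ideal I R"
proof -
  interpret M: module R "ring_module R" by (rule module_ring_module)
  note E = M.submoduleE[OF I]
  have cl: "\<And>a b. a \<in> I \<Longrightarrow> b \<in> carrier R \<Longrightarrow> b \<otimes> a \<in> I" using E(4) by simp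
  show ?thesis
  proof (rule idealI[OF ring_axioms])
    show "subgroup I (add_monoid R)"
    proof (rule add.subgroupI)
      show "I \<subseteq> carrier R" "I \<noteq> {}" using E(1,2) by auto
      fix a assume a: "a \<in> I"
      then have "a \<in> carrier R" using E(1) by auto
      then show "\<ominus> a \<in> I" using cl[OF a, of "\<ominus> \<one>"] by (simp add: l_minus)
      fix b assume "b \<in> I"
      then show "a \<oplus> b \<in> I" using E(5)[OF a] by simp
    qed
    show "\<And>a x. a \<in> I \<Longrightarrow> x \<in> carrier R \<Longrightarrow> x \<otimes> a \<in> I" by (rule cl)
    then show "\<And>a x. a \<in> I \<Longrightarrow> x \<in> carrier R \<Longrightarrow> a \<otimes> x \<in> I"
      using m_comm E(1) by (metis ring_module_simps(1) subsetD)
  qed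
qed

lemma (in cring) submodule_of_ideal:
  assumes "ideal I R" shows "submodule I R (ring_module R)"
proof -
  interpret M: module R "ring_module R" by (rule module_ring_module)
  interpret I: ideal I R by fact
  show ?thesis using I.a_subset I.I_l_closed by (intro M.submoduleI') auto
qed

lemma noetherian_ring_module:
  assumes "cring R" "noetherian_ring R"
  shows "noetherian_module R (ring_module R)"
proof -
  interpret cring R by fact
  interpret noetherian_ring R by fact
  show ?thesis
    unfolding noetherian_module_def using maximal_ideal_exists ideal_of_submodule by (metis all_not_in_conv)
qed

text \<open>A submodule is determined, among the submodules containing it, by its image under \<open>q\<close> and its
  preimage under \<open>l\<close>.\<close>

lemma noetherian_extension:
  assumes "module R M" "module R Q" "module R L"
    and q: "q \<in> lin_maps R M Q" and l: "l \<in> lin_maps R L M"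
    and ex: "{x \<in> carrier M. q x = \<zero>\<^bsub>Q\<^esub>} \<subseteq> l ` carrier L"
    and NQ: "noetherian_module R Q" and NL: "noetherian_module R L"
  shows "noetherian_module R M"
  unfolding noetherian_module_def
proof (intro allI impI)
  interpret M: module R M by fact
  interpret Q: module R Q by fact
  interpret L: module R L by fact
  fix S assume S: "S \<noteq> {} \<and> (\<forall>K\<in>S. submodule K R M)"
  have subK: "submodule K R M" if "K \<in> S" for K using S that by blast
  have img: "submodule (q ` K) R Q" if "K \<in> S" for K
  proof -
    note E = M.submoduleE[OF subK[OF that]]
    show ?thesis
    proof (rule Q.submoduleI')
      show "q ` K \<subseteq> carrier Q" using E(1) lin_closed[OF q] by auto
      show "\<zero>\<^bsub>Q\<^esub> \<in> q ` K"
        using M.submodule_zero[OF subK[OF that]] lin_zero[OF assms(1,2) q] by force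
      fix a b assume "a \<in> q ` K" "b \<in> q ` K"
      then obtain x y where "x \<in> K" "y \<in> K" "a = q x" "b = q y" by auto
      then show "a \<oplus>\<^bsub>Q\<^esub> b \<in> q ` K"
        using E(1,5) lin_add[OF q, of x y] by (intro image_eqI[of _ _ "x \<oplus>\<^bsub>M\<^esub> y"]) (simp_all add: subset_iff)
    next
      fix r a assume "r \<in> carrier R" "a \<in> q ` K"
      then obtain x where "x \<in> K" "a = q x" by auto
      then show "r \<odot>\<^bsub>Q\<^esub> a \<in> q ` K"
        using E(1,4) lin_smult[OF q, of r x] \<open>r \<in> carrier R\<close>
        by (intro image_eqI[of _ _ "r \<odot>\<^bsub>M\<^esub> x"]) (simp_all add: subset_iff)
    qed
  qed
  obtain K0 where K0: "K0 \<in> S" using S by auto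
  \<comment> \<open>The choice is lexicographic: \<open>K1\<close> has maximal image, and among the
    members with the same image \<open>K\<close> will have maximal preimage.\<close>
  obtain K1 where T: "K1 \<in> S" and Tmax: "\<And>K'. K' \<in> S \<Longrightarrow> q ` K1 \<subseteq> q ` K' \<Longrightarrow> q ` K' = q ` K1"
    using noetherian_module_maximal[where h = "\<lambda>K. q ` K", OF NQ K0 img] by blast
  define S' where "S' = {K \<in> S. q ` K = q ` K1}"
  define pre where "pre K = {x \<in> carrier L. l x \<in> K}" for K
  have K1: "K1 \<in> S'" using T unfolding S'_def by auto
  have sub': "submodule (pre K) R L" if "K \<in> S'" for K
    using lin_preimage_submodule[OF assms(3,1) l] subK that unfolding S'_def pre_def by auto
  obtain K where K: "K \<in> S'" and Pmax: "\<And>K'. K' \<in> S' \<Longrightarrow> pre K \<subseteq> pre K' \<Longrightarrow> pre K' = pre K"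
    using noetherian_module_maximal[where h = pre, OF NL K1 sub'] by blast
  have KS: "K \<in> S" using K S'_def by auto
  have "K' = K" if K': "K' \<in> S" "K \<subseteq> K'" for K'
  proof
    have "q ` K1 \<subseteq> q ` K'" using K' K unfolding S'_def by blast
    then have "q ` K' = q ` K1" using Tmax[of "K'"] K' by blast
    then have "K' \<in> S'" using K' by (simp add: S'_def)
    moreover have "pre K \<subseteq> pre K'" using K' unfolding pre_def by blast
    ultimately have pre: "pre K' = pre K" using Pmax by blast
    show "K' \<subseteq> K"
    proof
      fix x assume x: "x \<in> K'"
      have "q x \<in> q ` K" using x \<open>q ` K' = q ` K1\<close> K unfolding S'_def by auto
      then obtain y where y: "y \<in> K" "q x = q y" by auto
      note E = M.submoduleE(1)[OF subK[OF K'(1)]] M.submoduleE(1)[OF subK[OF KS]]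
      have xc: "x \<in> carrier M" "y \<in> carrier M" using x y E by auto
      have "x \<ominus>\<^bsub>M\<^esub> y \<in> K'"
        using x y K' M.submodule_minus[OF subK[OF K'(1)]] by auto
      moreover have "q (x \<ominus>\<^bsub>M\<^esub> y) = \<zero>\<^bsub>Q\<^esub>"
        using xc y(2) lin_minus[OF assms(1,2) q xc] lin_closed[OF q] Q.minus_eq_zero_iff by simp
      moreover have "x \<ominus>\<^bsub>M\<^esub> y \<in> carrier M" using xc by auto
      ultimately obtain w where w: "w \<in> carrier L" "x \<ominus>\<^bsub>M\<^esub> y = l w" using ex by blast
      then have "w \<in> pre K'" using \<open>x \<ominus>\<^bsub>M\<^esub> y \<in> K'\<close> by (simp add: pre_def)
      then have "x \<ominus>\<^bsub>M\<^esub> y \<in> K" using w pre unfolding pre_def by auto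
      then have "(x \<ominus>\<^bsub>M\<^esub> y) \<oplus>\<^bsub>M\<^esub> y \<in> K" using y M.submoduleE(5)[OF subK[OF KS]] by blast
      moreover have "(x \<ominus>\<^bsub>M\<^esub> y) \<oplus>\<^bsub>M\<^esub> y = x"
        using xc by (simp add: a_minus_def M.M.a_assoc M.M.l_neg)
      ultimately show "x \<in> K" by simp
    qed
  qed (use K' in auto)
  then show "\<exists>K\<in>S. \<forall>K'\<in>S. K \<subseteq> K' \<longrightarrow> K' = K" using KS by blast
qed

section \<open>Finite free modules over a Noetherian ring\<close>

text \<open>The coordinate at \<open>a\<close> is a map to the ring whose kernel is the free module
  on the remaining indices, so each new index is an extension by the ring.\<close>

lemma noetherian_fvec:
  assumes "cring R" "noetherian_ring R" "finite I"
  shows "noetherian_module R (fvec R I)"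
  using assms(3)
proof (induction I)
  case empty
  interpret cring R by fact
  interpret F: module R "fvec R {}" by (rule module_fvec)
  have "K = {\<zero>\<^bsub>fvec R {}\<^esub>}" if "submodule K R (fvec R {})" for K
    using F.submoduleE(1)[OF that] F.submodule_zero[OF that] by (auto simp: fvec_carrier fun_eq_iff)
  then show ?case unfolding noetherian_module_def by (metis all_not_in_conv)
next
  case (insert a I)
  interpret cring R by fact
  have "(\<lambda>v. v) \<in> lin_maps R (fvec R I) (fvec R (insert a I))"
    by (rule lin_mapsI) (auto simp: fvec_carrier)
  moreover have "{x \<in> carrier (fvec R (insert a I)). x a = \<zero>\<^bsub>ring_module R\<^esub>} \<subseteq> (\<lambda>v. v) ` carrier (fvec R I)"
    by (auto simp: fvec_carrier)
  ultimately show ?case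
    by (rule noetherian_extension[OF module_fvec module_ring_module module_fvec lin_coord])
      (use insert noetherian_ring_module assms in auto)
qed

text \<open>Among the finitely generated submodules of \<open>K\<close> a maximal one must be
  \<open>K\<close>: otherwise one further element of \<open>K\<close> could be added as a
  generator.\<close>

lemma submodule_fvec_finitely_generated:
  
  assumes "cring R" "noetherian_module R M" "module R M" and K: "submodule K R M"
  shows "\<exists>m f. f \<in> lin_maps R (fvec R {..<m::nat}) M \<and> f ` carrier (fvec R {..<m}) = K"
proof -
  interpret cring R by fact
  interpret M: module R M by fact
  define S where "S = {L. L \<subseteq> K \<and> (\<exists>m f. f \<in> lin_maps R (fvec R {..<m::nat}) M \<and> f ` carrier (fvec R {..<m}) = L)}"
  have "(\<lambda>_. \<zero>\<^bsub>M\<^esub>) ` carrier (fvec R {..<0::nat}) \<in> S"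
    unfolding S_def using M.submodule_zero[OF K] lin_maps_zero[OF assms(3), where M = "fvec R {..<0::nat}"]
    by blast
  moreover have "submodule L R M" if "L \<in> S" for L
    using that lin_image_submodule[OF module_fvec assms(3)] unfolding S_def by blast
  ultimately obtain L where L: "L \<in> S" and max: "\<And>L'. L' \<in> S \<Longrightarrow> L \<subseteq> L' \<Longrightarrow> L' = L"
    using noetherian_module_maximal[where h = "\<lambda>K. K", OF assms(2)] by metis
  from L obtain m f where f: "f \<in> lin_maps R (fvec R {..<m::nat}) M" "f ` carrier (fvec R {..<m}) = L" and LK: "L \<subseteq> K"
    unfolding S_def by auto
  have "x \<in> L" if x: "x \<in> K" for x
  proof -
    have xM: "x \<in> carrier M" using x M.submoduleE(1)[OF K] by auto
    \<comment> \<open>\<open>g\<close> is \<open>f\<close> with one more generator: the new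
      coordinate \<open>m\<close> is sent to \<open>x\<close>.\<close>
    define g where "g v = f (\<lambda>i. if i < m then v i else \<zero>\<^bsub>R\<^esub>) \<oplus>\<^bsub>M\<^esub> v m \<odot>\<^bsub>M\<^esub> x" for v
    have tr: "(\<lambda>v i. if i < m then v i else \<zero>\<^bsub>R\<^esub>) \<in> lin_maps R (fvec R {..<Suc m}) (fvec R {..<m})"
      by (rule lin_mapsI) (auto simp: fvec_carrier fun_eq_iff)
    have "(\<lambda>v. v m \<odot>\<^bsub>M\<^esub> x) \<in> lin_maps R (fvec R {..<Suc m}) M"
      using xM by (intro lin_mapsI) (auto simp: M.smult_l_distr M.smult_assoc1)
    with lin_comp[OF f(1) tr] have g: "g \<in> lin_maps R (fvec R {..<Suc m}) M"
      unfolding g_def by (intro lin_maps_add assms(3))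
    have LS: "L \<subseteq> g ` carrier (fvec R {..<Suc m})"
    proof
      fix y assume "y \<in> L"
      then obtain v where v: "v \<in> carrier (fvec R {..<m})" "y = f v" using f(2) by auto
      have *: "(\<lambda>i. if i < m then v i else \<zero>\<^bsub>R\<^esub>) = v"
        using fvec_outside[OF v(1)] by (intro ext) simp
      have "v m = \<zero>\<^bsub>R\<^esub>" using fvec_outside[OF v(1)] by simp
      then have "g v = y"
        unfolding g_def * using v(2) xM lin_closed[OF f(1) v(1)] by simp
      moreover have "v \<in> carrier (fvec R {..<Suc m})" using v(1) by (simp add: fvec_carrier)
      ultimately show "y \<in> g ` carrier (fvec R {..<Suc m})" by blast
    qed
    have "g ` carrier (fvec R {..<Suc m}) \<subseteq> K"
    proof
      fix y assume "y \<in> g ` carrier (fvec R {..<Suc m})"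
      then obtain v where v: "v \<in> carrier (fvec R {..<Suc m})" "y = g v" by auto
      have "f (\<lambda>i. if i < m then v i else \<zero>\<^bsub>R\<^esub>) \<in> K" using lin_closed[OF tr v(1)] f(2) LK by blast
      then show "y \<in> K" using v x M.submoduleE(4,5)[OF K] by (simp add: g_def)
    qed
    then have "g ` carrier (fvec R {..<Suc m}) = L" using max LS g unfolding S_def by blast
    moreover have "g (unit_vec R m) = x"
    proof -
      have "(\<lambda>i. if i < m then unit_vec R m i else \<zero>\<^bsub>R\<^esub>) = (\<lambda>_. \<zero>\<^bsub>R\<^esub>)" by (auto simp: unit_vec_def)
      moreover have "f (\<lambda>_. \<zero>\<^bsub>R\<^esub>) = \<zero>\<^bsub>M\<^esub>" using lin_zero[OF module_fvec assms(3) f(1)] by simp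
      ultimately show ?thesis unfolding g_def using xM by (simp add: unit_vec_def)
    qed
    moreover have "unit_vec R m \<in> carrier (fvec R {..<Suc m})" by (rule unit_vec_closed) auto
    ultimately show "x \<in> L" by blast
  qed
  then show ?thesis using LK f by blast
qed

subsection \<open>Maximal annihilators\<close>

text \<open>The usual argument that maximal annihilators are prime: if \<open>b\<close> does not
  kill \<open>e\<close>, then \<open>b e\<close> is again nonzero with a larger annihilator, hence
  the same one, and \<open>a b e = 0\<close> gives \<open>a e = 0\<close>. It is stated for an
  abstract \<open>ann\<close>, since it is applied both to \<open>R / J\<close> and to a module
  modulo a submodule; \<open>T\<close> stands for the nonzero elements.\<close>

lemma (in cring) maximal_annihilator_prime:
  assumes e: "e \<in> T" and id: "\<And>x. x \<in> T \<Longrightarrow> ideal (ann x) R"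
    and proper: "\<And>x. x \<in> T \<Longrightarrow> \<one> \<notin> ann x"
    and step: "\<And>x r. \<lbrakk>x \<in> T; r \<in> carrier R; r \<notin> ann x\<rbrakk> \<Longrightarrow>
      \<exists>y\<in>T. ann y = {s \<in> carrier R. s \<otimes> r \<in> ann x}"
    and max: "\<And>x. x \<in> T \<Longrightarrow> ann e \<subseteq> ann x \<Longrightarrow> ann x = ann e"
  shows "primeideal (ann e) R"
proof (rule primeidealI[OF id[OF e] is_cring])
  show "carrier R \<noteq> ann e" using proper[OF e] by auto
  fix a b assume ab: "a \<in> carrier R" "b \<in> carrier R" "a \<otimes> b \<in> ann e"
  interpret I: ideal "ann e" R by (rule id[OF e])
  show "a \<in> ann e \<or> b \<in> ann e"
  proof (rule disjCI)
    assume "b \<notin> ann e"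
    then obtain y where y: "y \<in> T" "ann y = {s \<in> carrier R. s \<otimes> b \<in> ann e}" using step[OF e ab(2)] by blast
    have "ann e \<subseteq> ann y" using y I.a_subset I.I_r_closed ab by auto
    then have "ann y = ann e" using max y by blast
    then show "a \<in> ann e" using y ab by auto
  qed
qed

subsection \<open>Saturated ideals and associated primes\<close>

text \<open>Equivalently, \<open>R / J\<close> embeds into its localization at \<open>p\<close>, so
  that a congruence modulo \<open>J\<close> is an equality over the localized quotient.\<close>

definition saturated :: "('r, 'x) ring_scheme \<Rightarrow> 'r set \<Rightarrow> 'r set \<Rightarrow> bool" where
  "saturated R p J \<longleftrightarrow> (\<forall>s\<in>carrier R - p. \<forall>r\<in>carrier R. s \<otimes>\<^bsub>R\<^esub> r \<in> J \<longrightarrow> r \<in> J)"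

text \<open>The contraction to \<open>R\<close> of the extension of \<open>J\<close> to the
  localization at \<open>p\<close>.\<close>

definition saturation :: "('r, 'x) ring_scheme \<Rightarrow> 'r set \<Rightarrow> 'r set \<Rightarrow> 'r set" where
  "saturation R p J = {r \<in> carrier R. \<exists>s\<in>carrier R - p. s \<otimes>\<^bsub>R\<^esub> r \<in> J}"

text \<open>The annihilator of the class of \<open>a\<close> in \<open>R / J\<close>; thus
  \<open>colon R J a = p\<close> exhibits \<open>p\<close> as an associated prime of
  \<open>R / J\<close>.\<close>

definition colon :: "('r, 'x) ring_scheme \<Rightarrow> 'r set \<Rightarrow> 'r \<Rightarrow> 'r set" where
  "colon R J a = {r \<in> carrier R. r \<otimes>\<^bsub>R\<^esub> a \<in> J}"

lemma (in cring) idealI':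
  assumes "I \<subseteq> carrier R" "\<zero> \<in> I" "\<And>a b. a \<in> I \<Longrightarrow> b \<in> I \<Longrightarrow> a \<oplus> b \<in> I"
    and "\<And>a r. a \<in> I \<Longrightarrow> r \<in> carrier R \<Longrightarrow> r \<otimes> a \<in> I"
  shows "ideal I R"
proof (rule ideal_of_submodule)
  interpret M: module R "ring_module R" by (rule module_ring_module)
  show "submodule I R (ring_module R)" using assms by (intro M.submoduleI') auto
qed

lemma primeideal_mult_closed:
  assumes "primeideal p R" "s \<in> carrier R - p" "t \<in> carrier R - p"
  shows "s \<otimes>\<^bsub>R\<^esub> t \<in> carrier R - p"
proof -
  interpret primeideal p R by fact
  show ?thesis using assms(2,3) I_prime by auto
qed

lemma primeideal_one_notin:
  assumes "primeideal p R" shows "\<one>\<^bsub>R\<^esub> \<in> carrier R - p"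
proof -
  interpret primeideal p R by fact
  show ?thesis using I_notcarr one_imp_carrier by auto
qed

lemma (in cring) ideal_colon:
  assumes "ideal J R" "a \<in> carrier R" shows "ideal (colon R J a) R"
proof -
  interpret J: ideal J R by fact
  show ?thesis using assms(2)
    by (intro idealI') (auto simp: colon_def l_distr J.I_l_closed m_assoc)
qed

lemma (in cring) ideal_saturation:
  assumes p: "primeideal p R" and J: "ideal J R"
  shows "ideal (saturation R p J) R"
proof -
  interpret J: ideal J R by fact
  show ?thesis
  proof (rule idealI')
    show "\<zero> \<in> saturation R p J"
      unfolding saturation_def using primeideal_one_notin[OF p] by (auto intro!: bexI[of _ \<one>])
  next
    fix a b assume "a \<in> saturation R p J" "b \<in> saturation R p J"
    then obtain s t where st: "s \<in> carrier R - p" "t \<in> carrier R - p" "s \<otimes> a \<in> J" "t \<otimes> b \<in> J"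
      and ab: "a \<in> carrier R" "b \<in> carrier R" unfolding saturation_def by blast
    have "(s \<otimes> t) \<otimes> (a \<oplus> b) = t \<otimes> (s \<otimes> a) \<oplus> s \<otimes> (t \<otimes> b)"
      using st ab by (simp add: r_distr m_ac)
    also have "\<dots> \<in> J" using st J.I_l_closed by auto
    finally show "a \<oplus> b \<in> saturation R p J"
      unfolding saturation_def using primeideal_mult_closed[OF p st(1,2)] ab by blast
  next
    fix a r assume "a \<in> saturation R p J" and r: "r \<in> carrier R"
    then obtain s where s: "s \<in> carrier R - p" "s \<otimes> a \<in> J" and a: "a \<in> carrier R" unfolding saturation_def by blast
    have "s \<otimes> (r \<otimes> a) = r \<otimes> (s \<otimes> a)" using s a r by (simp add: m_lcomm)
    then show "r \<otimes> a \<in> saturation R p J"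
      unfolding saturation_def using s a r J.I_l_closed by (auto intro!: bexI[of _ s])
  qed (auto simp: saturation_def)
qed

lemma (in cring) saturated_saturation:
  assumes "primeideal p R" shows "saturated R p (saturation R p J)"
  unfolding saturated_def saturation_def
  using primeideal_mult_closed[OF assms] by (auto simp: m_assoc[symmetric])

lemma saturation_subset_prime:
  assumes "primeideal p R" "J \<subseteq> p" shows "saturation R p J \<subseteq> p"
proof -
  interpret primeideal p R by fact
  show ?thesis using assms(2) I_prime unfolding saturation_def by blast
qed

lemma (in cring) subset_saturation:
  assumes "primeideal p R" "J \<subseteq> carrier R" shows "J \<subseteq> saturation R p J"
  unfolding saturation_def using assms primeideal_one_notin[OF assms(1)] by (auto intro!: bexI[of _ \<one>])

lemma (in cring) maximal_colon_prime:
  assumes J: "ideal J R" and a: "a \<in> carrier R - J"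
    and max: "\<And>b. b \<in> carrier R - J \<Longrightarrow> colon R J a \<subseteq> colon R J b \<Longrightarrow> colon R J b = colon R J a"
  shows "primeideal (colon R J a) R"
proof (rule maximal_annihilator_prime[where T = "carrier R - J" and ann = "colon R J"])
  fix x r assume x: "x \<in> carrier R - J" and r: "r \<in> carrier R" "r \<notin> colon R J x"
  have "r \<otimes> x \<in> carrier R - J" using x r by (auto simp: colon_def)
  moreover have "colon R J (r \<otimes> x) = {s \<in> carrier R. s \<otimes> r \<in> colon R J x}"
    using x r by (auto simp: colon_def m_assoc)
  ultimately show "\<exists>y\<in>carrier R - J. colon R J y = {s \<in> carrier R. s \<otimes> r \<in> colon R J x}" by blast
qed (use assms ideal_colon in \<open>auto simp: colon_def\<close>)

text \<open>An associated prime of \<open>R / J\<close> localized at \<open>q\<close> lies between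
  \<open>J\<close> and \<open>q\<close> and consists of zero divisors, so it cannot contain
  \<open>x\<close>, which is regular modulo \<open>J\<close> and lies in \<open>q\<close>.\<close>

lemma prime_below:
  assumes "cring R" "noetherian_ring R" and q: "primeideal q R" and J: "ideal J R" and Jq: "J \<subseteq> q"
    and x: "x \<in> q" and nzd: "\<And>r. r \<in> carrier R \<Longrightarrow> x \<otimes>\<^bsub>R\<^esub> r \<in> J \<Longrightarrow> r \<in> J"
  shows "\<exists>P. primeideal P R \<and> J \<subseteq> P \<and> P \<subset> q"
proof -
  interpret cring R by fact
  interpret noetherian_ring R by fact
  interpret q: primeideal q R by fact
  let ?K = "saturation R q J"
  have K: "ideal ?K R" by (rule ideal_saturation[OF q J])
  interpret K: ideal ?K R by fact
  have sat: "saturated R q ?K" by (rule saturated_saturation[OF q])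
  have "?K \<subseteq> q" by (rule saturation_subset_prime[OF q Jq])
  then have one: "\<one>\<^bsub>R\<^esub> \<in> carrier R - ?K" using primeideal_one_notin[OF q] by auto
  then obtain I where "I \<in> colon R ?K ` (carrier R - ?K)"
    and Imax: "\<And>I'. I' \<in> colon R ?K ` (carrier R - ?K) \<Longrightarrow> I \<subseteq> I' \<Longrightarrow> I' = I"
    using maximal_ideal_exists[of "colon R ?K \<one>\<^bsub>R\<^esub>" "colon R ?K ` (carrier R - ?K)"] ideal_colon[OF K] by blast
  then obtain a where a: "a \<in> carrier R - ?K" "I = colon R ?K a" by auto
  have P: "primeideal I R"
    unfolding a(2) using a Imax by (intro maximal_colon_prime K) auto
  have "J \<subseteq> I"
  proof
    fix j assume j: "j \<in> J"
    then have "j \<in> ?K" using subset_saturation[OF q] q.a_subset Jq by blast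
    then show "j \<in> I" using a K.I_r_closed K.a_subset by (auto simp: colon_def)
  qed
  \<comment> \<open>An element outside \<open>q\<close> that multiplies \<open>a\<close> into the
    saturated ideal would already place \<open>a\<close> in it.\<close>
  moreover have "I \<subseteq> q"
    using sat a unfolding saturated_def colon_def by auto
  \<comment> \<open>If \<open>x a\<close> lies in the saturation, some \<open>t\<close> outside
    \<open>q\<close> gives \<open>x t a\<close> in \<open>J\<close>; cancelling \<open>x\<close>
    puts \<open>a\<close> itself into the saturation.\<close>
  moreover have "x \<notin> I"
  proof
    assume "x \<in> I"
    then have "x \<otimes>\<^bsub>R\<^esub> a \<in> ?K" using a by (simp add: colon_def)
    then obtain t where t: "t \<in> carrier R - q" "t \<otimes>\<^bsub>R\<^esub> (x \<otimes>\<^bsub>R\<^esub> a) \<in> J" unfolding saturation_def by auto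
    have xc: "x \<in> carrier R" using x q.a_subset by auto
    have "t \<otimes>\<^bsub>R\<^esub> (x \<otimes>\<^bsub>R\<^esub> a) = x \<otimes>\<^bsub>R\<^esub> (t \<otimes>\<^bsub>R\<^esub> a)" using t a xc by (simp add: m_lcomm)
    then have "t \<otimes>\<^bsub>R\<^esub> a \<in> J" using nzd[of "t \<otimes>\<^bsub>R\<^esub> a"] t a by auto
    then have "a \<in> ?K" unfolding saturation_def using t a by auto
    then show False using a by auto
  qed
  ultimately show ?thesis using P x by blast
qed

section \<open>Prime avoidance and the dichotomy for associated primes\<close>

text \<open>From each ideal choose an element outside \<open>P\<close>; the product of these lies in
  every ideal and, \<open>P\<close> being prime, still outside \<open>P\<close>.\<close>

lemma (in cring) prime_finite_intersection:
  assumes P: "primeideal P R" and "finite Q" "\<And>I. I \<in> Q \<Longrightarrow> ideal I R \<and> \<not> I \<subseteq> P"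
  shows "\<exists>z\<in>carrier R - P. \<forall>I\<in>Q. z \<in> I"
  using assms(2,3)
proof (induction Q)
  case empty
  then show ?case using primeideal_one_notin[OF P] by auto
next
  case (insert I Q)
  then obtain z where z: "z \<in> carrier R - P" "\<forall>I\<in>Q. z \<in> I" by auto
  interpret I: ideal I R using insert by auto
  obtain y where y: "y \<in> I" "y \<notin> P" using insert by auto
  then have "y \<in> carrier R - P" using I.a_subset by auto
  then have "z \<otimes> y \<in> carrier R - P" using primeideal_mult_closed[OF P z(1)] by auto
  moreover have "z \<otimes> y \<in> I" using y z I.I_l_closed by auto
  moreover have "z \<otimes> y \<in> I'" if "I' \<in> Q" for I'
  proof -
    interpret I': ideal I' R using insert that by auto
    show ?thesis using z that I'.I_r_closed \<open>y \<in> carrier R - P\<close> by auto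
  qed
  ultimately show ?case by auto
qed

text \<open>If the element \<open>x\<close> avoiding the other primes happens to lie in
  \<open>P\<close>, it is corrected by an element \<open>z\<close> of \<open>I\<close> that lies in
  all the others but not in \<open>P\<close>. Incomparability of the primes is what makes such a
  \<open>z\<close> exist.\<close>

lemma (in cring) prime_avoidance:
  assumes "finite Q" and prime: "\<And>P. P \<in> Q \<Longrightarrow> primeideal P R"
    and incomp: "\<And>P P'. P \<in> Q \<Longrightarrow> P' \<in> Q \<Longrightarrow> P \<subseteq> P' \<Longrightarrow> P = P'"
    and I: "ideal I R" and "\<And>P. P \<in> Q \<Longrightarrow> \<not> I \<subseteq> P"
  shows "\<exists>x\<in>I. \<forall>P\<in>Q. x \<notin> P"
  using assms(1) prime incomp assms(5)
proof (induction Q)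
  case empty
  then show ?case using additive_subgroup.zero_closed[OF ideal.axioms(1)[OF I]] by auto
next
  interpret I: ideal I R by fact
  case (insert P Q)
  then obtain x where x: "x \<in> I" "\<forall>P\<in>Q. x \<notin> P" by auto
  have P: "primeideal P R" using insert by auto
  interpret P: primeideal P R by fact
  have xc: "x \<in> carrier R" using x I.a_subset by auto
  show ?case
  proof (cases "x \<in> P")
    case False
    then show ?thesis using x by auto
  next
    case True
    have H: "ideal P' R \<and> \<not> P' \<subseteq> P" if "P' \<in> insert I Q" for P'
    proof (cases "P' = I")
      case True
      then show ?thesis using insert I by auto
    next
      case False
      then have "P' \<in> Q" using that by auto
      then have "primeideal P' R" using insert.prems(1) by simp
      moreover have "\<not> P' \<subseteq> P"
        using insert.prems(2)[of P' P] insert.hyps(2) \<open>P' \<in> Q\<close> by auto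
      ultimately show ?thesis using primeideal.axioms(1) by blast
    qed
    have "finite (insert I Q)" using insert.hyps(1) by simp
    from prime_finite_intersection[OF P this H]
    obtain z where z: "z \<in> carrier R - P" "\<forall>J\<in>insert I Q. z \<in> J" by blast
    have "x \<oplus> z \<notin> P'" if P': "P' \<in> insert P Q" for P'
    proof
      assume xz: "x \<oplus> z \<in> P'"
      have "primeideal P' R" using insert P' by auto
      then interpret P': primeideal P' R .
      have zc: "z \<in> carrier R" using z(1) by simp
      have e1: "a = (a \<oplus> b) \<ominus> b" if "a \<in> carrier R" "b \<in> carrier R" for a b
        using that by (simp add: a_minus_def a_assoc r_neg)
      have e: "x = (x \<oplus> z) \<ominus> z" "z = (x \<oplus> z) \<ominus> x"
        using e1[OF xc zc] e1[OF zc xc] by (simp_all only: a_comm[OF xc zc])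
      show False
      proof (cases "P' = P")
        case True
        then have "(x \<oplus> z) \<ominus> x \<in> P" using xz \<open>x \<in> P\<close> by (auto simp: a_minus_def)
        then show False using e(2) z by simp
      next
        case False
        then have "z \<in> P'" "x \<notin> P'" using P' z x by auto
        moreover have "(x \<oplus> z) \<ominus> z \<in> P'" using xz \<open>z \<in> P'\<close> by (auto simp: a_minus_def)
        ultimately show False using e(1) by simp
      qed
    qed
    moreover have "x \<oplus> z \<in> I" using x z by auto
    ultimately show ?thesis by blast
  qed
qed

text \<open>Either the maximal ideal of the localization at \<open>p\<close> is associated to \<open>R / J\<close>, or it contains
  a nonzerodivisor on \<open>R / J\<close>: the zero divisors form the union of the maximal members of the
  family of ideals \<open>(J : a)\<close>, and these are finitely many primes.\<close>

lemma associated_or_regular: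
  assumes "cring R" "noetherian_ring R" and p: "primeideal p R" and J: "ideal J R" and Jp: "J \<subseteq> p"
    and sat: "saturated R p J"
  shows "(\<exists>a\<in>carrier R. colon R J a = p) \<or>
    (\<exists>x\<in>p. \<forall>r\<in>carrier R. x \<otimes>\<^bsub>R\<^esub> r \<in> J \<longrightarrow> r \<in> J)"
proof (rule disjCI)
  interpret cring R by fact
  interpret noetherian_ring R by fact
  interpret p: primeideal p R by fact
  interpret J: ideal J R by fact
  assume zd: "\<not> (\<exists>x\<in>p. \<forall>r\<in>carrier R. x \<otimes>\<^bsub>R\<^esub> r \<in> J \<longrightarrow> r \<in> J)"
  \<comment> \<open>The \<open>a\<close> whose ideals \<open>(J : a)\<close> are maximal; these
    ideals are prime and pairwise incomparable.\<close>
  define A where "A = {a \<in> carrier R - J. \<forall>b\<in>carrier R - J. colon R J a \<subseteq> colon R J b \<longrightarrow> colon R J b = colon R J a}"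
  have Aprime: "primeideal (colon R J a) R" if "a \<in> A" for a
    using that unfolding A_def by (intro maximal_colon_prime[OF J]) auto
  have Aabove: "\<exists>a\<in>A. colon R J b \<subseteq> colon R J a" if b: "b \<in> carrier R - J" for b
  proof -
    define S where "S = {colon R J c | c. c \<in> carrier R - J \<and> colon R J b \<subseteq> colon R J c}"
    have "colon R J b \<in> S" using b unfolding S_def by blast
    moreover have "ideal I R" if "I \<in> S" for I using that ideal_colon[OF J] unfolding S_def by auto
    ultimately obtain I where I: "I \<in> S" and max: "\<And>I'. I' \<in> S \<Longrightarrow> I \<subseteq> I' \<Longrightarrow> I' = I"
      using maximal_ideal_exists by metis
    then obtain c where c: "c \<in> carrier R - J" "colon R J b \<subseteq> colon R J c" "I = colon R J c"
      unfolding S_def by auto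
    have "colon R J d = colon R J c" if "d \<in> carrier R - J" "colon R J c \<subseteq> colon R J d" for d
      using max[of "colon R J d"] that c unfolding S_def by blast
    then have "c \<in> A" using c unfolding A_def by blast
    then show ?thesis using c by blast
  qed
  have fin: "finite (colon R J ` A)"
  proof -
    \<comment> \<open>\<open>ann F\<close> consists of the \<open>b\<close> that the intersection of
      the \<open>(J : a)\<close>, \<open>a \<in> F\<close>, multiplies into \<open>J\<close>; it
      grows with \<open>F\<close>. When it is maximal, adjoining any \<open>b \<in> A\<close>
      changes nothing, so the prime \<open>(J : b)\<close> contains that finite intersection, hence
      one \<open>(J : a)\<close>, and equals it.\<close>
    define ann where "ann F = {b \<in> carrier R. \<forall>r\<in>carrier R. (\<forall>a\<in>F. r \<in> colon R J a) \<longrightarrow> r \<otimes>\<^bsub>R\<^esub> b \<in> J}" for F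
    have annid: "ideal (ann F) R" if "F \<subseteq> carrier R" for F
      using J.a_Hcarr J.I_l_closed that
      by (intro idealI') (auto simp: ann_def r_distr m_lcomm)
    define S where "S = ann ` {F. finite F \<and> F \<subseteq> A}"
    have Ac: "A \<subseteq> carrier R" by (auto simp: A_def)
    have "ann {} \<in> S" unfolding S_def by auto
    moreover have "ideal I R" if "I \<in> S" for I using that annid Ac unfolding S_def by auto
    ultimately obtain I where "I \<in> S" and max: "\<And>I'. I' \<in> S \<Longrightarrow> I \<subseteq> I' \<Longrightarrow> I' = I"
      using maximal_ideal_exists by metis
    then obtain F where F: "finite F" "F \<subseteq> A" "I = ann F" unfolding S_def by auto
    have "colon R J b \<in> colon R J ` F" if b: "b \<in> A" for b
    proof -
      have "ann (insert b F) \<in> S" using F b unfolding S_def by auto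
      moreover have "I \<subseteq> ann (insert b F)" unfolding F ann_def by auto
      ultimately have "ann (insert b F) = ann F" using max F by blast
      moreover have "b \<in> ann (insert b F)" using b Ac by (auto simp: ann_def colon_def)
      ultimately have bF: "b \<in> ann F" by simp
      have P: "primeideal (colon R J b) R" by (rule Aprime[OF b])
      have "\<exists>a\<in>F. colon R J a \<subseteq> colon R J b"
      proof (rule ccontr)
        assume no: "\<not> (\<exists>a\<in>F. colon R J a \<subseteq> colon R J b)"
        have "ideal I' R \<and> \<not> I' \<subseteq> colon R J b" if "I' \<in> colon R J ` F" for I'
          using that no F Ac ideal_colon[OF J] by blast
        from prime_finite_intersection[OF P finite_imageI[OF F(1)] this]
        obtain z where "z \<in> carrier R - colon R J b" "\<forall>I\<in>colon R J ` F. z \<in> I" by blast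
        then show False using bF unfolding ann_def colon_def by auto
      qed
      then obtain a where a: "a \<in> F" "colon R J a \<subseteq> colon R J b" by blast
      then have "colon R J b = colon R J a" using F b unfolding A_def by blast
      then show ?thesis using a by blast
    qed
    then have "colon R J ` A \<subseteq> colon R J ` F" by blast
    then show ?thesis using F finite_surj by blast
  qed
  \<comment> \<open>Otherwise prime avoidance gives \<open>x \<in> p\<close> outside all maximal
    \<open>(J : a)\<close>; but every element of \<open>p\<close> is assumed to be a zero divisor
    modulo \<open>J\<close> and thus lies in one of them.\<close>
  have "\<exists>P\<in>colon R J ` A. p \<subseteq> P"
  proof (rule ccontr)
    assume no: "\<not> (\<exists>P\<in>colon R J ` A. p \<subseteq> P)"
    have incomp: "P = P'" if "P \<in> colon R J ` A" "P' \<in> colon R J ` A" "P \<subseteq> P'" for P P'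
      using that unfolding A_def by blast
    have "\<exists>x\<in>p. \<forall>P\<in>colon R J ` A. x \<notin> P"
      by (rule prime_avoidance[OF fin _ incomp p.is_ideal]) (use Aprime no in auto)
    then obtain x where x: "x \<in> p" "\<forall>a\<in>A. x \<notin> colon R J a" by auto
    obtain r where r: "r \<in> carrier R" "x \<otimes>\<^bsub>R\<^esub> r \<in> J" "r \<notin> J" using zd x by blast
    obtain a where "a \<in> A" "colon R J r \<subseteq> colon R J a" using Aabove r by blast
    moreover have "x \<in> colon R J r" using r x p.a_subset by (auto simp: colon_def)
    ultimately show False using x by blast
  qed
  then obtain a where a: "a \<in> A" "p \<subseteq> colon R J a" by auto
  \<comment> \<open>Saturation: an element outside \<open>p\<close> multiplying \<open>a\<close>
    into \<open>J\<close> would force \<open>a \<in> J\<close>.\<close>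
  have "colon R J a \<subseteq> p"
    using sat a unfolding saturated_def colon_def A_def by auto
  then show "\<exists>a\<in>carrier R. colon R J a = p" using a unfolding A_def by blast
qed

section \<open>Common denominators and chains of primes\<close>

text \<open>The form in which denominators are cleared throughout: each \<open>k\<close> comes with
  its own \<open>s\<close> outside \<open>p\<close>, the property survives further factors outside
  \<open>p\<close>, so the product of finitely many \<open>s\<close> serves all \<open>k\<close> at
  once.\<close>

lemma common_multiple:
  assumes p: "primeideal p R" and "finite K" and ex: "\<And>k. k \<in> K \<Longrightarrow> \<exists>s\<in>carrier R - p. Q k s"
    and up: "\<And>k s t. \<lbrakk>k \<in> K; s \<in> carrier R - p; t \<in> carrier R - p; Q k s\<rbrakk> \<Longrightarrow> Q k (t \<otimes>\<^bsub>R\<^esub> s)"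
  shows "\<exists>s\<in>carrier R - p. \<forall>k\<in>K. Q k s"
  using assms(2) ex up
proof (induction K)
  case empty
  then show ?case using primeideal_one_notin[OF p] by auto
next
  interpret primeideal p R by fact
  case (insert a K)
  obtain s where s: "s \<in> carrier R - p" "\<forall>k\<in>K. Q k s" using insert by auto
  obtain t where t: "t \<in> carrier R - p" "Q a t" using insert.prems(1)[of a] by blast
  have st: "t \<otimes>\<^bsub>R\<^esub> s \<in> carrier R - p" by (rule primeideal_mult_closed[OF p t(1) s(1)])
  have "Q a (t \<otimes>\<^bsub>R\<^esub> s)" using insert.prems(2)[of a t s] t s by (simp add: m_comm)
  moreover have "\<forall>k\<in>K. Q k (t \<otimes>\<^bsub>R\<^esub> s)" using insert.prems(2) s t by auto
  ultimately show ?case using st by auto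
qed

text \<open>For an ideal \<open>J\<close>, this expresses that the localization of
  \<open>R / J\<close> at \<open>p\<close> has dimension at least \<open>n\<close>; its negation is
  the upper bound on the dimension that drives the induction.\<close>

definition chain_below :: "('r, 'x) ring_scheme \<Rightarrow> 'r set \<Rightarrow> 'r set \<Rightarrow> nat \<Rightarrow> bool" where
  "chain_below R J p n \<longleftrightarrow> (\<exists>C. prime_chain R n C \<and> J \<subseteq> C 0 \<and> C n \<subseteq> p)"

text \<open>The regular element \<open>x\<close> lies in the smallest prime of the chain over
  \<open>J'\<close>, so below that prime there is a further one that still contains
  \<open>J\<close>. Hence factoring out \<open>x\<close> lowers the dimension.\<close>

lemma chain_below_regular:
  assumes "cring R" "noetherian_ring R" and J: "ideal J R"
    and x: "x \<in> J'" and nzd: "\<And>r. r \<in> carrier R \<Longrightarrow> x \<otimes>\<^bsub>R\<^esub> r \<in> J \<Longrightarrow> r \<in> J"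
    and JJ': "J \<subseteq> J'" and chain: "chain_below R J' p n"
  shows "chain_below R J p (Suc n)"
proof -
  obtain C where C: "prime_chain R n C" "J' \<subseteq> C 0" "C n \<subseteq> p"
    using chain unfolding chain_below_def by blast
  have C0: "primeideal (C 0) R" "J \<subseteq> C 0" "x \<in> C 0" using C x JJ' unfolding prime_chain_def by auto
  obtain P where P: "primeideal P R" "J \<subseteq> P" "P \<subset> C 0"
    using prime_below[OF assms(1,2) C0(1) J C0(2,3) nzd] by auto
  have "prime_chain R (Suc n) (case_nat P C)"
    unfolding prime_chain_def
  proof (intro conjI allI impI)
    fix i assume "i \<le> Suc n"
    then show "primeideal (case_nat P C i) R"
      using C(1) P(1) unfolding prime_chain_def by (cases i) auto
  next
    fix i assume "i < Suc n"
    then show "case_nat P C i \<subset> case_nat P C (Suc i)"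
      using C(1) P(3) unfolding prime_chain_def by (cases i) auto
  qed
  then show ?thesis unfolding chain_below_def using P C by (intro exI[of _ "case_nat P C"]) auto
qed

subsection \<open>Congruences modulo an ideal\<close>

text \<open>The carrier conditions belong to the relation, so that a congruence also records that
  both sides are ring elements.\<close>

definition icong :: "('r, 'x) ring_scheme \<Rightarrow> 'r set \<Rightarrow> 'r \<Rightarrow> 'r \<Rightarrow> bool" where
  "icong R J a b \<longleftrightarrow> a \<in> carrier R \<and> b \<in> carrier R \<and> a \<ominus>\<^bsub>R\<^esub> b \<in> J"

context cring
begin

context
  fixes J assumes J: "ideal J R"
begin

interpretation J: ideal J R by (rule J)

lemma icong_refl: "a \<in> carrier R \<Longrightarrow> icong R J a a"
  using additive_subgroup.zero_closed[OF ideal.axioms(1)[OF J]]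
  by (simp add: icong_def a_minus_def r_neg)

lemma icong_sym: "icong R J a b \<Longrightarrow> icong R J b a"
proof -
  assume a: "icong R J a b"
  then have "\<ominus> (a \<ominus> b) \<in> J" by (simp add: icong_def)
  moreover have "\<ominus> (a \<ominus> b) = b \<ominus> a" using a unfolding icong_def by (simp add: a_minus_def minus_add a_comm)
  ultimately show ?thesis using a by (simp add: icong_def)
qed

lemma icong_add: "icong R J a b \<Longrightarrow> icong R J c d \<Longrightarrow> icong R J (a \<oplus> c) (b \<oplus> d)"
proof -
  assume a: "icong R J a b" "icong R J c d"
  then have "(a \<ominus> b) \<oplus> (c \<ominus> d) \<in> J" by (simp add: icong_def)
  moreover have "(a \<ominus> b) \<oplus> (c \<ominus> d) = (a \<oplus> c) \<ominus> (b \<oplus> d)"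
    using a unfolding icong_def by (simp add: a_minus_def minus_add a_ac)
  ultimately show ?thesis using a by (simp add: icong_def)
qed

lemma icong_mult: "r \<in> carrier R \<Longrightarrow> icong R J a b \<Longrightarrow> icong R J (r \<otimes> a) (r \<otimes> b)"
  unfolding icong_def using J.I_l_closed[of "a \<ominus> b" r]
  by (auto simp: a_minus_def r_distr r_minus)

lemma icong_minus: "icong R J a b \<Longrightarrow> icong R J c d \<Longrightarrow> icong R J (a \<ominus> c) (b \<ominus> d)"
proof -
  assume a: "icong R J a b" "icong R J c d"
  then have cl: "a \<in> carrier R" "b \<in> carrier R" "c \<in> carrier R" "d \<in> carrier R" by (auto simp: icong_def)
  have "icong R J (a \<oplus> (\<ominus> \<one>) \<otimes> c) (b \<oplus> (\<ominus> \<one>) \<otimes> d)"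
    by (intro icong_add icong_mult a) auto
  then show ?thesis using cl by (simp add: l_minus a_minus_def)
qed

lemma icong_trans [trans]: "icong R J a b \<Longrightarrow> icong R J b c \<Longrightarrow> icong R J a c"
proof -
  assume a: "icong R J a b" "icong R J b c"
  then have "(a \<ominus> b) \<oplus> (b \<ominus> c) \<in> J" by (simp add: icong_def)
  moreover have "(a \<ominus> b) \<oplus> (b \<ominus> c) = a \<ominus> c"
    using a unfolding icong_def by (simp add: a_minus_def a_assoc r_neg1)
  ultimately show ?thesis using a by (simp add: icong_def)
qed

lemma icong_zero: "a \<in> carrier R \<Longrightarrow> icong R J a \<zero> \<longleftrightarrow> a \<in> J"
  by (simp add: icong_def a_minus_def)

lemma icong_mem: "icong R J a b \<Longrightarrow> b \<in> J \<Longrightarrow> a \<in> J"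
  using icong_trans[of a b \<zero>] icong_zero[of a] icong_zero[of b] by (auto simp: icong_def)

lemma icong_mem': "icong R J a b \<Longrightarrow> a \<in> J \<Longrightarrow> b \<in> J"
  using icong_sym icong_mem by blast

lemma functional_icong:
  assumes "l \<in> lin_maps R (fvec R I) (ring_module R)" "l' \<in> lin_maps R (fvec R I) (ring_module R)"
    and "finite I" "\<And>k. k \<in> I \<Longrightarrow> icong R J (l (unit_vec R k)) (l' (unit_vec R k))"
    and v: "v \<in> carrier (fvec R I)"
  shows "icong R J (l v) (l' v)"
proof -
  have "l v \<ominus>\<^bsub>ring_module R\<^esub> l' v \<in> J"
    using assms(4) lin_closed[OF assms(1) unit_vec_closed] lin_closed[OF assms(2) unit_vec_closed]
    by (intro lin_maps_fvec_in[OF module_ring_module lin_maps_minus[OF module_ring_module assms(1,2)] assms(3)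
          submodule_of_ideal[OF J] _ v]) (simp add: icong_def)
  then show ?thesis using lin_closed[OF assms(1) v] lin_closed[OF assms(2) v] by (simp add: icong_def)
qed

lemma dot_icong:
  assumes "finite I" "f \<in> carrier (fvec R I)" "v \<in> carrier (fvec R I)" "w \<in> carrier (fvec R I)"
    and "\<And>k. icong R J (v k) (w k)"
  shows "icong R J (dot R I f v) (dot R I f w)"
proof -
  have "icong R J (dot R I v f) (dot R I w f)"
    by (rule functional_icong[OF lin_dot[OF assms(1,3)] lin_dot[OF assms(1,4)] assms(1) _ assms(2)])
      (simp add: dot_unit assms)
  then show ?thesis using assms by (simp add: dot_comm)
qed

lemma lin_icong:
  assumes "finite I" "f \<in> lin_maps R (fvec R I) (fvec R I')" "v \<in> carrier (fvec R I)" "w \<in> carrier (fvec R I)"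
    and "\<And>k. icong R J (v k) (w k)"
  shows "icong R J (f v k) (f w k)"
proof -
  obtain g where g: "g \<in> carrier (fvec R I)" "\<And>v. v \<in> carrier (fvec R I) \<Longrightarrow> dot R I g v = f v k"
    using row_of_functional[OF lin_comp[OF lin_coord assms(2)] assms(1)] by blast
  show ?thesis using dot_icong[OF assms(1) g(1) assms(3-5)] g(2) assms by simp
qed

end

lemma fvec_closed:
  "r \<in> carrier R \<Longrightarrow> v \<in> carrier (fvec R I) \<Longrightarrow> (\<lambda>k. r \<otimes> v k) \<in> carrier (fvec R I)"
  "v \<in> carrier (fvec R I) \<Longrightarrow> w \<in> carrier (fvec R I) \<Longrightarrow> (\<lambda>k. v k \<oplus> w k) \<in> carrier (fvec R I)"
  "v \<in> carrier (fvec R I) \<Longrightarrow> w \<in> carrier (fvec R I) \<Longrightarrow> (\<lambda>k. v k \<ominus> w k) \<in> carrier (fvec R I)"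
  "(\<lambda>k. \<zero>) \<in> carrier (fvec R I)"
  by (auto simp: fvec_carrier a_minus_def)

lemma lin_fvec_to_fvec:
  assumes "f \<in> lin_maps R (fvec R I) (fvec R I')"
  shows "r \<in> carrier R \<Longrightarrow> v \<in> carrier (fvec R I) \<Longrightarrow> f (\<lambda>k. r \<otimes> v k) = (\<lambda>k. r \<otimes> f v k)"
    and "v \<in> carrier (fvec R I) \<Longrightarrow> w \<in> carrier (fvec R I) \<Longrightarrow> f (\<lambda>k. v k \<ominus> w k) = (\<lambda>k. f v k \<ominus> f w k)"
  using lin_smult[OF assms, of r v] lin_minus[OF module_fvec module_fvec assms, of v w]
    fvec_minus[of v I w] fvec_minus[of "f v" I' "f w"] lin_closed[OF assms] by auto

lemma dot_algebra:
  assumes "finite I"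
  shows "f \<in> carrier (fvec R I) \<Longrightarrow> r \<in> carrier R \<Longrightarrow> v \<in> carrier (fvec R I) \<Longrightarrow>
      dot R I f (\<lambda>k. r \<otimes> v k) = r \<otimes> dot R I f v"
    and "f \<in> carrier (fvec R I) \<Longrightarrow> v \<in> carrier (fvec R I) \<Longrightarrow> w \<in> carrier (fvec R I) \<Longrightarrow>
      dot R I f (\<lambda>k. v k \<ominus> w k) = dot R I f v \<ominus> dot R I f w"
    and "v \<in> carrier (fvec R I) \<Longrightarrow> r \<in> carrier R \<Longrightarrow> f \<in> carrier (fvec R I) \<Longrightarrow>
      dot R I (\<lambda>k. r \<otimes> f k) v = r \<otimes> dot R I f v"
    and "v \<in> carrier (fvec R I) \<Longrightarrow> f \<in> carrier (fvec R I) \<Longrightarrow> g \<in> carrier (fvec R I) \<Longrightarrow>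
      dot R I (\<lambda>k. f k \<ominus> g k) v = dot R I f v \<ominus> dot R I g v"
    and "v \<in> carrier (fvec R I) \<Longrightarrow> f \<in> carrier (fvec R I) \<Longrightarrow> g \<in> carrier (fvec R I) \<Longrightarrow>
      dot R I (\<lambda>k. f k \<oplus> g k) v = dot R I f v \<oplus> dot R I g v"
    and "v \<in> carrier (fvec R I) \<Longrightarrow> dot R I (\<lambda>k. \<zero>) v = \<zero>"
    and "v \<in> carrier (fvec R I) \<Longrightarrow> dot R I v (\<lambda>k. \<zero>) = \<zero>"
proof -
  assume v: "v \<in> carrier (fvec R I)"
  show "dot R I f (\<lambda>k. r \<otimes> v k) = r \<otimes> dot R I f v" if "f \<in> carrier (fvec R I)" "r \<in> carrier R"
    using lin_smult[OF lin_dot[OF assms that(1)] that(2) v] by simp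
  show "dot R I f (\<lambda>k. v k \<ominus> w k) = dot R I f v \<ominus> dot R I f w"
    if "f \<in> carrier (fvec R I)" "w \<in> carrier (fvec R I)"
    using lin_minus[OF module_fvec module_ring_module lin_dot[OF assms that(1)] v that(2)] that v
    by (simp add: fvec_minus)
  show "dot R I (\<lambda>k. r \<otimes> f k) v = r \<otimes> dot R I f v" if "r \<in> carrier R" "f \<in> carrier (fvec R I)"
    using lin_smult[OF lin_dot_left[OF assms v] that] by simp
  show "dot R I (\<lambda>k. f k \<ominus> g k) v = dot R I f v \<ominus> dot R I g v"
    if "f \<in> carrier (fvec R I)" "g \<in> carrier (fvec R I)"
    using lin_minus[OF module_fvec module_ring_module lin_dot_left[OF assms v] that] that v
    by (simp add: fvec_minus)
  show "dot R I (\<lambda>k. f k \<oplus> g k) v = dot R I f v \<oplus> dot R I g v"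
    if "f \<in> carrier (fvec R I)" "g \<in> carrier (fvec R I)"
    using lin_add[OF lin_dot_left[OF assms v] that] by simp
  show "dot R I (\<lambda>k. \<zero>) v = \<zero>"
    using lin_zero[OF module_fvec module_ring_module lin_dot_left[OF assms v]] by simp
  show "dot R I v (\<lambda>k. \<zero>) = \<zero>"
    using lin_zero[OF module_fvec module_ring_module lin_dot[OF assms v]] by simp
qed

end

subsection \<open>Local Nakayama\<close>

text \<open>Localized at \<open>p\<close>, \<open>Z / B\<close> is a nonzero finitely generated
  module and therefore has a maximal proper submodule, whose preimage is \<open>W\<close>. The
  quotient \<open>Z / W\<close> is locally a line over the residue field: it is killed by
  \<open>p\<close>, and any element outside \<open>W\<close> generates it up to a
  denominator.\<close>

lemma maximal_saturated_submodule:
  assumes "module R M" "noetherian_module R M" and p: "primeideal p R"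
    and Z: "submodule Z R M" and B: "submodule B R M" and BZ: "B \<subset> Z"
    and sat: "\<And>s z. s \<in> carrier R - p \<Longrightarrow> z \<in> Z \<Longrightarrow> s \<odot>\<^bsub>M\<^esub> z \<in> B \<Longrightarrow> z \<in> B"
  obtains W where "submodule W R M" "B \<subseteq> W" "W \<subset> Z"
    "\<And>s z. s \<in> carrier R - p \<Longrightarrow> z \<in> Z \<Longrightarrow> s \<odot>\<^bsub>M\<^esub> z \<in> W \<Longrightarrow> z \<in> W"
    "\<And>x z. x \<in> p \<Longrightarrow> z \<in> Z \<Longrightarrow> x \<odot>\<^bsub>M\<^esub> z \<in> W"
    "\<And>z y. z \<in> Z \<Longrightarrow> z \<notin> W \<Longrightarrow> y \<in> Z \<Longrightarrow>
      \<exists>s\<in>carrier R - p. \<exists>r\<in>carrier R. s \<odot>\<^bsub>M\<^esub> y \<ominus>\<^bsub>M\<^esub> r \<odot>\<^bsub>M\<^esub> z \<in> W"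
proof -
  interpret M: module R M by fact
  interpret p: primeideal p R by fact
  have pc: "p \<subseteq> carrier R" by (rule p.a_subset)
  define S where "S = {W. submodule W R M \<and> B \<subseteq> W \<and> W \<subset> Z \<and>
    (\<forall>s\<in>carrier R - p. \<forall>z\<in>Z. s \<odot>\<^bsub>M\<^esub> z \<in> W \<longrightarrow> z \<in> W)}"
  have "B \<in> S" using B BZ sat unfolding S_def by auto
  moreover have "submodule W R M" if "W \<in> S" for W using that by (simp add: S_def)
  ultimately obtain W where WS: "W \<in> S" and max: "\<And>W'. W' \<in> S \<Longrightarrow> W \<subseteq> W' \<Longrightarrow> W' = W"
    using noetherian_module_maximal[where h = "\<lambda>K. K", OF assms(2)] by metis
  have W: "submodule W R M" "B \<subseteq> W" "W \<subset> Z" using WS by (auto simp: S_def)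
  have satW: "z \<in> W" if "s \<in> carrier R - p" "z \<in> Z" "s \<odot>\<^bsub>M\<^esub> z \<in> W" for s z
    using WS that by (auto simp: S_def)
  note ZE = M.submoduleE[OF Z] and WE = M.submoduleE[OF W(1)]
  have Zc: "z \<in> carrier M" if "z \<in> Z" for z using ZE(1) that by auto
  have third: "\<exists>s\<in>carrier R - p. \<exists>r\<in>carrier R. s \<odot>\<^bsub>M\<^esub> y \<ominus>\<^bsub>M\<^esub> r \<odot>\<^bsub>M\<^esub> z \<in> W"
    if z: "z \<in> Z" "z \<notin> W" and y: "y \<in> Z" for z y
  proof -
    \<comment> \<open>The saturated submodule generated by \<open>W\<close> and \<open>z\<close>; by
      maximality of \<open>W\<close> it is all of \<open>Z\<close>.\<close>
    define W' where "W' = {y \<in> Z. \<exists>s\<in>carrier R - p. \<exists>r\<in>carrier R. s \<odot>\<^bsub>M\<^esub> y \<ominus>\<^bsub>M\<^esub> r \<odot>\<^bsub>M\<^esub> z \<in> W}"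
    have zc: "z \<in> carrier M" using z Zc by auto
    have one: "\<one>\<^bsub>R\<^esub> \<in> carrier R - p" by (rule primeideal_one_notin[OF p])
    have WW': "W \<subseteq> W'"
    proof
      fix w assume w: "w \<in> W"
      then have "\<one>\<^bsub>R\<^esub> \<odot>\<^bsub>M\<^esub> w \<ominus>\<^bsub>M\<^esub> \<zero>\<^bsub>R\<^esub> \<odot>\<^bsub>M\<^esub> z = w" using W Zc zc by (auto simp: a_minus_def)
      then show "w \<in> W'" unfolding W'_def using w W(3) one M.R.zero_closed by force
    qed
    have "submodule W' R M"
    proof (rule M.submoduleI')
      show "W' \<subseteq> carrier M" using Zc by (auto simp: W'_def)
      show "\<zero>\<^bsub>M\<^esub> \<in> W'" using M.submodule_zero[OF W(1)] WW' by auto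
    next
      fix a b assume "a \<in> W'" "b \<in> W'"
      then obtain s r s' r' where st: "s \<in> carrier R - p" "r \<in> carrier R" "s' \<in> carrier R - p" "r' \<in> carrier R"
        and w: "s \<odot>\<^bsub>M\<^esub> a \<ominus>\<^bsub>M\<^esub> r \<odot>\<^bsub>M\<^esub> z \<in> W" "s' \<odot>\<^bsub>M\<^esub> b \<ominus>\<^bsub>M\<^esub> r' \<odot>\<^bsub>M\<^esub> z \<in> W"
        and ab: "a \<in> Z" "b \<in> Z" unfolding W'_def by blast
      have abc: "a \<in> carrier M" "b \<in> carrier M" using ab Zc by auto
      have "s' \<odot>\<^bsub>M\<^esub> (s \<odot>\<^bsub>M\<^esub> a \<ominus>\<^bsub>M\<^esub> r \<odot>\<^bsub>M\<^esub> z) \<oplus>\<^bsub>M\<^esub> s \<odot>\<^bsub>M\<^esub> (s' \<odot>\<^bsub>M\<^esub> b \<ominus>\<^bsub>M\<^esub> r' \<odot>\<^bsub>M\<^esub> z) \<in> W"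
        using w st WE(4,5) by auto
      also have "s' \<odot>\<^bsub>M\<^esub> (s \<odot>\<^bsub>M\<^esub> a \<ominus>\<^bsub>M\<^esub> r \<odot>\<^bsub>M\<^esub> z) \<oplus>\<^bsub>M\<^esub> s \<odot>\<^bsub>M\<^esub> (s' \<odot>\<^bsub>M\<^esub> b \<ominus>\<^bsub>M\<^esub> r' \<odot>\<^bsub>M\<^esub> z) =
        (s \<otimes>\<^bsub>R\<^esub> s') \<odot>\<^bsub>M\<^esub> (a \<oplus>\<^bsub>M\<^esub> b) \<ominus>\<^bsub>M\<^esub> (s' \<otimes>\<^bsub>R\<^esub> r \<oplus>\<^bsub>R\<^esub> s \<otimes>\<^bsub>R\<^esub> r') \<odot>\<^bsub>M\<^esub> z"
        using st abc zc
        by (simp add: a_minus_def M.smult_r_distr M.smult_l_distr M.smult_r_minus M.smult_assoc1[symmetric]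
            M.R.m_comm M.M.minus_add M.M.a_ac)
      finally show "a \<oplus>\<^bsub>M\<^esub> b \<in> W'"
        unfolding W'_def using ab ZE(5) primeideal_mult_closed[OF p st(1,3)] st by blast
    next
      fix t a assume t: "t \<in> carrier R" and "a \<in> W'"
      then obtain s r where st: "s \<in> carrier R - p" "r \<in> carrier R"
        and w: "s \<odot>\<^bsub>M\<^esub> a \<ominus>\<^bsub>M\<^esub> r \<odot>\<^bsub>M\<^esub> z \<in> W" and a: "a \<in> Z" unfolding W'_def by blast
      have "t \<odot>\<^bsub>M\<^esub> (s \<odot>\<^bsub>M\<^esub> a \<ominus>\<^bsub>M\<^esub> r \<odot>\<^bsub>M\<^esub> z) \<in> W" using w t WE(4) by auto
      also have "t \<odot>\<^bsub>M\<^esub> (s \<odot>\<^bsub>M\<^esub> a \<ominus>\<^bsub>M\<^esub> r \<odot>\<^bsub>M\<^esub> z) = s \<odot>\<^bsub>M\<^esub> (t \<odot>\<^bsub>M\<^esub> a) \<ominus>\<^bsub>M\<^esub> (t \<otimes>\<^bsub>R\<^esub> r) \<odot>\<^bsub>M\<^esub> z"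
        using st t Zc[OF a] zc
        by (simp add: a_minus_def M.smult_r_distr M.smult_r_minus M.smult_assoc1[symmetric] M.R.m_comm)
      finally show "t \<odot>\<^bsub>M\<^esub> a \<in> W'"
        unfolding W'_def using a t ZE(4) st by blast
    qed
    moreover have "B \<subseteq> W'" using W WW' by auto
    moreover have "\<forall>s\<in>carrier R - p. \<forall>y\<in>Z. s \<odot>\<^bsub>M\<^esub> y \<in> W' \<longrightarrow> y \<in> W'"
    proof (intro ballI impI)
      fix t y assume t: "t \<in> carrier R - p" and y: "y \<in> Z" and "t \<odot>\<^bsub>M\<^esub> y \<in> W'"
      then obtain s r where st: "s \<in> carrier R - p" "r \<in> carrier R"
        and w: "s \<odot>\<^bsub>M\<^esub> (t \<odot>\<^bsub>M\<^esub> y) \<ominus>\<^bsub>M\<^esub> r \<odot>\<^bsub>M\<^esub> z \<in> W" unfolding W'_def by blast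
      have "(s \<otimes>\<^bsub>R\<^esub> t) \<odot>\<^bsub>M\<^esub> y \<ominus>\<^bsub>M\<^esub> r \<odot>\<^bsub>M\<^esub> z \<in> W"
        using w st t Zc[OF y] by (simp add: M.smult_assoc1)
      then show "y \<in> W'" unfolding W'_def using y primeideal_mult_closed[OF p st(1) t] st(2) by blast
    qed
    moreover have "z \<in> W'"
    proof -
      have "\<one>\<^bsub>R\<^esub> \<odot>\<^bsub>M\<^esub> z \<ominus>\<^bsub>M\<^esub> \<one>\<^bsub>R\<^esub> \<odot>\<^bsub>M\<^esub> z \<in> W"
        using zc M.submodule_zero[OF W(1)] by (simp add: a_minus_def M.M.r_neg)
      then show ?thesis unfolding W'_def using z one by blast
    qed
    ultimately have "\<not> W' \<subset> Z" using max[OF _ WW'] z unfolding S_def by blast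
    then have "W' = Z" unfolding W'_def by blast
    then show ?thesis using y unfolding W'_def by blast
  qed
  \<comment> \<open>If \<open>x z\<close> were outside \<open>W\<close>, it would generate
    \<open>z\<close> up to a denominator, giving \<open>(s - r x) z \<in> W\<close>. Since
    \<open>x \<in> p\<close>, the factor \<open>s - r x\<close> is outside \<open>p\<close>, so
    saturation yields \<open>z \<in> W\<close> and with it \<open>x z \<in> W\<close>.\<close>
  have second: "x \<odot>\<^bsub>M\<^esub> z \<in> W" if x: "x \<in> p" and z: "z \<in> Z" for x z
  proof (rule ccontr)
    assume no: "x \<odot>\<^bsub>M\<^esub> z \<notin> W"
    have xc: "x \<in> carrier R" using x pc by auto
    then have "x \<odot>\<^bsub>M\<^esub> z \<in> Z" using z ZE(4) by auto
    from third[OF this no z] obtain s r where st: "s \<in> carrier R - p" "r \<in> carrier R"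
      and w: "s \<odot>\<^bsub>M\<^esub> z \<ominus>\<^bsub>M\<^esub> r \<odot>\<^bsub>M\<^esub> (x \<odot>\<^bsub>M\<^esub> z) \<in> W" by blast
    have "(s \<ominus>\<^bsub>R\<^esub> r \<otimes>\<^bsub>R\<^esub> x) \<odot>\<^bsub>M\<^esub> z \<in> W"
      using w st xc Zc[OF z] by (simp add: M.smult_minus_distr M.smult_assoc1)
    moreover have "s \<ominus>\<^bsub>R\<^esub> r \<otimes>\<^bsub>R\<^esub> x \<in> carrier R - p"
    proof -
      have "s \<in> p" if "s \<ominus>\<^bsub>R\<^esub> r \<otimes>\<^bsub>R\<^esub> x \<in> p"
      proof -
        have "(s \<ominus>\<^bsub>R\<^esub> r \<otimes>\<^bsub>R\<^esub> x) \<oplus>\<^bsub>R\<^esub> r \<otimes>\<^bsub>R\<^esub> x \<in> p" using that p.I_l_closed[OF x st(2)] by auto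
        moreover have "(s \<ominus>\<^bsub>R\<^esub> r \<otimes>\<^bsub>R\<^esub> x) \<oplus>\<^bsub>R\<^esub> r \<otimes>\<^bsub>R\<^esub> x = s"
          using st xc by (simp add: a_minus_def M.R.a_assoc M.R.l_neg)
        ultimately show ?thesis by simp
      qed
      then show ?thesis using st xc by auto
    qed
    ultimately have "z \<in> W" using satW z by blast
    then show False using no WE(4) xc by blast
  qed
  show ?thesis using that W satW second third by blast
qed

subsection \<open>Dualizing a free complex\<close>

text \<open>Linear functionals on \<open>fvec R I\<close> (rows) are represented by vectors via the pairing \<open>dot\<close>.\<close>

locale free_complex = cring R for R (structure) +
  fixes p :: "'a set" and I :: "nat \<Rightarrow> 'i set" and \<phi> :: "nat \<Rightarrow> ('i \<Rightarrow> 'a) \<Rightarrow> ('i \<Rightarrow> 'a)"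
  assumes noetherian: "noetherian_ring R" and prime: "primeideal p R"
    and fin [simp]: "finite (I i)"
    and lin: "\<phi> i \<in> lin_maps R (fvec R (I (Suc i))) (fvec R (I i))"
    and complex: "v \<in> carrier (fvec R (I (Suc (Suc i)))) \<Longrightarrow> \<phi> i (\<phi> (Suc i) v) = (\<lambda>_. \<zero>)"
    and split: "\<exists>e\<ge>n. \<exists>h\<in>lin_maps R (fvec R (I (Suc e))) (fvec R (I (Suc (Suc e)))).
      \<exists>h'\<in>lin_maps R (fvec R (I e)) (fvec R (I (Suc e))).
      \<forall>v\<in>carrier (fvec R (I (Suc e))). v = (\<lambda>k. \<phi> (Suc e) (h v) k \<oplus> h' (\<phi> e v) k)"
begin

abbreviation "F i \<equiv> fvec R (I i)"
abbreviation "V i \<equiv> carrier (fvec R (I i))"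

text \<open>Everything is understood over the localization of \<open>R / J\<close> at \<open>p\<close>. Note the index shift:
  \<open>coboundary_rows J i\<close>, \<open>exact_mod J i\<close> and \<open>split_mod J i\<close> refer to the place \<open>i + 1\<close>.\<close>

definition cocycle_rows :: "'a set \<Rightarrow> nat \<Rightarrow> ('i \<Rightarrow> 'a) set" where
  "cocycle_rows J i = {z \<in> V i. \<forall>v\<in>V (Suc i). dot R (I i) z (\<phi> i v) \<in> J}"

text \<open>The factor \<open>s\<close> makes this the contraction of the localized coboundaries.
  The cocycles carry no such factor, because a saturated \<open>J\<close> absorbs
  denominators.\<close>

definition coboundary_rows :: "'a set \<Rightarrow> nat \<Rightarrow> ('i \<Rightarrow> 'a) set" where
  "coboundary_rows J i = {z \<in> V (Suc i). \<exists>s\<in>carrier R - p. \<exists>g\<in>V i. \<forall>v\<in>V (Suc i).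
     icong R J (s \<otimes> dot R (I (Suc i)) z v) (dot R (I i) g (\<phi> i v))}"

definition exact_mod :: "'a set \<Rightarrow> nat \<Rightarrow> bool" where
  "exact_mod J i \<longleftrightarrow> (\<forall>v\<in>V (Suc i). (\<forall>k. \<phi> i v k \<in> J) \<longrightarrow>
     (\<exists>s\<in>carrier R - p. \<exists>u\<in>V (Suc (Suc i)). \<forall>k. icong R J (s \<otimes> v k) (\<phi> (Suc i) u k)))"

text \<open>\<open>T\<close> is the transpose of a projection onto the cocycles, up to the scalar \<open>s\<close>.\<close>

definition split_mod :: "'a set \<Rightarrow> nat \<Rightarrow> bool" where
  "split_mod J i \<longleftrightarrow> (\<exists>s\<in>carrier R - p. \<exists>T\<in>lin_maps R (F (Suc i)) (F (Suc i)).
     (\<forall>v\<in>V (Suc (Suc i)). \<forall>k. T (\<phi> (Suc i) v) k \<in> J) \<and>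
     (\<forall>z\<in>cocycle_rows J (Suc i). \<forall>v\<in>V (Suc i).
        icong R J (s \<otimes> dot R (I (Suc i)) z v) (dot R (I (Suc i)) z (T v))))"

lemma phi_closed [simp]: "v \<in> V (Suc i) \<Longrightarrow> \<phi> i v \<in> V i"
  using lin_closed[OF lin] .

lemma phi_coord [simp]: "v \<in> V (Suc i) \<Longrightarrow> \<phi> i v k \<in> carrier R"
  by (rule fvec_coord[OF phi_closed])

lemma phi_mult: "r \<in> carrier R \<Longrightarrow> v \<in> V (Suc i) \<Longrightarrow> \<phi> i (\<lambda>k. r \<otimes> v k) = (\<lambda>k. r \<otimes> \<phi> i v k)"
  and phi_minus: "v \<in> V (Suc i) \<Longrightarrow> w \<in> V (Suc i) \<Longrightarrow> \<phi> i (\<lambda>k. v k \<ominus> w k) = (\<lambda>k. \<phi> i v k \<ominus> \<phi> i w k)"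
  using lin_fvec_to_fvec[OF lin] by blast+

lemma noetherian_F: "noetherian_module R (F i)"
  by (rule noetherian_fvec[OF is_cring noetherian fin])

lemma one_np: "\<one> \<in> carrier R - p" by (rule primeideal_one_notin[OF prime])

lemma mult_np: "s \<in> carrier R - p \<Longrightarrow> t \<in> carrier R - p \<Longrightarrow> s \<otimes> t \<in> carrier R - p"
  by (rule primeideal_mult_closed[OF prime])

lemma functional_row:
  assumes "l \<in> lin_maps R (F i) (F j)"
  obtains f where "f \<in> V i" "\<And>v. v \<in> V i \<Longrightarrow> dot R (I i) f v = l v k"
  using row_of_functional[OF lin_comp[OF lin_coord assms] fin] by blast

section \<open>Cocycle and coboundary rows as saturated submodules\<close>

context
  fixes J assumes J: "ideal J R" and Jp: "J \<subseteq> p" and sat: "saturated R p J"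
begin

interpretation J: ideal J R by (rule J)

lemma saturatedD: "s \<in> carrier R - p \<Longrightarrow> r \<in> carrier R \<Longrightarrow> s \<otimes> r \<in> J \<Longrightarrow> r \<in> J"
  using sat unfolding saturated_def by blast

lemma J_carrier: "r \<in> J \<Longrightarrow> r \<in> carrier R" using J.a_subset by auto

lemma zero_J: "\<zero> \<in> J" by (rule additive_subgroup.zero_closed[OF ideal.axioms(1)[OF J]])

lemma submodule_cocycle_rows: "submodule (cocycle_rows J i) R (F i)"
proof -
  interpret M: module R "F i" by (rule module_fvec)
  show ?thesis
    by (rule M.submoduleI')
      (auto simp: cocycle_rows_def fvec_closed dot_algebra zero_J J.I_l_closed)
qed

lemma submodule_coboundary_rows: "submodule (coboundary_rows J i) R (F (Suc i))"
proof -
  interpret M: module R "F (Suc i)" by (rule module_fvec)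
  show ?thesis
  proof (rule M.submoduleI')
    show "coboundary_rows J i \<subseteq> V (Suc i)" by (auto simp: coboundary_rows_def)
    show "\<zero>\<^bsub>F (Suc i)\<^esub> \<in> coboundary_rows J i"
      unfolding coboundary_rows_def using one_np
      by (auto intro!: bexI[of _ \<one>] bexI[of _ "\<lambda>_. \<zero>"] simp: fvec_closed dot_algebra icong_refl[OF J])
  next
    fix a b assume "a \<in> coboundary_rows J i" "b \<in> coboundary_rows J i"
    then obtain s t g h where st: "s \<in> carrier R - p" "t \<in> carrier R - p" and gh: "g \<in> V i" "h \<in> V i"
      and ab: "a \<in> V (Suc i)" "b \<in> V (Suc i)"
      and c: "\<And>v. v \<in> V (Suc i) \<Longrightarrow> icong R J (s \<otimes> dot R (I (Suc i)) a v) (dot R (I i) g (\<phi> i v))"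
        "\<And>v. v \<in> V (Suc i) \<Longrightarrow> icong R J (t \<otimes> dot R (I (Suc i)) b v) (dot R (I i) h (\<phi> i v))"
      unfolding coboundary_rows_def by blast
    have st': "s \<in> carrier R" "t \<in> carrier R" using st by auto
    let ?g = "\<lambda>k. t \<otimes> g k \<oplus> s \<otimes> h k"
    have g: "?g \<in> V i" using gh st' by (intro fvec_closed) auto
    have "icong R J ((s \<otimes> t) \<otimes> dot R (I (Suc i)) (\<lambda>k. a k \<oplus> b k) v) (dot R (I i) ?g (\<phi> i v))"
      if v: "v \<in> V (Suc i)" for v
    proof -
      have "icong R J (t \<otimes> (s \<otimes> dot R (I (Suc i)) a v) \<oplus> s \<otimes> (t \<otimes> dot R (I (Suc i)) b v))
          (t \<otimes> dot R (I i) g (\<phi> i v) \<oplus> s \<otimes> dot R (I i) h (\<phi> i v))"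
        using c[OF v] st' by (intro icong_add[OF J] icong_mult[OF J]) auto
      then show ?thesis using v st' ab gh
        by (simp add: dot_algebra fvec_closed r_distr m_ac)
    qed
    then show "a \<oplus>\<^bsub>F (Suc i)\<^esub> b \<in> coboundary_rows J i"
      unfolding coboundary_rows_def using mult_np[OF st] g ab fvec_closed(2)[OF ab] by auto
  next
    fix r a assume r: "r \<in> carrier R" and "a \<in> coboundary_rows J i"
    then obtain s g where st: "s \<in> carrier R - p" and gh: "g \<in> V i" and ab: "a \<in> V (Suc i)"
      and c: "\<And>v. v \<in> V (Suc i) \<Longrightarrow> icong R J (s \<otimes> dot R (I (Suc i)) a v) (dot R (I i) g (\<phi> i v))"
      unfolding coboundary_rows_def by blast
    have s: "s \<in> carrier R" using st by auto
    have "icong R J (s \<otimes> dot R (I (Suc i)) (\<lambda>k. r \<otimes> a k) v) (dot R (I i) (\<lambda>k. r \<otimes> g k) (\<phi> i v))"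
      if v: "v \<in> V (Suc i)" for v
    proof -
      have "icong R J (r \<otimes> (s \<otimes> dot R (I (Suc i)) a v)) (r \<otimes> dot R (I i) g (\<phi> i v))"
        using c[OF v] r by (intro icong_mult[OF J])
      then show ?thesis using v r s ab gh by (simp add: dot_algebra m_lcomm)
    qed
    then show "r \<odot>\<^bsub>F (Suc i)\<^esub> a \<in> coboundary_rows J i"
      unfolding coboundary_rows_def using st fvec_closed(1)[OF r gh] fvec_closed(1)[OF r ab] by auto
  qed
qed

lemma coboundary_rowsI:
  assumes "z \<in> V (Suc i)" "s \<in> carrier R - p" "g \<in> V i"
    and "\<And>v. v \<in> V (Suc i) \<Longrightarrow> icong R J (s \<otimes> dot R (I (Suc i)) z v) (dot R (I i) g (\<phi> i v))"
  shows "z \<in> coboundary_rows J i"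
  using assms unfolding coboundary_rows_def by blast

lemma coboundary_rows_J:
  assumes "z \<in> V (Suc i)" "\<And>v. v \<in> V (Suc i) \<Longrightarrow> dot R (I (Suc i)) z v \<in> J"
  shows "z \<in> coboundary_rows J i"
  using assms(1) one_np
proof (rule coboundary_rowsI)
  show "(\<lambda>_. \<zero>) \<in> V i" by (rule fvec_closed)
  show "icong R J (\<one> \<otimes> dot R (I (Suc i)) z v) (dot R (I i) (\<lambda>_. \<zero>) (\<phi> i v))" if "v \<in> V (Suc i)" for v
    using assms that by (simp add: dot_algebra icong_zero[OF J])
qed

lemma coboundary_rows_subset: "coboundary_rows J i \<subseteq> cocycle_rows J (Suc i)"
proof
  fix z assume "z \<in> coboundary_rows J i"
  then obtain s g where s: "s \<in> carrier R - p" and g: "g \<in> V i" and z: "z \<in> V (Suc i)"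
    and c: "\<And>v. v \<in> V (Suc i) \<Longrightarrow> icong R J (s \<otimes> dot R (I (Suc i)) z v) (dot R (I i) g (\<phi> i v))"
    unfolding coboundary_rows_def by blast
  have "dot R (I (Suc i)) z (\<phi> (Suc i) v) \<in> J" if v: "v \<in> V (Suc (Suc i))" for v
  proof -
    have "icong R J (s \<otimes> dot R (I (Suc i)) z (\<phi> (Suc i) v)) \<zero>"
      using c[of "\<phi> (Suc i) v"] v g by (simp add: complex dot_algebra)
    then have "s \<otimes> dot R (I (Suc i)) z (\<phi> (Suc i) v) \<in> J"
      using icong_zero[OF J] unfolding icong_def by blast
    then show ?thesis using saturatedD[OF s] z v by simp
  qed
  then show "z \<in> cocycle_rows J (Suc i)" using z by (simp add: cocycle_rows_def)
qed

lemma coboundary_rows_saturated: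
  assumes s: "s \<in> carrier R - p" and z: "z \<in> V (Suc i)" and sz: "(\<lambda>k. s \<otimes> z k) \<in> coboundary_rows J i"
  shows "z \<in> coboundary_rows J i"
proof -
  obtain t g where t: "t \<in> carrier R - p" and g: "g \<in> V i"
    and c: "\<And>v. v \<in> V (Suc i) \<Longrightarrow> icong R J (t \<otimes> dot R (I (Suc i)) (\<lambda>k. s \<otimes> z k) v) (dot R (I i) g (\<phi> i v))"
    using sz unfolding coboundary_rows_def by blast
  show ?thesis
  proof (rule coboundary_rowsI[OF z mult_np[OF t s] g])
    show "icong R J (t \<otimes> s \<otimes> dot R (I (Suc i)) z v) (dot R (I i) g (\<phi> i v))" if "v \<in> V (Suc i)" for v
      using c[OF that] z that s t by (simp add: dot_algebra m_assoc)
  qed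
qed

text \<open>If the dual complex has cohomology at this place, the cohomology has a quotient
  \<open>Z / W\<close> that is locally a line over the residue field. The vanishing proofs below
  derive their contradictions from this line.\<close>

lemma proper_coboundary_rows:
  assumes "\<not> cocycle_rows J (Suc i) \<subseteq> coboundary_rows J i"
  obtains W where "submodule W R (F (Suc i))" "coboundary_rows J i \<subseteq> W" "W \<subset> cocycle_rows J (Suc i)"
    "\<And>s z. s \<in> carrier R - p \<Longrightarrow> z \<in> cocycle_rows J (Suc i) \<Longrightarrow> (\<lambda>k. s \<otimes> z k) \<in> W \<Longrightarrow> z \<in> W"
    "\<And>x z. x \<in> p \<Longrightarrow> z \<in> cocycle_rows J (Suc i) \<Longrightarrow> (\<lambda>k. x \<otimes> z k) \<in> W"
    "\<And>z y. z \<in> cocycle_rows J (Suc i) \<Longrightarrow> z \<notin> W \<Longrightarrow> y \<in> cocycle_rows J (Suc i) \<Longrightarrow>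
      \<exists>s\<in>carrier R - p. \<exists>r\<in>carrier R. (\<lambda>k. s \<otimes> y k \<ominus> r \<otimes> z k) \<in> W"
proof -
  have sub: "coboundary_rows J i \<subset> cocycle_rows J (Suc i)" using assms coboundary_rows_subset by blast
  have Zc: "z \<in> V (Suc i)" if "z \<in> cocycle_rows J (Suc i)" for z using that by (simp add: cocycle_rows_def)
  have eq: "s \<odot>\<^bsub>F (Suc i)\<^esub> y \<ominus>\<^bsub>F (Suc i)\<^esub> r \<odot>\<^bsub>F (Suc i)\<^esub> z = (\<lambda>k. s \<otimes> y k \<ominus> r \<otimes> z k)"
    if "s \<in> carrier R" "r \<in> carrier R" "y \<in> cocycle_rows J (Suc i)" "z \<in> cocycle_rows J (Suc i)" for s r y z
    using that Zc fvec_minus[of "\<lambda>k. s \<otimes> y k" "I (Suc i)" "\<lambda>k. r \<otimes> z k"] by (simp add: fvec_closed)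
  show ?thesis
  proof (rule maximal_saturated_submodule[OF module_fvec noetherian_F prime submodule_cocycle_rows
      submodule_coboundary_rows sub])
    show "z \<in> coboundary_rows J i"
      if "s \<in> carrier R - p" "z \<in> cocycle_rows J (Suc i)" "s \<odot>\<^bsub>F (Suc i)\<^esub> z \<in> coboundary_rows J i" for s z
      using coboundary_rows_saturated[OF that(1) Zc[OF that(2)]] that by simp
    fix W assume W: "submodule W R (F (Suc i))" "coboundary_rows J i \<subseteq> W" "W \<subset> cocycle_rows J (Suc i)"
      and W4: "\<And>s z. s \<in> carrier R - p \<Longrightarrow> z \<in> cocycle_rows J (Suc i) \<Longrightarrow> s \<odot>\<^bsub>F (Suc i)\<^esub> z \<in> W \<Longrightarrow> z \<in> W"
      and W5: "\<And>x z. x \<in> p \<Longrightarrow> z \<in> cocycle_rows J (Suc i) \<Longrightarrow> x \<odot>\<^bsub>F (Suc i)\<^esub> z \<in> W"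
      and W6: "\<And>z y. z \<in> cocycle_rows J (Suc i) \<Longrightarrow> z \<notin> W \<Longrightarrow> y \<in> cocycle_rows J (Suc i) \<Longrightarrow>
        \<exists>s\<in>carrier R - p. \<exists>r\<in>carrier R. s \<odot>\<^bsub>F (Suc i)\<^esub> y \<ominus>\<^bsub>F (Suc i)\<^esub> r \<odot>\<^bsub>F (Suc i)\<^esub> z \<in> W"
    show ?thesis
    proof (rule that[OF W])
      show "z \<in> W" if "s \<in> carrier R - p" "z \<in> cocycle_rows J (Suc i)" "(\<lambda>k. s \<otimes> z k) \<in> W" for s z
        using W4[OF that(1,2)] that(3) unfolding fvec_simps by blast
      show "(\<lambda>k. x \<otimes> z k) \<in> W" if "x \<in> p" "z \<in> cocycle_rows J (Suc i)" for x z
        using W5[OF that] by simp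
      show "\<exists>s\<in>carrier R - p. \<exists>r\<in>carrier R. (\<lambda>k. s \<otimes> y k \<ominus> r \<otimes> z k) \<in> W"
        if H: "z \<in> cocycle_rows J (Suc i)" "z \<notin> W" "y \<in> cocycle_rows J (Suc i)" for z y
      proof -
        obtain s r where "s \<in> carrier R - p" "r \<in> carrier R"
          "s \<odot>\<^bsub>F (Suc i)\<^esub> y \<ominus>\<^bsub>F (Suc i)\<^esub> r \<odot>\<^bsub>F (Suc i)\<^esub> z \<in> W" using W6[OF H] by blast
        then show ?thesis using eq[OF _ _ H(3,1), of s r] by (intro bexI[of _ s] bexI[of _ r]) simp_all
      qed
    qed
  qed
qed

subsection \<open>Depth zero\<close>

text \<open>The multiples of \<open>a\<close> form a copy of \<open>R / p\<close> inside
  \<open>R / J\<close>. Projecting rows onto the cocycles and then onto the line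
  \<open>Z / W\<close> is a functional on all rows, hence given by a vector \<open>v\<close>. It
  kills coboundaries, so \<open>\<phi> i v\<close> has coordinates in \<open>p\<close> and
  \<open>a v\<close> is a cycle modulo \<open>J\<close>. By exactness it is a boundary up to a
  denominator, so the cocycle \<open>z\<close> pairs with \<open>a v\<close> into \<open>J\<close>;
  this puts the pairing of \<open>z\<close> and \<open>v\<close> into \<open>p\<close>, although it
  represents the nonzero class of \<open>z\<close>.\<close>

lemma depth_zero_coboundary:
  assumes a: "a \<in> carrier R" "colon R J a = p" and ex: "exact_mod J i" and spl: "split_mod J i"
  shows "cocycle_rows J (Suc i) \<subseteq> coboundary_rows J i"
proof (rule ccontr)
  let ?Z = "cocycle_rows J (Suc i)" and ?d = "dot R (I (Suc i))"
  assume "\<not> ?Z \<subseteq> coboundary_rows J i"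
  then obtain W where W: "submodule W R (F (Suc i))" "coboundary_rows J i \<subseteq> W" "W \<subset> ?Z"
    and satW: "\<And>s z. s \<in> carrier R - p \<Longrightarrow> z \<in> ?Z \<Longrightarrow> (\<lambda>k. s \<otimes> z k) \<in> W \<Longrightarrow> z \<in> W"
    and pW: "\<And>x z. x \<in> p \<Longrightarrow> z \<in> ?Z \<Longrightarrow> (\<lambda>k. x \<otimes> z k) \<in> W"
    and cyc: "\<And>z y. z \<in> ?Z \<Longrightarrow> z \<notin> W \<Longrightarrow> y \<in> ?Z \<Longrightarrow>
      \<exists>s\<in>carrier R - p. \<exists>r\<in>carrier R. (\<lambda>k. s \<otimes> y k \<ominus> r \<otimes> z k) \<in> W"
    by (rule proper_coboundary_rows) blast
  interpret M: module R "F (Suc i)" by (rule module_fvec)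
  interpret p: primeideal p R by (rule prime)
  have Wadd: "(\<lambda>k. x k \<oplus> y k) \<in> W" if "x \<in> W" "y \<in> W" for x y
    using M.submoduleE(5)[OF W(1) that] by simp
  have Wmult: "(\<lambda>k. r \<otimes> y k) \<in> W" if "r \<in> carrier R" "y \<in> W" for r y
    using M.submoduleE(4)[OF W(1) that] by simp
  have Zc: "z \<in> V (Suc i)" if "z \<in> ?Z" for z using that by (simp add: cocycle_rows_def)
  have WZ: "z \<in> ?Z" if "z \<in> W" for z using that W(3) by blast
  obtain z where z: "z \<in> ?Z" "z \<notin> W" using W(3) by blast
  have zc: "z \<in> V (Suc i)" using Zc z by blast
  obtain t T where t: "t \<in> carrier R - p" and T: "T \<in> lin_maps R (F (Suc i)) (F (Suc i))"
    and TJ: "\<And>v k. v \<in> V (Suc (Suc i)) \<Longrightarrow> T (\<phi> (Suc i) v) k \<in> J"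
    and TZ: "\<And>z v. z \<in> ?Z \<Longrightarrow> v \<in> V (Suc i) \<Longrightarrow> icong R J (t \<otimes> ?d z v) (?d z (T v))"
    using spl unfolding split_mod_def by blast
  have tc: "t \<in> carrier R" using t by auto
  \<comment> \<open>\<open>E k\<close> is the row of the \<open>k\<close>-th coordinate of
    \<open>T\<close>. As \<open>T\<close> kills boundaries modulo \<open>J\<close>, these rows are
    cocycles: the transpose of \<open>T\<close> takes its values there.\<close>
  have "\<exists>E. \<forall>k. E k \<in> V (Suc i) \<and> (\<forall>v\<in>V (Suc i). ?d (E k) v = T v k)"
    using functional_row[OF T] by (intro choice) metis
  then obtain E where E: "\<And>k. E k \<in> V (Suc i)" "\<And>k v. v \<in> V (Suc i) \<Longrightarrow> ?d (E k) v = T v k" by blast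
  have EZ: "E k \<in> ?Z" for k
    using E TJ by (simp add: cocycle_rows_def)
  have "\<exists>s\<in>carrier R - p. \<forall>k\<in>I (Suc i). \<exists>r\<in>carrier R. (\<lambda>j. s \<otimes> E k j \<ominus> r \<otimes> z j) \<in> W"
  proof (rule common_multiple[OF prime fin])
    show "\<exists>s\<in>carrier R - p. \<exists>r\<in>carrier R. (\<lambda>j. s \<otimes> E k j \<ominus> r \<otimes> z j) \<in> W" for k
      using cyc[OF z EZ] .
    fix k s u assume su: "s \<in> carrier R - p" "u \<in> carrier R - p"
      and "\<exists>r\<in>carrier R. (\<lambda>j. s \<otimes> E k j \<ominus> r \<otimes> z j) \<in> W"
    then obtain r where r: "r \<in> carrier R" "(\<lambda>j. s \<otimes> E k j \<ominus> r \<otimes> z j) \<in> W" by blast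
    have "(\<lambda>j. u \<otimes> (s \<otimes> E k j \<ominus> r \<otimes> z j)) \<in> W" using Wmult[OF _ r(2)] su by simp
    moreover have "u \<otimes> (s \<otimes> E k j \<ominus> r \<otimes> z j) = (u \<otimes> s) \<otimes> E k j \<ominus> (u \<otimes> r) \<otimes> z j" for j
      using su r(1) E(1)[of k] zc by (simp add: a_minus_def r_distr r_minus m_assoc)
    ultimately show "\<exists>r\<in>carrier R. (\<lambda>j. (u \<otimes> s) \<otimes> E k j \<ominus> r \<otimes> z j) \<in> W"
      using r su by (intro bexI[of _ "u \<otimes> r"]) auto
  qed
  then obtain s where s: "s \<in> carrier R - p"
    and "\<forall>k\<in>I (Suc i). \<exists>r\<in>carrier R. (\<lambda>j. s \<otimes> E k j \<ominus> r \<otimes> z j) \<in> W" by blast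
  then obtain r where r: "\<And>k. k \<in> I (Suc i) \<Longrightarrow> r k \<in> carrier R"
    "\<And>k. k \<in> I (Suc i) \<Longrightarrow> (\<lambda>j. s \<otimes> E k j \<ominus> r k \<otimes> z j) \<in> W" by metis
  have sc: "s \<in> carrier R" using s by auto
  \<comment> \<open>In the line \<open>Z / W\<close> with generator \<open>z\<close>, the row
    \<open>E k\<close> has the coordinate \<open>r k\<close>, up to the common factor
    \<open>s\<close>. These coordinates are the entries of the vector representing the
    functional.\<close>
  define v where "v = (\<lambda>k. if k \<in> I (Suc i) then r k else \<zero>)"
  have v: "v \<in> V (Suc i)" using r(1) by (auto simp: v_def fvec_carrier)
  \<comment> \<open>\<open>L\<close> is the transpose of \<open>T\<close>: it sends the unit row
    \<open>k\<close> to \<open>E k\<close>.\<close>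
  define L where "L = vec_map (F (Suc i)) (I (Suc i)) E"
  have E': "E \<in> I (Suc i) \<rightarrow> V (Suc i)" using E by auto
  have L: "L \<in> lin_maps R (F (Suc i)) (F (Suc i))"
    unfolding L_def by (rule lin_vec_map[OF module_fvec fin E'])
  have Lunit: "L (unit_vec R k) = E k" if "k \<in> I (Suc i)" for k
    unfolding L_def by (rule vec_map_unit[OF module_fvec fin E' that])
  have Ldot: "?d (L f) w = ?d f (T w)" if f: "f \<in> V (Suc i)" and w: "w \<in> V (Suc i)" for f w
  proof (rule lin_maps_fvec_eq[OF module_ring_module _ _ fin _ f])
    show "(\<lambda>f. ?d (L f) w) \<in> lin_maps R (F (Suc i)) (ring_module R)"
      by (rule lin_comp[OF lin_dot_left[OF fin w] L])
    show "(\<lambda>f. ?d f (T w)) \<in> lin_maps R (F (Suc i)) (ring_module R)"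
      by (rule lin_dot_left[OF fin lin_closed[OF T w]])
    show "?d (L (unit_vec R k)) w = ?d (unit_vec R k) (T w)" if "k \<in> I (Suc i)" for k
      using that E w lin_closed[OF T w] by (simp add: Lunit dot_unit_left)
  qed
  \<comment> \<open>Up to the factor \<open>s t\<close>, the pairing with \<open>v\<close> is the
    coordinate of a cocycle in \<open>Z / W\<close> with respect to \<open>z\<close>. One factor
    comes from the denominator of the coordinates, the other from \<open>T\<close> being a
    projection only up to \<open>t\<close>.\<close>
  have key: "(\<lambda>j. (s \<otimes> t) \<otimes> y j \<ominus> ?d y v \<otimes> z j) \<in> W" if y: "y \<in> ?Z" for y
  proof -
    have yc: "y \<in> V (Suc i)" using Zc y by blast
    have Ly: "L y \<in> V (Suc i)" by (rule lin_closed[OF L yc])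
    have lin1: "(\<lambda>f. ?d f v \<odot>\<^bsub>F (Suc i)\<^esub> z) \<in> lin_maps R (F (Suc i)) (F (Suc i))"
      using v zc by (intro lin_mapsI) (auto simp: dot_algebra fvec_closed l_distr m_assoc)
    have "s \<odot>\<^bsub>F (Suc i)\<^esub> L y \<ominus>\<^bsub>F (Suc i)\<^esub> ?d y v \<odot>\<^bsub>F (Suc i)\<^esub> z \<in> W"
    proof (rule lin_maps_fvec_in[OF module_fvec lin_maps_minus[OF module_fvec lin_maps_smult[OF module_fvec L sc] lin1] fin W(1) _ yc])
      fix k assume k: "k \<in> I (Suc i)"
      have "?d (unit_vec R k) v = r k" using k v by (simp add: dot_unit_left) (simp add: v_def)
      then show "s \<odot>\<^bsub>F (Suc i)\<^esub> L (unit_vec R k) \<ominus>\<^bsub>F (Suc i)\<^esub> ?d (unit_vec R k) v \<odot>\<^bsub>F (Suc i)\<^esub> z \<in> W"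
        using r[OF k] Lunit[OF k] E(1)[of k] sc zc fvec_minus[of "\<lambda>j. s \<otimes> E k j" "I (Suc i)" "\<lambda>j. r k \<otimes> z j"]
        by (simp add: fvec_closed)
    qed
    then have 1: "(\<lambda>j. s \<otimes> L y j \<ominus> ?d y v \<otimes> z j) \<in> W"
      using fvec_minus[of "\<lambda>j. s \<otimes> L y j" "I (Suc i)" "\<lambda>j. ?d y v \<otimes> z j"] sc zc Ly yc v
      by (simp add: fvec_closed)
    have "(\<lambda>j. t \<otimes> y j \<ominus> L y j) \<in> coboundary_rows J i"
    proof (rule coboundary_rows_J)
      show "(\<lambda>j. t \<otimes> y j \<ominus> L y j) \<in> V (Suc i)" using tc yc Ly by (intro fvec_closed)
      fix w assume w: "w \<in> V (Suc i)"
      have "?d (\<lambda>j. t \<otimes> y j \<ominus> L y j) w = t \<otimes> ?d y w \<ominus> ?d y (T w)"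
        using w tc yc Ly by (simp add: dot_algebra fvec_closed Ldot)
      then show "?d (\<lambda>j. t \<otimes> y j \<ominus> L y j) w \<in> J" using TZ[OF y w] by (simp add: icong_def)
    qed
    then have "(\<lambda>j. s \<otimes> (t \<otimes> y j \<ominus> L y j)) \<in> W" using W(2) Wmult sc by blast
    from Wadd[OF this 1]
    have "(\<lambda>j. s \<otimes> (t \<otimes> y j \<ominus> L y j) \<oplus> (s \<otimes> L y j \<ominus> ?d y v \<otimes> z j)) \<in> W" .
    moreover have "s \<otimes> (t \<otimes> y j \<ominus> L y j) \<oplus> (s \<otimes> L y j \<ominus> ?d y v \<otimes> z j) = (s \<otimes> t) \<otimes> y j \<ominus> ?d y v \<otimes> z j" for j
    proof -
      have "y j \<in> carrier R" "L y j \<in> carrier R" "?d y v \<otimes> z j \<in> carrier R" using yc Ly v zc by auto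
      then show ?thesis using sc tc by (simp add: a_minus_def r_distr r_minus m_assoc a_assoc l_neg r_neg1 r_neg2)
    qed
    ultimately show ?thesis by simp
  qed
  \<comment> \<open>A pairing outside \<open>p\<close> would be invertible locally, and
    \<open>key\<close> would then put \<open>z\<close> into \<open>W\<close>.\<close>
  have dotp: "?d y v \<in> p" if y: "y \<in> W" for y
  proof (rule ccontr)
    assume no: "?d y v \<notin> p"
    have yc: "y \<in> V (Suc i)" using Zc WZ y by blast
    have st: "s \<otimes> t \<in> carrier R" using sc tc by auto
    have "(\<lambda>j. (\<ominus> \<one>) \<otimes> ((s \<otimes> t) \<otimes> y j \<ominus> ?d y v \<otimes> z j)) \<in> W" "(\<lambda>j. (s \<otimes> t) \<otimes> y j) \<in> W"
      using key[OF WZ[OF y]] y st by (auto intro: Wmult)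
    from Wadd[OF this] have "(\<lambda>j. (\<ominus> \<one>) \<otimes> ((s \<otimes> t) \<otimes> y j \<ominus> ?d y v \<otimes> z j) \<oplus> (s \<otimes> t) \<otimes> y j) \<in> W" .
    moreover have "(\<ominus> \<one>) \<otimes> ((s \<otimes> t) \<otimes> y j \<ominus> ?d y v \<otimes> z j) \<oplus> (s \<otimes> t) \<otimes> y j = ?d y v \<otimes> z j" for j
    proof -
      have "(s \<otimes> t) \<otimes> y j \<in> carrier R" "?d y v \<otimes> z j \<in> carrier R" using yc v zc st by auto
      then show ?thesis by (simp add: l_minus a_minus_def minus_add a_ac r_neg r_neg1 r_neg2)
    qed
    ultimately have "(\<lambda>j. ?d y v \<otimes> z j) \<in> W" by simp
    then show False using satW[of "?d y v" z] z no yc v by auto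
  qed
  \<comment> \<open>Each coordinate of \<open>\<phi> i\<close> is the pullback of a unit row, hence
    a coboundary and an element of \<open>W\<close>.\<close>
  have phiv: "\<phi> i v l \<in> p" for l
  proof -
    obtain \<rho> where \<rho>: "\<rho> \<in> V (Suc i)" "\<And>w. w \<in> V (Suc i) \<Longrightarrow> ?d \<rho> w = \<phi> i w l"
      using functional_row[OF lin] by blast
    show ?thesis
    proof (cases "l \<in> I i")
      case True
      have "\<rho> \<in> coboundary_rows J i"
        by (rule coboundary_rowsI[OF \<rho>(1) one_np unit_vec_closed[OF True]])
          (use \<rho> True in \<open>simp add: dot_unit_left icong_refl[OF J]\<close>)
      then show ?thesis using dotp[of \<rho>] W(2) \<rho>(2)[OF v] by auto
    next
      case False
      then show ?thesis using fvec_outside[OF phi_closed[OF v]] p.zero_closed by simp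
    qed
  qed
  have av: "(\<lambda>k. a \<otimes> v k) \<in> V (Suc i)" using a v by (intro fvec_closed)
  \<comment> \<open>Multiplication by \<open>a\<close> carries \<open>p\<close> into
    \<open>J\<close>.\<close>
  have "\<forall>k. \<phi> i (\<lambda>k. a \<otimes> v k) k \<in> J"
  proof
    fix k
    have "\<phi> i v k \<in> colon R J a" using phiv a(2) by simp
    then have "\<phi> i v k \<otimes> a \<in> J" by (simp add: colon_def)
    then show "\<phi> i (\<lambda>k. a \<otimes> v k) k \<in> J" using phi_mult[OF a(1) v] m_comm[of a "\<phi> i v k"] a(1) v by simp
  qed
  then obtain u w where u: "u \<in> carrier R - p" "w \<in> V (Suc (Suc i))"
    "\<And>k. icong R J (u \<otimes> (a \<otimes> v k)) (\<phi> (Suc i) w k)"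
    using ex av unfolding exact_mod_def by blast
  have uc: "u \<in> carrier R" using u by auto
  have "icong R J (?d z (\<lambda>k. u \<otimes> (a \<otimes> v k))) (?d z (\<phi> (Suc i) w))"
    using u uc av by (intro dot_icong[OF J fin zc]) (auto intro: fvec_closed)
  moreover have "?d z (\<phi> (Suc i) w) \<in> J" using z u by (simp add: cocycle_rows_def)
  ultimately have "?d z (\<lambda>k. u \<otimes> (a \<otimes> v k)) \<in> J" using icong_mem[OF J] by blast
  moreover have "?d z (\<lambda>k. u \<otimes> (a \<otimes> v k)) = (u \<otimes> ?d z v) \<otimes> a"
    using dot_algebra(1)[OF fin zc uc av] dot_algebra(1)[OF fin zc a(1) v] uc a(1) zc v by (simp add: m_ac)
  ultimately have "(u \<otimes> ?d z v) \<otimes> a \<in> J" by simp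
  then have "u \<otimes> ?d z v \<in> colon R J a" unfolding colon_def using uc zc v by simp
  then have "?d z v \<in> p" using a(2) u(1) p.I_prime[of u "?d z v"] zc v by auto
  then have "(\<lambda>j. ?d z v \<otimes> z j) \<in> W" using pW z(1) by blast
  from Wadd[OF key[OF z(1)] this]
  have "(\<lambda>j. ((s \<otimes> t) \<otimes> z j \<ominus> ?d z v \<otimes> z j) \<oplus> ?d z v \<otimes> z j) \<in> W" .
  moreover have "((s \<otimes> t) \<otimes> z j \<ominus> ?d z v \<otimes> z j) \<oplus> ?d z v \<otimes> z j = (s \<otimes> t) \<otimes> z j" for j
  proof -
    have "(s \<otimes> t) \<otimes> z j \<in> carrier R" "?d z v \<otimes> z j \<in> carrier R" using v zc sc tc by auto
    then show ?thesis by (simp add: a_minus_def a_assoc l_neg)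
  qed
  ultimately have "(\<lambda>j. (s \<otimes> t) \<otimes> z j) \<in> W" by simp
  then show False using satW[OF mult_np[OF s t] z(1)] z(2) by blast
qed

end
end

section \<open>Descending the splitting along the complex\<close>

context free_complex
begin

lemma split_modI:
  assumes "s \<in> carrier R - p" "T \<in> lin_maps R (F (Suc i)) (F (Suc i))"
    and "\<And>v k. v \<in> V (Suc (Suc i)) \<Longrightarrow> T (\<phi> (Suc i) v) k \<in> J"
    and "\<And>z v. z \<in> cocycle_rows J (Suc i) \<Longrightarrow> v \<in> V (Suc i) \<Longrightarrow>
      icong R J (s \<otimes> dot R (I (Suc i)) z v) (dot R (I (Suc i)) z (T v))"
  shows "split_mod J i"
  unfolding split_mod_def using assms by (intro bexI[of _ s] bexI[of _ T] conjI ballI allI)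

context
  fixes J assumes J: "ideal J R" and Jp: "J \<subseteq> p" and sat: "saturated R p J"
begin

interpretation J: ideal J R by (rule J)

text \<open>With the identity equal to \<open>\<phi> h + h' \<phi>\<close>, take
  \<open>h' \<phi>\<close> for \<open>T\<close>: it kills boundaries, and a cocycle row annihilates
  the other summand, so it does not see the difference between the identity and
  \<open>T\<close>.\<close>

lemma split_mod_start:
  assumes h: "h \<in> lin_maps R (F (Suc i)) (F (Suc (Suc i)))"
    and h': "h' \<in> lin_maps R (F i) (F (Suc i))"
    and hh: "\<And>v. v \<in> V (Suc i) \<Longrightarrow> v = (\<lambda>k. \<phi> (Suc i) (h v) k \<oplus> h' (\<phi> i v) k)"
  shows "split_mod J i"
proof -
  have T: "(\<lambda>v. h' (\<phi> i v)) \<in> lin_maps R (F (Suc i)) (F (Suc i))" by (rule lin_comp[OF h' lin])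
  have "h' (\<phi> i (\<phi> (Suc i) v)) k \<in> J" if "v \<in> V (Suc (Suc i))" for v k
    using lin_zero[OF module_fvec module_fvec h'] that zero_J[OF J Jp sat] by (simp add: complex)
  moreover have "icong R J (\<one> \<otimes> dot R (I (Suc i)) z v) (dot R (I (Suc i)) z (h' (\<phi> i v)))"
    if z: "z \<in> cocycle_rows J (Suc i)" and v: "v \<in> V (Suc i)" for z v
  proof -
    have zc: "z \<in> V (Suc i)" using z by (simp add: cocycle_rows_def)
    have hv: "h v \<in> V (Suc (Suc i))" by (rule lin_closed[OF h v])
    have T': "h' (\<phi> i v) \<in> V (Suc i)" using lin_closed[OF T v] .
    have "dot R (I (Suc i)) z v =
        dot R (I (Suc i)) z (\<lambda>k. \<phi> (Suc i) (h v) k \<oplus> h' (\<phi> i v) k)" using hh[OF v] by simp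
    also have "\<dots> = dot R (I (Suc i)) z (\<phi> (Suc i) (h v)) \<oplus> dot R (I (Suc i)) z (h' (\<phi> i v))"
      using lin_add[OF lin_dot[OF fin zc] phi_closed[OF hv] T'] by simp
    finally have "dot R (I (Suc i)) z v \<ominus> dot R (I (Suc i)) z (h' (\<phi> i v)) = dot R (I (Suc i)) z (\<phi> (Suc i) (h v))"
      using zc hv T' by (simp add: a_minus_def a_assoc r_neg)
    then show ?thesis using z hv zc v T' by (simp add: icong_def cocycle_rows_def)
  qed
  ultimately show ?thesis by (rule split_modI[OF one_np T])
qed

text \<open>The cocycles at the next place are the coboundaries, so the projection onto them lifts to the
  rows at the present place; subtract the lift from the identity.\<close>

lemma split_mod_step:
  assumes spl: "split_mod J (Suc i)" and cob: "cocycle_rows J (Suc (Suc i)) \<subseteq> coboundary_rows J (Suc i)"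
  shows "split_mod J i"
proof -
  let ?n = "Suc i" and ?m = "Suc (Suc i)"
  obtain t T where t: "t \<in> carrier R - p" and T: "T \<in> lin_maps R (F ?m) (F ?m)"
    and TJ: "\<And>v k. v \<in> V (Suc ?m) \<Longrightarrow> T (\<phi> ?m v) k \<in> J"
    and TZ: "\<And>z v. z \<in> cocycle_rows J ?m \<Longrightarrow> v \<in> V ?m \<Longrightarrow>
      icong R J (t \<otimes> dot R (I ?m) z v) (dot R (I ?m) z (T v))"
    using spl unfolding split_mod_def by blast
  have tc: "t \<in> carrier R" using t by auto
  have row: "\<exists>s\<in>carrier R - p. \<exists>g\<in>V ?n. \<forall>v\<in>V ?m. icong R J (s \<otimes> T v k) (dot R (I ?n) g (\<phi> ?n v))" for k
  proof -
    obtain f where f: "f \<in> V ?m" "\<And>v. v \<in> V ?m \<Longrightarrow> dot R (I ?m) f v = T v k"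
      using functional_row[OF T] by blast
    then have "f \<in> cocycle_rows J ?m" using TJ by (simp add: cocycle_rows_def)
    then have "f \<in> coboundary_rows J ?n" using cob by blast
    then show ?thesis unfolding coboundary_rows_def using f by force
  qed
  have "\<exists>s\<in>carrier R - p. \<forall>k\<in>I ?m. \<exists>g\<in>V ?n. \<forall>v\<in>V ?m. icong R J (s \<otimes> T v k) (dot R (I ?n) g (\<phi> ?n v))"
  proof (rule common_multiple[OF prime fin row])
    fix k s u assume su: "s \<in> carrier R - p" "u \<in> carrier R - p"
      and "\<exists>g\<in>V ?n. \<forall>v\<in>V ?m. icong R J (s \<otimes> T v k) (dot R (I ?n) g (\<phi> ?n v))"
    then obtain g where g: "g \<in> V ?n" "\<And>v. v \<in> V ?m \<Longrightarrow> icong R J (s \<otimes> T v k) (dot R (I ?n) g (\<phi> ?n v))" by blast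
    have uc: "u \<in> carrier R" "s \<in> carrier R" using su by auto
    have "icong R J ((u \<otimes> s) \<otimes> T v k) (dot R (I ?n) (\<lambda>k. u \<otimes> g k) (\<phi> ?n v))" if v: "v \<in> V ?m" for v
      using icong_mult[OF J uc(1) g(2)[OF v]] uc fvec_coord[OF lin_closed[OF T v]] g(1) v
        dot_algebra(3)[OF fin phi_closed[OF v] uc(1) g(1)] by (simp add: m_assoc)
    then show "\<exists>g\<in>V ?n. \<forall>v\<in>V ?m. icong R J ((u \<otimes> s) \<otimes> T v k) (dot R (I ?n) g (\<phi> ?n v))"
      using fvec_closed(1)[OF uc(1) g(1)] by blast
  qed
  then obtain s where s: "s \<in> carrier R - p"
    and "\<forall>k\<in>I ?m. \<exists>g. g \<in> V ?n \<and> (\<forall>v\<in>V ?m. icong R J (s \<otimes> T v k) (dot R (I ?n) g (\<phi> ?n v)))" by blast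
  from bchoice[OF this(2)] obtain g where
    "\<forall>k\<in>I ?m. g k \<in> V ?n \<and> (\<forall>v\<in>V ?m. icong R J (s \<otimes> T v k) (dot R (I ?n) (g k) (\<phi> ?n v)))" ..
  then have g: "\<And>k. k \<in> I ?m \<Longrightarrow> g k \<in> V ?n"
    and gT: "\<And>k v. k \<in> I ?m \<Longrightarrow> v \<in> V ?m \<Longrightarrow> icong R J (s \<otimes> T v k) (dot R (I ?n) (g k) (\<phi> ?n v))"
    by auto
  have sc: "s \<in> carrier R" using s by auto
  have st: "s \<otimes> t \<in> carrier R" using sc tc by simp
  \<comment> \<open>Each row of \<open>s T\<close> is modulo \<open>J\<close> a row
    \<open>g k\<close> composed with \<open>\<phi>\<close>; \<open>G\<close> has the rows
    \<open>g k\<close>, so that \<open>G \<phi>\<close> is congruent to \<open>s T\<close>.\<close>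
  define G where "G = (\<lambda>w k. if k \<in> I ?m then dot R (I ?n) (g k) w else \<zero>)"
  have G: "G \<in> lin_maps R (F ?n) (F ?m)"
    unfolding G_def by (rule lin_into_fvec) (rule lin_dot[OF fin g])
  have Gc: "G w \<in> V ?m" if "w \<in> V ?n" for w using lin_closed[OF G that] .
  have GT: "icong R J (s \<otimes> T v k) (G (\<phi> ?n v) k)" if v: "v \<in> V ?m" for v k
  proof (cases "k \<in> I ?m")
    case True
    then show ?thesis using gT v by (simp add: G_def)
  next
    case False
    then show ?thesis using fvec_outside[OF lin_closed[OF T v] False] sc by (simp add: G_def icong_refl[OF J])
  qed
  \<comment> \<open>The transpose of \<open>\<phi> G\<close> is a lift of the next projection; its
    difference from \<open>s t\<close> times the identity is the projection at the present
    place.\<close>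
  define T' where "T' = (\<lambda>v. (\<lambda>k. (s \<otimes> t) \<otimes> v k \<ominus> \<phi> ?n (G v) k))"
  have T': "T' \<in> lin_maps R (F ?n) (F ?n)"
  proof -
    have 1: "(\<lambda>v. (s \<otimes> t) \<odot>\<^bsub>F ?n\<^esub> v \<ominus>\<^bsub>F ?n\<^esub> \<phi> ?n (G v)) \<in> lin_maps R (F ?n) (F ?n)"
      by (intro lin_maps_minus module_fvec lin_maps_smult lin_id st lin_comp[OF lin G])
    have 2: "T' v = (s \<otimes> t) \<odot>\<^bsub>F ?n\<^esub> v \<ominus>\<^bsub>F ?n\<^esub> \<phi> ?n (G v)" if "v \<in> V ?n" for v
      unfolding T'_def
      using fvec_minus[OF fvec_closed(1)[OF st that] phi_closed[OF Gc[OF that]]] by simp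
    interpret M: module R "F ?n" by (rule module_fvec)
    show ?thesis
      using lin_mapsD[OF 1] by (intro lin_mapsI) (simp_all only: 2 M.M.a_closed M.smult_closed)
  qed
  \<comment> \<open>On boundaries \<open>T'\<close> is congruent to
    \<open>s (t \<phi> - \<phi> T)\<close>. The rows of \<open>\<phi>\<close> are cocycles at the
    next place, where \<open>T\<close> acts as multiplication by \<open>t\<close>.\<close>
  have "T' (\<phi> ?n v) k \<in> J" if v: "v \<in> V ?m" for v k
  proof -
    have Tv: "T v \<in> V ?m" by (rule lin_closed[OF T v])
    obtain f where f: "f \<in> V ?m" "\<And>v. v \<in> V ?m \<Longrightarrow> dot R (I ?m) f v = \<phi> ?n v k"
      using functional_row[OF lin] by blast
    have "f \<in> cocycle_rows J ?m" using f zero_J[OF J Jp sat] by (simp add: cocycle_rows_def complex)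
    from TZ[OF this v] have 1: "icong R J (t \<otimes> \<phi> ?n v k) (\<phi> ?n (T v) k)" using f v Tv by simp
    have "icong R J (\<phi> ?n (\<lambda>k. s \<otimes> T v k) k) (\<phi> ?n (G (\<phi> ?n v)) k)"
      by (rule lin_icong[OF J fin lin fvec_closed(1)[OF sc Tv] Gc[OF phi_closed[OF v]] GT[OF v]])
    then have 2: "icong R J (s \<otimes> \<phi> ?n (T v) k) (\<phi> ?n (G (\<phi> ?n v)) k)" using phi_mult[OF sc Tv] by simp
    from icong_trans[OF J icong_mult[OF J sc 1] 2]
    show ?thesis using sc tc v by (simp add: T'_def icong_def m_assoc)
  qed
  moreover have "icong R J ((s \<otimes> t) \<otimes> dot R (I ?n) z v) (dot R (I ?n) z (T' v))"
    if z: "z \<in> cocycle_rows J ?n" and v: "v \<in> V ?n" for z v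
  proof -
    have zc: "z \<in> V ?n" using z by (simp add: cocycle_rows_def)
    have "dot R (I ?n) z (T' v) = (s \<otimes> t) \<otimes> dot R (I ?n) z v \<ominus> dot R (I ?n) z (\<phi> ?n (G v))"
      unfolding T'_def using dot_algebra(1)[OF fin zc st v]
        dot_algebra(2)[OF fin zc fvec_closed(1)[OF st v] phi_closed[OF Gc[OF v]]] by simp
    moreover have "icong R J ((s \<otimes> t) \<otimes> dot R (I ?n) z v \<ominus> \<zero>)
        ((s \<otimes> t) \<otimes> dot R (I ?n) z v \<ominus> dot R (I ?n) z (\<phi> ?n (G v)))"
    proof (rule icong_minus[OF J icong_refl[OF J] icong_sym[OF J]])
      show "s \<otimes> t \<otimes> dot R (I ?n) z v \<in> carrier R" using st zc v by simp
      show "icong R J (dot R (I ?n) z (\<phi> ?n (G v))) \<zero>"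
        using z zc Gc[OF v] by (simp add: icong_zero[OF J] cocycle_rows_def)
    qed
    ultimately show ?thesis using st zc v by (simp add: a_minus_def)
  qed
  ultimately show ?thesis by (rule split_modI[OF mult_np[OF s t] T'])
qed

text \<open>A splitting is known only at some place beyond \<open>i\<close>. Descending from there,
  a splitting forces the cohomology to vanish at its place, and vanishing at a place gives a
  splitting one place lower.\<close>

lemma depth_zero:
  assumes a: "a \<in> carrier R" "colon R J a = p" and ex: "\<And>i. i \<ge> c \<Longrightarrow> exact_mod J i" and i: "i \<ge> c"
  shows "cocycle_rows J (Suc i) \<subseteq> coboundary_rows J i"
proof -
  have "\<exists>e\<ge>i. split_mod J e"
  proof -
    obtain e h h' where e: "e \<ge> i" "h \<in> lin_maps R (F (Suc e)) (F (Suc (Suc e)))"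
      "h' \<in> lin_maps R (F e) (F (Suc e))"
      "\<forall>v\<in>V (Suc e). v = (\<lambda>k. \<phi> (Suc e) (h v) k \<oplus> h' (\<phi> e v) k)"
      using split[of i] by blast
    show ?thesis using split_mod_start[OF e(2,3)] e(1,4) by blast
  qed
  then obtain e where e: "e \<ge> i" "split_mod J e" by blast
  have "split_mod J i" using e
  proof (induction rule: inc_induct)
    case (step n)
    have "cocycle_rows J (Suc (Suc n)) \<subseteq> coboundary_rows J (Suc n)"
      by (rule depth_zero_coboundary[OF J Jp sat a ex]) (use step i in auto)
    then show ?case using split_mod_step step by blast
  qed
  then show ?thesis using depth_zero_coboundary[OF J Jp sat a ex[OF i]] by blast
qed

subsection \<open>Dividing by a regular element\<close>

context
  fixes x J' assumes x: "x \<in> p" and regular: "\<And>r. r \<in> carrier R \<Longrightarrow> x \<otimes> r \<in> J \<Longrightarrow> r \<in> J"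
    and J'_def: "J' = saturation R p {j \<oplus> x \<otimes> r | j r. j \<in> J \<and> r \<in> carrier R}"
begin

lemma x_carrier: "x \<in> carrier R"
proof -
  interpret p: primeideal p R by (rule prime)
  show ?thesis using x p.a_subset by auto
qed

lemma ideal_J'_aux: "ideal {j \<oplus> x \<otimes> r | j r. j \<in> J \<and> r \<in> carrier R} R" (is "ideal ?K R")
proof (rule idealI')
  note [simp] = x_carrier J_carrier[OF J Jp sat]
  show "?K \<subseteq> carrier R" by auto
  have "\<zero> = \<zero> \<oplus> x \<otimes> \<zero>" by simp
  then show "\<zero> \<in> ?K" using zero_J[OF J Jp sat] zero_closed by blast
next
  note [simp] = x_carrier J_carrier[OF J Jp sat]
  fix a b assume "a \<in> ?K" "b \<in> ?K"
  then obtain j r k s where e: "a = j \<oplus> x \<otimes> r" "b = k \<oplus> x \<otimes> s" "j \<in> J" "k \<in> J" "r \<in> carrier R" "s \<in> carrier R"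
    by blast
  then have "a \<oplus> b = (j \<oplus> k) \<oplus> x \<otimes> (r \<oplus> s)" by (simp add: r_distr a_ac)
  then show "a \<oplus> b \<in> ?K" using e additive_subgroup.a_closed[OF ideal.axioms(1)[OF J]] a_closed by blast
next
  note [simp] = x_carrier J_carrier[OF J Jp sat]
  fix a u assume "a \<in> ?K" and u: "u \<in> carrier R"
  then obtain j r where e: "a = j \<oplus> x \<otimes> r" "j \<in> J" "r \<in> carrier R" by blast
  then have "u \<otimes> a = u \<otimes> j \<oplus> x \<otimes> (u \<otimes> r)" using u by (simp add: r_distr m_lcomm)
  then show "u \<otimes> a \<in> ?K" using e u J.I_l_closed m_closed by blast
qed

text \<open>Up to a denominator, the elements of \<open>J'\<close> are those divisible by
  \<open>x\<close> modulo \<open>J\<close>; this is the form in which division by \<open>x\<close>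
  is carried out below.\<close>

lemma J'_iff: "r \<in> J' \<longleftrightarrow> r \<in> carrier R \<and> (\<exists>s\<in>carrier R - p. \<exists>w\<in>carrier R. icong R J (s \<otimes> r) (x \<otimes> w))"
proof
  note [simp] = x_carrier J_carrier[OF J Jp sat]
  assume "r \<in> J'"
  then obtain s j w where e: "r \<in> carrier R" "s \<in> carrier R - p" "s \<otimes> r = j \<oplus> x \<otimes> w" "j \<in> J" "w \<in> carrier R"
    unfolding J'_def saturation_def by blast
  have "(j \<oplus> x \<otimes> w) \<ominus> x \<otimes> w = j" using e by (simp add: a_minus_def a_assoc r_neg)
  then have "icong R J (s \<otimes> r) (x \<otimes> w)" using e by (simp add: icong_def)
  then show "r \<in> carrier R \<and> (\<exists>s\<in>carrier R - p. \<exists>w\<in>carrier R. icong R J (s \<otimes> r) (x \<otimes> w))"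
    using e by blast
next
  note [simp] = x_carrier J_carrier[OF J Jp sat]
  assume "r \<in> carrier R \<and> (\<exists>s\<in>carrier R - p. \<exists>w\<in>carrier R. icong R J (s \<otimes> r) (x \<otimes> w))"
  then obtain s w where e: "r \<in> carrier R" "s \<in> carrier R - p" "w \<in> carrier R" "icong R J (s \<otimes> r) (x \<otimes> w)" by blast
  have "s \<otimes> r = (s \<otimes> r \<ominus> x \<otimes> w) \<oplus> x \<otimes> w"
    using e by (simp add: a_minus_def a_assoc l_neg)
  then show "r \<in> J'" unfolding J'_def saturation_def using e unfolding icong_def by blast
qed

lemma ideal_J': "ideal J' R"
  unfolding J'_def by (rule ideal_saturation[OF prime ideal_J'_aux])

lemma saturated_J': "saturated R p J'"
  unfolding J'_def by (rule saturated_saturation[OF prime])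

lemma J'_subset: "J' \<subseteq> p"
proof -
  interpret p: primeideal p R by (rule prime)
  show ?thesis unfolding J'_def
    using Jp x by (intro saturation_subset_prime[OF prime]) (auto intro!: p.a_closed p.I_r_closed)
qed

lemma J_J': "J \<subseteq> J'"
proof
  fix j assume j: "j \<in> J"
  then have "icong R J (\<one> \<otimes> j) (x \<otimes> \<zero>)"
    using J_carrier[OF J Jp sat j] x_carrier by (simp add: icong_zero[OF J])
  then show "j \<in> J'" unfolding J'_iff using one_np J_carrier[OF J Jp sat j] by blast
qed

lemma x_J': "x \<in> J'"
proof -
  have "icong R J (\<one> \<otimes> x) (x \<otimes> \<one>)" using x_carrier by (simp add: icong_refl[OF J])
  then show ?thesis unfolding J'_iff using one_np x_carrier by blast
qed

text \<open>Finitely many coordinates allow a single denominator, so that a whole vector over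
  \<open>J'\<close> can be divided by \<open>x\<close>.\<close>

lemma common_J':
  assumes v: "v \<in> V i" and "\<And>k. v k \<in> J'"
  obtains s w where "s \<in> carrier R - p" "w \<in> V i" "\<And>k. icong R J (s \<otimes> v k) (x \<otimes> w k)"
proof -
  have "\<exists>s\<in>carrier R - p. \<forall>k\<in>I i. \<exists>w\<in>carrier R. icong R J (s \<otimes> v k) (x \<otimes> w)"
  proof (rule common_multiple[OF prime fin])
    show "\<exists>s\<in>carrier R - p. \<exists>w\<in>carrier R. icong R J (s \<otimes> v k) (x \<otimes> w)" for k
      using assms(2)[of k] unfolding J'_iff by blast
    fix k s t assume st: "s \<in> carrier R - p" "t \<in> carrier R - p" and "\<exists>w\<in>carrier R. icong R J (s \<otimes> v k) (x \<otimes> w)"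
    then obtain w where w: "w \<in> carrier R" "icong R J (s \<otimes> v k) (x \<otimes> w)" by blast
    have tc: "t \<in> carrier R" "s \<in> carrier R" using st by auto
    have "icong R J ((t \<otimes> s) \<otimes> v k) (x \<otimes> (t \<otimes> w))"
      using icong_mult[OF J tc(1) w(2)] tc w(1) v x_carrier by (simp add: m_assoc m_lcomm)
    then show "\<exists>w\<in>carrier R. icong R J ((t \<otimes> s) \<otimes> v k) (x \<otimes> w)" using tc w(1) by blast
  qed
  then obtain s where s: "s \<in> carrier R - p"
    and "\<forall>k\<in>I i. \<exists>w. w \<in> carrier R \<and> icong R J (s \<otimes> v k) (x \<otimes> w)" by blast
  from bchoice[OF this(2)] obtain w where
    "\<forall>k\<in>I i. w k \<in> carrier R \<and> icong R J (s \<otimes> v k) (x \<otimes> w k)" ..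
  then have w: "\<And>k. k \<in> I i \<Longrightarrow> w k \<in> carrier R"
    "\<And>k. k \<in> I i \<Longrightarrow> icong R J (s \<otimes> v k) (x \<otimes> w k)" by auto
  let ?w = "\<lambda>k. if k \<in> I i then w k else \<zero>"
  show ?thesis
  proof (rule that[OF s])
    show "?w \<in> V i" using w(1) by (auto simp: fvec_carrier)
    show "icong R J (s \<otimes> v k) (x \<otimes> ?w k)" for k
      using w s x_carrier fvec_outside[OF v, of k] by (cases "k \<in> I i") (auto simp: icong_refl[OF J])
  qed
qed

text \<open>The long exact sequence of multiplication by \<open>x\<close>: homology modulo
  \<open>J'\<close> at a place sits between the homology modulo \<open>J\<close> at that place and
  at the one below. This is where exactness at one place is lost.\<close>

lemma exact_regular:
  assumes ex: "exact_mod J i" "exact_mod J (Suc i)"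
  shows "exact_mod J' (Suc i)"
  unfolding exact_mod_def
proof (intro ballI impI)
  let ?n = "Suc i" and ?m = "Suc (Suc i)"
  note xc = x_carrier
  fix v assume v: "v \<in> V ?m" and "\<forall>k. \<phi> ?n v k \<in> J'"
  then obtain s w where s: "s \<in> carrier R - p" and w: "w \<in> V ?n"
    and sw: "\<And>k. icong R J (s \<otimes> \<phi> ?n v k) (x \<otimes> w k)"
    using common_J'[OF phi_closed[OF v]] by blast
  have sc: "s \<in> carrier R" using s by auto
  \<comment> \<open>A further application of \<open>\<phi>\<close> kills the left-hand side, so
    \<open>x\<close> times \<open>\<phi> i w\<close> vanishes modulo \<open>J\<close>; by regularity
    \<open>w\<close> is a cycle.\<close>
  have "icong R J (\<phi> i (\<lambda>k. s \<otimes> \<phi> ?n v k) k) (\<phi> i (\<lambda>k. x \<otimes> w k) k)" for k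
    by (rule lin_icong[OF J fin lin fvec_closed(1)[OF sc phi_closed[OF v]] fvec_closed(1)[OF xc w] sw])
  then have "icong R J \<zero> (x \<otimes> \<phi> i w k)" for k
    using phi_mult[OF sc phi_closed[OF v]] phi_mult[OF xc w] complex[OF v] sc by simp
  then have "x \<otimes> \<phi> i w k \<in> J" for k
    using icong_mem'[OF J] zero_J[OF J Jp sat] by blast
  then have "\<phi> i w k \<in> J" for k using regular[of "\<phi> i w k"] w by simp
  then obtain s' u where s': "s' \<in> carrier R - p" and u: "u \<in> V ?m"
    and su: "\<And>k. icong R J (s' \<otimes> w k) (\<phi> ?n u k)"
    using ex(1) w unfolding exact_mod_def by blast
  have s'c: "s' \<in> carrier R" using s' by auto
  have sv: "(\<lambda>k. (s' \<otimes> s) \<otimes> v k) \<in> V ?m" "(\<lambda>k. x \<otimes> u k) \<in> V ?m"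
    using fvec_closed(1)[OF _ v] fvec_closed(1)[OF xc u] sc s'c by auto
  \<comment> \<open>The boundary of \<open>v\<close> is \<open>x w\<close> and \<open>w\<close> is
    the boundary of \<open>u\<close>, both up to denominators. Subtracting \<open>x u\<close>, which
    is zero modulo \<open>J'\<close>, turns a multiple of \<open>v\<close> into a cycle modulo
    \<open>J\<close>.\<close>
  let ?v = "\<lambda>k. (s' \<otimes> s) \<otimes> v k \<ominus> x \<otimes> u k"
  have v': "?v \<in> V ?m" by (rule fvec_closed(3)[OF sv])
  have "\<phi> ?n ?v k \<in> J" for k
  proof -
    have eq: "\<phi> ?n ?v k = s' \<otimes> (s \<otimes> \<phi> ?n v k) \<ominus> x \<otimes> \<phi> ?n u k"
      using phi_minus[OF sv] phi_mult[OF _ v, of "s' \<otimes> s"] phi_mult[OF xc u] sc s'c v by (simp add: m_assoc)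
    have "icong R J (s' \<otimes> (s \<otimes> \<phi> ?n v k)) (s' \<otimes> (x \<otimes> w k))" by (rule icong_mult[OF J s'c sw])
    also have "s' \<otimes> (x \<otimes> w k) = x \<otimes> (s' \<otimes> w k)" using s'c xc w by (simp add: m_lcomm)
    also have "icong R J \<dots> (x \<otimes> \<phi> ?n u k)" by (rule icong_mult[OF J xc su])
    finally (icong_trans[OF J]) show ?thesis by (simp add: eq icong_def)
  qed
  then obtain s'' y where s'': "s'' \<in> carrier R - p" and y: "y \<in> V (Suc ?m)"
    and sy: "\<And>k. icong R J (s'' \<otimes> ?v k) (\<phi> ?m y k)"
    using ex(2) v' unfolding exact_mod_def by blast
  have s''c: "s'' \<in> carrier R" using s'' by auto
  have "icong R J' ((s'' \<otimes> (s' \<otimes> s)) \<otimes> v k) (\<phi> ?m y k)" for k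
  proof -
    have 1: "icong R J' (s'' \<otimes> ?v k) (\<phi> ?m y k)" using sy[of k] J_J' unfolding icong_def by blast
    have vk: "v k \<in> carrier R" "u k \<in> carrier R" using v u by auto
    have "x \<otimes> u k \<in> J'" using ideal.I_r_closed[OF ideal_J' x_J' vk(2)] .
    then have "icong R J' ((s' \<otimes> s) \<otimes> v k \<ominus> \<zero>) (?v k)"
      using vk sc s'c xc
      by (intro icong_minus[OF ideal_J' icong_refl[OF ideal_J'] icong_sym[OF ideal_J']])
        (simp_all add: icong_zero[OF ideal_J'])
    then have "icong R J' ((s' \<otimes> s) \<otimes> v k) (?v k)" using vk sc s'c by (simp add: a_minus_def)
    from icong_trans[OF ideal_J' icong_mult[OF ideal_J' s''c this] 1] show ?thesis
      using vk sc s'c s''c by (simp add: m_assoc)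
  qed
  then show "\<exists>s\<in>carrier R - p. \<exists>u\<in>V (Suc ?m). \<forall>k. icong R J' (s \<otimes> v k) (\<phi> ?m u k)"
    using mult_np[OF s'' mult_np[OF s' s]] y by blast
qed

text \<open>Vanishing modulo \<open>J'\<close> says that every cocycle modulo \<open>J\<close> is,
  up to a denominator, a coboundary plus \<open>x h\<close>, where \<open>h\<close> is again a
  cocycle. So multiplication by \<open>x\<close> is surjective on the localized cohomology, and as
  \<open>x \<in> p\<close> no proper \<open>W\<close> can exist.\<close>

lemma regular_coboundary:
  assumes cob: "cocycle_rows J' (Suc i) \<subseteq> coboundary_rows J' i"
  shows "cocycle_rows J (Suc i) \<subseteq> coboundary_rows J i"
proof (rule ccontr)
  let ?Z = "cocycle_rows J (Suc i)" and ?d = "dot R (I (Suc i))"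
  note xc = x_carrier
  assume "\<not> ?Z \<subseteq> coboundary_rows J i"
  then obtain W where W: "submodule W R (F (Suc i))" "coboundary_rows J i \<subseteq> W" "W \<subset> ?Z"
    and satW: "\<And>s z. s \<in> carrier R - p \<Longrightarrow> z \<in> ?Z \<Longrightarrow> (\<lambda>k. s \<otimes> z k) \<in> W \<Longrightarrow> z \<in> W"
    and pW: "\<And>x z. x \<in> p \<Longrightarrow> z \<in> ?Z \<Longrightarrow> (\<lambda>k. x \<otimes> z k) \<in> W"
    by (rule proper_coboundary_rows[OF J Jp sat]) blast
  interpret M: module R "F (Suc i)" by (rule module_fvec)
  have "z \<in> W" if z: "z \<in> ?Z" for z
  proof -
    have zc: "z \<in> V (Suc i)" using z by (simp add: cocycle_rows_def)
    have "z \<in> cocycle_rows J' (Suc i)" using z J_J' unfolding cocycle_rows_def by blast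
    then obtain s g where s: "s \<in> carrier R - p" and g: "g \<in> V i"
      and sg: "\<And>v. v \<in> V (Suc i) \<Longrightarrow> icong R J' (s \<otimes> ?d z v) (dot R (I i) g (\<phi> i v))"
      using cob unfolding coboundary_rows_def by blast
    have sc: "s \<in> carrier R" using s by auto
    obtain f where f: "f \<in> V (Suc i)" "\<And>v. v \<in> V (Suc i) \<Longrightarrow> ?d f v = dot R (I i) g (\<phi> i v)"
      using row_of_functional[OF lin_comp[OF lin_dot[OF fin g] lin] fin] by blast
    let ?y = "\<lambda>k. s \<otimes> z k \<ominus> f k"
    have sz: "(\<lambda>k. s \<otimes> z k) \<in> V (Suc i)" by (rule fvec_closed(1)[OF sc zc])
    have y: "?y \<in> V (Suc i)" by (rule fvec_closed(3)[OF sz f(1)])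
    have "?y k \<in> J'" for k
    proof (cases "k \<in> I (Suc i)")
      case True
      have "icong R J' (s \<otimes> z k) (f k)"
        using sg[OF unit_vec_closed[OF True]] f(2)[OF unit_vec_closed[OF True]] dot_unit[OF fin zc True]
          dot_unit[OF fin f(1) True] by simp
      then show ?thesis by (simp add: icong_def)
    next
      case False
      then show ?thesis
        using fvec_outside[OF y False] zero_J[OF ideal_J' J'_subset saturated_J'] by simp
    qed
    then obtain s' h where s': "s' \<in> carrier R - p" and h: "h \<in> V (Suc i)"
      and sh: "\<And>k. icong R J (s' \<otimes> ?y k) (x \<otimes> h k)"
      using common_J'[OF y] by blast
    have s'c: "s' \<in> carrier R" using s' by auto
    have xh: "(\<lambda>k. x \<otimes> h k) \<in> V (Suc i)" by (rule fvec_closed(1)[OF xc h])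
    have s'y: "(\<lambda>k. s' \<otimes> ?y k) \<in> V (Suc i)" by (rule fvec_closed(1)[OF s'c y])
    have dot1: "icong R J (s' \<otimes> (s \<otimes> ?d z v \<ominus> dot R (I i) g (\<phi> i v))) (x \<otimes> ?d h v)" if v: "v \<in> V (Suc i)" for v
    proof -
      have "icong R J (?d v (\<lambda>k. s' \<otimes> ?y k)) (?d v (\<lambda>k. x \<otimes> h k))"
        by (rule dot_icong[OF J fin v s'y xh sh])
      then have "icong R J (?d (\<lambda>k. s' \<otimes> ?y k) v) (?d (\<lambda>k. x \<otimes> h k) v)"
        using dot_comm[OF v s'y] dot_comm[OF v xh] by simp
      moreover have "?d (\<lambda>k. s' \<otimes> ?y k) v = s' \<otimes> (s \<otimes> ?d z v \<ominus> dot R (I i) g (\<phi> i v))"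
        using dot_algebra(3)[OF fin v s'c y] dot_algebra(4)[OF fin v sz f(1)] dot_algebra(3)[OF fin v sc zc] f(2)[OF v]
        by simp
      moreover have "?d (\<lambda>k. x \<otimes> h k) v = x \<otimes> ?d h v" by (rule dot_algebra(3)[OF fin v xc h])
      ultimately show ?thesis by simp
    qed
    \<comment> \<open>\<open>x h\<close> is congruent to a combination of the cocycle
      \<open>z\<close> and a coboundary; the factor \<open>x\<close> cancels from its values on
      boundaries.\<close>
    have "h \<in> ?Z"
    proof -
      have "?d h (\<phi> (Suc i) v) \<in> J" if v: "v \<in> V (Suc (Suc i))" for v
      proof -
        have pv: "\<phi> (Suc i) v \<in> V (Suc i)" using v by simp
        have "?d z (\<phi> (Suc i) v) \<in> J" using z v by (simp add: cocycle_rows_def)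
        then have "s' \<otimes> (s \<otimes> ?d z (\<phi> (Suc i) v)) \<in> J" using J.I_l_closed sc s'c by blast
        then have "s' \<otimes> (s \<otimes> ?d z (\<phi> (Suc i) v) \<ominus> dot R (I i) g (\<phi> i (\<phi> (Suc i) v))) \<in> J"
          using complex[OF v] dot_algebra(7)[OF fin g] sc zc pv by (simp add: a_minus_def)
        then have "x \<otimes> ?d h (\<phi> (Suc i) v) \<in> J" using icong_mem'[OF J dot1[OF pv]] by blast
        then show ?thesis using regular h pv by simp
      qed
      then show ?thesis using h by (simp add: cocycle_rows_def)
    qed
    then have xhW: "(\<lambda>k. x \<otimes> h k) \<in> W" using pW x by blast
    \<comment> \<open>A coboundary, with \<open>s' g\<close> as witness. Together with
      \<open>x h \<in> W\<close> it shows that a multiple of \<open>z\<close> with factor outside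
      \<open>p\<close> lies in \<open>W\<close>.\<close>
    let ?b = "\<lambda>k. (s' \<otimes> s) \<otimes> z k \<ominus> x \<otimes> h k"
    have ssz: "(\<lambda>k. (s' \<otimes> s) \<otimes> z k) \<in> V (Suc i)" using fvec_closed(1)[OF _ zc] sc s'c by simp
    have "?b \<in> coboundary_rows J i"
    proof (rule coboundary_rowsI[OF J Jp sat _ one_np fvec_closed(1)[OF s'c g]])
      show b: "?b \<in> V (Suc i)" by (rule fvec_closed(3)[OF ssz xh])
      fix v assume v: "v \<in> V (Suc i)"
      have ss: "s' \<otimes> s \<in> carrier R" using sc s'c by simp
      have 1: "?d ?b v = s' \<otimes> (s \<otimes> ?d z v) \<ominus> x \<otimes> ?d h v"
        using dot_algebra(4)[OF fin v ssz xh] dot_algebra(3)[OF fin v ss zc] dot_algebra(3)[OF fin v xc h] sc s'c zc v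
        by (simp add: m_assoc)
      have 2: "dot R (I i) (\<lambda>k. s' \<otimes> g k) (\<phi> i v) = s' \<otimes> dot R (I i) g (\<phi> i v)"
        by (rule dot_algebra(3)[OF fin phi_closed[OF v] s'c g])
      have cl: "s \<otimes> ?d z v \<in> carrier R" "dot R (I i) g (\<phi> i v) \<in> carrier R" "x \<otimes> ?d h v \<in> carrier R"
        using sc zc v g xc h by auto
      have "s' \<otimes> (s \<otimes> ?d z v \<ominus> dot R (I i) g (\<phi> i v)) \<ominus> x \<otimes> ?d h v \<in> J"
        using dot1[OF v] by (simp add: icong_def)
      also have "s' \<otimes> (s \<otimes> ?d z v \<ominus> dot R (I i) g (\<phi> i v)) \<ominus> x \<otimes> ?d h v =
          (s' \<otimes> (s \<otimes> ?d z v) \<ominus> x \<otimes> ?d h v) \<ominus> s' \<otimes> dot R (I i) g (\<phi> i v)"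
        using cl s'c by (simp add: a_minus_def r_distr r_minus a_ac)
      finally show "icong R J (\<one> \<otimes> ?d ?b v) (dot R (I i) (\<lambda>k. s' \<otimes> g k) (\<phi> i v))"
        using 1 2 cl s'c by (simp add: icong_def)
    qed
    then have "?b \<in> W" using W(2) by blast
    from M.submoduleE(5)[OF W(1) this xhW]
    have "(\<lambda>k. ?b k \<oplus> x \<otimes> h k) \<in> W" by simp
    moreover have "?b k \<oplus> x \<otimes> h k = (s' \<otimes> s) \<otimes> z k" for k
      using fvec_coord[OF ssz, of k] fvec_coord[OF xh, of k] by (simp add: a_minus_def a_assoc l_neg)
    ultimately show "z \<in> W" using satW[OF mult_np[OF s' s] z] by simp
  qed
  then show False using W(3) by blast
qed

end
end

section \<open>Vanishing of the dual cohomology by induction on the dimension\<close>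

text \<open>A regular element trades one unit of dimension for one place of exactness, so
  \<open>c + d\<close> is unchanged when the induction hypothesis is used with \<open>Suc c\<close>.
  When \<open>p\<close> is associated to \<open>R / J\<close>, the depth-zero argument already
  covers every \<open>i \<ge> c\<close>.\<close>

theorem cocycle_rows_subset_coboundary_rows:
  assumes "ideal J R" "J \<subseteq> p" "saturated R p J" and "\<And>i. i \<ge> c \<Longrightarrow> exact_mod J i"
    and "\<not> chain_below R J p d" and "Suc i \<ge> c + d"
  shows "cocycle_rows J (Suc i) \<subseteq> coboundary_rows J i"
  using assms
proof (induction d arbitrary: J c)
  case 0
  \<comment> \<open>The base case is contradictory: \<open>p\<close> alone is a chain of length
    \<open>0\<close> over \<open>J\<close>.\<close>
  have "prime_chain R 0 (\<lambda>_. p)" using prime by (simp add: prime_chain_def)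
  then have "chain_below R J p 0" unfolding chain_below_def using "0.prems"(2) by blast
  then show ?case using "0.prems"(5) by blast
next
  case (Suc d)
  note J = Suc.prems(1-3)
  have ic: "i \<ge> c" using Suc.prems(6) by simp
  from associated_or_regular[OF is_cring noetherian prime J(1-3)]
  consider a where "a \<in> carrier R" "colon R J a = p"
    | x where "x \<in> p" "\<And>r. r \<in> carrier R \<Longrightarrow> x \<otimes> r \<in> J \<Longrightarrow> r \<in> J" by blast
  then show ?case
  proof cases
    case 1
    then show ?thesis using depth_zero[OF J 1 Suc.prems(4) ic] by blast
  next
    case 2
    define J' where J': "J' = saturation R p {j \<oplus> x \<otimes> r | j r. j \<in> J \<and> r \<in> carrier R}"
    note C = J 2 J'
    have "cocycle_rows J' (Suc i) \<subseteq> coboundary_rows J' i"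
    proof (rule Suc.IH[where c = "Suc c"])
      show "ideal J' R" "J' \<subseteq> p" "saturated R p J'"
        using ideal_J'[OF C] J'_subset[OF C] saturated_J'[OF C] by auto
      show "exact_mod J' j" if "j \<ge> Suc c" for j
      proof -
        have "j = Suc (j - 1)" "j - 1 \<ge> c" using that by auto
        then obtain j' where "j = Suc j'" "j' \<ge> c" by blast
        then show ?thesis using exact_regular[OF C, of j'] Suc.prems(4)[of j'] Suc.prems(4)[of "Suc j'"] by simp
      qed
      show "\<not> chain_below R J' p d"
        using chain_below_regular[OF is_cring noetherian J(1) x_J'[OF C] 2(2) J_J'[OF C]] Suc.prems(5) by blast
      show "Suc c + d \<le> Suc i" using Suc.prems(6) by simp
    qed
    then show ?thesis using regular_coboundary[OF C] by blast
  qed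
qed

end

subsection \<open>Lifting along surjections\<close>

text \<open>A predicate in HOL cannot quantify over modules of all element types, so the lifting
  property is stated for one map at a time. Since \<open>g\<close> has only to take values in the
  image of \<open>\<pi>\<close>, it applies directly to the differentials of an exact
  complex.\<close>

definition lifts ::
  "('r, 'x) ring_scheme \<Rightarrow> ('r, 'p, 'y) module_scheme \<Rightarrow> ('r, 'a, 'z) module_scheme \<Rightarrow>
   ('r, 'b, 'w) module_scheme \<Rightarrow> ('a \<Rightarrow> 'b) \<Rightarrow> bool" where
  "lifts R P A B \<pi> \<longleftrightarrow> (\<forall>g\<in>lin_maps R P B. g ` carrier P \<subseteq> \<pi> ` carrier A \<longrightarrow>
     (\<exists>h\<in>lin_maps R P A. \<forall>x\<in>carrier P. \<pi> (h x) = g x))"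

lemma liftsE:
  assumes "lifts R P A B \<pi>" "g \<in> lin_maps R P B" "\<And>x. x \<in> carrier P \<Longrightarrow> g x \<in> \<pi> ` carrier A"
  obtains h where "h \<in> lin_maps R P A" "\<And>x. x \<in> carrier P \<Longrightarrow> \<pi> (h x) = g x"
proof -
  have "g ` carrier P \<subseteq> \<pi> ` carrier A" using assms(3) by auto
  then show ?thesis using that assms(1,2) unfolding lifts_def by metis
qed

text \<open>A lift is determined by chosen preimages of the images of the unit vectors.\<close>

lemma lifts_fvec:
  assumes "module R A" "module R B" "\<pi> \<in> lin_maps R A B" "finite I"
  shows "lifts R (fvec R I) A B \<pi>"
  unfolding lifts_def
proof (intro ballI impI)
  interpret A: module R A by fact
  fix g assume g: "g \<in> lin_maps R (fvec R I) B" and im: "g ` carrier (fvec R I) \<subseteq> \<pi> ` carrier A"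
  have "\<exists>a. a \<in> carrier A \<and> \<pi> a = g (unit_vec R k)" if "k \<in> I" for k
    using im A.R.unit_vec_closed[OF that] by (metis imageE image_subset_iff)
  then have "\<forall>k\<in>I. \<exists>a. a \<in> carrier A \<and> \<pi> a = g (unit_vec R k)" by blast
  from bchoice[OF this] obtain a where a: "\<forall>k\<in>I. a k \<in> carrier A \<and> \<pi> (a k) = g (unit_vec R k)" ..
  then have a': "a \<in> I \<rightarrow> carrier A" by blast
  note L = A.R.lin_vec_map[OF assms(1,4) a']
  have eq: "\<pi> (vec_map A I a (unit_vec R k)) = g (unit_vec R k)" if "k \<in> I" for k
    using A.R.vec_map_unit[OF assms(1,4) a' that] a that by simp
  have "\<pi> (vec_map A I a x) = g x" if "x \<in> carrier (fvec R I)" for x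
    by (rule A.R.lin_maps_fvec_eq[OF assms(2) lin_comp[OF assms(3) L] g assms(4) eq that])
  then show "\<exists>h\<in>lin_maps R (fvec R I) A. \<forall>x\<in>carrier (fvec R I). \<pi> (h x) = g x" using L by blast
qed

lemma (in module) lin_comb_extend:
  assumes "finite A" "finite A'" "A \<subseteq> A'" "g \<in> A' \<rightarrow> carrier M" "a \<in> A \<rightarrow> carrier R"
  shows "(\<Oplus>\<^bsub>M\<^esub>v\<in>A. a v \<odot>\<^bsub>M\<^esub> g v) = (\<Oplus>\<^bsub>M\<^esub>v\<in>A'. (if v \<in> A then a v else \<zero>) \<odot>\<^bsub>M\<^esub> g v)"
proof (rule M.add.finprod_mono_neutral_cong_left[OF assms(2,3)])
  have g: "g v \<in> carrier M" if "v \<in> A'" for v using assms(4) that by auto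
  have a: "a v \<in> carrier R" if "v \<in> A" for v using assms(5) that by auto
  show "(if i \<in> A then a i else \<zero>) \<odot>\<^bsub>M\<^esub> g i = \<zero>\<^bsub>M\<^esub>" if "i \<in> A' - A" for i
    using that g by auto
  show "(\<lambda>v. (if v \<in> A then a v else \<zero>) \<odot>\<^bsub>M\<^esub> g v) \<in> A' \<rightarrow> carrier M"
    using g a by auto
qed auto

text \<open>The lift is defined on linear combinations of a basis; its graph is a submodule of the product
  which linear independence shows to be single-valued.\<close>

lemma free_module_lifts:
  assumes F: "free_module R F" and A: "module R A" and B: "module R B" and \<pi>: "\<pi> \<in> lin_maps R A B"
  shows "lifts R F A B \<pi>"
  unfolding lifts_def
proof (intro ballI impI)
  interpret F: module R F using F by (simp add: free_module_def)
  interpret A: module R A by fact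
  interpret B: module R B by fact
  have "\<exists>X\<subseteq>carrier F. lin_span R F X = carrier F \<and> lin_indep R F X"
    using F by (simp add: free_module_def)
  then obtain X where X: "X \<subseteq> carrier F" "lin_span R F X = carrier F" "lin_indep R F X" by auto
  fix g assume g: "g \<in> lin_maps R F B" and im: "g ` carrier F \<subseteq> \<pi> ` carrier A"
  have "\<exists>a. a \<in> carrier A \<and> \<pi> a = g x" if "x \<in> X" for x
    using im X(1) that by (metis imageE image_subset_iff subsetD)
  then have "\<forall>x\<in>X. \<exists>a. a \<in> carrier A \<and> \<pi> a = g x" by blast
  from bchoice[OF this] obtain a where a: "\<forall>x\<in>X. a x \<in> carrier A \<and> \<pi> (a x) = g x" ..
  define graph where "graph = {(x, y). \<exists>S c. finite S \<and> S \<subseteq> X \<and> c \<in> S \<rightarrow> carrier R \<and>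
    x = (\<Oplus>\<^bsub>F\<^esub>v\<in>S. c v \<odot>\<^bsub>F\<^esub> v) \<and> y = (\<Oplus>\<^bsub>A\<^esub>v\<in>S. c v \<odot>\<^bsub>A\<^esub> a v)}"
  have graph_iff: "(x, y) \<in> graph \<longleftrightarrow> (\<exists>S c. finite S \<and> S \<subseteq> X \<and> c \<in> S \<rightarrow> carrier R \<and>
    x = (\<Oplus>\<^bsub>F\<^esub>v\<in>S. c v \<odot>\<^bsub>F\<^esub> v) \<and> y = (\<Oplus>\<^bsub>A\<^esub>v\<in>S. c v \<odot>\<^bsub>A\<^esub> a v))" for x y
    by (simp add: graph_def)
  have graphI: "((\<Oplus>\<^bsub>F\<^esub>v\<in>S. c v \<odot>\<^bsub>F\<^esub> v), (\<Oplus>\<^bsub>A\<^esub>v\<in>S. c v \<odot>\<^bsub>A\<^esub> a v)) \<in> graph"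
    if "finite S" "S \<subseteq> X" "c \<in> S \<rightarrow> carrier R" for S c
    unfolding graph_iff by (rule exI[of _ S], rule exI[of _ c]) (intro conjI refl that)
  have cva: "c v \<in> carrier R" "v \<in> carrier F" "a v \<in> carrier A"
    if "S \<subseteq> X" "c \<in> S \<rightarrow> carrier R" "v \<in> S" for S c v
    using that X(1) a by auto
  have sumF: "(\<lambda>v. c v \<odot>\<^bsub>F\<^esub> v) \<in> S \<rightarrow> carrier F"
    if "S \<subseteq> X" "c \<in> S \<rightarrow> carrier R" for S c
    by (intro Pi_I F.smult_closed cva[OF that])
  have sumA: "(\<lambda>v. c v \<odot>\<^bsub>A\<^esub> a v) \<in> S \<rightarrow> carrier A"
    if "S \<subseteq> X" "c \<in> S \<rightarrow> carrier R" for S c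
    by (intro Pi_I A.smult_closed cva[OF that])
  have graph_closed: "x \<in> carrier F \<and> y \<in> carrier A \<and> \<pi> y = g x" if gr: "(x, y) \<in> graph" for x y
  proof -
    obtain S c where S: "finite S" "S \<subseteq> X" "c \<in> S \<rightarrow> carrier R"
      and xy: "x = (\<Oplus>\<^bsub>F\<^esub>v\<in>S. c v \<odot>\<^bsub>F\<^esub> v)" "y = (\<Oplus>\<^bsub>A\<^esub>v\<in>S. c v \<odot>\<^bsub>A\<^esub> a v)"
      using gr unfolding graph_iff by blast
    have "\<pi> y = (\<Oplus>\<^bsub>B\<^esub>v\<in>S. \<pi> (c v \<odot>\<^bsub>A\<^esub> a v))"
      unfolding xy by (rule lin_finsum[OF A B \<pi> sumA[OF S(2,3)]])
    also have "\<dots> = (\<Oplus>\<^bsub>B\<^esub>v\<in>S. g (c v \<odot>\<^bsub>F\<^esub> v))"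
    proof (rule B.M.finsum_cong')
      have 1: "g (c v \<odot>\<^bsub>F\<^esub> v) \<in> carrier B" if "v \<in> S" for v
        using lin_closed[OF g] sumF[OF S(2,3)] that by (simp add: Pi_iff)
      then show "(\<lambda>v. g (c v \<odot>\<^bsub>F\<^esub> v)) \<in> S \<rightarrow> carrier B" by simp
      show "\<pi> (c v \<odot>\<^bsub>A\<^esub> a v) = g (c v \<odot>\<^bsub>F\<^esub> v)" if "v \<in> S" for v
      proof -
        have "c v \<in> carrier R" "v \<in> X" using S that by auto
        then show ?thesis using a X(1) lin_smult[OF \<pi>, of "c v" "a v"] lin_smult[OF g, of "c v" v] by auto
      qed
    qed simp
    also have "\<dots> = g x" unfolding xy by (rule lin_finsum[OF _ B g sumF[OF S(2,3)], symmetric]) unfold_locales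
    finally have "\<pi> y = g x" .
    moreover have "x \<in> carrier F" unfolding xy by (rule F.M.finsum_closed[OF sumF[OF S(2,3)]])
    moreover have "y \<in> carrier A" unfolding xy by (rule A.M.finsum_closed[OF sumA[OF S(2,3)]])
    ultimately show ?thesis by simp
  qed
  have graph_total: "\<exists>y. (x, y) \<in> graph" if "x \<in> carrier F" for x
  proof -
    obtain S c where S: "finite S" "S \<subseteq> X" "c \<in> S \<rightarrow> carrier R" "x = (\<Oplus>\<^bsub>F\<^esub>v\<in>S. c v \<odot>\<^bsub>F\<^esub> v)"
      using \<open>x \<in> carrier F\<close>[folded X(2)] unfolding lin_span_def mem_Collect_eq by (elim exE conjE)
    show ?thesis unfolding S(4) by (rule exI) (rule graphI[OF S(1-3)])
  qed
  have graph_smult: "(r \<odot>\<^bsub>F\<^esub> x, r \<odot>\<^bsub>A\<^esub> y) \<in> graph" if gr: "(x, y) \<in> graph" and r: "r \<in> carrier R" for r x y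
  proof -
    obtain S c where S: "finite S" "S \<subseteq> X" "c \<in> S \<rightarrow> carrier R"
      and xy: "x = (\<Oplus>\<^bsub>F\<^esub>v\<in>S. c v \<odot>\<^bsub>F\<^esub> v)" "y = (\<Oplus>\<^bsub>A\<^esub>v\<in>S. c v \<odot>\<^bsub>A\<^esub> a v)"
      using gr unfolding graph_iff by blast
    have c: "c v \<in> carrier R" "v \<in> carrier F" "a v \<in> carrier A" if "v \<in> S" for v using S that X(1) a by auto
    have "r \<odot>\<^bsub>F\<^esub> x = (\<Oplus>\<^bsub>F\<^esub>v\<in>S. r \<odot>\<^bsub>F\<^esub> (c v \<odot>\<^bsub>F\<^esub> v))"
      unfolding xy by (rule F.finsum_smult_ldistr[OF S(1) r sumF[OF S(2,3)]])
    also have "\<dots> = (\<Oplus>\<^bsub>F\<^esub>v\<in>S. (r \<otimes>\<^bsub>R\<^esub> c v) \<odot>\<^bsub>F\<^esub> v)"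
      using c r by (intro F.M.finsum_cong') (auto simp: F.smult_assoc1)
    finally have 1: "r \<odot>\<^bsub>F\<^esub> x = (\<Oplus>\<^bsub>F\<^esub>v\<in>S. (r \<otimes>\<^bsub>R\<^esub> c v) \<odot>\<^bsub>F\<^esub> v)" .
    have "r \<odot>\<^bsub>A\<^esub> y = (\<Oplus>\<^bsub>A\<^esub>v\<in>S. r \<odot>\<^bsub>A\<^esub> (c v \<odot>\<^bsub>A\<^esub> a v))"
      unfolding xy by (rule A.finsum_smult_ldistr[OF S(1) r sumA[OF S(2,3)]])
    also have "\<dots> = (\<Oplus>\<^bsub>A\<^esub>v\<in>S. (r \<otimes>\<^bsub>R\<^esub> c v) \<odot>\<^bsub>A\<^esub> a v)"
      using c r by (intro A.M.finsum_cong') (auto simp: A.smult_assoc1)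
    finally have 2: "r \<odot>\<^bsub>A\<^esub> y = (\<Oplus>\<^bsub>A\<^esub>v\<in>S. (r \<otimes>\<^bsub>R\<^esub> c v) \<odot>\<^bsub>A\<^esub> a v)" .
    have "(\<lambda>v. r \<otimes>\<^bsub>R\<^esub> c v) \<in> S \<rightarrow> carrier R" using c r by auto
    then show ?thesis unfolding 1 2 by (rule graphI[OF S(1,2)])
  qed
  have graph_add: "(x \<oplus>\<^bsub>F\<^esub> x', y \<oplus>\<^bsub>A\<^esub> y') \<in> graph" if gr: "(x, y) \<in> graph" and gr': "(x', y') \<in> graph" for x y x' y'
  proof -
    obtain S c where S: "finite S" "S \<subseteq> X" "c \<in> S \<rightarrow> carrier R"
      and xy: "x = (\<Oplus>\<^bsub>F\<^esub>v\<in>S. c v \<odot>\<^bsub>F\<^esub> v)" "y = (\<Oplus>\<^bsub>A\<^esub>v\<in>S. c v \<odot>\<^bsub>A\<^esub> a v)"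
      using gr unfolding graph_iff by blast
    obtain S' c' where S': "finite S'" "S' \<subseteq> X" "c' \<in> S' \<rightarrow> carrier R"
      and xy': "x' = (\<Oplus>\<^bsub>F\<^esub>v\<in>S'. c' v \<odot>\<^bsub>F\<^esub> v)" "y' = (\<Oplus>\<^bsub>A\<^esub>v\<in>S'. c' v \<odot>\<^bsub>A\<^esub> a v)"
      using gr' unfolding graph_iff by blast
    \<comment> \<open>Both combinations are rewritten over the union of their supports, with
      coefficient zero where one of them has no term.\<close>
    let ?S = "S \<union> S'"
    let ?c = "\<lambda>v. if v \<in> S then c v else \<zero>\<^bsub>R\<^esub>" and ?c' = "\<lambda>v. if v \<in> S' then c' v else \<zero>\<^bsub>R\<^esub>"
    have U: "finite ?S" "?S \<subseteq> X" using S S' by auto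
    have c: "?c \<in> ?S \<rightarrow> carrier R" "?c' \<in> ?S \<rightarrow> carrier R" using S(3) S'(3) by (auto simp: Pi_iff)
    have cc: "?c v \<in> carrier R" "?c' v \<in> carrier R" for v using S(3) S'(3) by (auto simp: Pi_iff)
    have XF: "(\<lambda>v. v) \<in> ?S \<rightarrow> carrier F" "a \<in> ?S \<rightarrow> carrier A" using U(2) X(1) a by auto
    have va: "v \<in> carrier F" "a v \<in> carrier A" if "v \<in> ?S" for v using XF that by blast+
    have e: "x = (\<Oplus>\<^bsub>F\<^esub>v\<in>?S. ?c v \<odot>\<^bsub>F\<^esub> v)" "x' = (\<Oplus>\<^bsub>F\<^esub>v\<in>?S. ?c' v \<odot>\<^bsub>F\<^esub> v)"
      "y = (\<Oplus>\<^bsub>A\<^esub>v\<in>?S. ?c v \<odot>\<^bsub>A\<^esub> a v)" "y' = (\<Oplus>\<^bsub>A\<^esub>v\<in>?S. ?c' v \<odot>\<^bsub>A\<^esub> a v)"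
      unfolding xy xy'
      by (rule F.lin_comb_extend[OF _ U(1) _ XF(1)] A.lin_comb_extend[OF _ U(1) _ XF(2)]; use S S' in auto)+
    have "x \<oplus>\<^bsub>F\<^esub> x' = (\<Oplus>\<^bsub>F\<^esub>v\<in>?S. ?c v \<odot>\<^bsub>F\<^esub> v \<oplus>\<^bsub>F\<^esub> ?c' v \<odot>\<^bsub>F\<^esub> v)"
      unfolding e by (rule F.M.finsum_addf[OF sumF[OF U(2) c(1)] sumF[OF U(2) c(2)], symmetric])
    also have "\<dots> = (\<Oplus>\<^bsub>F\<^esub>v\<in>?S. (?c v \<oplus>\<^bsub>R\<^esub> ?c' v) \<odot>\<^bsub>F\<^esub> v)"
      by (rule F.M.finsum_cong'[OF refl]) (use cc va in \<open>simp_all add: F.smult_l_distr Pi_iff\<close>)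
    finally have 1: "x \<oplus>\<^bsub>F\<^esub> x' = (\<Oplus>\<^bsub>F\<^esub>v\<in>?S. (?c v \<oplus>\<^bsub>R\<^esub> ?c' v) \<odot>\<^bsub>F\<^esub> v)" .
    have "y \<oplus>\<^bsub>A\<^esub> y' = (\<Oplus>\<^bsub>A\<^esub>v\<in>?S. ?c v \<odot>\<^bsub>A\<^esub> a v \<oplus>\<^bsub>A\<^esub> ?c' v \<odot>\<^bsub>A\<^esub> a v)"
      unfolding e by (rule A.M.finsum_addf[OF sumA[OF U(2) c(1)] sumA[OF U(2) c(2)], symmetric])
    also have "\<dots> = (\<Oplus>\<^bsub>A\<^esub>v\<in>?S. (?c v \<oplus>\<^bsub>R\<^esub> ?c' v) \<odot>\<^bsub>A\<^esub> a v)"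
      by (rule A.M.finsum_cong'[OF refl]) (use cc va in \<open>simp_all add: A.smult_l_distr Pi_iff\<close>)
    finally have 2: "y \<oplus>\<^bsub>A\<^esub> y' = (\<Oplus>\<^bsub>A\<^esub>v\<in>?S. (?c v \<oplus>\<^bsub>R\<^esub> ?c' v) \<odot>\<^bsub>A\<^esub> a v)" .
    have "(\<lambda>v. ?c v \<oplus>\<^bsub>R\<^esub> ?c' v) \<in> ?S \<rightarrow> carrier R" using cc by blast
    then show ?thesis unfolding 1 2 by (rule graphI[OF U])
  qed
  have graph_zero: "y = \<zero>\<^bsub>A\<^esub>" if gr: "(\<zero>\<^bsub>F\<^esub>, y) \<in> graph" for y
  proof -
    obtain S c where S: "finite S" "S \<subseteq> X" "c \<in> S \<rightarrow> carrier R"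
      and xy: "\<zero>\<^bsub>F\<^esub> = (\<Oplus>\<^bsub>F\<^esub>v\<in>S. c v \<odot>\<^bsub>F\<^esub> v)" "y = (\<Oplus>\<^bsub>A\<^esub>v\<in>S. c v \<odot>\<^bsub>A\<^esub> a v)"
      using gr unfolding graph_iff by blast
    have "\<forall>v\<in>S. c v = \<zero>\<^bsub>R\<^esub>"
      using X(3) S xy(1)[symmetric] unfolding lin_indep_def by blast
    then have "y = (\<Oplus>\<^bsub>A\<^esub>v\<in>S. \<zero>\<^bsub>A\<^esub>)"
      unfolding xy using S a by (intro A.M.finsum_cong') auto
    then show ?thesis by simp
  qed
  have graph_unique: "y = y'" if "(x, y) \<in> graph" "(x, y') \<in> graph" for x y y'
  proof -
    have cl: "x \<in> carrier F" "y \<in> carrier A" "y' \<in> carrier A" using graph_closed that by blast+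
    have "(x \<oplus>\<^bsub>F\<^esub> (\<ominus>\<^bsub>R\<^esub> \<one>\<^bsub>R\<^esub>) \<odot>\<^bsub>F\<^esub> x, y \<oplus>\<^bsub>A\<^esub> (\<ominus>\<^bsub>R\<^esub> \<one>\<^bsub>R\<^esub>) \<odot>\<^bsub>A\<^esub> y') \<in> graph"
      by (intro graph_add graph_smult that) simp
    then have "(\<zero>\<^bsub>F\<^esub>, y \<ominus>\<^bsub>A\<^esub> y') \<in> graph"
      using cl by (simp add: F.smult_l_minus A.smult_l_minus F.M.r_neg a_minus_def)
    then show ?thesis using graph_zero A.minus_eq_zero_iff cl by blast
  qed
  define h where "h x = (SOME y. (x, y) \<in> graph)" for x
  have h: "(x, h x) \<in> graph" if "x \<in> carrier F" for x
    unfolding h_def by (rule someI_ex[OF graph_total[OF that]])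
  have "h \<in> lin_maps R F A"
  proof (rule lin_mapsI)
    show "h x \<in> carrier A" if "x \<in> carrier F" for x using graph_closed[OF h[OF that]] by blast
    show "h (x \<oplus>\<^bsub>F\<^esub> y) = h x \<oplus>\<^bsub>A\<^esub> h y" if "x \<in> carrier F" "y \<in> carrier F" for x y
      by (rule graph_unique[OF h[OF F.M.a_closed[OF that]] graph_add[OF h[OF that(1)] h[OF that(2)]]])
    show "h (r \<odot>\<^bsub>F\<^esub> x) = r \<odot>\<^bsub>A\<^esub> h x" if "r \<in> carrier R" "x \<in> carrier F" for r x
      by (rule graph_unique[OF h[OF F.smult_closed[OF that]] graph_smult[OF h[OF that(2)] that(1)]])
  qed
  then show "\<exists>h\<in>lin_maps R F A. \<forall>x\<in>carrier F. \<pi> (h x) = g x" using graph_closed h by blast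
qed

text \<open>Lift the composite of \<open>g\<close> with the retraction \<open>q\<close> from the
  free module, then restrict the lift along the section \<open>i\<close>.\<close>

lemma projective_module_lifts:
  fixes P :: "('r, 'p, 'w) module_scheme"
  assumes P: "projective_module R P" and A: "module R A" and B: "module R B" and \<pi>: "\<pi> \<in> lin_maps R A B"
  shows "lifts R P A B \<pi>"
  unfolding lifts_def
proof (intro ballI impI)
  fix g assume g: "g \<in> lin_maps R P B" and im: "g ` carrier P \<subseteq> \<pi> ` carrier A"
  obtain F :: "('r, 'p \<Rightarrow> 'r) module" and i q where F: "free_module R F" "i \<in> lin_maps R P F"
    "q \<in> lin_maps R F P" "\<forall>x\<in>carrier P. q (i x) = x"
    using P unfolding projective_module_def by (elim exE conjE)
  have gq: "(\<lambda>x. g (q x)) \<in> lin_maps R F B" by (rule lin_comp[OF g F(3)])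
  have im': "g (q x) \<in> \<pi> ` carrier A" if "x \<in> carrier F" for x
    using im lin_closed[OF F(3) that] by (simp add: image_subset_iff)
  obtain h where h: "h \<in> lin_maps R F A" "\<And>x. x \<in> carrier F \<Longrightarrow> \<pi> (h x) = g (q x)"
    by (rule liftsE[OF free_module_lifts[OF F(1) A B \<pi>] gq im']) auto
  show "\<exists>h\<in>lin_maps R P A. \<forall>x\<in>carrier P. \<pi> (h x) = g x"
  proof (rule bexI[OF _ lin_comp[OF h(1) F(2)]], rule ballI)
    show "\<pi> (h (i x)) = g x" if "x \<in> carrier P" for x
      using h(2)[OF lin_closed[OF F(2) that]] bspec[OF F(4) that] by simp
  qed
qed

subsection \<open>Comparison of resolutions\<close>

text \<open>Exactness without projectivity. The lifting property enters the comparison lemmas as a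
  separate hypothesis, so that projective modules and coordinate modules are treated alike.\<close>

definition resolution ::
  "('r, 'x) ring_scheme \<Rightarrow> ('r, 'm, 'y) module_scheme \<Rightarrow>
   (nat \<Rightarrow> ('r, 'p, 'w) module_scheme) \<Rightarrow> (nat \<Rightarrow> 'p \<Rightarrow> 'p) \<Rightarrow> ('p \<Rightarrow> 'm) \<Rightarrow> bool" where
  "resolution R M P \<delta> \<epsilon> \<longleftrightarrow> (\<forall>i. module R (P i)) \<and> (\<forall>i. \<delta> i \<in> lin_maps R (P (Suc i)) (P i)) \<and>
     \<epsilon> \<in> lin_maps R (P 0) M \<and> \<epsilon> ` carrier (P 0) = carrier M \<and>
     \<delta> 0 ` carrier (P (Suc 0)) = {x \<in> carrier (P 0). \<epsilon> x = \<zero>\<^bsub>M\<^esub>} \<and>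
     (\<forall>i. \<delta> (Suc i) ` carrier (P (Suc (Suc i))) = {x \<in> carrier (P (Suc i)). \<delta> i x = \<zero>\<^bsub>P i\<^esub>})"

lemma projective_resolution_resolution:
  "projective_resolution R M P \<delta> \<epsilon> \<Longrightarrow> resolution R M P \<delta> \<epsilon>"
  by (auto simp: projective_resolution_def resolution_def a_kernel_def' projective_module_def)

lemma resolutionD:
  assumes "resolution R M P \<delta> \<epsilon>"
  shows "module R (P i)" "\<delta> i \<in> lin_maps R (P (Suc i)) (P i)" "\<epsilon> \<in> lin_maps R (P 0) M"
    and "\<epsilon> ` carrier (P 0) = carrier M"
    and "x \<in> carrier (P 0) \<Longrightarrow> \<epsilon> x = \<zero>\<^bsub>M\<^esub> \<Longrightarrow> x \<in> \<delta> 0 ` carrier (P (Suc 0))"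
    and "x \<in> carrier (P (Suc i)) \<Longrightarrow> \<delta> i x = \<zero>\<^bsub>P i\<^esub> \<Longrightarrow> x \<in> \<delta> (Suc i) ` carrier (P (Suc (Suc i)))"
    and "y \<in> carrier (P (Suc 0)) \<Longrightarrow> \<epsilon> (\<delta> 0 y) = \<zero>\<^bsub>M\<^esub>"
    and "y \<in> carrier (P (Suc (Suc i))) \<Longrightarrow> \<delta> i (\<delta> (Suc i) y) = \<zero>\<^bsub>P i\<^esub>"
proof -
  have R: "\<forall>i. module R (P i)" "\<forall>i. \<delta> i \<in> lin_maps R (P (Suc i)) (P i)" "\<epsilon> \<in> lin_maps R (P 0) M"
    "\<epsilon> ` carrier (P 0) = carrier M"
    "\<delta> 0 ` carrier (P (Suc 0)) = {x \<in> carrier (P 0). \<epsilon> x = \<zero>\<^bsub>M\<^esub>}"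
    "\<forall>i. \<delta> (Suc i) ` carrier (P (Suc (Suc i))) = {x \<in> carrier (P (Suc i)). \<delta> i x = \<zero>\<^bsub>P i\<^esub>}"
    using assms unfolding resolution_def by - (elim conjE, assumption)+
  show "module R (P i)" "\<delta> i \<in> lin_maps R (P (Suc i)) (P i)" "\<epsilon> \<in> lin_maps R (P 0) M"
    "\<epsilon> ` carrier (P 0) = carrier M"
    using R(1-4) by auto
  show "x \<in> carrier (P 0) \<Longrightarrow> \<epsilon> x = \<zero>\<^bsub>M\<^esub> \<Longrightarrow> x \<in> \<delta> 0 ` carrier (P (Suc 0))"
    unfolding R(5) by simp
  show "x \<in> carrier (P (Suc i)) \<Longrightarrow> \<delta> i x = \<zero>\<^bsub>P i\<^esub> \<Longrightarrow> x \<in> \<delta> (Suc i) ` carrier (P (Suc (Suc i)))"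
    unfolding R(6)[rule_format] by simp
  show "\<epsilon> (\<delta> 0 y) = \<zero>\<^bsub>M\<^esub>" if "y \<in> carrier (P (Suc 0))"
    using imageI[OF that, of "\<delta> 0", unfolded R(5)] by simp
  show "\<delta> i (\<delta> (Suc i) y) = \<zero>\<^bsub>P i\<^esub>" if "y \<in> carrier (P (Suc (Suc i)))"
    using imageI[OF that, of "\<delta> (Suc i)", unfolded R(6)[rule_format]] by simp
qed

lemma comparison:
  assumes M: "module R M" and A: "resolution R M A a \<alpha>" and B: "resolution R M B b \<beta>"
    and l0: "lifts R (A 0) (B 0) M \<beta>" and lS: "\<And>i. lifts R (A (Suc i)) (B (Suc i)) (B i) (b i)"
  obtains u where "\<And>i. u i \<in> lin_maps R (A i) (B i)" "\<And>x. x \<in> carrier (A 0) \<Longrightarrow> \<beta> (u 0 x) = \<alpha> x"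
    "\<And>i x. x \<in> carrier (A (Suc i)) \<Longrightarrow> b i (u (Suc i) x) = u i (a i x)"
proof -
  note RA = resolutionD[OF A] and RB = resolutionD[OF B]
  \<comment> \<open>The last conjunct is what the recursion needs: once \<open>u (a n x)\<close>
    lies in the image of \<open>b n\<close>, the next component can be lifted.\<close>
  define Pr where "Pr n u \<longleftrightarrow> u \<in> lin_maps R (A n) (B n) \<and> (n = 0 \<longrightarrow> (\<forall>x\<in>carrier (A 0). \<beta> (u x) = \<alpha> x)) \<and>
    (\<forall>x\<in>carrier (A (Suc n)). u (a n x) \<in> b n ` carrier (B (Suc n)))" for n u
  have "\<exists>u. Pr 0 u"
  proof -
    have "\<alpha> x \<in> \<beta> ` carrier (B 0)" if "x \<in> carrier (A 0)" for x
      using lin_closed[OF RA(3) that] RB(4) by simp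
    then obtain u where u: "u \<in> lin_maps R (A 0) (B 0)" "\<And>x. x \<in> carrier (A 0) \<Longrightarrow> \<beta> (u x) = \<alpha> x"
      using liftsE[OF l0 RA(3)] by metis
    have "u (a 0 x) \<in> b 0 ` carrier (B (Suc 0))" if "x \<in> carrier (A (Suc 0))" for x
      using RB(5)[OF lin_closed[OF u(1) lin_closed[OF RA(2) that]]] u(2)[OF lin_closed[OF RA(2) that]] RA(7)[OF that] by simp
    then show ?thesis unfolding Pr_def using u by blast
  qed
  moreover have "\<exists>u'. Pr (Suc n) u' \<and> (\<forall>x\<in>carrier (A (Suc n)). b n (u' x) = u (a n x))" if P: "Pr n u" for n u
  proof -
    have u: "u \<in> lin_maps R (A n) (B n)" "\<And>x. x \<in> carrier (A (Suc n)) \<Longrightarrow> u (a n x) \<in> b n ` carrier (B (Suc n))"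
      using P unfolding Pr_def by auto
    obtain u' where u': "u' \<in> lin_maps R (A (Suc n)) (B (Suc n))"
      "\<And>x. x \<in> carrier (A (Suc n)) \<Longrightarrow> b n (u' x) = u (a n x)"
      by (rule liftsE[OF lS lin_comp[OF u(1) RA(2)] u(2)]) auto
    have "u' (a (Suc n) x) \<in> b (Suc n) ` carrier (B (Suc (Suc n)))" if x: "x \<in> carrier (A (Suc (Suc n)))" for x
    proof (rule RB(6))
      have ax: "a (Suc n) x \<in> carrier (A (Suc n))" by (rule lin_closed[OF RA(2) x])
      show "u' (a (Suc n) x) \<in> carrier (B (Suc n))" by (rule lin_closed[OF u'(1) ax])
      show "b n (u' (a (Suc n) x)) = \<zero>\<^bsub>B n\<^esub>"
        using u'(2)[OF ax] RA(8)[OF x] lin_zero[OF RA(1) RB(1) u(1)] by simp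
    qed
    then show ?thesis unfolding Pr_def using u' by blast
  qed
  ultimately obtain u where "\<forall>n. Pr n (u n) \<and> (\<forall>x\<in>carrier (A (Suc n)). b n (u (Suc n) x) = u n (a n x))"
    using dependent_nat_choice[of Pr "\<lambda>n u u'. \<forall>x\<in>carrier (A (Suc n)). b n (u' x) = u (a n x)"] by blast
  then show ?thesis using that[of u] unfolding Pr_def by blast
qed

lemma null_homotopy:
  assumes M: "module R M" and A: "resolution R M A a \<alpha>" and B: "resolution R M B b \<beta>"
    and l: "\<And>i. lifts R (A i) (B (Suc i)) (B i) (b i)"
    and w: "\<And>i. w i \<in> lin_maps R (A i) (B i)" and w0: "\<And>x. x \<in> carrier (A 0) \<Longrightarrow> \<beta> (w 0 x) = \<zero>\<^bsub>M\<^esub>"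
    and wS: "\<And>i x. x \<in> carrier (A (Suc i)) \<Longrightarrow> b i (w (Suc i) x) = w i (a i x)"
  obtains h where "\<And>i. h i \<in> lin_maps R (A i) (B (Suc i))" "\<And>x. x \<in> carrier (A 0) \<Longrightarrow> b 0 (h 0 x) = w 0 x"
    "\<And>i x. x \<in> carrier (A (Suc i)) \<Longrightarrow> b (Suc i) (h (Suc i) x) = w (Suc i) x \<ominus>\<^bsub>B (Suc i)\<^esub> h i (a i x)"
proof -
  note RA = resolutionD[OF A] and RB = resolutionD[OF B]
  \<comment> \<open>The relation \<open>b h = w\<close> is demanded only on the image of
    \<open>a\<close>, where the contribution of the preceding homotopy vanishes. It makes
    \<open>w - h a\<close> at the next place a cycle, so that it can be lifted.\<close>
  define Pr where "Pr n h \<longleftrightarrow> h \<in> lin_maps R (A n) (B (Suc n)) \<and> (n = 0 \<longrightarrow> (\<forall>x\<in>carrier (A 0). b 0 (h x) = w 0 x)) \<and>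
    (\<forall>x\<in>carrier (A (Suc n)). b n (h (a n x)) = w n (a n x))" for n h
  have "\<exists>h. Pr 0 h"
  proof -
    have "w 0 x \<in> b 0 ` carrier (B (Suc 0))" if "x \<in> carrier (A 0)" for x
      by (rule RB(5)[OF lin_closed[OF w that] w0[OF that]])
    then obtain h where h: "h \<in> lin_maps R (A 0) (B (Suc 0))" "\<And>x. x \<in> carrier (A 0) \<Longrightarrow> b 0 (h x) = w 0 x"
      using liftsE[OF l w] by metis
    then show ?thesis unfolding Pr_def using lin_closed[OF RA(2)] by blast
  qed
  moreover have "\<exists>h'. Pr (Suc n) h' \<and>
      (\<forall>x\<in>carrier (A (Suc n)). b (Suc n) (h' x) = w (Suc n) x \<ominus>\<^bsub>B (Suc n)\<^esub> h (a n x))" if P: "Pr n h" for n h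
  proof -
    interpret Bn: module R "B n" by (rule RB(1))
    interpret Bs: module R "B (Suc n)" by (rule RB(1))
    have h: "h \<in> lin_maps R (A n) (B (Suc n))" "\<And>x. x \<in> carrier (A (Suc n)) \<Longrightarrow> b n (h (a n x)) = w n (a n x)"
      using P unfolding Pr_def by auto
    let ?g = "\<lambda>x. w (Suc n) x \<ominus>\<^bsub>B (Suc n)\<^esub> h (a n x)"
    have ha: "(\<lambda>x. h (a n x)) \<in> lin_maps R (A (Suc n)) (B (Suc n))" by (rule lin_comp[OF h(1) RA(2)])
    have g: "?g \<in> lin_maps R (A (Suc n)) (B (Suc n))" by (rule lin_maps_minus[OF RB(1) w ha])
    have im: "?g x \<in> b (Suc n) ` carrier (B (Suc (Suc n)))" if x: "x \<in> carrier (A (Suc n))" for x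
    proof (rule RB(6)[OF lin_closed[OF g x]])
      have "b n (?g x) = b n (w (Suc n) x) \<ominus>\<^bsub>B n\<^esub> b n (h (a n x))"
        by (rule lin_minus[OF RB(1) RB(1) RB(2) lin_closed[OF w x] lin_closed[OF ha x]])
      also have "\<dots> = \<zero>\<^bsub>B n\<^esub>"
        using h(2)[OF x] wS[OF x] lin_closed[OF w lin_closed[OF RA(2) x]] by (simp add: Bn.minus_eq_zero_iff)
      finally show "b n (?g x) = \<zero>\<^bsub>B n\<^esub>" .
    qed
    obtain h' where h': "h' \<in> lin_maps R (A (Suc n)) (B (Suc (Suc n)))"
      "\<And>x. x \<in> carrier (A (Suc n)) \<Longrightarrow> b (Suc n) (h' x) = ?g x"
      by (rule liftsE[OF l g im]) auto
    have "b (Suc n) (h' (a (Suc n) x)) = w (Suc n) (a (Suc n) x)" if x: "x \<in> carrier (A (Suc (Suc n)))" for x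
    proof -
      have ax: "a (Suc n) x \<in> carrier (A (Suc n))" by (rule lin_closed[OF RA(2) x])
      have "h (a n (a (Suc n) x)) = \<zero>\<^bsub>B (Suc n)\<^esub>" using RA(8)[OF x] lin_zero[OF RA(1) RB(1) h(1)] by simp
      then show ?thesis using h'(2)[OF ax] lin_closed[OF w ax] by (simp add: a_minus_def)
    qed
    then show ?thesis unfolding Pr_def using h' by blast
  qed
  ultimately obtain h where "\<forall>n. Pr n (h n) \<and>
      (\<forall>x\<in>carrier (A (Suc n)). b (Suc n) (h (Suc n) x) = w (Suc n) x \<ominus>\<^bsub>B (Suc n)\<^esub> h n (a n x))"
    using dependent_nat_choice[of Pr "\<lambda>n h h'. \<forall>x\<in>carrier (A (Suc n)).
      b (Suc n) (h' x) = w (Suc n) x \<ominus>\<^bsub>B (Suc n)\<^esub> h (a n x)"] by blast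
  then show ?thesis using that[of h] unfolding Pr_def by blast
qed

text \<open>The difference between the identity and \<open>v u\<close> induces zero on
  \<open>M\<close>, hence is null-homotopic.\<close>

lemma comparison_homotopy:
  assumes M: "module R M" and A: "resolution R M A a \<alpha>"
    and l: "\<And>i. lifts R (A i) (A (Suc i)) (A i) (a i)"
    and u: "\<And>i. u i \<in> lin_maps R (A i) (B i)" "\<And>x. x \<in> carrier (A 0) \<Longrightarrow> \<beta> (u 0 x) = \<alpha> x"
    "\<And>i x. x \<in> carrier (A (Suc i)) \<Longrightarrow> b i (u (Suc i) x) = u i (a i x)"
    and v: "\<And>i. v i \<in> lin_maps R (B i) (A i)" "\<And>x. x \<in> carrier (B 0) \<Longrightarrow> \<alpha> (v 0 x) = \<beta> x"
    "\<And>i x. x \<in> carrier (B (Suc i)) \<Longrightarrow> a i (v (Suc i) x) = v i (b i x)"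
  obtains h where "\<And>i. h i \<in> lin_maps R (A i) (A (Suc i))"
    "\<And>x. x \<in> carrier (A 0) \<Longrightarrow> a 0 (h 0 x) = x \<ominus>\<^bsub>A 0\<^esub> v 0 (u 0 x)"
    "\<And>i x. x \<in> carrier (A (Suc i)) \<Longrightarrow>
      a (Suc i) (h (Suc i) x) = (x \<ominus>\<^bsub>A (Suc i)\<^esub> v (Suc i) (u (Suc i) x)) \<ominus>\<^bsub>A (Suc i)\<^esub> h i (a i x)"
proof (rule null_homotopy[OF M A A l, where w = "\<lambda>i x. x \<ominus>\<^bsub>A i\<^esub> v i (u i x)"])
  note RA = resolutionD[OF A]
  interpret M: module R M by fact
  have vu: "(\<lambda>x. v i (u i x)) \<in> lin_maps R (A i) (A i)" for i by (rule lin_comp[OF v(1) u(1)])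
  show "(\<lambda>x. x \<ominus>\<^bsub>A i\<^esub> v i (u i x)) \<in> lin_maps R (A i) (A i)" for i
    by (rule lin_maps_minus[OF RA(1) lin_id vu])
  show "\<alpha> (x \<ominus>\<^bsub>A 0\<^esub> v 0 (u 0 x)) = \<zero>\<^bsub>M\<^esub>" if x: "x \<in> carrier (A 0)" for x
    using lin_minus[OF RA(1) M RA(3) x lin_closed[OF vu x]] v(2)[OF lin_closed[OF u(1) x]] u(2)[OF x]
      lin_closed[OF RA(3) x] by (simp add: M.minus_eq_zero_iff)
  show "a i (x \<ominus>\<^bsub>A (Suc i)\<^esub> v (Suc i) (u (Suc i) x)) = a i x \<ominus>\<^bsub>A i\<^esub> v i (u i (a i x))"
    if x: "x \<in> carrier (A (Suc i))" for i x
    using lin_minus[OF RA(1) RA(1) RA(2) x lin_closed[OF vu x]] v(3)[OF lin_closed[OF u(1) x]] u(3)[OF x] by simp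
qed (use that in auto)

subsection \<open>Resolutions by finite free modules\<close>

text \<open>Numbering the generators gives all free modules the same index type \<open>nat\<close>,
  whatever the elements of \<open>M\<close> are.\<close>

lemma fin_gen_module_presentation:
  assumes "fin_gen_module R M"
  obtains n and f where "f \<in> lin_maps R (fvec R {..<n::nat}) M" "f ` carrier (fvec R {..<n}) = carrier M"
proof -
  interpret M: module R M using assms by (simp add: fin_gen_module_def)
  have mod: "module R M" by unfold_locales
  obtain B where B: "B \<subseteq> carrier M" "finite B" "lin_span R M B = carrier M"
    using assms unfolding fin_gen_module_def by blast
  obtain g where g: "bij_betw g {..<card B} B"
    using ex_bij_betw_nat_finite[OF B(2)] by (auto simp: atLeast0LessThan)
  have gM: "g \<in> {..<card B} \<rightarrow> carrier M" using g B(1) by (auto simp: bij_betw_def)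
  let ?f = "vec_map M {..<card B} g"
  have f: "?f \<in> lin_maps R (fvec R {..<card B}) M" by (rule M.R.lin_vec_map[OF mod _ gM]) simp
  have sub: "submodule (?f ` carrier (fvec R {..<card B})) R M"
    by (rule lin_image_submodule[OF M.R.module_fvec mod f])
  have inB: "v \<in> ?f ` carrier (fvec R {..<card B})" if "v \<in> B" for v
  proof -
    have "v \<in> g ` {..<card B}" using g \<open>v \<in> B\<close> by (simp add: bij_betw_def)
    then obtain k where k: "k \<in> {..<card B}" "g k = v" by auto
    have "?f (unit_vec R k) = v" using M.R.vec_map_unit[OF mod _ gM k(1)] k(2) by simp
    then show ?thesis using M.R.unit_vec_closed[OF k(1)] by blast
  qed
  have "carrier M \<subseteq> ?f ` carrier (fvec R {..<card B})"
  proof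
    fix x assume x: "x \<in> carrier M"
    obtain S c where S: "finite S" "S \<subseteq> B" "c \<in> S \<rightarrow> carrier R" "x = (\<Oplus>\<^bsub>M\<^esub>v\<in>S. c v \<odot>\<^bsub>M\<^esub> v)"
      using x[folded B(3)] unfolding lin_span_def mem_Collect_eq by (elim exE conjE)
    have "c v \<odot>\<^bsub>M\<^esub> v \<in> ?f ` carrier (fvec R {..<card B})" if "v \<in> S" for v
      using S(2,3) that by (intro M.submoduleE(4)[OF sub] inB) auto
    then show "x \<in> ?f ` carrier (fvec R {..<card B})"
      unfolding S(4) by (intro M.submodule_finsum[OF sub] Pi_I)
  qed
  then show ?thesis using that[OF f] lin_closed[OF f] by blast
qed

lemma kernel_presentation:
  assumes "cring R" "noetherian_ring R" and g: "g \<in> lin_maps R (fvec R {..<n::nat}) Q" and Q: "module R Q"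
  shows "\<exists>m f. f \<in> lin_maps R (fvec R {..<m::nat}) (fvec R {..<n}) \<and>
    f ` carrier (fvec R {..<m}) = {x \<in> carrier (fvec R {..<n}). g x = \<zero>\<^bsub>Q\<^esub>}"
proof -
  interpret cring R by fact
  have "submodule {x \<in> carrier (fvec R {..<n}). g x \<in> {\<zero>\<^bsub>Q\<^esub>}} R (fvec R {..<n})"
    by (rule lin_preimage_submodule[OF module_fvec Q g submodule_singleton_zero[OF Q]])
  from submodule_fvec_finitely_generated[OF assms(1) noetherian_fvec[OF assms(1,2)] module_fvec this]
  show ?thesis by simp
qed

lemma finite_free_resolution:
  assumes "cring R" "noetherian_ring R" "fin_gen_module R M"
  obtains m :: "nat \<Rightarrow> nat" and \<phi> \<epsilon> where "resolution R M (\<lambda>i. fvec R {..<m i}) \<phi> \<epsilon>"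
proof -
  interpret cring R by fact
  have M: "module R M" using assms(3) by (simp add: fin_gen_module_def)
  obtain n \<epsilon> where \<epsilon>: "\<epsilon> \<in> lin_maps R (fvec R {..<n::nat}) M" "\<epsilon> ` carrier (fvec R {..<n}) = carrier M"
    by (rule fin_gen_module_presentation[OF assms(3)])

  \<comment> \<open>A state \<open>(p, q, f)\<close> is a map from rank \<open>q\<close> to rank
    \<open>p\<close>. The relation \<open>Qr\<close> makes the source of one map the target of the
    next and prescribes its image as the kernel.\<close>
  define Pr where "Pr (k::nat) = (\<lambda>(p::nat, q::nat, f). f \<in> lin_maps R (fvec R {..<q}) (fvec R {..<p}) \<and>
    (k = 0 \<longrightarrow> p = n \<and> f ` carrier (fvec R {..<q}) = {x \<in> carrier (fvec R {..<n}). \<epsilon> x = \<zero>\<^bsub>M\<^esub>}))" for k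
  define Qr where "Qr (k::nat) = (\<lambda>(p::nat, q::nat, f) (p', q' :: nat, f'). p' = q \<and>
    f' ` carrier (fvec R {..<q'}) = {x \<in> carrier (fvec R {..<q}). f x = \<zero>\<^bsub>fvec R {..<p}\<^esub>})" for k
  have "\<exists>t. Pr 0 t"
  proof -
    obtain m :: nat and f where "f \<in> lin_maps R (fvec R {..<m}) (fvec R {..<n})"
      "f ` carrier (fvec R {..<m}) = {x \<in> carrier (fvec R {..<n}). \<epsilon> x = \<zero>\<^bsub>M\<^esub>}"
      using kernel_presentation[OF assms(1,2) \<epsilon>(1) M] by blast
    then show ?thesis unfolding Pr_def by (intro exI[of _ "(n, m, f)"]) simp
  qed
  moreover have "\<exists>t'. Pr (Suc k) t' \<and> Qr k t t'" if "Pr k t" for k t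
  proof -
    obtain p q f where t: "t = (p, q, f)" by (cases t) auto
    have "f \<in> lin_maps R (fvec R {..<q}) (fvec R {..<p})" using that by (simp add: Pr_def t)
    from kernel_presentation[OF assms(1,2) this module_fvec] obtain m :: nat and f' where "f' \<in> lin_maps R (fvec R {..<m}) (fvec R {..<q})"
      "f' ` carrier (fvec R {..<m}) = {x \<in> carrier (fvec R {..<q}). f x = \<zero>\<^bsub>fvec R {..<p}\<^esub>}"
      by blast
    then show ?thesis unfolding Pr_def Qr_def t by (intro exI[of _ "(q, m, f')"]) simp
  qed
  ultimately obtain t where t: "\<forall>k. Pr k (t k) \<and> Qr k (t k) (t (Suc k))"
    using dependent_nat_choice[of Pr Qr] by blast
  let ?m = "\<lambda>k. fst (t k)" and ?\<phi> = "\<lambda>k. snd (snd (t k))"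
  have m: "fst (snd (t k)) = ?m (Suc k)" for k
    using t[rule_format, of k] by (auto simp: Qr_def split: prod.splits)
  have n: "?m 0 = n" using t[rule_format, of 0] by (auto simp: Pr_def split: prod.splits)
  have \<phi>: "?\<phi> k \<in> lin_maps R (fvec R {..<?m (Suc k)}) (fvec R {..<?m k})" for k
    using t[rule_format, of k] m[of k] by (auto simp: Pr_def split: prod.splits)
  have k0: "?\<phi> 0 ` carrier (fvec R {..<?m (Suc 0)}) = {x \<in> carrier (fvec R {..<?m 0}). \<epsilon> x = \<zero>\<^bsub>M\<^esub>}"
    using conjunct1[OF t[rule_format, of 0]] n by (simp only: Pr_def case_prod_beta m simp_thms)
  have kS: "?\<phi> (Suc k) ` carrier (fvec R {..<?m (Suc (Suc k))}) =
      {x \<in> carrier (fvec R {..<?m (Suc k)}). ?\<phi> k x = \<zero>\<^bsub>fvec R {..<?m k}\<^esub>}" for k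
    using conjunct2[OF t[rule_format, of k]] by (simp only: Qr_def case_prod_beta m simp_thms)
  have "resolution R M (\<lambda>i. fvec R {..<?m i}) ?\<phi> \<epsilon>"
    unfolding resolution_def
    by (intro conjI allI) (rule module_fvec \<phi> k0 kS \<epsilon>[folded n])+
  then show ?thesis by (rule that)
qed

subsection \<open>Quotient modules\<close>

context module
begin

context
  fixes K assumes K: "submodule K R M"
begin

abbreviation "coset x \<equiv> a_r_coset M K x"

lemma abelian_subgroup_K: "abelian_subgroup K M"
  by (intro abelian_subgroupI3 additive_subgroupI submodule.axioms(1)[OF K]) unfold_locales

lemma coset_sum:
  "x \<in> carrier M \<Longrightarrow> y \<in> carrier M \<Longrightarrow> set_add M (coset x) (coset y) = coset (x \<oplus>\<^bsub>M\<^esub> y)"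
  by (rule abelian_subgroup.a_rcos_sum[OF abelian_subgroup_K])

lemma coset_eq_iff:
  assumes "x \<in> carrier M" "y \<in> carrier M"
  shows "coset x = coset y \<longleftrightarrow> x \<ominus>\<^bsub>M\<^esub> y \<in> K"
proof -
  interpret S: abelian_subgroup K M by (rule abelian_subgroup_K)
  have "coset x = coset y \<longleftrightarrow> x \<in> coset y"
    using S.a_repr_independence'[of x y] S.a_repr_independenceD[OF assms(2)] assms
      S.a_rcos_self[OF assms(1)] by metis
  then show ?thesis using S.a_rcos_module[OF assms(2,1)] by (simp add: a_minus_def)
qed

lemma coset_zero: "coset \<zero>\<^bsub>M\<^esub> = K"
  using submoduleE(1)[OF K] by (rule M.a_coset_add_zero)

lemma coset_carrier: "A \<in> a_rcosets\<^bsub>M\<^esub> K \<longleftrightarrow> (\<exists>x\<in>carrier M. A = coset x)"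
  by (auto simp: A_RCOSETS_def' a_r_coset_def')

lemma coset_smult:
  assumes r: "r \<in> carrier R" and x: "x \<in> carrier M"
  shows "(\<Union>y\<in>coset x. coset (r \<odot>\<^bsub>M\<^esub> y)) = coset (r \<odot>\<^bsub>M\<^esub> x)"
proof -
  interpret S: abelian_subgroup K M by (rule abelian_subgroup_K)
  have self: "x \<in> coset x" by (rule S.a_rcos_self[OF x])
  have "coset (r \<odot>\<^bsub>M\<^esub> y) = coset (r \<odot>\<^bsub>M\<^esub> x)" if y: "y \<in> coset x" for y
  proof -
    have yc: "y \<in> carrier M" by (rule S.a_elemrcos_carrier[OF x y])
    have "coset x = coset y" using S.a_repr_independence'[OF y x] .
    then have "x \<ominus>\<^bsub>M\<^esub> y \<in> K" using coset_eq_iff[OF x yc] by simp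
    then have "r \<odot>\<^bsub>M\<^esub> (x \<ominus>\<^bsub>M\<^esub> y) \<in> K" by (rule submoduleE(4)[OF K r])
    then have "r \<odot>\<^bsub>M\<^esub> x \<ominus>\<^bsub>M\<^esub> r \<odot>\<^bsub>M\<^esub> y \<in> K"
      using r x yc by (simp add: a_minus_def smult_r_distr smult_r_minus)
    then show ?thesis using coset_eq_iff[of "r \<odot>\<^bsub>M\<^esub> x" "r \<odot>\<^bsub>M\<^esub> y"] r x yc by simp
  qed
  then show ?thesis using self by blast
qed

lemma quot_module_simps:
  "carrier (quot_module M K) = coset ` carrier M" "\<zero>\<^bsub>quot_module M K\<^esub> = K"
  "x \<in> carrier M \<Longrightarrow> y \<in> carrier M \<Longrightarrow> coset x \<oplus>\<^bsub>quot_module M K\<^esub> coset y = coset (x \<oplus>\<^bsub>M\<^esub> y)"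
  "r \<in> carrier R \<Longrightarrow> x \<in> carrier M \<Longrightarrow> r \<odot>\<^bsub>quot_module M K\<^esub> coset x = coset (r \<odot>\<^bsub>M\<^esub> x)"
  using coset_sum coset_smult coset_carrier by (auto simp: quot_module_def)

lemma module_quot_module: "module R (quot_module M K)"
proof (intro moduleI abelian_groupI)
  note Q = quot_module_simps
  show "cring R" by (rule R.is_cring)
  show "A \<oplus>\<^bsub>quot_module M K\<^esub> B \<in> carrier (quot_module M K)"
    if "A \<in> carrier (quot_module M K)" "B \<in> carrier (quot_module M K)" for A B
    using that by (auto simp: Q)
  show "\<zero>\<^bsub>quot_module M K\<^esub> \<in> carrier (quot_module M K)"
    using coset_zero by (auto simp: Q intro!: image_eqI[of _ _ "\<zero>\<^bsub>M\<^esub>"])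
  show "(A \<oplus>\<^bsub>quot_module M K\<^esub> B) \<oplus>\<^bsub>quot_module M K\<^esub> C = A \<oplus>\<^bsub>quot_module M K\<^esub> (B \<oplus>\<^bsub>quot_module M K\<^esub> C)"
    if "A \<in> carrier (quot_module M K)" "B \<in> carrier (quot_module M K)" "C \<in> carrier (quot_module M K)" for A B C
    using that by (auto simp: Q M.a_assoc)
  show "A \<oplus>\<^bsub>quot_module M K\<^esub> B = B \<oplus>\<^bsub>quot_module M K\<^esub> A"
    if "A \<in> carrier (quot_module M K)" "B \<in> carrier (quot_module M K)" for A B
    using that by (auto simp: Q M.a_comm)
  show "\<zero>\<^bsub>quot_module M K\<^esub> \<oplus>\<^bsub>quot_module M K\<^esub> A = A" if "A \<in> carrier (quot_module M K)" for A
  proof -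
    obtain x where x: "x \<in> carrier M" "A = coset x" using \<open>A \<in> _\<close> by (auto simp: Q)
    have "\<zero>\<^bsub>quot_module M K\<^esub> = coset \<zero>\<^bsub>M\<^esub>" by (simp add: Q coset_zero)
    then show ?thesis using x Q(3)[of "\<zero>\<^bsub>M\<^esub>" x] by simp
  qed
  show "\<exists>B\<in>carrier (quot_module M K). B \<oplus>\<^bsub>quot_module M K\<^esub> A = \<zero>\<^bsub>quot_module M K\<^esub>"
    if "A \<in> carrier (quot_module M K)" for A
  proof -
    obtain x where x: "x \<in> carrier M" "A = coset x" using \<open>A \<in> _\<close> by (auto simp: Q)
    have "coset (\<ominus>\<^bsub>M\<^esub> x) \<oplus>\<^bsub>quot_module M K\<^esub> A = \<zero>\<^bsub>quot_module M K\<^esub>"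
      using x Q(3)[of "\<ominus>\<^bsub>M\<^esub> x" x] by (simp add: M.l_neg coset_zero Q)
    then show ?thesis using x by (auto simp: Q)
  qed
  show "r \<odot>\<^bsub>quot_module M K\<^esub> A \<in> carrier (quot_module M K)"
    if "r \<in> carrier R" "A \<in> carrier (quot_module M K)" for r A using that by (auto simp: Q)
  show "(r \<oplus> s) \<odot>\<^bsub>quot_module M K\<^esub> A = r \<odot>\<^bsub>quot_module M K\<^esub> A \<oplus>\<^bsub>quot_module M K\<^esub> s \<odot>\<^bsub>quot_module M K\<^esub> A"
    if "r \<in> carrier R" "s \<in> carrier R" "A \<in> carrier (quot_module M K)" for r s A
    using that by (auto simp: Q smult_l_distr)
  show "r \<odot>\<^bsub>quot_module M K\<^esub> (A \<oplus>\<^bsub>quot_module M K\<^esub> B) =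
      r \<odot>\<^bsub>quot_module M K\<^esub> A \<oplus>\<^bsub>quot_module M K\<^esub> r \<odot>\<^bsub>quot_module M K\<^esub> B"
    if "r \<in> carrier R" "A \<in> carrier (quot_module M K)" "B \<in> carrier (quot_module M K)" for r A B
    using that by (auto simp: Q smult_r_distr)
  show "(r \<otimes> s) \<odot>\<^bsub>quot_module M K\<^esub> A = r \<odot>\<^bsub>quot_module M K\<^esub> (s \<odot>\<^bsub>quot_module M K\<^esub> A)"
    if "r \<in> carrier R" "s \<in> carrier R" "A \<in> carrier (quot_module M K)" for r s A
    using that by (auto simp: Q smult_assoc1)
  show "\<one> \<odot>\<^bsub>quot_module M K\<^esub> A = A" if "A \<in> carrier (quot_module M K)" for A
    using that by (auto simp: Q)
qed

end
end

subsection \<open>Modules of finite length\<close>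

text \<open>The ideal generated by \<open>\<mm>\<close> and \<open>r\<close> is the whole ring; a
  representation of one in it gives an inverse of \<open>r\<close> modulo
  \<open>\<mm>\<close>.\<close>

lemma (in cring) maximalideal_inverse_mod:
  assumes \<mm>: "maximalideal \<mm> R" and r: "r \<in> carrier R" "r \<notin> \<mm>"
  shows "\<exists>t\<in>carrier R. \<one> \<ominus> t \<otimes> r \<in> \<mm>"
proof -
  interpret m: maximalideal \<mm> R by fact
  have mc: "a \<in> carrier R" if "a \<in> \<mm>" for a using m.a_subset that by auto
  have z: "\<zero> \<in> \<mm>" by (rule additive_subgroup.zero_closed[OF ideal.axioms(1)[OF m.is_ideal]])
  define J where "J = {a \<oplus> t \<otimes> r | a t. a \<in> \<mm> \<and> t \<in> carrier R}"
  have JI: "a \<oplus> t \<otimes> r \<in> J" if "a \<in> \<mm>" "t \<in> carrier R" for a t unfolding J_def using that by blast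
  have "ideal J R"
  proof (rule idealI')
    show "J \<subseteq> carrier R" using mc r by (auto simp: J_def)
    have "\<zero> = \<zero> \<oplus> \<zero> \<otimes> r" using r by simp
    then show "\<zero> \<in> J" using JI[OF z zero_closed] by simp
  next
    fix x y assume "x \<in> J" "y \<in> J"
    then obtain a t b s where e: "x = a \<oplus> t \<otimes> r" "y = b \<oplus> s \<otimes> r" "a \<in> \<mm>" "b \<in> \<mm>" "t \<in> carrier R" "s \<in> carrier R"
      unfolding J_def by blast
    then have "x \<oplus> y = (a \<oplus> b) \<oplus> (t \<oplus> s) \<otimes> r" using r mc by (simp add: l_distr a_ac)
    moreover have "a \<oplus> b \<in> \<mm>" using e by auto
    ultimately show "x \<oplus> y \<in> J" using e JI[of "a \<oplus> b" "t \<oplus> s"] by simp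
  next
    fix x s assume "x \<in> J" and s: "s \<in> carrier R"
    then obtain a t where e: "x = a \<oplus> t \<otimes> r" "a \<in> \<mm>" "t \<in> carrier R" unfolding J_def by blast
    then have "s \<otimes> x = s \<otimes> a \<oplus> (s \<otimes> t) \<otimes> r" using r mc s by (simp add: r_distr m_assoc)
    moreover have "s \<otimes> a \<in> \<mm>" using e s m.I_l_closed by auto
    ultimately show "s \<otimes> x \<in> J" using e s JI[of "s \<otimes> a" "s \<otimes> t"] by simp
  qed
  moreover have "\<mm> \<subseteq> J"
  proof
    fix a assume a: "a \<in> \<mm>"
    then have "a = a \<oplus> \<zero> \<otimes> r" using r mc by simp
    then show "a \<in> J" using JI[OF a zero_closed] by simp
  qed
  moreover have "J \<subseteq> carrier R" using mc r by (auto simp: J_def)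
  moreover have "r \<in> J"
  proof -
    have "r = \<zero> \<oplus> \<one> \<otimes> r" using r by simp
    then show ?thesis using JI[OF z one_closed] by simp
  qed
  ultimately have "J = carrier R" using m.I_maximal[of J] r(2) by metis
  then have "\<one> \<in> J" by simp
  then obtain a t where e: "\<one> = a \<oplus> t \<otimes> r" "a \<in> \<mm>" "t \<in> carrier R" unfolding J_def by blast
  have "\<one> \<ominus> t \<otimes> r = a" unfolding e(1) using e(2,3) r mc by (simp add: a_minus_def a_assoc r_neg)
  then show ?thesis using e by blast
qed

text \<open>A composition series whose top \<open>C n\<close> is left open, so that it can be
  extended step by step.\<close>

definition composition_chain :: "('r, 'x) ring_scheme \<Rightarrow> ('r, 'm, 'y) module_scheme \<Rightarrow> nat \<Rightarrow> (nat \<Rightarrow> 'm set) \<Rightarrow> bool" where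
  "composition_chain R M n C \<longleftrightarrow> C 0 = {\<zero>\<^bsub>M\<^esub>} \<and> (\<forall>i\<le>n. submodule (C i) R M) \<and>
     (\<forall>i<n. C i \<subset> C (Suc i) \<and> \<not> (\<exists>K. submodule K R M \<and> C i \<subset> K \<and> K \<subset> C (Suc i)))"

lemma composition_chain_extend:
  assumes C: "composition_chain R M n C" and D: "submodule D R M" "C n \<subset> D"
    and simple: "\<And>K. submodule K R M \<Longrightarrow> C n \<subset> K \<Longrightarrow> K \<subseteq> D \<Longrightarrow> K = D"
  shows "composition_chain R M (Suc n) (\<lambda>i. if i \<le> n then C i else D)"
  unfolding composition_chain_def
proof (intro conjI allI impI)
  show "(if 0 \<le> n then C 0 else D) = {\<zero>\<^bsub>M\<^esub>}" using C by (simp add: composition_chain_def)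
  show "submodule (if i \<le> n then C i else D) R M" for i
    using C D(1) by (simp add: composition_chain_def)
  fix i assume "i < Suc n"
  then consider "i < n" | "i = n" by linarith
  then show "(if i \<le> n then C i else D) \<subset> (if Suc i \<le> n then C (Suc i) else D)"
    "\<not> (\<exists>K. submodule K R M \<and> (if i \<le> n then C i else D) \<subset> K \<and> K \<subset> (if Suc i \<le> n then C (Suc i) else D))"
    using C D simple by (cases; auto simp: composition_chain_def)+
qed

text \<open>Take \<open>D\<close> maximal among the submodules reached by composition chains. If
  \<open>D\<close> were proper, \<open>E / D\<close> would have an associated prime, which the
  torsion condition forces to be \<open>\<mm>\<close>. The corresponding element generates a copy of
  the simple module \<open>R / \<mm>\<close> above \<open>D\<close>, and the chain could be
  extended.\<close>

lemma finite_length_of_torsion: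
  assumes "module R E" "noetherian_ring R" and noeth: "noetherian_module R E" and \<mm>: "maximalideal \<mm> R"
    and tors: "\<And>p e. primeideal p R \<Longrightarrow> p \<noteq> \<mm> \<Longrightarrow> e \<in> carrier E \<Longrightarrow>
      \<exists>s\<in>carrier R - p. s \<odot>\<^bsub>E\<^esub> e = \<zero>\<^bsub>E\<^esub>"
  shows "finite_length R E"
proof -
  interpret E: module R E by fact
  interpret N: noetherian_ring R by fact
  have mod: "module R E" by fact
  define S where "S = {D. \<exists>n C. composition_chain R E n C \<and> C n = D}"
  have sub: "submodule D R E" if "D \<in> S" for D
    using that unfolding S_def composition_chain_def by blast
  have "composition_chain R E 0 (\<lambda>_. {\<zero>\<^bsub>E\<^esub>})"
    using E.R.submodule_singleton_zero[OF mod] by (simp add: composition_chain_def)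
  then have "{\<zero>\<^bsub>E\<^esub>} \<in> S" unfolding S_def by blast
  then obtain D where D: "D \<in> S" and max: "\<And>D'. D' \<in> S \<Longrightarrow> D \<subseteq> D' \<Longrightarrow> D' = D"
    using noetherian_module_maximal[where h = "\<lambda>K. K", OF noeth _ sub] by metis
  note DE = E.submoduleE[OF sub[OF D]]
  have "D = carrier E"
  proof (rule ccontr)
    assume "D \<noteq> carrier E"
    then obtain x0 where x0: "x0 \<in> carrier E - D" using DE(1) by blast
    define T where "T = carrier E - D"
    \<comment> \<open>The annihilator of the class of \<open>e\<close> in
      \<open>E / D\<close>.\<close>
    define ann where "ann e = {r \<in> carrier R. r \<odot>\<^bsub>E\<^esub> e \<in> D}" for e
    have annid: "ideal (ann e) R" if "e \<in> T" for e
    proof (rule E.R.idealI')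
      have e: "e \<in> carrier E" using that by (simp add: T_def)
      show "ann e \<subseteq> carrier R" by (auto simp: ann_def)
      show "\<zero>\<^bsub>R\<^esub> \<in> ann e" using e E.submodule_zero[OF sub[OF D]] by (simp add: ann_def)
      show "a \<oplus>\<^bsub>R\<^esub> b \<in> ann e" if "a \<in> ann e" "b \<in> ann e" for a b
        using that e DE(5) by (simp add: ann_def E.smult_l_distr)
      show "r \<otimes>\<^bsub>R\<^esub> a \<in> ann e" if "a \<in> ann e" "r \<in> carrier R" for a r
        using that e DE(4) by (simp add: ann_def E.smult_assoc1)
    qed
    obtain I where I: "I \<in> ann ` T" and Imax: "\<And>I'. I' \<in> ann ` T \<Longrightarrow> I \<subseteq> I' \<Longrightarrow> I' = I"
      using N.maximal_ideal_exists[of "ann x0" "ann ` T"] annid x0 T_def by blast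
    then obtain e where e: "e \<in> T" "I = ann e" by auto
    have ec: "e \<in> carrier E" "e \<notin> D" using e by (auto simp: T_def)
    have prime: "primeideal (ann e) R"
    proof (rule E.R.maximal_annihilator_prime[of e T ann])
      show "\<one>\<^bsub>R\<^esub> \<notin> ann x" if "x \<in> T" for x using that by (simp add: ann_def T_def)
      show "ann x = ann e" if "x \<in> T" "ann e \<subseteq> ann x" for x using Imax[of "ann x"] that e by blast
      fix x r assume x: "x \<in> T" and r: "r \<in> carrier R" "r \<notin> ann x"
      have "r \<odot>\<^bsub>E\<^esub> x \<in> T" using x r by (simp add: T_def ann_def)
      moreover have "ann (r \<odot>\<^bsub>E\<^esub> x) = {s \<in> carrier R. s \<otimes>\<^bsub>R\<^esub> r \<in> ann x}"
        using x r by (auto simp: ann_def T_def E.smult_assoc1)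
      ultimately show "\<exists>y\<in>T. ann y = {s \<in> carrier R. s \<otimes>\<^bsub>R\<^esub> r \<in> ann x}" by blast
    qed (use e annid in auto)
    have annm: "ann e = \<mm>"
    proof (rule ccontr)
      assume "ann e \<noteq> \<mm>"
      from tors[OF prime this ec(1)] obtain s where "s \<in> carrier R - ann e" "s \<odot>\<^bsub>E\<^esub> e = \<zero>\<^bsub>E\<^esub>" by blast
      then show False using E.submodule_zero[OF sub[OF D]] by (simp add: ann_def)
    qed
    define D' where "D' = {c \<oplus>\<^bsub>E\<^esub> r \<odot>\<^bsub>E\<^esub> e | c r. c \<in> D \<and> r \<in> carrier R}"
    have Dc: "c \<in> carrier E" if "c \<in> D" for c using DE(1) that by auto
    have D'I: "c \<oplus>\<^bsub>E\<^esub> r \<odot>\<^bsub>E\<^esub> e \<in> D'" if "c \<in> D" "r \<in> carrier R" for c r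
      unfolding D'_def using that by blast
    have DD': "D \<subseteq> D'"
    proof
      fix c assume c: "c \<in> D"
      then show "c \<in> D'" using D'I[OF c E.R.zero_closed] Dc ec(1) by simp
    qed
    have eD': "e \<in> D'" using D'I[OF E.submodule_zero[OF sub[OF D]] E.R.one_closed] ec(1) by simp
    have D': "submodule D' R E"
    proof (rule E.submoduleI')
      show "D' \<subseteq> carrier E" using Dc ec(1) by (auto simp: D'_def)
      show "\<zero>\<^bsub>E\<^esub> \<in> D'" using DD' E.submodule_zero[OF sub[OF D]] by auto
    next
      fix a b assume "a \<in> D'" "b \<in> D'"
      then obtain c r c' r' where q: "a = c \<oplus>\<^bsub>E\<^esub> r \<odot>\<^bsub>E\<^esub> e" "b = c' \<oplus>\<^bsub>E\<^esub> r' \<odot>\<^bsub>E\<^esub> e"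
        "c \<in> D" "c' \<in> D" "r \<in> carrier R" "r' \<in> carrier R" unfolding D'_def by blast
      have "a \<oplus>\<^bsub>E\<^esub> b = (c \<oplus>\<^bsub>E\<^esub> c') \<oplus>\<^bsub>E\<^esub> (r \<oplus>\<^bsub>R\<^esub> r') \<odot>\<^bsub>E\<^esub> e"
        using q Dc ec(1) by (simp add: E.smult_l_distr E.M.a_ac)
      then show "a \<oplus>\<^bsub>E\<^esub> b \<in> D'" using D'I[of "c \<oplus>\<^bsub>E\<^esub> c'" "r \<oplus>\<^bsub>R\<^esub> r'"] q DE(5) by simp
    next
      fix s a assume s: "s \<in> carrier R" and "a \<in> D'"
      then obtain c r where q: "a = c \<oplus>\<^bsub>E\<^esub> r \<odot>\<^bsub>E\<^esub> e" "c \<in> D" "r \<in> carrier R" unfolding D'_def by blast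
      have "s \<odot>\<^bsub>E\<^esub> a = s \<odot>\<^bsub>E\<^esub> c \<oplus>\<^bsub>E\<^esub> (s \<otimes>\<^bsub>R\<^esub> r) \<odot>\<^bsub>E\<^esub> e"
        using q s Dc ec(1) by (simp add: E.smult_r_distr E.smult_assoc1)
      then show "s \<odot>\<^bsub>E\<^esub> a \<in> D'" using D'I[of "s \<odot>\<^bsub>E\<^esub> c" "s \<otimes>\<^bsub>R\<^esub> r"] q s DE(4) by simp
    qed
    \<comment> \<open>Some element of \<open>K\<close> outside \<open>D\<close> involves
      \<open>e\<close> with a coefficient \<open>r \<notin> \<mm>\<close>. As \<open>r\<close> is
      invertible modulo \<open>\<mm>\<close> and \<open>\<mm>\<close> carries \<open>e\<close> into
      \<open>D\<close>, this puts \<open>e\<close> into \<open>K\<close>.\<close>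
    have simple: "K = D'" if K: "submodule K R E" "D \<subset> K" "K \<subseteq> D'" for K
    proof -
      note KE = E.submoduleE[OF K(1)]
      obtain k where k: "k \<in> K" "k \<notin> D" using K(2) by blast
      then obtain c r where q: "k = c \<oplus>\<^bsub>E\<^esub> r \<odot>\<^bsub>E\<^esub> e" "c \<in> D" "r \<in> carrier R" using K(3) unfolding D'_def by blast
      have "r \<notin> \<mm>"
      proof
        assume "r \<in> \<mm>"
        then have "r \<odot>\<^bsub>E\<^esub> e \<in> D" using annm by (auto simp: ann_def)
        then show False using k(2) q DE(5) by simp
      qed
      then obtain t where t: "t \<in> carrier R" "\<one>\<^bsub>R\<^esub> \<ominus>\<^bsub>R\<^esub> t \<otimes>\<^bsub>R\<^esub> r \<in> \<mm>"
        using E.R.maximalideal_inverse_mod[OF \<mm> q(3)] by blast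
      have re: "r \<odot>\<^bsub>E\<^esub> e = k \<ominus>\<^bsub>E\<^esub> c"
        using q Dc ec(1) by (simp add: a_minus_def E.M.a_ac E.M.r_neg2 E.M.r_neg1)
      have "r \<odot>\<^bsub>E\<^esub> e \<in> K" unfolding re using k q(2) K(2) by (intro E.submodule_minus[OF K(1)]) auto
      then have "t \<odot>\<^bsub>E\<^esub> (r \<odot>\<^bsub>E\<^esub> e) \<in> K" using KE(4) t by simp
      moreover have "(\<one>\<^bsub>R\<^esub> \<ominus>\<^bsub>R\<^esub> t \<otimes>\<^bsub>R\<^esub> r) \<odot>\<^bsub>E\<^esub> e \<in> K" using t annm K(2) by (auto simp: ann_def)
      ultimately have "(\<one>\<^bsub>R\<^esub> \<ominus>\<^bsub>R\<^esub> t \<otimes>\<^bsub>R\<^esub> r) \<odot>\<^bsub>E\<^esub> e \<oplus>\<^bsub>E\<^esub> t \<odot>\<^bsub>E\<^esub> (r \<odot>\<^bsub>E\<^esub> e) \<in> K" using KE(5) by blast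
      moreover have "(\<one>\<^bsub>R\<^esub> \<ominus>\<^bsub>R\<^esub> t \<otimes>\<^bsub>R\<^esub> r) \<odot>\<^bsub>E\<^esub> e \<oplus>\<^bsub>E\<^esub> t \<odot>\<^bsub>E\<^esub> (r \<odot>\<^bsub>E\<^esub> e) = e"
        using t(1) q(3) ec(1) E.smult_minus_distr[of "\<one>\<^bsub>R\<^esub>" "t \<otimes>\<^bsub>R\<^esub> r" e]
        by (simp add: E.smult_assoc1 a_minus_def[of E] E.M.a_assoc E.M.l_neg)
      ultimately have eK: "e \<in> K" by simp
      have "D' \<subseteq> K"
      proof
        fix a assume "a \<in> D'"
        then obtain c r where q: "a = c \<oplus>\<^bsub>E\<^esub> r \<odot>\<^bsub>E\<^esub> e" "c \<in> D" "r \<in> carrier R" unfolding D'_def by blast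
        then show "a \<in> K" using eK K(2) KE(4,5) by auto
      qed
      then show ?thesis using K(3) by blast
    qed
    obtain n C where C: "composition_chain R E n C" "C n = D" using D unfolding S_def by blast
    have "composition_chain R E (Suc n) (\<lambda>i. if i \<le> n then C i else D')"
      using composition_chain_extend[OF C(1) D'] C(2) simple DD' eD' ec(2) by blast
    then have "D' \<in> S" unfolding S_def by force
    then show False using max DD' eD' ec(2) by blast
  qed
  then obtain n C where "composition_chain R E n C" "C n = carrier E" using D unfolding S_def by blast
  then show ?thesis unfolding finite_length_def composition_chain_def by blast
qed

subsection \<open>Modules of homomorphisms\<close>

lemma hom_module_simps [simp]:
  "carrier (hom_module R M N) = lin_maps R M N \<inter> extensional (carrier M)"
  "\<zero>\<^bsub>hom_module R M N\<^esub> = (\<lambda>x\<in>carrier M. \<zero>\<^bsub>N\<^esub>)"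
  "f \<oplus>\<^bsub>hom_module R M N\<^esub> g = (\<lambda>x\<in>carrier M. f x \<oplus>\<^bsub>N\<^esub> g x)"
  "r \<odot>\<^bsub>hom_module R M N\<^esub> f = (\<lambda>x\<in>carrier M. r \<odot>\<^bsub>N\<^esub> f x)"
  by (simp_all add: hom_module_def)

lemma restrict_lin_maps:
  assumes "module R M" "f \<in> lin_maps R M N"
  shows "restrict f (carrier M) \<in> carrier (hom_module R M N)"
proof -
  interpret M: module R M by fact
  show ?thesis using lin_mapsD[OF assms(2)] by (auto intro!: lin_mapsI)
qed

lemma module_hom_module:
  assumes M: "module R M" and N: "module R N"
  shows "module R (hom_module R M N)"
proof (intro moduleI abelian_groupI)
  interpret M: module R M by fact
  interpret N: module R N by fact
  let ?H = "hom_module R M N"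
  show "cring R" by (rule M.R.is_cring)
  have cl: "f x \<in> carrier N" if "f \<in> carrier ?H" "x \<in> carrier M" for f x
    using that lin_closed[of f R M N x] by simp
  show "f \<oplus>\<^bsub>?H\<^esub> g \<in> carrier ?H" if "f \<in> carrier ?H" "g \<in> carrier ?H" for f g
    unfolding hom_module_simps(3) using that by (intro restrict_lin_maps M lin_maps_add N) auto
  show "\<zero>\<^bsub>?H\<^esub> \<in> carrier ?H" unfolding hom_module_simps(2) by (intro restrict_lin_maps M lin_maps_zero N)
  show "(f \<oplus>\<^bsub>?H\<^esub> g) \<oplus>\<^bsub>?H\<^esub> h = f \<oplus>\<^bsub>?H\<^esub> (g \<oplus>\<^bsub>?H\<^esub> h)"
    if "f \<in> carrier ?H" "g \<in> carrier ?H" "h \<in> carrier ?H" for f g h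
    using cl[OF that(1)] cl[OF that(2)] cl[OF that(3)]
    unfolding hom_module_simps by (intro restrict_ext) (simp add: N.M.a_assoc)
  show "f \<oplus>\<^bsub>?H\<^esub> g = g \<oplus>\<^bsub>?H\<^esub> f" if "f \<in> carrier ?H" "g \<in> carrier ?H" for f g
    using cl[OF that(1)] cl[OF that(2)]
    unfolding hom_module_simps by (intro restrict_ext) (simp add: N.M.a_comm)
  have ext: "(\<lambda>x\<in>carrier M. f x) = f" if "f \<in> carrier ?H" for f
    using that by (simp add: extensional_restrict)
  show "\<zero>\<^bsub>?H\<^esub> \<oplus>\<^bsub>?H\<^esub> f = f" if "f \<in> carrier ?H" for f
  proof -
    have "\<zero>\<^bsub>?H\<^esub> \<oplus>\<^bsub>?H\<^esub> f = (\<lambda>x\<in>carrier M. f x)"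
      using cl[OF that] unfolding hom_module_simps by (intro restrict_ext) simp
    then show ?thesis using ext[OF that] by simp
  qed
  show "\<exists>g\<in>carrier ?H. g \<oplus>\<^bsub>?H\<^esub> f = \<zero>\<^bsub>?H\<^esub>" if "f \<in> carrier ?H" for f
  proof (rule bexI)
    let ?g = "(\<ominus>\<^bsub>R\<^esub> \<one>\<^bsub>R\<^esub>) \<odot>\<^bsub>?H\<^esub> f"
    show "?g \<in> carrier ?H"
      unfolding hom_module_simps(4) using that by (intro restrict_lin_maps M lin_maps_smult N) auto
    show "?g \<oplus>\<^bsub>?H\<^esub> f = \<zero>\<^bsub>?H\<^esub>"
      using cl[OF that] unfolding hom_module_simps
      by (intro restrict_ext) (simp add: N.smult_l_minus N.M.l_neg)
  qed
  show "r \<odot>\<^bsub>?H\<^esub> f \<in> carrier ?H" if "r \<in> carrier R" "f \<in> carrier ?H" for r f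
    unfolding hom_module_simps(4) using that by (intro restrict_lin_maps M lin_maps_smult N) auto
  show "(r \<oplus>\<^bsub>R\<^esub> s) \<odot>\<^bsub>?H\<^esub> f = r \<odot>\<^bsub>?H\<^esub> f \<oplus>\<^bsub>?H\<^esub> s \<odot>\<^bsub>?H\<^esub> f"
    if "r \<in> carrier R" "s \<in> carrier R" "f \<in> carrier ?H" for r s f
    using cl[OF that(3)] that unfolding hom_module_simps by (intro restrict_ext) (simp add: N.smult_l_distr)
  show "r \<odot>\<^bsub>?H\<^esub> (f \<oplus>\<^bsub>?H\<^esub> g) = r \<odot>\<^bsub>?H\<^esub> f \<oplus>\<^bsub>?H\<^esub> r \<odot>\<^bsub>?H\<^esub> g"
    if "r \<in> carrier R" "f \<in> carrier ?H" "g \<in> carrier ?H" for r f g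
    using cl[OF that(2)] cl[OF that(3)] that unfolding hom_module_simps
    by (intro restrict_ext) (simp add: N.smult_r_distr)
  show "(r \<otimes>\<^bsub>R\<^esub> s) \<odot>\<^bsub>?H\<^esub> f = r \<odot>\<^bsub>?H\<^esub> (s \<odot>\<^bsub>?H\<^esub> f)"
    if "r \<in> carrier R" "s \<in> carrier R" "f \<in> carrier ?H" for r s f
    using cl[OF that(3)] that unfolding hom_module_simps by (intro restrict_ext) (simp add: N.smult_assoc1)
  show "\<one>\<^bsub>R\<^esub> \<odot>\<^bsub>?H\<^esub> f = f" if "f \<in> carrier ?H" for f
  proof -
    have "\<one>\<^bsub>R\<^esub> \<odot>\<^bsub>?H\<^esub> f = (\<lambda>x\<in>carrier M. f x)"
      using cl[OF that] unfolding hom_module_simps by (intro restrict_ext) simp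
    then show ?thesis using ext[OF that] by simp
  qed
qed

subsection \<open>Fractions\<close>

text \<open>Ring fractions are module fractions of the ring over itself, so the calculus of
  fractions is developed only once.\<close>

lemma ring_fraction_module_fraction:
  "ring_fraction R S r s = module_fraction (ring_module R) S r s"
  by (simp add: ring_fraction_def module_fraction_def)

lemma UN_pairs_constant:
  fixes C :: "'e set"
  assumes "\<And>a b c d. (a, b) \<in> A \<Longrightarrow> (c, d) \<in> B \<Longrightarrow> f a b c d = C"
    and "(a0, b0) \<in> A" "(c0, d0) \<in> B"
  shows "(\<Union>(a, b)\<in>A. \<Union>(c, d)\<in>B. f a b c d) = C"
proof (rule SUP_eq_const)
  have "(\<Union>(c, d)\<in>B. f a b c d) = C" if "(a, b) \<in> A" for a b
    using assms(1)[OF that] assms(3) by (intro SUP_eq_const) auto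
  then show "(case x of (a, b) \<Rightarrow> \<Union>(c, d)\<in>B. f a b c d) = C" if "x \<in> A" for x
    using that by (cases x) simp
qed (use assms(2) in auto)

context module
begin

context
  fixes S assumes S: "S \<subseteq> carrier R" "\<one> \<in> S" "\<forall>s\<in>S. \<forall>t\<in>S. s \<otimes> t \<in> S"
begin

abbreviation "mfrac x s \<equiv> module_fraction M S x s"

lemma S_carrier: "s \<in> S \<Longrightarrow> s \<in> carrier R" using S(1) by auto

lemma mem_frac:
  "x \<in> carrier M \<Longrightarrow> s \<in> S \<Longrightarrow> (y, t) \<in> mfrac x s \<longleftrightarrow>
    y \<in> carrier M \<and> t \<in> S \<and> (\<exists>u\<in>S. (u \<otimes> t) \<odot>\<^bsub>M\<^esub> x = (u \<otimes> s) \<odot>\<^bsub>M\<^esub> y)"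
  using S_carrier by (auto simp: module_fraction_def smult_assoc1)

lemma frac_self: "x \<in> carrier M \<Longrightarrow> s \<in> S \<Longrightarrow> (x, s) \<in> mfrac x s"
  using S(2) by (auto simp: mem_frac)

lemma frac_equiv:
  assumes x: "x \<in> carrier M" "s \<in> S" and y: "y \<in> carrier M" "t \<in> S" and z: "z \<in> carrier M" "v \<in> S"
    and 1: "u \<in> S" "(u \<otimes> t) \<odot>\<^bsub>M\<^esub> x = (u \<otimes> s) \<odot>\<^bsub>M\<^esub> y"
    and 2: "w \<in> S" "(w \<otimes> v) \<odot>\<^bsub>M\<^esub> y = (w \<otimes> t) \<odot>\<^bsub>M\<^esub> z"
  shows "\<exists>k\<in>S. (k \<otimes> v) \<odot>\<^bsub>M\<^esub> x = (k \<otimes> s) \<odot>\<^bsub>M\<^esub> z"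
proof (intro bexI)
  note c = S_carrier[OF x(2)] S_carrier[OF y(2)] S_carrier[OF z(2)] S_carrier[OF 1(1)] S_carrier[OF 2(1)]
  \<comment> \<open>Besides the two given witnesses, the middle denominator \<open>t\<close> has to
    be a factor, since it cannot be cancelled.\<close>
  show "u \<otimes> w \<otimes> t \<in> S" using S(3) 1(1) 2(1) y(2) by blast
  have "((u \<otimes> w \<otimes> t) \<otimes> v) \<odot>\<^bsub>M\<^esub> x = (w \<otimes> v) \<odot>\<^bsub>M\<^esub> ((u \<otimes> t) \<odot>\<^bsub>M\<^esub> x)"
    using c x(1) by (simp add: smult_assoc1[symmetric] m_ac)
  also have "\<dots> = (u \<otimes> s) \<odot>\<^bsub>M\<^esub> ((w \<otimes> v) \<odot>\<^bsub>M\<^esub> y)"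
    unfolding 1(2) using c y(1) by (simp add: smult_assoc1[symmetric] m_ac)
  also have "\<dots> = ((u \<otimes> w \<otimes> t) \<otimes> s) \<odot>\<^bsub>M\<^esub> z"
    unfolding 2(2) using c z(1) by (simp add: smult_assoc1[symmetric] m_ac)
  finally show "((u \<otimes> w \<otimes> t) \<otimes> v) \<odot>\<^bsub>M\<^esub> x = ((u \<otimes> w \<otimes> t) \<otimes> s) \<odot>\<^bsub>M\<^esub> z" .
qed

lemma frac_eqI:
  assumes x: "x \<in> carrier M" "s \<in> S" and y: "y \<in> carrier M" "t \<in> S"
    and u: "u \<in> S" "(u \<otimes> t) \<odot>\<^bsub>M\<^esub> x = (u \<otimes> s) \<odot>\<^bsub>M\<^esub> y"
  shows "mfrac x s = mfrac y t"
proof -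
  have "(z, v) \<in> mfrac y t" if "(z, v) \<in> mfrac x s" for z v
    using that frac_equiv[OF y x _ _ u(1) u(2)[symmetric]] y x by (auto simp: mem_frac)
  moreover have "(z, v) \<in> mfrac x s" if "(z, v) \<in> mfrac y t" for z v
    using that frac_equiv[OF x y _ _ u] y x by (auto simp: mem_frac)
  ultimately show ?thesis by auto
qed

lemma frac_eqD:
  assumes x: "x \<in> carrier M" "s \<in> S" and y: "y \<in> carrier M" "t \<in> S" and eq: "mfrac x s = mfrac y t"
  shows "\<exists>u\<in>S. (u \<otimes> t) \<odot>\<^bsub>M\<^esub> x = (u \<otimes> s) \<odot>\<^bsub>M\<^esub> y"
proof -
  have "(y, t) \<in> mfrac x s" unfolding eq by (rule frac_self[OF y])
  then show ?thesis using mem_frac[OF x] by blast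
qed

lemma frac_add:
  assumes x: "x \<in> carrier M" "s \<in> S" and y: "y \<in> carrier M" "t \<in> S"
  shows "(\<Union>(x', s')\<in>mfrac x s. \<Union>(y', t')\<in>mfrac y t. mfrac (t' \<odot>\<^bsub>M\<^esub> x' \<oplus>\<^bsub>M\<^esub> s' \<odot>\<^bsub>M\<^esub> y') (s' \<otimes> t')) =
    mfrac (t \<odot>\<^bsub>M\<^esub> x \<oplus>\<^bsub>M\<^esub> s \<odot>\<^bsub>M\<^esub> y) (s \<otimes> t)"
proof -
  have "mfrac (t' \<odot>\<^bsub>M\<^esub> x' \<oplus>\<^bsub>M\<^esub> s' \<odot>\<^bsub>M\<^esub> y') (s' \<otimes> t') = mfrac (t \<odot>\<^bsub>M\<^esub> x \<oplus>\<^bsub>M\<^esub> s \<odot>\<^bsub>M\<^esub> y) (s \<otimes> t)"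
    if "(x', s') \<in> mfrac x s" "(y', t') \<in> mfrac y t" for x' s' y' t'
  proof -
    from that obtain u w where x': "x' \<in> carrier M" "s' \<in> S" and y': "y' \<in> carrier M" "t' \<in> S"
      and u: "u \<in> S" "(u \<otimes> s') \<odot>\<^bsub>M\<^esub> x = (u \<otimes> s) \<odot>\<^bsub>M\<^esub> x'"
      and w: "w \<in> S" "(w \<otimes> t') \<odot>\<^bsub>M\<^esub> y = (w \<otimes> t) \<odot>\<^bsub>M\<^esub> y'"
      using mem_frac[OF x] mem_frac[OF y] by blast
    note c = S_carrier[OF x(2)] S_carrier[OF y(2)] S_carrier[OF x'(2)] S_carrier[OF y'(2)]
      S_carrier[OF u(1)] S_carrier[OF w(1)]
    have "((u \<otimes> w) \<otimes> (s' \<otimes> t')) \<odot>\<^bsub>M\<^esub> (t \<odot>\<^bsub>M\<^esub> x \<oplus>\<^bsub>M\<^esub> s \<odot>\<^bsub>M\<^esub> y) =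
        (w \<otimes> t \<otimes> t') \<odot>\<^bsub>M\<^esub> ((u \<otimes> s') \<odot>\<^bsub>M\<^esub> x) \<oplus>\<^bsub>M\<^esub> (u \<otimes> s \<otimes> s') \<odot>\<^bsub>M\<^esub> ((w \<otimes> t') \<odot>\<^bsub>M\<^esub> y)"
      using c x(1) y(1) by (simp add: smult_r_distr smult_assoc1[symmetric] m_ac)
    also have "\<dots> = ((u \<otimes> w) \<otimes> (s \<otimes> t)) \<odot>\<^bsub>M\<^esub> (t' \<odot>\<^bsub>M\<^esub> x' \<oplus>\<^bsub>M\<^esub> s' \<odot>\<^bsub>M\<^esub> y')"
      unfolding u(2) w(2) using c x'(1) y'(1) by (simp add: smult_r_distr smult_assoc1[symmetric] m_ac)
    finally have e: "((u \<otimes> w) \<otimes> (s' \<otimes> t')) \<odot>\<^bsub>M\<^esub> (t \<odot>\<^bsub>M\<^esub> x \<oplus>\<^bsub>M\<^esub> s \<odot>\<^bsub>M\<^esub> y) = ((u \<otimes> w) \<otimes> (s \<otimes> t)) \<odot>\<^bsub>M\<^esub> (t' \<odot>\<^bsub>M\<^esub> x' \<oplus>\<^bsub>M\<^esub> s' \<odot>\<^bsub>M\<^esub> y')" .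
    show ?thesis
      by (rule frac_eqI[OF _ _ _ _ _ e[symmetric]]) (use c x y x' y' u(1) w(1) S(3) in simp_all)
  qed
  then show ?thesis using frac_self[OF x] frac_self[OF y] by (rule UN_pairs_constant)
qed

lemma frac_smult:
  assumes r: "r \<in> carrier R" "s \<in> S" and y: "y \<in> carrier M" "t \<in> S"
  shows "(\<Union>(r', s')\<in>ring_fraction R S r s. \<Union>(y', t')\<in>mfrac y t. mfrac (r' \<odot>\<^bsub>M\<^esub> y') (s' \<otimes> t')) =
    mfrac (r \<odot>\<^bsub>M\<^esub> y) (s \<otimes> t)"
proof -
  have mem: "(r', s') \<in> ring_fraction R S r s \<longleftrightarrow>
    r' \<in> carrier R \<and> s' \<in> S \<and> (\<exists>u\<in>S. (u \<otimes> s') \<otimes> r = (u \<otimes> s) \<otimes> r')" for r' s'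
    using S_carrier r by (auto simp: ring_fraction_def m_assoc)
  have "mfrac (r' \<odot>\<^bsub>M\<^esub> y') (s' \<otimes> t') = mfrac (r \<odot>\<^bsub>M\<^esub> y) (s \<otimes> t)"
    if "(r', s') \<in> ring_fraction R S r s" "(y', t') \<in> mfrac y t" for r' s' y' t'
  proof -
    from that obtain u w where r': "r' \<in> carrier R" "s' \<in> S" and y': "y' \<in> carrier M" "t' \<in> S"
      and u: "u \<in> S" "(u \<otimes> s') \<otimes> r = (u \<otimes> s) \<otimes> r'"
      and w: "w \<in> S" "(w \<otimes> t') \<odot>\<^bsub>M\<^esub> y = (w \<otimes> t) \<odot>\<^bsub>M\<^esub> y'"
      using mem mem_frac[OF y] by blast
    note c = S_carrier[OF r(2)] S_carrier[OF y(2)] S_carrier[OF r'(2)] S_carrier[OF y'(2)]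
      S_carrier[OF u(1)] S_carrier[OF w(1)]
    have "((u \<otimes> w) \<otimes> (s' \<otimes> t')) \<odot>\<^bsub>M\<^esub> (r \<odot>\<^bsub>M\<^esub> y) = ((u \<otimes> s') \<otimes> r) \<odot>\<^bsub>M\<^esub> ((w \<otimes> t') \<odot>\<^bsub>M\<^esub> y)"
      using c r(1) y(1) by (simp add: smult_assoc1[symmetric] m_ac)
    also have "\<dots> = ((u \<otimes> w) \<otimes> (s \<otimes> t)) \<odot>\<^bsub>M\<^esub> (r' \<odot>\<^bsub>M\<^esub> y')"
      unfolding u(2) w(2) using c r'(1) y'(1) by (simp add: smult_assoc1[symmetric] m_ac)
    finally have e: "((u \<otimes> w) \<otimes> (s' \<otimes> t')) \<odot>\<^bsub>M\<^esub> (r \<odot>\<^bsub>M\<^esub> y) = ((u \<otimes> w) \<otimes> (s \<otimes> t)) \<odot>\<^bsub>M\<^esub> (r' \<odot>\<^bsub>M\<^esub> y')" .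
    show ?thesis
      by (rule frac_eqI[OF _ _ _ _ _ e[symmetric]]) (use c r y r' y' u(1) w(1) S(3) in simp_all)
  qed
  moreover have "(r, s) \<in> ring_fraction R S r s" using mem r S(2) by auto
  ultimately show ?thesis using frac_self[OF y] by (rule UN_pairs_constant)
qed

lemma module_localization_simps:
  "carrier (module_localization R M S) = {mfrac x s | x s. x \<in> carrier M \<and> s \<in> S}"
  "\<zero>\<^bsub>module_localization R M S\<^esub> = mfrac \<zero>\<^bsub>M\<^esub> \<one>"
  "x \<in> carrier M \<Longrightarrow> s \<in> S \<Longrightarrow> y \<in> carrier M \<Longrightarrow> t \<in> S \<Longrightarrow>
    mfrac x s \<oplus>\<^bsub>module_localization R M S\<^esub> mfrac y t = mfrac (t \<odot>\<^bsub>M\<^esub> x \<oplus>\<^bsub>M\<^esub> s \<odot>\<^bsub>M\<^esub> y) (s \<otimes> t)"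
  "r \<in> carrier R \<Longrightarrow> s \<in> S \<Longrightarrow> y \<in> carrier M \<Longrightarrow> t \<in> S \<Longrightarrow>
    ring_fraction R S r s \<odot>\<^bsub>module_localization R M S\<^esub> mfrac y t = mfrac (r \<odot>\<^bsub>M\<^esub> y) (s \<otimes> t)"
  using frac_add frac_smult by (simp_all add: module_localization_def)

end
end

subsection \<open>Localization at a multiplicative set\<close>

text \<open>That the localization is a module is taken as an assumption because local freeness
  supplies it: \<open>free_module\<close> includes the module axioms over the localized
  ring.\<close>

locale localized_module = module R M for R (structure) and M (structure) +
  fixes S assumes S: "S \<subseteq> carrier R" "\<one>\<^bsub>R\<^esub> \<in> S" "\<forall>s\<in>S. \<forall>t\<in>S. s \<otimes>\<^bsub>R\<^esub> t \<in> S"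
    and mod: "module (ring_localization R S) (module_localization R M S)"
begin

abbreviation "RS \<equiv> ring_localization R S"
abbreviation "MS \<equiv> module_localization R M S"
abbreviation "jR r \<equiv> ring_fraction R S r \<one>\<^bsub>R\<^esub>"
abbreviation "jM x \<equiv> module_fraction M S x \<one>\<^bsub>R\<^esub>"

interpretation RM: module R "ring_module R" by (rule R.module_ring_module)
interpretation L: module RS MS by (rule mod)

lemmas MS_simps = module_localization_simps[OF S]
lemmas S_car = S_carrier[OF S]

lemma RS_simps:
  "carrier RS = {ring_fraction R S r s | r s. r \<in> carrier R \<and> s \<in> S}"
  "\<zero>\<^bsub>RS\<^esub> = jR \<zero>\<^bsub>R\<^esub>"
  "r \<in> carrier R \<Longrightarrow> s \<in> S \<Longrightarrow> q \<in> carrier R \<Longrightarrow> t \<in> S \<Longrightarrow>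
    ring_fraction R S r s \<otimes>\<^bsub>RS\<^esub> ring_fraction R S q t = ring_fraction R S (r \<otimes>\<^bsub>R\<^esub> q) (s \<otimes>\<^bsub>R\<^esub> t)"
  using RM.frac_smult[OF S, of r s q t]
  by (simp_all add: ring_localization_def ring_fraction_module_fraction)

lemma jR_closed [simp]: "r \<in> carrier R \<Longrightarrow> jR r \<in> carrier RS"
  unfolding RS_simps using S(2) by blast

lemma jM_closed [simp]: "x \<in> carrier M \<Longrightarrow> jM x \<in> carrier MS"
  using S(2) by (auto simp: MS_simps)

lemma jR_mult: "r \<in> carrier R \<Longrightarrow> q \<in> carrier R \<Longrightarrow> jR r \<otimes>\<^bsub>RS\<^esub> jR q = jR (r \<otimes>\<^bsub>R\<^esub> q)"
  using RS_simps(3)[of r "\<one>\<^bsub>R\<^esub>" q "\<one>\<^bsub>R\<^esub>"] S(2) by simp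

lemma jM_smult: "r \<in> carrier R \<Longrightarrow> x \<in> carrier M \<Longrightarrow> jR r \<odot>\<^bsub>MS\<^esub> jM x = jM (r \<odot>\<^bsub>M\<^esub> x)"
  using MS_simps(4)[of r "\<one>\<^bsub>R\<^esub>" x "\<one>\<^bsub>R\<^esub>"] S(2) by simp

lemma jM_add: "x \<in> carrier M \<Longrightarrow> y \<in> carrier M \<Longrightarrow> jM (x \<oplus>\<^bsub>M\<^esub> y) = jM x \<oplus>\<^bsub>MS\<^esub> jM y"
  using MS_simps(3)[of x "\<one>\<^bsub>R\<^esub>" y "\<one>\<^bsub>R\<^esub>"] S(2) by simp

lemma jM_finsum: "finite A \<Longrightarrow> f \<in> A \<rightarrow> carrier M \<Longrightarrow> jM (\<Oplus>\<^bsub>M\<^esub>i\<in>A. f i) = (\<Oplus>\<^bsub>MS\<^esub>i\<in>A. jM (f i))"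
proof (induction A rule: finite_induct)
  case empty
  then show ?case using MS_simps(2) by simp
next
  case (insert a A)
  have "f a \<in> carrier M" "f \<in> A \<rightarrow> carrier M" using insert.prems by auto
  moreover from this have "jM (f a) \<in> carrier MS" "(\<lambda>i. jM (f i)) \<in> A \<rightarrow> carrier MS" by (auto simp: Pi_iff)
  ultimately show ?case using insert by (simp add: jM_add)
qed

lemma jM_eqD: "x \<in> carrier M \<Longrightarrow> y \<in> carrier M \<Longrightarrow> jM x = jM y \<Longrightarrow> \<exists>s\<in>S. s \<odot>\<^bsub>M\<^esub> x = s \<odot>\<^bsub>M\<^esub> y"
  using frac_eqD[OF S, of x "\<one>\<^bsub>R\<^esub>" y "\<one>\<^bsub>R\<^esub>"] S(2) S_car by force

lemma jR_zeroD: "r \<in> carrier R \<Longrightarrow> jR r = \<zero>\<^bsub>RS\<^esub> \<Longrightarrow> \<exists>s\<in>S. s \<otimes>\<^bsub>R\<^esub> r = \<zero>\<^bsub>R\<^esub>"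
  using RM.frac_eqD[OF S, of r "\<one>\<^bsub>R\<^esub>" "\<zero>\<^bsub>R\<^esub>" "\<one>\<^bsub>R\<^esub>"] S(2) S_car
  by (force simp: RS_simps ring_fraction_module_fraction)

lemma RS_denominator:
  assumes "c \<in> carrier RS"
  shows "\<exists>s\<in>S. \<exists>r\<in>carrier R. jR s \<otimes>\<^bsub>RS\<^esub> c = jR r"
proof -
  obtain r s where c: "c = ring_fraction R S r s" "r \<in> carrier R" "s \<in> S"
    using assms unfolding RS_simps by blast
  have "ring_fraction R S (s \<otimes>\<^bsub>R\<^esub> r) s = jR r"
    unfolding ring_fraction_module_fraction
    using c S(2) S_car by (intro RM.frac_eqI[OF S, of _ _ _ _ "\<one>\<^bsub>R\<^esub>"]) auto
  then have "jR s \<otimes>\<^bsub>RS\<^esub> c = jR r"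
    using c S(2) S_car RS_simps(3)[of s "\<one>\<^bsub>R\<^esub>" r s] by simp
  then show ?thesis using c by blast
qed

lemma MS_denominator:
  assumes "b \<in> carrier MS"
  shows "\<exists>s\<in>S. \<exists>x\<in>carrier M. jR s \<odot>\<^bsub>MS\<^esub> b = jM x"
proof -
  obtain x s where c: "b = module_fraction M S x s" "x \<in> carrier M" "s \<in> S"
    using assms unfolding MS_simps by blast
  have "module_fraction M S (s \<odot>\<^bsub>M\<^esub> x) s = jM x"
    using c S(2) S_car by (intro frac_eqI[OF S, of _ _ _ _ "\<one>\<^bsub>R\<^esub>"]) (auto simp: smult_assoc1)
  then have "jR s \<odot>\<^bsub>MS\<^esub> b = jM x"
    using c S(2) S_car MS_simps(4)[of s "\<one>\<^bsub>R\<^esub>" x s] by simp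
  then show ?thesis using c by blast
qed

end

text \<open>The elements \<open>n b\<close> are, up to a common denominator, members of a basis of the localization of
  \<open>N\<close>, whence the last property of the coordinate rows \<open>\<rho> b\<close>.\<close>

lemma locally_free_coordinates:
  fixes R :: "('r, 'x) ring_scheme" and N :: "('r, 'n, 'y) module_scheme"
  assumes N: "module R N" and p: "primeideal p R" and free: "locally_free_at R N p"
    and I: "finite I" and f: "f \<in> lin_maps R (fvec R I) N"
  obtains s and B :: "('n \<times> 'r) set set" and \<rho> n where "s \<in> carrier R - p" "finite B"
    "\<And>b. b \<in> B \<Longrightarrow> \<rho> b \<in> carrier (fvec R I)" "\<And>b. b \<in> B \<Longrightarrow> n b \<in> carrier N"
    "\<And>v. v \<in> carrier (fvec R I) \<Longrightarrow> s \<odot>\<^bsub>N\<^esub> f v = (\<Oplus>\<^bsub>N\<^esub>b\<in>B. dot R I (\<rho> b) v \<odot>\<^bsub>N\<^esub> n b)"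
    "\<And>b v. b \<in> B \<Longrightarrow> v \<in> carrier (fvec R I) \<Longrightarrow> f v = \<zero>\<^bsub>N\<^esub> \<Longrightarrow>
      \<exists>t\<in>carrier R - p. t \<otimes>\<^bsub>R\<^esub> dot R I (\<rho> b) v = \<zero>\<^bsub>R\<^esub>"
proof -
  define S where "S = carrier R - p"
  interpret N: module R N by fact
  let ?RS = "ring_localization R S" and ?NS = "module_localization R N S"
  have free': "free_module ?RS ?NS" using free by (simp add: locally_free_at_def S_def)
  have modL: "module ?RS ?NS" using free' by (simp add: free_module_def)
  have mult: "s \<otimes>\<^bsub>R\<^esub> t \<in> S" if "s \<in> S" "t \<in> S" for s t
    using primeideal_mult_closed[OF p] that by (simp add: S_def)
  have one: "\<one>\<^bsub>R\<^esub> \<in> S" using primeideal_one_notin[OF p] by (simp add: S_def)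
  have Sc: "S \<subseteq> carrier R" by (auto simp: S_def)
  have "localized_module R N S"
    by (intro localized_module.intro localized_module_axioms.intro N Sc one modL) (simp add: mult)
  then interpret L: localized_module R N S .
  interpret LM: module ?RS ?NS by (rule modL)
  have "\<exists>X\<subseteq>carrier ?NS. lin_span ?RS ?NS X = carrier ?NS \<and> lin_indep ?RS ?NS X"
    using free' by (simp add: free_module_def)
  then obtain X where X: "X \<subseteq> carrier ?NS" "lin_span ?RS ?NS X = carrier ?NS" "lin_indep ?RS ?NS X" by auto
  define x where "x k = f (unit_vec R k)" for k
  have x: "x k \<in> carrier N" if "k \<in> I" for k
    unfolding x_def by (rule lin_closed[OF f N.R.unit_vec_closed[OF that]])
  have "\<exists>Ac. finite (fst Ac) \<and> fst Ac \<subseteq> X \<and> snd Ac \<in> fst Ac \<rightarrow> carrier ?RS \<and>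
    L.jM (x k) = (\<Oplus>\<^bsub>?NS\<^esub>v\<in>fst Ac. snd Ac v \<odot>\<^bsub>?NS\<^esub> v)" if "k \<in> I" for k
  proof -
    have k: "L.jM (x k) \<in> carrier ?NS" using x[OF that] by simp
    obtain A c where "finite A" "A \<subseteq> X" "c \<in> A \<rightarrow> carrier ?RS" "L.jM (x k) = (\<Oplus>\<^bsub>?NS\<^esub>v\<in>A. c v \<odot>\<^bsub>?NS\<^esub> v)"
      using k[folded X(2)] unfolding lin_span_def mem_Collect_eq by (elim exE conjE)
    then show ?thesis by (intro exI[of _ "(A, c)"]) simp
  qed
  then have "\<forall>k\<in>I. \<exists>Ac. finite (fst Ac) \<and> fst Ac \<subseteq> X \<and> snd Ac \<in> fst Ac \<rightarrow> carrier ?RS \<and>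
    L.jM (x k) = (\<Oplus>\<^bsub>?NS\<^esub>v\<in>fst Ac. snd Ac v \<odot>\<^bsub>?NS\<^esub> v)" by blast
  from bchoice[OF this] obtain Ac where Ac: "\<forall>k\<in>I. finite (fst (Ac k)) \<and> fst (Ac k) \<subseteq> X \<and>
    snd (Ac k) \<in> fst (Ac k) \<rightarrow> carrier ?RS \<and>
    L.jM (x k) = (\<Oplus>\<^bsub>?NS\<^esub>v\<in>fst (Ac k). snd (Ac k) v \<odot>\<^bsub>?NS\<^esub> v)" ..
  \<comment> \<open>Only finitely many basis elements occur in the images of the finitely many unit
    vectors. Coefficients are extended by zero to this common set \<open>B\<close>.\<close>
  define B where "B = (\<Union>k\<in>I. fst (Ac k))"
  define c where "c k b = (if b \<in> fst (Ac k) then snd (Ac k) b else \<zero>\<^bsub>?RS\<^esub>)" for k b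
  have B: "finite B" "B \<subseteq> X" using Ac I by (auto simp: B_def)
  have Bc: "b \<in> carrier ?NS" if "b \<in> B" for b using B(2) X(1) that by auto
  have c: "c k b \<in> carrier ?RS" if "k \<in> I" for k b
    using Ac that by (auto simp: c_def)
  have xc: "L.jM (x k) = (\<Oplus>\<^bsub>?NS\<^esub>b\<in>B. c k b \<odot>\<^bsub>?NS\<^esub> b)" if k: "k \<in> I" for k
  proof -
    have A: "finite (fst (Ac k))" "fst (Ac k) \<subseteq> B" "snd (Ac k) \<in> fst (Ac k) \<rightarrow> carrier ?RS"
      using Ac k by (auto simp: B_def)
    have "L.jM (x k) = (\<Oplus>\<^bsub>?NS\<^esub>v\<in>fst (Ac k). snd (Ac k) v \<odot>\<^bsub>?NS\<^esub> v)" using Ac k by simp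
    also have "\<dots> = (\<Oplus>\<^bsub>?NS\<^esub>b\<in>B. c k b \<odot>\<^bsub>?NS\<^esub> b)"
      unfolding c_def by (rule LM.lin_comb_extend[OF A(1) B(1) A(2) _ A(3)]) (use Bc in auto)
    finally show ?thesis .
  qed
  \<comment> \<open>One denominator for the basis elements in \<open>B\<close>: multiplied by
    \<open>sB\<close>, each comes from an element \<open>n b\<close> of \<open>N\<close>.\<close>
  have "\<exists>s\<in>carrier R - p. \<forall>b\<in>B. \<exists>n\<in>carrier N. L.jR s \<odot>\<^bsub>?NS\<^esub> b = L.jM n"
  proof (rule common_multiple[OF p B(1)])
    show "\<exists>s\<in>carrier R - p. \<exists>n\<in>carrier N. L.jR s \<odot>\<^bsub>?NS\<^esub> b = L.jM n" if "b \<in> B" for b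
      using L.MS_denominator[OF Bc[OF that]] by (simp add: S_def)
    fix b s t assume b: "b \<in> B" and st: "s \<in> carrier R - p" "t \<in> carrier R - p"
      and "\<exists>n\<in>carrier N. L.jR s \<odot>\<^bsub>?NS\<^esub> b = L.jM n"
    then obtain n where n: "n \<in> carrier N" "L.jR s \<odot>\<^bsub>?NS\<^esub> b = L.jM n" by blast
    have "L.jR (t \<otimes>\<^bsub>R\<^esub> s) \<odot>\<^bsub>?NS\<^esub> b = L.jR t \<odot>\<^bsub>?NS\<^esub> (L.jR s \<odot>\<^bsub>?NS\<^esub> b)"
      using st Bc[OF b] by (simp add: L.jR_mult[symmetric] LM.smult_assoc1)
    also have "\<dots> = L.jM (t \<odot>\<^bsub>N\<^esub> n)" using n st by (simp add: L.jM_smult)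
    finally show "\<exists>n\<in>carrier N. L.jR (t \<otimes>\<^bsub>R\<^esub> s) \<odot>\<^bsub>?NS\<^esub> b = L.jM n" using n st by blast
  qed
  then obtain sB where sB: "sB \<in> carrier R - p" and "\<forall>b\<in>B. \<exists>n. n \<in> carrier N \<and> L.jR sB \<odot>\<^bsub>?NS\<^esub> b = L.jM n"
    by blast
  from bchoice[OF this(2)] obtain n where "\<forall>b\<in>B. n b \<in> carrier N \<and> L.jR sB \<odot>\<^bsub>?NS\<^esub> b = L.jM (n b)" ..
  then have n: "n b \<in> carrier N" "L.jR sB \<odot>\<^bsub>?NS\<^esub> b = L.jM (n b)" if "b \<in> B" for b using that by auto
  \<comment> \<open>One denominator \<open>sC\<close> for all coefficients, so that these come from
    \<open>R\<close>.\<close>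
  have "\<exists>s\<in>carrier R - p. \<forall>kb\<in>I \<times> B. \<exists>r\<in>carrier R. L.jR s \<otimes>\<^bsub>?RS\<^esub> c (fst kb) (snd kb) = L.jR r"
  proof (rule common_multiple[OF p])
    show "finite (I \<times> B)" using I B(1) by simp
    show "\<exists>s\<in>carrier R - p. \<exists>r\<in>carrier R. L.jR s \<otimes>\<^bsub>?RS\<^esub> c (fst kb) (snd kb) = L.jR r" if "kb \<in> I \<times> B" for kb
    proof -
      have "fst kb \<in> I" using that by auto
      then show ?thesis using L.RS_denominator[OF c] by (simp add: S_def)
    qed
    fix kb s t assume b: "kb \<in> I \<times> B" and st: "s \<in> carrier R - p" "t \<in> carrier R - p"
      and "\<exists>r\<in>carrier R. L.jR s \<otimes>\<^bsub>?RS\<^esub> c (fst kb) (snd kb) = L.jR r"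
    then obtain r where r: "r \<in> carrier R" "L.jR s \<otimes>\<^bsub>?RS\<^esub> c (fst kb) (snd kb) = L.jR r" by blast
    have cc: "c (fst kb) (snd kb) \<in> carrier ?RS" using c b by auto
    have "L.jR (t \<otimes>\<^bsub>R\<^esub> s) \<otimes>\<^bsub>?RS\<^esub> c (fst kb) (snd kb) = L.jR t \<otimes>\<^bsub>?RS\<^esub> (L.jR s \<otimes>\<^bsub>?RS\<^esub> c (fst kb) (snd kb))"
      using st cc by (simp add: L.jR_mult[symmetric] LM.R.m_assoc)
    also have "\<dots> = L.jR (t \<otimes>\<^bsub>R\<^esub> r)" using r st by (simp add: L.jR_mult)
    finally show "\<exists>r\<in>carrier R. L.jR (t \<otimes>\<^bsub>R\<^esub> s) \<otimes>\<^bsub>?RS\<^esub> c (fst kb) (snd kb) = L.jR r" using r st by blast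
  qed
  then obtain sC where sC: "sC \<in> carrier R - p"
    and "\<forall>kb\<in>I \<times> B. \<exists>r. r \<in> carrier R \<and> L.jR sC \<otimes>\<^bsub>?RS\<^esub> c (fst kb) (snd kb) = L.jR r" by blast
  from bchoice[OF this(2)] obtain r0 where
    "\<forall>kb\<in>I \<times> B. r0 kb \<in> carrier R \<and> L.jR sC \<otimes>\<^bsub>?RS\<^esub> c (fst kb) (snd kb) = L.jR (r0 kb)" ..
  then have r0: "r0 (k, b) \<in> carrier R" "L.jR sC \<otimes>\<^bsub>?RS\<^esub> c k b = L.jR (r0 (k, b))"
    if "k \<in> I" "b \<in> B" for k b using that by auto
  have scar: "sB \<in> carrier R" "sC \<in> carrier R" using sB sC by auto
  have eqL: "L.jM ((sC \<otimes>\<^bsub>R\<^esub> sB) \<odot>\<^bsub>N\<^esub> x k) = L.jM (\<Oplus>\<^bsub>N\<^esub>b\<in>B. r0 (k, b) \<odot>\<^bsub>N\<^esub> n b)" if k: "k \<in> I" for k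
  proof -
    have cb: "(\<lambda>b. c k b \<odot>\<^bsub>?NS\<^esub> b) \<in> B \<rightarrow> carrier ?NS" using c[OF k] Bc by (intro Pi_I LM.smult_closed)
    have "L.jM ((sC \<otimes>\<^bsub>R\<^esub> sB) \<odot>\<^bsub>N\<^esub> x k) = L.jR (sC \<otimes>\<^bsub>R\<^esub> sB) \<odot>\<^bsub>?NS\<^esub> L.jM (x k)"
      using scar x[OF k] by (simp add: L.jM_smult)
    also have "\<dots> = (\<Oplus>\<^bsub>?NS\<^esub>b\<in>B. L.jR (sC \<otimes>\<^bsub>R\<^esub> sB) \<odot>\<^bsub>?NS\<^esub> (c k b \<odot>\<^bsub>?NS\<^esub> b))"
      unfolding xc[OF k] using scar by (intro LM.finsum_smult_ldistr[OF B(1) _ cb]) simp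
    also have "\<dots> = (\<Oplus>\<^bsub>?NS\<^esub>b\<in>B. L.jM (r0 (k, b) \<odot>\<^bsub>N\<^esub> n b))"
    proof (rule LM.M.finsum_cong'[OF refl])
      show "(\<lambda>b. L.jM (r0 (k, b) \<odot>\<^bsub>N\<^esub> n b)) \<in> B \<rightarrow> carrier ?NS"
        using r0(1)[OF k] n(1) by (intro Pi_I L.jM_closed N.smult_closed)
      fix b assume b: "b \<in> B"
      note ck = c[OF k, of b] and bc = Bc[OF b]
      have "L.jR (sC \<otimes>\<^bsub>R\<^esub> sB) \<odot>\<^bsub>?NS\<^esub> (c k b \<odot>\<^bsub>?NS\<^esub> b) =
          ((L.jR sC \<otimes>\<^bsub>?RS\<^esub> L.jR sB) \<otimes>\<^bsub>?RS\<^esub> c k b) \<odot>\<^bsub>?NS\<^esub> b"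
        using scar ck bc by (simp add: L.jR_mult LM.smult_assoc1)
      also have "(L.jR sC \<otimes>\<^bsub>?RS\<^esub> L.jR sB) \<otimes>\<^bsub>?RS\<^esub> c k b = (L.jR sC \<otimes>\<^bsub>?RS\<^esub> c k b) \<otimes>\<^bsub>?RS\<^esub> L.jR sB"
        using scar ck L.jR_closed[OF scar(1)] L.jR_closed[OF scar(2)] by (simp add: LM.R.m_ac del: L.jR_closed)
      also have "((L.jR sC \<otimes>\<^bsub>?RS\<^esub> c k b) \<otimes>\<^bsub>?RS\<^esub> L.jR sB) \<odot>\<^bsub>?NS\<^esub> b =
          (L.jR sC \<otimes>\<^bsub>?RS\<^esub> c k b) \<odot>\<^bsub>?NS\<^esub> (L.jR sB \<odot>\<^bsub>?NS\<^esub> b)"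
        using scar ck bc by (intro LM.smult_assoc1) simp_all
      also have "\<dots> = L.jM (r0 (k, b) \<odot>\<^bsub>N\<^esub> n b)"
        unfolding r0(2)[OF k b] n(2)[OF b] using r0(1)[OF k b] n(1)[OF b] by (rule L.jM_smult)
      finally show "L.jR (sC \<otimes>\<^bsub>R\<^esub> sB) \<odot>\<^bsub>?NS\<^esub> (c k b \<odot>\<^bsub>?NS\<^esub> b) = L.jM (r0 (k, b) \<odot>\<^bsub>N\<^esub> n b)" .
    qed
    also have "\<dots> = L.jM (\<Oplus>\<^bsub>N\<^esub>b\<in>B. r0 (k, b) \<odot>\<^bsub>N\<^esub> n b)"
      using r0(1)[OF k] n(1) by (intro L.jM_finsum[OF B(1), symmetric] Pi_I N.smult_closed)
    finally show ?thesis .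
  qed
  have sumc: "(\<lambda>b. a b \<odot>\<^bsub>N\<^esub> n b) \<in> B \<rightarrow> carrier N" if "\<And>b. b \<in> B \<Longrightarrow> a b \<in> carrier R" for a
    using that n(1) by (intro Pi_I N.smult_closed)
  \<comment> \<open>The expansion holds so far only in the localization; a further factor
    \<open>w\<close> makes it an equality in \<open>N\<close>.\<close>
  have "\<exists>w\<in>carrier R - p. \<forall>k\<in>I. w \<odot>\<^bsub>N\<^esub> ((sC \<otimes>\<^bsub>R\<^esub> sB) \<odot>\<^bsub>N\<^esub> x k) = w \<odot>\<^bsub>N\<^esub> (\<Oplus>\<^bsub>N\<^esub>b\<in>B. r0 (k, b) \<odot>\<^bsub>N\<^esub> n b)"
  proof (rule common_multiple[OF p I])
    fix k assume k: "k \<in> I"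
    have cl: "(sC \<otimes>\<^bsub>R\<^esub> sB) \<odot>\<^bsub>N\<^esub> x k \<in> carrier N" "(\<Oplus>\<^bsub>N\<^esub>b\<in>B. r0 (k, b) \<odot>\<^bsub>N\<^esub> n b) \<in> carrier N"
      using scar x[OF k] r0(1)[OF k] by (auto intro!: N.M.finsum_closed sumc)
    show "\<exists>w\<in>carrier R - p. w \<odot>\<^bsub>N\<^esub> ((sC \<otimes>\<^bsub>R\<^esub> sB) \<odot>\<^bsub>N\<^esub> x k) = w \<odot>\<^bsub>N\<^esub> (\<Oplus>\<^bsub>N\<^esub>b\<in>B. r0 (k, b) \<odot>\<^bsub>N\<^esub> n b)"
      using L.jM_eqD[OF cl eqL[OF k]] by (simp add: S_def)
    fix w u assume wu: "w \<in> carrier R - p" "u \<in> carrier R - p"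
      and e: "w \<odot>\<^bsub>N\<^esub> ((sC \<otimes>\<^bsub>R\<^esub> sB) \<odot>\<^bsub>N\<^esub> x k) = w \<odot>\<^bsub>N\<^esub> (\<Oplus>\<^bsub>N\<^esub>b\<in>B. r0 (k, b) \<odot>\<^bsub>N\<^esub> n b)"
    have wuc: "w \<in> carrier R" "u \<in> carrier R" using wu by auto
    show "(u \<otimes>\<^bsub>R\<^esub> w) \<odot>\<^bsub>N\<^esub> ((sC \<otimes>\<^bsub>R\<^esub> sB) \<odot>\<^bsub>N\<^esub> x k) = (u \<otimes>\<^bsub>R\<^esub> w) \<odot>\<^bsub>N\<^esub> (\<Oplus>\<^bsub>N\<^esub>b\<in>B. r0 (k, b) \<odot>\<^bsub>N\<^esub> n b)"
      unfolding N.smult_assoc1[OF wuc(2,1) cl(1)] N.smult_assoc1[OF wuc(2,1) cl(2)] e ..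
  qed
  then obtain w where w: "w \<in> carrier R - p"
    and wx: "\<And>k. k \<in> I \<Longrightarrow> w \<odot>\<^bsub>N\<^esub> ((sC \<otimes>\<^bsub>R\<^esub> sB) \<odot>\<^bsub>N\<^esub> x k) = w \<odot>\<^bsub>N\<^esub> (\<Oplus>\<^bsub>N\<^esub>b\<in>B. r0 (k, b) \<odot>\<^bsub>N\<^esub> n b)" by blast
  have wc: "w \<in> carrier R" using w by auto
  define s where "s = w \<otimes>\<^bsub>R\<^esub> (sC \<otimes>\<^bsub>R\<^esub> sB)"
  have s: "s \<in> carrier R - p"
    unfolding s_def by (rule primeideal_mult_closed[OF p w primeideal_mult_closed[OF p sC sB]])
  define \<rho> where "\<rho> b = (\<lambda>k. if k \<in> I then w \<otimes>\<^bsub>R\<^esub> r0 (k, b) else \<zero>\<^bsub>R\<^esub>)" for b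
  have \<rho>: "\<rho> b \<in> carrier (fvec R I)" if "b \<in> B" for b
    unfolding \<rho>_def fvec_carrier using r0(1)[OF _ that] wc by simp
  define G where "G v = vec_map N B n (\<lambda>b. if b \<in> B then dot R I (\<rho> b) v else \<zero>\<^bsub>R\<^esub>)" for v
  have nB: "n \<in> B \<rightarrow> carrier N" using n(1) by auto
  have G: "G \<in> lin_maps R (fvec R I) N"
    unfolding G_def
    by (rule lin_comp[OF N.R.lin_vec_map[OF N B(1) nB] N.R.lin_into_fvec[OF N.R.lin_dot[OF I \<rho>]]])
  have G_eq: "G v = (\<Oplus>\<^bsub>N\<^esub>b\<in>B. dot R I (\<rho> b) v \<odot>\<^bsub>N\<^esub> n b)" if v: "v \<in> carrier (fvec R I)" for v
    unfolding G_def vec_map_def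
    by (rule N.M.finsum_cong'[OF refl sumc[OF N.R.dot_closed[OF \<rho> v]]]) simp_all
  have sf: "s \<odot>\<^bsub>N\<^esub> f v = G v" if v: "v \<in> carrier (fvec R I)" for v
  proof (rule N.R.lin_maps_fvec_eq[OF N lin_maps_smult[OF N f] G I _ v])
    show "s \<in> carrier R" using s by simp
    fix k assume k: "k \<in> I"
    have "s \<odot>\<^bsub>N\<^esub> f (unit_vec R k) = w \<odot>\<^bsub>N\<^esub> ((sC \<otimes>\<^bsub>R\<^esub> sB) \<odot>\<^bsub>N\<^esub> x k)"
      unfolding s_def x_def[symmetric] using wc scar x[OF k] by (intro N.smult_assoc1) auto
    also have "\<dots> = (\<Oplus>\<^bsub>N\<^esub>b\<in>B. w \<odot>\<^bsub>N\<^esub> (r0 (k, b) \<odot>\<^bsub>N\<^esub> n b))"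
      unfolding wx[OF k] by (rule N.finsum_smult_ldistr[OF B(1) wc sumc]) (rule r0(1)[OF k])
    also have "\<dots> = (\<Oplus>\<^bsub>N\<^esub>b\<in>B. dot R I (\<rho> b) (unit_vec R k) \<odot>\<^bsub>N\<^esub> n b)"
    proof (rule N.M.finsum_cong'[OF refl sumc])
      fix b assume b: "b \<in> B"
      show "dot R I (\<rho> b) (unit_vec R k) \<in> carrier R"
        by (rule N.R.dot_closed[OF \<rho>[OF b] N.R.unit_vec_closed[OF k]])
      show "w \<odot>\<^bsub>N\<^esub> (r0 (k, b) \<odot>\<^bsub>N\<^esub> n b) = dot R I (\<rho> b) (unit_vec R k) \<odot>\<^bsub>N\<^esub> n b"
        unfolding N.R.dot_unit[OF I \<rho>[OF b] k] using k wc r0(1)[OF k b] n(1)[OF b]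
        by (simp add: \<rho>_def N.smult_assoc1)
    qed
    also have "\<dots> = G (unit_vec R k)" by (rule G_eq[OF N.R.unit_vec_closed[OF k], symmetric])
    finally show "s \<odot>\<^bsub>N\<^esub> f (unit_vec R k) = G (unit_vec R k)" .
  qed
  show ?thesis
  proof (rule that[OF s B(1) \<rho> n(1)])
    show "s \<odot>\<^bsub>N\<^esub> f v = (\<Oplus>\<^bsub>N\<^esub>b\<in>B. dot R I (\<rho> b) v \<odot>\<^bsub>N\<^esub> n b)" if "v \<in> carrier (fvec R I)" for v
      using sf[OF that] G_eq[OF that] by simp
    fix b v assume b: "b \<in> B" and v: "v \<in> carrier (fvec R I)" and fv: "f v = \<zero>\<^bsub>N\<^esub>"
    let ?a = "\<lambda>b. dot R I (\<rho> b) v"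
    have a: "?a b \<in> carrier R" if "b \<in> B" for b by (rule N.R.dot_closed[OF \<rho>[OF that] v])
    have "\<zero>\<^bsub>N\<^esub> = (\<Oplus>\<^bsub>N\<^esub>b\<in>B. ?a b \<odot>\<^bsub>N\<^esub> n b)" using sf[OF v] G_eq[OF v] fv s by simp
    then have "\<zero>\<^bsub>?NS\<^esub> = (\<Oplus>\<^bsub>?NS\<^esub>b\<in>B. L.jM (?a b \<odot>\<^bsub>N\<^esub> n b))"
      using L.jM_finsum[OF B(1) sumc[of ?a]] a L.MS_simps(2) by simp
    also have "\<dots> = (\<Oplus>\<^bsub>?NS\<^esub>b\<in>B. L.jR (?a b \<otimes>\<^bsub>R\<^esub> sB) \<odot>\<^bsub>?NS\<^esub> b)"
    proof (rule LM.M.finsum_cong'[OF refl])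
      show "(\<lambda>b. L.jR (?a b \<otimes>\<^bsub>R\<^esub> sB) \<odot>\<^bsub>?NS\<^esub> b) \<in> B \<rightarrow> carrier ?NS"
        using a scar Bc by (intro Pi_I LM.smult_closed L.jR_closed N.R.m_closed)
      fix b assume b: "b \<in> B"
      have "L.jM (?a b \<odot>\<^bsub>N\<^esub> n b) = L.jR (?a b) \<odot>\<^bsub>?NS\<^esub> (L.jR sB \<odot>\<^bsub>?NS\<^esub> b)"
        using a[OF b] n[OF b] by (simp add: L.jM_smult)
      also have "\<dots> = (L.jR (?a b) \<otimes>\<^bsub>?RS\<^esub> L.jR sB) \<odot>\<^bsub>?NS\<^esub> b"
        using a[OF b] scar Bc[OF b] by (intro LM.smult_assoc1[symmetric]) simp_all
      finally show "L.jM (?a b \<odot>\<^bsub>N\<^esub> n b) = L.jR (?a b \<otimes>\<^bsub>R\<^esub> sB) \<odot>\<^bsub>?NS\<^esub> b"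
        using a[OF b] scar by (simp add: L.jR_mult)
    qed
    finally have sum0: "(\<Oplus>\<^bsub>?NS\<^esub>b\<in>B. L.jR (?a b \<otimes>\<^bsub>R\<^esub> sB) \<odot>\<^bsub>?NS\<^esub> b) = \<zero>\<^bsub>?NS\<^esub>" by simp
    have "(\<lambda>b. L.jR (?a b \<otimes>\<^bsub>R\<^esub> sB)) \<in> B \<rightarrow> carrier ?RS"
      using a scar by (intro Pi_I L.jR_closed N.R.m_closed)
    \<comment> \<open>Since \<open>n b\<close> is \<open>sB\<close> times the basis element
      \<open>b\<close> in the localization, the coefficients of the vanishing sum acquire the factor
      \<open>sB\<close>; linear independence makes them zero.\<close>
    then have "L.jR (?a b \<otimes>\<^bsub>R\<^esub> sB) = \<zero>\<^bsub>?RS\<^esub>"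
      using X(3)[unfolded lin_indep_def, rule_format, of B "\<lambda>b. L.jR (?a b \<otimes>\<^bsub>R\<^esub> sB)" b] B sum0 b by simp
    then obtain t where t: "t \<in> S" "t \<otimes>\<^bsub>R\<^esub> (?a b \<otimes>\<^bsub>R\<^esub> sB) = \<zero>\<^bsub>R\<^esub>"
      using L.jR_zeroD a[OF b] scar by blast
    have tc: "t \<in> carrier R" using t(1) by (simp add: S_def)
    have "(t \<otimes>\<^bsub>R\<^esub> sB) \<otimes>\<^bsub>R\<^esub> ?a b = \<zero>\<^bsub>R\<^esub>"
      using t(2) tc scar a[OF b] by (simp add: N.R.m_ac)
    then show "\<exists>t\<in>carrier R - p. t \<otimes>\<^bsub>R\<^esub> ?a b = \<zero>\<^bsub>R\<^esub>"
      using mult[OF t(1)] sB unfolding S_def by blast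
  qed
qed

subsection \<open>The cohomology of Hom(P, N)\<close>

text \<open>\<open>v u\<close> is homotopic to the identity of \<open>P\<close>, so \<open>P\<close>
  is a retract of \<open>F\<close> up to homotopy and precomposition with \<open>v\<close> is
  injective on the cohomology of maps into \<open>N\<close>. Thus \<open>F\<close> may carry the
  finiteness while \<open>P\<close> stays arbitrary. The homotopy identity has its own form at place
  \<open>0\<close>, where no differential leaves.\<close>

locale homotopy_retract =
  fixes R :: "('r, 'x) ring_scheme" and P :: "nat \<Rightarrow> ('r, 'p, 'w) module_scheme" and \<delta> :: "nat \<Rightarrow> 'p \<Rightarrow> 'p"
    and F :: "nat \<Rightarrow> ('r, 'q, 'z) module_scheme" and \<phi> :: "nat \<Rightarrow> 'q \<Rightarrow> 'q"
    and N :: "('r, 'n, 'y) module_scheme"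
    and u :: "nat \<Rightarrow> 'p \<Rightarrow> 'q" and v :: "nat \<Rightarrow> 'q \<Rightarrow> 'p" and h :: "nat \<Rightarrow> 'p \<Rightarrow> 'p"
  assumes P: "module R (P i)" and F: "module R (F i)" and N: "module R N"
    and \<delta>: "\<delta> i \<in> lin_maps R (P (Suc i)) (P i)" and \<phi>: "\<phi> i \<in> lin_maps R (F (Suc i)) (F i)"
    and complex: "x \<in> carrier (P (Suc (Suc i))) \<Longrightarrow> \<delta> i (\<delta> (Suc i) x) = \<zero>\<^bsub>P i\<^esub>"
    and u: "u i \<in> lin_maps R (P i) (F i)" and v: "v i \<in> lin_maps R (F i) (P i)"
    and h: "h i \<in> lin_maps R (P i) (P (Suc i))"
    and u_comm: "x \<in> carrier (P (Suc i)) \<Longrightarrow> \<phi> i (u (Suc i) x) = u i (\<delta> i x)"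
    and v_comm: "y \<in> carrier (F (Suc i)) \<Longrightarrow> \<delta> i (v (Suc i) y) = v i (\<phi> i y)"
    and h_0: "x \<in> carrier (P 0) \<Longrightarrow> \<delta> 0 (h 0 x) = x \<ominus>\<^bsub>P 0\<^esub> v 0 (u 0 x)"
    and h_Suc: "x \<in> carrier (P (Suc i)) \<Longrightarrow>
      \<delta> (Suc i) (h (Suc i) x) = (x \<ominus>\<^bsub>P (Suc i)\<^esub> v (Suc i) (u (Suc i) x)) \<ominus>\<^bsub>P (Suc i)\<^esub> h i (\<delta> i x)"
begin

abbreviation "H i \<equiv> hom_module R (P i) N"
abbreviation "Z i \<equiv> hom_cocycles R P \<delta> N i"
abbreviation "B i \<equiv> hom_coboundaries R P \<delta> N i"
abbreviation "HZ i \<equiv> (H i)\<lparr>carrier := Z i\<rparr>"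

interpretation N: module R N by (rule N)

lemma cocycles_iff:
  "f \<in> Z i \<longleftrightarrow> f \<in> lin_maps R (P i) N \<and> f \<in> extensional (carrier (P i)) \<and>
     (\<forall>x\<in>carrier (P (Suc i)). f (\<delta> i x) = \<zero>\<^bsub>N\<^esub>)"
  unfolding hom_cocycles_def a_kernel_def' hom_coboundary_def compose_def
  by (auto simp: restrict_def fun_eq_iff split: if_splits)

lemma cocyclesD:
  assumes "f \<in> Z i"
  shows "f \<in> lin_maps R (P i) N" "x \<in> carrier (P (Suc i)) \<Longrightarrow> f (\<delta> i x) = \<zero>\<^bsub>N\<^esub>"
    "f \<in> carrier (H i)"
  using assms by (auto simp: cocycles_iff)

lemma coboundaries_Suc_iff:
  "f \<in> B (Suc j) \<longleftrightarrow> f \<in> extensional (carrier (P (Suc j))) \<and>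
     (\<exists>g\<in>lin_maps R (P j) N. \<forall>x\<in>carrier (P (Suc j)). f x = g (\<delta> j x))"
proof
  assume "f \<in> B (Suc j)"
  then obtain g where g: "g \<in> carrier (H j)" "f = compose (carrier (P (Suc j))) g (\<delta> j)"
    unfolding hom_coboundaries_def hom_coboundary_def by auto
  then show "f \<in> extensional (carrier (P (Suc j))) \<and>
     (\<exists>g\<in>lin_maps R (P j) N. \<forall>x\<in>carrier (P (Suc j)). f x = g (\<delta> j x))"
    by (auto simp: compose_eq intro!: bexI[of _ g])
next
  assume f: "f \<in> extensional (carrier (P (Suc j))) \<and>
     (\<exists>g\<in>lin_maps R (P j) N. \<forall>x\<in>carrier (P (Suc j)). f x = g (\<delta> j x))"
  then obtain g where g: "g \<in> lin_maps R (P j) N" "\<And>x. x \<in> carrier (P (Suc j)) \<Longrightarrow> f x = g (\<delta> j x)" by blast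
  have "f = hom_coboundary P \<delta> j (restrict g (carrier (P j)))"
  proof (rule extensionalityI)
    show "f \<in> extensional (carrier (P (Suc j)))" using f by blast
    show "hom_coboundary P \<delta> j (restrict g (carrier (P j))) \<in> extensional (carrier (P (Suc j)))"
      unfolding hom_coboundary_def by (rule compose_extensional)
    show "f x = hom_coboundary P \<delta> j (restrict g (carrier (P j))) x" if "x \<in> carrier (P (Suc j))" for x
      using that g(2)[OF that] lin_closed[OF \<delta> that] by (simp add: hom_coboundary_def compose_eq)
  qed
  then show "f \<in> B (Suc j)"
    unfolding hom_coboundaries_def using restrict_lin_maps[OF P g(1)] by (simp del: hom_module_simps)
qed

lemma coboundariesI:
  assumes "f \<in> extensional (carrier (P (Suc j)))" "g \<in> lin_maps R (P j) N"
    and "\<And>x. x \<in> carrier (P (Suc j)) \<Longrightarrow> f x = g (\<delta> j x)"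
  shows "f \<in> B (Suc j)"
  unfolding coboundaries_Suc_iff using assms by (intro conjI bexI[of _ g] ballI)

lemma submodule_cocycles: "submodule (Z i) R (H i)"
proof -
  interpret H: module R "H i" by (rule module_hom_module[OF P N])
  interpret Pi: module R "P i" by (rule P)
  have \<delta>c: "\<delta> i x \<in> carrier (P i)" if "x \<in> carrier (P (Suc i))" for x by (rule lin_closed[OF \<delta> that])
  show ?thesis
  proof (rule H.submoduleI')
    show "Z i \<subseteq> carrier (H i)" using cocyclesD(3) by blast
    have "\<zero>\<^bsub>H i\<^esub> \<in> carrier (H i)" by (rule H.M.zero_closed)
    then show "\<zero>\<^bsub>H i\<^esub> \<in> Z i" using \<delta>c by (auto simp: cocycles_iff)
    show "a \<oplus>\<^bsub>H i\<^esub> b \<in> Z i" if "a \<in> Z i" "b \<in> Z i" for a b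
      using H.M.a_closed[OF cocyclesD(3)[OF that(1)] cocyclesD(3)[OF that(2)]] \<delta>c cocyclesD(2)[OF that(1)]
        cocyclesD(2)[OF that(2)] by (auto simp: cocycles_iff)
    show "r \<odot>\<^bsub>H i\<^esub> a \<in> Z i" if "r \<in> carrier R" "a \<in> Z i" for r a
      using H.smult_closed[OF that(1) cocyclesD(3)[OF that(2)]] \<delta>c cocyclesD(2)[OF that(2)] that(1)
      by (auto simp: cocycles_iff)
  qed
qed

lemma module_HZ: "module R (HZ i)"
  by (rule submodule.submodule_is_module[OF submodule_cocycles module_hom_module[OF P N]])

lemma submodule_coboundaries: "submodule (B i) R (HZ i)"
proof (cases i)
  case 0
  have "B i = {\<zero>\<^bsub>HZ i\<^esub>}" using 0 by (simp add: hom_coboundaries_def)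
  then show ?thesis using N.R.submodule_singleton_zero[OF module_HZ] by metis
next
  case (Suc j)
  interpret HZ: module R "HZ i" by (rule module_HZ)
  note M = module_hom_module[OF P[of i] N]
  interpret H: module R "H i" by (rule M)
  have ext: "f \<in> extensional (carrier (P (Suc j)))" if "f \<in> B i" for f
    using that Suc coboundaries_Suc_iff by blast
  show ?thesis
  proof (rule HZ.submoduleI')
    show BZ: "B i \<subseteq> carrier (HZ i)"
    proof
      fix f assume "f \<in> B i"
      then obtain g where f: "f \<in> extensional (carrier (P (Suc j)))" and g: "g \<in> lin_maps R (P j) N"
        and fg: "\<And>x. x \<in> carrier (P (Suc j)) \<Longrightarrow> f x = g (\<delta> j x)"
        using Suc coboundaries_Suc_iff by blast
      interpret Ps: module R "P (Suc j)" by (rule P)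
      have L: "(\<lambda>x. g (\<delta> j x)) \<in> lin_maps R (P (Suc j)) N" by (rule lin_comp[OF g \<delta>])
      have "f \<in> lin_maps R (P (Suc j)) N"
        using lin_mapsD[OF L] by (intro lin_mapsI) (simp_all add: fg)
      moreover have "f (\<delta> (Suc j) x) = \<zero>\<^bsub>N\<^esub>" if "x \<in> carrier (P (Suc (Suc j)))" for x
        using fg[OF lin_closed[OF \<delta> that]] complex[OF that] lin_zero[OF P N g] by simp
      ultimately show "f \<in> carrier (HZ i)" using f by (simp add: cocycles_iff Suc)
    qed
    have \<delta>c: "\<delta> j x \<in> carrier (P j)" if "x \<in> carrier (P (Suc j))" for x by (rule lin_closed[OF \<delta> that])
    show "\<zero>\<^bsub>HZ i\<^esub> \<in> B i"
      unfolding Suc by (rule coboundariesI[OF _ lin_maps_zero[OF N]]) simp_all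
    show "a \<oplus>\<^bsub>HZ i\<^esub> b \<in> B i" if ab: "a \<in> B i" "b \<in> B i" for a b
    proof -
      obtain g where g: "g \<in> lin_maps R (P j) N" "\<And>x. x \<in> carrier (P (Suc j)) \<Longrightarrow> a x = g (\<delta> j x)"
        using ab(1) Suc coboundaries_Suc_iff by blast
      obtain g' where g': "g' \<in> lin_maps R (P j) N" "\<And>x. x \<in> carrier (P (Suc j)) \<Longrightarrow> b x = g' (\<delta> j x)"
        using ab(2) Suc coboundaries_Suc_iff by blast
      show ?thesis
        unfolding Suc by (rule coboundariesI[OF _ lin_maps_add[OF N g(1) g'(1)]]) (simp_all add: g(2) g'(2))
    qed
    show "r \<odot>\<^bsub>HZ i\<^esub> a \<in> B i" if r: "r \<in> carrier R" and ab: "a \<in> B i" for r a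
    proof -
      obtain g where g: "g \<in> lin_maps R (P j) N" "\<And>x. x \<in> carrier (P (Suc j)) \<Longrightarrow> a x = g (\<delta> j x)"
        using ab Suc coboundaries_Suc_iff by blast
      show ?thesis
        unfolding Suc by (rule coboundariesI[OF _ lin_maps_smult[OF N g(1) r]]) (simp_all add: g(2))
    qed
  qed
qed

text \<open>Applying the cocycle \<open>f\<close> to the homotopy identity gives
  \<open>f = f v u + f h \<delta>\<close>. If \<open>f v = g \<phi>\<close>, then
  \<open>f v u = g u \<delta>\<close>, so \<open>f = (g u + f h) \<delta>\<close>.\<close>

lemma coboundary_of_factor:
  assumes f: "f \<in> Z (Suc j)" and g: "g \<in> lin_maps R (F j) N"
    and fg: "\<And>y. y \<in> carrier (F (Suc j)) \<Longrightarrow> f (v (Suc j) y) = g (\<phi> j y)"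
  shows "f \<in> B (Suc j)"
proof -
  interpret Ps: module R "P (Suc j)" by (rule P)
  note fl = cocyclesD(1)[OF f]
  have gu: "(\<lambda>x. g (u j x)) \<in> lin_maps R (P j) N" by (rule lin_comp[OF g u])
  have fh: "(\<lambda>x. f (h j x)) \<in> lin_maps R (P j) N" by (rule lin_comp[OF fl h])
  have "f x = g (u j (\<delta> j x)) \<oplus>\<^bsub>N\<^esub> f (h j (\<delta> j x))" if x: "x \<in> carrier (P (Suc j))" for x
  proof -
    have dx: "\<delta> j x \<in> carrier (P j)" by (rule lin_closed[OF \<delta> x])
    have ux: "u (Suc j) x \<in> carrier (F (Suc j))" by (rule lin_closed[OF u x])
    have vux: "v (Suc j) (u (Suc j) x) \<in> carrier (P (Suc j))" by (rule lin_closed[OF v ux])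
    have hdx: "h j (\<delta> j x) \<in> carrier (P (Suc j))" by (rule lin_closed[OF h dx])
    have hx: "h (Suc j) x \<in> carrier (P (Suc (Suc j)))" by (rule lin_closed[OF h x])
    have "\<zero>\<^bsub>N\<^esub> = f ((x \<ominus>\<^bsub>P (Suc j)\<^esub> v (Suc j) (u (Suc j) x)) \<ominus>\<^bsub>P (Suc j)\<^esub> h j (\<delta> j x))"
      using cocyclesD(2)[OF f hx] h_Suc[OF x] by simp
    also have "\<dots> = (f x \<ominus>\<^bsub>N\<^esub> f (v (Suc j) (u (Suc j) x))) \<ominus>\<^bsub>N\<^esub> f (h j (\<delta> j x))"
      using lin_minus[OF P N fl _ hdx] lin_minus[OF P N fl x vux] x vux by simp
    finally have "(f x \<ominus>\<^bsub>N\<^esub> f (v (Suc j) (u (Suc j) x))) = f (h j (\<delta> j x))"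
      using N.minus_eq_zero_iff[of "f x \<ominus>\<^bsub>N\<^esub> f (v (Suc j) (u (Suc j) x))" "f (h j (\<delta> j x))"]
        lin_closed[OF fl x] lin_closed[OF fl vux] lin_closed[OF fl hdx] by simp
    moreover have "f x = f (v (Suc j) (u (Suc j) x)) \<oplus>\<^bsub>N\<^esub> (f x \<ominus>\<^bsub>N\<^esub> f (v (Suc j) (u (Suc j) x)))"
      using lin_closed[OF fl x] lin_closed[OF fl vux] by (simp add: a_minus_def N.M.a_lcomm N.M.r_neg)
    ultimately show ?thesis using fg[OF ux] u_comm[OF x] by simp
  qed
  then show ?thesis
    using f by (intro coboundariesI[OF _ lin_maps_add[OF N gu fh]]) (auto simp: cocycles_iff)
qed

text \<open>The case \<open>g = 0\<close>. In degree \<open>0\<close>, where zero is the only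
  coboundary, the homotopy identity gives \<open>f = 0\<close> outright.\<close>

lemma coboundary_of_zero:
  assumes f: "f \<in> Z i" and f0: "\<And>y. y \<in> carrier (F i) \<Longrightarrow> f (v i y) = \<zero>\<^bsub>N\<^esub>"
  shows "f \<in> B i"
proof (cases i)
  case 0
  interpret Ps: module R "P 0" by (rule P)
  note fl = cocyclesD(1)[OF f]
  have "f x = \<zero>\<^bsub>N\<^esub>" if x: "x \<in> carrier (P 0)" for x
  proof -
    have ux: "u 0 x \<in> carrier (F 0)" by (rule lin_closed[OF u x])
    have vux: "v 0 (u 0 x) \<in> carrier (P 0)" by (rule lin_closed[OF v ux])
    have hx: "h 0 x \<in> carrier (P (Suc 0))" by (rule lin_closed[OF h x])
    have fl0: "f \<in> lin_maps R (P 0) N" using fl 0 by simp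
    have "\<zero>\<^bsub>N\<^esub> = f (x \<ominus>\<^bsub>P 0\<^esub> v 0 (u 0 x))"
      using cocyclesD(2)[OF f, of "h 0 x"] h_0[OF x] hx 0 by simp
    also have "\<dots> = f x \<ominus>\<^bsub>N\<^esub> f (v 0 (u 0 x))" by (rule lin_minus[OF P N fl0 x vux])
    finally have "f x \<ominus>\<^bsub>N\<^esub> f (v 0 (u 0 x)) = \<zero>\<^bsub>N\<^esub>" by simp
    moreover have "f (v 0 (u 0 x)) = \<zero>\<^bsub>N\<^esub>" using f0[of "u 0 x"] ux 0 by simp
    ultimately show ?thesis using N.minus_eq_zero_iff[OF lin_closed[OF fl0 x] N.M.zero_closed] by simp
  qed
  then have "f = (\<lambda>x\<in>carrier (P 0). \<zero>\<^bsub>N\<^esub>)"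
    using f 0 by (intro extensionalityI[of _ "carrier (P 0)"]) (auto simp: cocycles_iff)
  then show ?thesis using 0 by (simp add: hom_coboundaries_def)
next
  case (Suc j)
  show ?thesis unfolding Suc
    by (rule coboundary_of_factor[OF f[unfolded Suc] lin_maps_zero[OF N]]) (use f0 Suc in simp)
qed

lemma HZ_minus:
  assumes f: "f \<in> Z i" and g: "g \<in> Z i"
  shows "f \<ominus>\<^bsub>HZ i\<^esub> g \<in> Z i" "x \<in> carrier (P i) \<Longrightarrow> (f \<ominus>\<^bsub>HZ i\<^esub> g) x = f x \<ominus>\<^bsub>N\<^esub> g x"
proof -
  interpret HZ: module R "HZ i" by (rule module_HZ)
  have g': "g \<in> carrier (HZ i)" and f': "f \<in> carrier (HZ i)" using f g by auto
  show "f \<ominus>\<^bsub>HZ i\<^esub> g \<in> Z i" using HZ.M.minus_closed[OF f' g'] by simp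
  assume x: "x \<in> carrier (P i)"
  have "\<ominus>\<^bsub>HZ i\<^esub> g = (\<ominus>\<^bsub>R\<^esub> \<one>\<^bsub>R\<^esub>) \<odot>\<^bsub>HZ i\<^esub> g"
    using HZ.smult_l_minus[OF N.R.one_closed g'] HZ.smult_one[OF g'] by simp
  then show "(f \<ominus>\<^bsub>HZ i\<^esub> g) x = f x \<ominus>\<^bsub>N\<^esub> g x"
    using x lin_closed[OF cocyclesD(1)[OF g] x] by (simp add: a_minus_def N.smult_l_minus)
qed

end

text \<open>A class is represented by the coordinates of the values that the pulled back cocycle takes on
  the basis of \<open>F i\<close>; these coordinates range over a finite free module.\<close>

lemma noetherian_cohomology:
  fixes m :: "nat \<Rightarrow> nat"
  assumes "cring R" "noetherian_ring R"
    and retract: "homotopy_retract R P \<delta> (\<lambda>i. fvec R {..<m i}) \<phi> N u v h"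
    and fgN: "fin_gen_module R N"
  shows "noetherian_module R (hom_cohomology R P \<delta> N i)"
proof -
  interpret cring R by fact
  interpret homotopy_retract R P \<delta> "\<lambda>i. fvec R {..<m i}" \<phi> N u v h by (rule retract)
  interpret N: module R N by (rule N)
  obtain q \<psi> where \<psi>: "\<psi> \<in> lin_maps R (fvec R {..<q::nat}) N" "\<psi> ` carrier (fvec R {..<q}) = carrier N"
    by (rule fin_gen_module_presentation[OF fgN])
  let ?D = "{..<m i} \<times> {..<q}" and ?E = "hom_cohomology R P \<delta> N i"
  interpret HZ: module R "HZ i" by (rule module_HZ)
  interpret D: module R "fvec R ?D" by (rule module_fvec)
  note B = submodule_coboundaries[of i]
  have E_def: "?E = quot_module (HZ i) (B i)" by (simp add: hom_cohomology_def)
  let ?c = "a_r_coset (HZ i) (B i)"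
  note Q = HZ.quot_module_simps[OF B, folded E_def]
  interpret E: module R ?E unfolding E_def by (rule HZ.module_quot_module[OF B])
  have ev: "v i (unit_vec R k) \<in> carrier (P i)" if "k < m i" for k
    using that by (intro lin_closed[OF v] unit_vec_closed) simp
  have row: "(\<lambda>j. c (k, j)) \<in> carrier (fvec R {..<q})" if "c \<in> carrier (fvec R ?D)" for c k
    unfolding fvec_carrier[where I = "{..<q}"] using fvec_coord[OF that] fvec_outside[OF that] by simp
  \<comment> \<open>Coordinates of an element of \<open>N\<close> over its generators are not
    unique, so \<open>pre K\<close> collects all coordinate vectors of all cocycles whose class lies
    in \<open>K\<close>.\<close>
  define pre where "pre K = {c \<in> carrier (fvec R ?D). \<exists>f\<in>Z i. ?c f \<in> K \<and>
    (\<forall>k<m i. f (v i (unit_vec R k)) = \<psi> (\<lambda>j. c (k, j)))}" for K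
  have pre_sub: "submodule (pre K) R (fvec R ?D)" if K: "submodule K R ?E" for K
  proof (rule D.submoduleI')
    note KE = E.submoduleE[OF K]
    show "pre K \<subseteq> carrier (fvec R ?D)" by (auto simp: pre_def)
    have z: "\<zero>\<^bsub>HZ i\<^esub> \<in> Z i" using HZ.M.zero_closed by simp
    have "?c \<zero>\<^bsub>HZ i\<^esub> = \<zero>\<^bsub>?E\<^esub>" using HZ.coset_zero[OF B] Q(2) by simp
    then have "?c \<zero>\<^bsub>HZ i\<^esub> \<in> K" using E.submodule_zero[OF K] by simp
    moreover have "\<forall>k<m i. \<zero>\<^bsub>HZ i\<^esub> (v i (unit_vec R k)) = \<psi> (\<lambda>j. \<zero>\<^bsub>R\<^esub>)"
      using ev lin_zero[OF module_fvec N \<psi>(1)] by simp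
    ultimately show "\<zero>\<^bsub>fvec R ?D\<^esub> \<in> pre K"
      unfolding pre_def using z fvec_closed(4)[of ?D] by auto
  next
    note KE = E.submoduleE[OF K]
    fix a b assume "a \<in> pre K" "b \<in> pre K"
    then obtain f g where ab: "a \<in> carrier (fvec R ?D)" "b \<in> carrier (fvec R ?D)"
      and fg: "f \<in> Z i" "g \<in> Z i" "?c f \<in> K" "?c g \<in> K"
      and e: "\<forall>k<m i. f (v i (unit_vec R k)) = \<psi> (\<lambda>j. a (k, j))" "\<forall>k<m i. g (v i (unit_vec R k)) = \<psi> (\<lambda>j. b (k, j))"
      unfolding pre_def by blast
    have "f \<oplus>\<^bsub>HZ i\<^esub> g \<in> Z i" using HZ.M.a_closed[of f g] fg by simp
    moreover have "?c (f \<oplus>\<^bsub>HZ i\<^esub> g) \<in> K"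
      using KE(5)[OF fg(3,4)] Q(3)[of f g] fg by simp
    moreover have "\<forall>k<m i. (f \<oplus>\<^bsub>HZ i\<^esub> g) (v i (unit_vec R k)) = \<psi> (\<lambda>j. a (k, j) \<oplus>\<^bsub>R\<^esub> b (k, j))"
      using e ev lin_add[OF \<psi>(1) row[OF ab(1)] row[OF ab(2)]] by simp
    ultimately show "a \<oplus>\<^bsub>fvec R ?D\<^esub> b \<in> pre K"
      unfolding pre_def using fvec_closed(2)[OF ab] by auto
  next
    note KE = E.submoduleE[OF K]
    fix r a assume r: "r \<in> carrier R" and "a \<in> pre K"
    then obtain f where ab: "a \<in> carrier (fvec R ?D)" and fg: "f \<in> Z i" "?c f \<in> K"
      and e: "\<forall>k<m i. f (v i (unit_vec R k)) = \<psi> (\<lambda>j. a (k, j))"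
      unfolding pre_def by blast
    have "r \<odot>\<^bsub>HZ i\<^esub> f \<in> Z i" using HZ.smult_closed[OF r, of f] fg by simp
    moreover have "?c (r \<odot>\<^bsub>HZ i\<^esub> f) \<in> K"
      using KE(4)[OF r fg(2)] Q(4)[OF r, of f] fg by simp
    moreover have "\<forall>k<m i. (r \<odot>\<^bsub>HZ i\<^esub> f) (v i (unit_vec R k)) = \<psi> (\<lambda>j. r \<otimes>\<^bsub>R\<^esub> a (k, j))"
      using e ev lin_smult[OF \<psi>(1) r row[OF ab]] by simp
    ultimately show "r \<odot>\<^bsub>fvec R ?D\<^esub> a \<in> pre K"
      unfolding pre_def using fvec_closed(1)[OF r ab] by auto
  qed
  \<comment> \<open>Two cocycles sharing a coordinate vector agree on the image of \<open>v\<close>,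
    so they differ by a coboundary. Hence \<open>pre\<close> reflects inclusion and the maximal
    condition can be pulled back.\<close>
  have pre_inj: "K' \<subseteq> K" if K: "submodule K R ?E" "submodule K' R ?E" and sub: "pre K' \<subseteq> pre K" for K K'
  proof
    fix e assume e: "e \<in> K'"
    then have "e \<in> carrier ?E" using E.submoduleE(1)[OF K(2)] by auto
    then obtain f where f: "f \<in> Z i" "e = ?c f" unfolding Q(1) by auto
    have "\<exists>w. w \<in> carrier (fvec R {..<q}) \<and> \<psi> w = f (v i (unit_vec R k))" if "k < m i" for k
      using \<psi>(2) lin_closed[OF cocyclesD(1)[OF f(1)] ev[OF that]] by (metis imageE)
    then have "\<forall>k\<in>{..<m i}. \<exists>w. w \<in> carrier (fvec R {..<q}) \<and> \<psi> w = f (v i (unit_vec R k))" by blast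
    from bchoice[OF this] obtain w where
      w: "\<forall>k\<in>{..<m i}. w k \<in> carrier (fvec R {..<q}) \<and> \<psi> (w k) = f (v i (unit_vec R k))" ..
    let ?w = "\<lambda>(k, j). if k < m i then w k j else \<zero>\<^bsub>R\<^esub>"
    have "?w \<in> carrier (fvec R ?D)"
      unfolding fvec_carrier[where I = ?D]
    proof (intro conjI allI impI)
      fix kj :: "nat \<times> nat"
      obtain k j where kj: "kj = (k, j)" by (cases kj)
      show "?w kj \<in> carrier R" using w fvec_coord[of "w k"] unfolding kj by auto
      show "?w kj = \<zero>\<^bsub>R\<^esub>" if "kj \<notin> ?D"
        using w fvec_outside[of "w k" R "{..<q}" j] that unfolding kj by auto
    qed
    moreover have "\<forall>k<m i. f (v i (unit_vec R k)) = \<psi> (\<lambda>j. ?w (k, j))" using w by simp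
    ultimately have "?w \<in> pre K'" unfolding pre_def using f e by blast
    then have "?w \<in> pre K" using sub by blast
    then obtain f' where f': "f' \<in> Z i" "?c f' \<in> K" "\<forall>k<m i. f' (v i (unit_vec R k)) = \<psi> (\<lambda>j. ?w (k, j))"
      unfolding pre_def by blast
    have eqk: "f (v i (unit_vec R k)) = f' (v i (unit_vec R k))" if "k \<in> {..<m i}" for k
      using f'(3) w that by simp
    have fv: "(\<lambda>y. f (v i y)) \<in> lin_maps R (fvec R {..<m i}) N" "(\<lambda>y. f' (v i y)) \<in> lin_maps R (fvec R {..<m i}) N"
      using lin_comp[OF cocyclesD(1)[OF f(1)] v] lin_comp[OF cocyclesD(1)[OF f'(1)] v] .
    have "f \<ominus>\<^bsub>HZ i\<^esub> f' \<in> B i"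
    proof (rule coboundary_of_zero[OF HZ_minus(1)[OF f(1) f'(1)]])
      fix y assume y: "y \<in> carrier (fvec R {..<m i})"
      have "f (v i y) = f' (v i y)"
        by (rule lin_maps_fvec_eq[OF N fv _ eqk]) (use y in simp_all)
      then show "(f \<ominus>\<^bsub>HZ i\<^esub> f') (v i y) = \<zero>\<^bsub>N\<^esub>"
        using HZ_minus(2)[OF f(1) f'(1) lin_closed[OF v y]] lin_closed[OF cocyclesD(1)[OF f'(1)] lin_closed[OF v y]]
        by (simp add: a_minus_def N.M.r_neg)
    qed
    then have "?c f = ?c f'" using HZ.coset_eq_iff[OF B, of f f'] f(1) f'(1) by simp
    then show "e \<in> K" using f f' by simp
  qed
  show ?thesis unfolding noetherian_module_def
  proof (intro allI impI)
    fix S assume S: "S \<noteq> {} \<and> (\<forall>K\<in>S. submodule K R ?E)"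
    then obtain K0 where K0: "K0 \<in> S" by blast
    have sub: "submodule K R ?E" if "K \<in> S" for K using S that by blast
    obtain K where K: "K \<in> S" and max: "\<And>K'. K' \<in> S \<Longrightarrow> pre K \<subseteq> pre K' \<Longrightarrow> pre K' = pre K"
      using noetherian_module_maximal[OF noetherian_fvec[OF assms(1,2)] K0 pre_sub[OF sub]]
      by (metis finite_SigmaI finite_lessThan)
    have "K' = K" if K': "K' \<in> S" "K \<subseteq> K'" for K'
    proof -
      have "pre K \<subseteq> pre K'" unfolding pre_def using K'(2) by blast
      then have "pre K' = pre K" using max K'(1) by blast
      then show ?thesis using pre_inj[OF sub[OF K] sub[OF K'(1)]] K'(2) by blast
    qed
    then show "\<exists>K\<in>S. \<forall>K'\<in>S. K \<subseteq> K' \<longrightarrow> K' = K" using K by blast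
  qed
qed

subsection \<open>Local vanishing\<close>

context free_complex
begin

text \<open>Exactness of localization: the saturation of zero is the kernel of the map to the
  localization, so one common denominator turns a local cycle into a cycle over
  \<open>R\<close>.\<close>

lemma exact_mod_local_zero:
  assumes ex: "\<And>i x. x \<in> V (Suc i) \<Longrightarrow> \<phi> i x = (\<lambda>_. \<zero>) \<Longrightarrow> x \<in> \<phi> (Suc i) ` V (Suc (Suc i))"
  shows "exact_mod (saturation R p {\<zero>}) i"
  unfolding exact_mod_def
proof (intro ballI impI)
  let ?J = "saturation R p {\<zero>}"
  have J: "ideal ?J R" by (rule ideal_saturation[OF prime zeroideal])
  fix w assume w: "w \<in> V (Suc i)" and "\<forall>k. \<phi> i w k \<in> ?J"
  then have ex1: "\<exists>s\<in>carrier R - p. s \<otimes> \<phi> i w k = \<zero>" for k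
    unfolding saturation_def by blast
  have "\<exists>s\<in>carrier R - p. \<forall>k\<in>I i. s \<otimes> \<phi> i w k = \<zero>"
    by (rule common_multiple[OF prime fin ex1]) (use w in \<open>simp add: m_assoc\<close>)
  then obtain s where s: "s \<in> carrier R - p" "\<And>k. k \<in> I i \<Longrightarrow> s \<otimes> \<phi> i w k = \<zero>" by blast
  have sc: "s \<in> carrier R" using s by auto
  have "s \<otimes> \<phi> i w k = \<zero>" for k
    using s(2)[of k] fvec_outside[OF phi_closed[OF w], of k] sc by (cases "k \<in> I i") simp_all
  then have "\<phi> i (\<lambda>k. s \<otimes> w k) = (\<lambda>_. \<zero>)" using phi_mult[OF sc w] by simp
  then obtain y where y: "y \<in> V (Suc (Suc i))" "(\<lambda>k. s \<otimes> w k) = \<phi> (Suc i) y"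
    using ex[OF fvec_closed(1)[OF sc w]] by blast
  have "icong R ?J (s \<otimes> w k) (\<phi> (Suc i) y k)" for k
    using fun_cong[OF y(2), of k] phi_coord[OF y(1)] by (simp add: icong_refl[OF J])
  then show "\<exists>s\<in>carrier R - p. \<exists>u\<in>V (Suc (Suc i)). \<forall>k. icong R ?J (s \<otimes> w k) (\<phi> (Suc i) u k)"
    using s(1) y(1) by blast
qed

text \<open>Modulo the saturation of zero, a congruence is an equality after multiplication by some
  \<open>t\<close> outside \<open>p\<close>, and one \<open>t\<close> serves the finitely many
  coordinates of a row.\<close>

lemma coboundary_rows_local_zero:
  assumes "z \<in> coboundary_rows (saturation R p {\<zero>}) i"
  shows "\<exists>s\<in>carrier R - p. \<exists>g\<in>V i. \<forall>v\<in>V (Suc i). s \<otimes> dot R (I (Suc i)) z v = dot R (I i) g (\<phi> i v)"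
proof -
  let ?d = "dot R (I (Suc i))"
  obtain s g where s: "s \<in> carrier R - p" and g: "g \<in> V i" and z: "z \<in> V (Suc i)"
    and c: "\<And>v. v \<in> V (Suc i) \<Longrightarrow> icong R (saturation R p {\<zero>}) (s \<otimes> ?d z v) (dot R (I i) g (\<phi> i v))"
    using assms unfolding coboundary_rows_def by blast
  have sc: "s \<in> carrier R" using s by auto
  obtain f where f: "f \<in> V (Suc i)" "\<And>v. v \<in> V (Suc i) \<Longrightarrow> ?d f v = dot R (I i) g (\<phi> i v)"
    using row_of_functional[OF lin_comp[OF lin_dot[OF fin g] lin] fin] by blast
  have ex: "\<exists>t\<in>carrier R - p. t \<otimes> (s \<otimes> z k) = t \<otimes> f k" if k: "k \<in> I (Suc i)" for k
  proof -
    have "icong R (saturation R p {\<zero>}) (s \<otimes> z k) (f k)"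
      using c[OF unit_vec_closed[OF k]] f(2)[OF unit_vec_closed[OF k]] dot_unit[OF fin z k] dot_unit[OF fin f(1) k] by simp
    then obtain t where t: "t \<in> carrier R - p" "t \<otimes> (s \<otimes> z k \<ominus> f k) = \<zero>"
      unfolding icong_def saturation_def by blast
    have cl: "t \<otimes> (s \<otimes> z k) \<in> carrier R" "t \<otimes> f k \<in> carrier R" "t \<in> carrier R" "s \<otimes> z k \<in> carrier R" "f k \<in> carrier R"
      using t sc z f(1) by auto
    interpret RM: module R "ring_module R" by (rule module_ring_module)
    have "t \<otimes> (s \<otimes> z k) \<ominus> t \<otimes> f k = \<zero>"
      using t(2) cl by (simp add: a_minus_def r_distr r_minus)
    then have "t \<otimes> (s \<otimes> z k) = t \<otimes> f k" using RM.minus_eq_zero_iff[of "t \<otimes> (s \<otimes> z k)" "t \<otimes> f k"] cl by simp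
    then show ?thesis using t(1) by blast
  qed
  have "\<exists>t\<in>carrier R - p. \<forall>k\<in>I (Suc i). t \<otimes> (s \<otimes> z k) = t \<otimes> f k"
  proof (rule common_multiple[OF prime fin ex])
    fix k t r assume "t \<in> carrier R - p" "r \<in> carrier R - p" "t \<otimes> (s \<otimes> z k) = t \<otimes> f k"
    then show "(r \<otimes> t) \<otimes> (s \<otimes> z k) = (r \<otimes> t) \<otimes> f k"
      using sc fvec_coord[OF z, of k] fvec_coord[OF f(1), of k] by (simp add: m_assoc)
  qed
  then obtain t where t: "t \<in> carrier R - p" "\<And>k. k \<in> I (Suc i) \<Longrightarrow> t \<otimes> (s \<otimes> z k) = t \<otimes> f k" by blast
  have tc: "t \<in> carrier R" using t by auto
  have "(\<lambda>k. (t \<otimes> s) \<otimes> z k) = (\<lambda>k. t \<otimes> f k)"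
  proof
    fix k show "(t \<otimes> s) \<otimes> z k = t \<otimes> f k"
      using t(2)[of k] tc sc fvec_coord[OF z, of k] fvec_outside[OF z, of k] fvec_outside[OF f(1), of k]
      by (cases "k \<in> I (Suc i)") (simp_all add: m_assoc)
  qed
  then have "(t \<otimes> s) \<otimes> ?d z v = dot R (I i) (\<lambda>k. t \<otimes> g k) (\<phi> i v)" if v: "v \<in> V (Suc i)" for v
    using dot_algebra(3)[OF fin v _ z, of "t \<otimes> s"] dot_algebra(3)[OF fin v tc f(1)]
      dot_algebra(3)[OF fin phi_closed[OF v] tc g] f(2)[OF v] tc sc by simp
  then show ?thesis using mult_np[OF t(1) s] fvec_closed(1)[OF tc g] by blast
qed

text \<open>Over a point where \<open>N\<close> is free, a cocycle with values in \<open>N\<close> is a combination of cocycles with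
  values in \<open>R\<close>.\<close>

lemma locally_free_cocycle_is_coboundary:
  fixes N :: "('a, 'n, 'y) module_scheme"
  assumes ex: "\<And>i x. x \<in> V (Suc i) \<Longrightarrow> \<phi> i x = (\<lambda>_. \<zero>) \<Longrightarrow> x \<in> \<phi> (Suc i) ` V (Suc (Suc i))"
    and dim: "\<not> chain_below R (saturation R p {\<zero>}) p (Suc j)"
    and N: "module R N" and free: "locally_free_at R N p"
    and f: "f \<in> lin_maps R (F (Suc j)) N" and f0: "\<And>y. y \<in> V (Suc (Suc j)) \<Longrightarrow> f (\<phi> (Suc j) y) = \<zero>\<^bsub>N\<^esub>"
  shows "\<exists>s\<in>carrier R - p. \<exists>g\<in>lin_maps R (F j) N. \<forall>y\<in>V (Suc j). s \<odot>\<^bsub>N\<^esub> f y = g (\<phi> j y)"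
proof -
  interpret N: module R N by (rule N)
  let ?J = "saturation R p {\<zero>}" and ?d = "dot R (I (Suc j))"
  interpret pr: primeideal p R by (rule prime)
  have J: "ideal ?J R" by (rule ideal_saturation[OF prime zeroideal])
  have "\<zero> \<in> p" by (rule additive_subgroup.zero_closed[OF ideal.axioms(1)[OF pr.is_ideal]])
  then have Jp: "?J \<subseteq> p" by (intro saturation_subset_prime[OF prime]) simp
  have sat: "saturated R p ?J" by (rule saturated_saturation[OF prime])
  \<comment> \<open>The resolution is exact at every positive place, so \<open>c = 0\<close>, and
    the dimension is below \<open>Suc j\<close>; the bound \<open>c + d\<close> is met with equality
    at the place \<open>Suc j\<close>.\<close>
  have vanish: "cocycle_rows ?J (Suc j) \<subseteq> coboundary_rows ?J j"
    by (rule cocycle_rows_subset_coboundary_rows[OF J Jp sat exact_mod_local_zero[OF ex] dim, where c = 0]) simp_all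
  obtain s :: 'a and Bs :: "('n \<times> 'a) set set" and \<rho> n where s: "s \<in> carrier R - p" and Bs: "finite Bs"
    and \<rho>: "\<And>b. b \<in> Bs \<Longrightarrow> \<rho> b \<in> V (Suc j)" and n: "\<And>b. b \<in> Bs \<Longrightarrow> n b \<in> carrier N"
    and sf: "\<And>v. v \<in> V (Suc j) \<Longrightarrow> s \<odot>\<^bsub>N\<^esub> f v = (\<Oplus>\<^bsub>N\<^esub>b\<in>Bs. ?d (\<rho> b) v \<odot>\<^bsub>N\<^esub> n b)"
    and ker: "\<And>b v. b \<in> Bs \<Longrightarrow> v \<in> V (Suc j) \<Longrightarrow> f v = \<zero>\<^bsub>N\<^esub> \<Longrightarrow> \<exists>t\<in>carrier R - p. t \<otimes> ?d (\<rho> b) v = \<zero>"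
    using locally_free_coordinates[OF N prime free fin f] by blast
  have sc: "s \<in> carrier R" using s by auto
  have ex1: "\<exists>t\<in>carrier R - p. \<exists>g\<in>V j. \<forall>v\<in>V (Suc j). t \<otimes> ?d (\<rho> b) v = dot R (I j) g (\<phi> j v)" if b: "b \<in> Bs" for b
  proof -
    \<comment> \<open>\<open>f\<close> vanishes on boundaries, so each of its coordinate rows does
      so locally: the coordinates of zero with respect to a basis are zero.\<close>
    have "?d (\<rho> b) (\<phi> (Suc j) y) \<in> ?J" if y: "y \<in> V (Suc (Suc j))" for y
      using ker[OF b phi_closed[OF y] f0[OF y]] \<rho>[OF b] y by (simp add: saturation_def)
    then have "\<rho> b \<in> cocycle_rows ?J (Suc j)" using \<rho>[OF b] by (simp add: cocycle_rows_def)
    then show ?thesis using vanish coboundary_rows_local_zero by blast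
  qed
  have "\<exists>t\<in>carrier R - p. \<forall>b\<in>Bs. \<exists>g\<in>V j. \<forall>v\<in>V (Suc j). t \<otimes> ?d (\<rho> b) v = dot R (I j) g (\<phi> j v)"
  proof (rule common_multiple[OF prime Bs ex1])
    fix b t r assume b: "b \<in> Bs" and tr: "t \<in> carrier R - p" "r \<in> carrier R - p"
      and "\<exists>g\<in>V j. \<forall>v\<in>V (Suc j). t \<otimes> ?d (\<rho> b) v = dot R (I j) g (\<phi> j v)"
    then obtain g where g: "g \<in> V j" "\<And>v. v \<in> V (Suc j) \<Longrightarrow> t \<otimes> ?d (\<rho> b) v = dot R (I j) g (\<phi> j v)" by blast
    have trc: "t \<in> carrier R" "r \<in> carrier R" using tr by auto
    have "(r \<otimes> t) \<otimes> ?d (\<rho> b) v = dot R (I j) (\<lambda>k. r \<otimes> g k) (\<phi> j v)" if v: "v \<in> V (Suc j)" for v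
      using g(2)[OF v] dot_algebra(3)[OF fin phi_closed[OF v] trc(2) g(1)] trc \<rho>[OF b] v by (simp add: m_assoc)
    then show "\<exists>g\<in>V j. \<forall>v\<in>V (Suc j). (r \<otimes> t) \<otimes> ?d (\<rho> b) v = dot R (I j) g (\<phi> j v)"
      using fvec_closed(1)[OF trc(2) g(1)] by blast
  qed
  then obtain t where t: "t \<in> carrier R - p"
    and "\<forall>b\<in>Bs. \<exists>g. g \<in> V j \<and> (\<forall>v\<in>V (Suc j). t \<otimes> ?d (\<rho> b) v = dot R (I j) g (\<phi> j v))" by blast
  from bchoice[OF this(2)] obtain g where
    "\<forall>b\<in>Bs. g b \<in> V j \<and> (\<forall>v\<in>V (Suc j). t \<otimes> ?d (\<rho> b) v = dot R (I j) (g b) (\<phi> j v))" ..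
  then have g: "\<And>b. b \<in> Bs \<Longrightarrow> g b \<in> V j"
    and gd: "\<And>b v. b \<in> Bs \<Longrightarrow> v \<in> V (Suc j) \<Longrightarrow> t \<otimes> ?d (\<rho> b) v = dot R (I j) (g b) (\<phi> j v)" by auto
  have tc: "t \<in> carrier R" using t by auto
  have nB: "n \<in> Bs \<rightarrow> carrier N" using n by auto
  \<comment> \<open>The primitives \<open>g b\<close> of the coordinate rows are recombined with the
    elements \<open>n b\<close> into a primitive of \<open>f\<close> with values in
    \<open>N\<close>.\<close>
  define G where "G w = vec_map N Bs n (\<lambda>b. if b \<in> Bs then dot R (I j) (g b) w else \<zero>)" for w
  have G: "G \<in> lin_maps R (F j) N"
    unfolding G_def by (rule lin_comp[OF lin_vec_map[OF N Bs nB] lin_into_fvec[OF lin_dot[OF fin g]]])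
  have "(t \<otimes> s) \<odot>\<^bsub>N\<^esub> f y = G (\<phi> j y)" if y: "y \<in> V (Suc j)" for y
  proof -
    have fy: "f y \<in> carrier N" by (rule lin_closed[OF f y])
    have dc: "?d (\<rho> b) y \<in> carrier R" if "b \<in> Bs" for b by (rule dot_closed[OF \<rho>[OF that] y])
    have "(t \<otimes> s) \<odot>\<^bsub>N\<^esub> f y = t \<odot>\<^bsub>N\<^esub> (\<Oplus>\<^bsub>N\<^esub>b\<in>Bs. ?d (\<rho> b) y \<odot>\<^bsub>N\<^esub> n b)"
      using N.smult_assoc1[OF tc sc fy] sf[OF y] by simp
    also have "\<dots> = (\<Oplus>\<^bsub>N\<^esub>b\<in>Bs. t \<odot>\<^bsub>N\<^esub> (?d (\<rho> b) y \<odot>\<^bsub>N\<^esub> n b))"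
      by (rule N.finsum_smult_ldistr[OF Bs tc]) (intro Pi_I N.smult_closed dc n)
    also have "\<dots> = G (\<phi> j y)"
      unfolding G_def vec_map_def
    proof (rule N.M.finsum_cong'[OF refl])
      have cl: "dot R (I j) (g b) (\<phi> j y) \<in> carrier R" if "b \<in> Bs" for b
        by (rule dot_closed[OF g[OF that] phi_closed[OF y]])
      show "(\<lambda>b. (if b \<in> Bs then dot R (I j) (g b) (\<phi> j y) else \<zero>) \<odot>\<^bsub>N\<^esub> n b) \<in> Bs \<rightarrow> carrier N"
        using cl n by (intro Pi_I N.smult_closed) simp_all
      fix b assume b: "b \<in> Bs"
      show "t \<odot>\<^bsub>N\<^esub> (?d (\<rho> b) y \<odot>\<^bsub>N\<^esub> n b) = (if b \<in> Bs then dot R (I j) (g b) (\<phi> j y) else \<zero>) \<odot>\<^bsub>N\<^esub> n b"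
        using b gd[OF b y, symmetric] N.smult_assoc1[OF tc dc[OF b] n[OF b]] by simp
    qed
    finally show ?thesis .
  qed
  then show ?thesis using mult_np[OF t s] G by blast
qed

end

subsection \<open>Dimension\<close>

text \<open>A proper ideal that is maximal among those containing \<open>p\<close> is a maximal
  ideal, hence equals \<open>\<mm>\<close>.\<close>

lemma local_ring_contains_prime:
  assumes "noetherian_ring R" and loc: "local_ring R \<mm>" and p: "primeideal p R"
  shows "p \<subseteq> \<mm>"
proof -
  interpret noetherian_ring R by fact
  have cr: "cring R" using loc by (simp add: local_ring_def)
  interpret p: primeideal p R by (rule p)
  define S where "S = {I. ideal I R \<and> p \<subseteq> I \<and> I \<noteq> carrier R}"
  have "p \<in> S" using p.is_ideal p.I_notcarr by (auto simp: S_def)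
  moreover have "ideal I R" if "I \<in> S" for I using that by (simp add: S_def)
  ultimately obtain I where I: "I \<in> S" and max: "\<And>I'. I' \<in> S \<Longrightarrow> I \<subseteq> I' \<Longrightarrow> I' = I"
    using maximal_ideal_exists by metis
  have "maximalideal I R"
  proof (rule maximalidealI)
    show "ideal I R" "carrier R \<noteq> I" using I by (auto simp: S_def)
    show "J = I \<or> J = carrier R" if "ideal J R" "I \<subseteq> J" "J \<subseteq> carrier R" for J
      using max[of J] that I unfolding S_def by blast
  qed
  then have "I = \<mm>" using loc by (simp add: local_ring_def)
  then show ?thesis using I by (simp add: S_def)
qed

text \<open>Since \<open>p\<close> lies strictly inside \<open>\<mm>\<close>, a chain of length
  \<open>d\<close> below \<open>p\<close> would be lengthened by \<open>\<mm>\<close> to one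
  exceeding the dimension.\<close>

lemma no_long_chain_below:
  assumes "noetherian_ring R" and loc: "local_ring R \<mm>" and dim: "krull_dim R = enat d"
    and p: "primeideal p R" "p \<noteq> \<mm>"
  shows "\<not> chain_below R J p d"
proof
  assume "chain_below R J p d"
  then obtain C where C: "prime_chain R d C" "C d \<subseteq> p" unfolding chain_below_def by blast
  have cr: "cring R" and m: "maximalideal \<mm> R" using loc by (simp_all add: local_ring_def)
  have mp: "primeideal \<mm> R" by (rule cring.maximalideal_prime[OF cr m])
  have pm: "p \<subset> \<mm>" using local_ring_contains_prime[OF assms(1) loc p(1)] p(2) by blast
  have "prime_chain R (Suc d) (\<lambda>i. if i \<le> d then C i else \<mm>)"
    unfolding prime_chain_def
  proof (intro conjI allI impI)
    show "primeideal (if i \<le> d then C i else \<mm>) R" for i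
      using C(1) mp by (simp add: prime_chain_def)
    fix i assume "i < Suc d"
    then consider "i < d" | "i = d" by linarith
    then show "(if i \<le> d then C i else \<mm>) \<subset> (if Suc i \<le> d then C (Suc i) else \<mm>)"
      using C pm by cases (auto simp: prime_chain_def)
  qed
  then have "enat (Suc d) \<le> krull_dim R" unfolding krull_dim_def by (intro Sup_upper) blast
  then show False using dim by simp
qed

text \<open>The finite free resolution need not be finite, but a comparison with a projective resolution of
  length \<open>n\<close> contracts it beyond \<open>n\<close>.\<close>

lemma finite_length_hom_cohomology:
  fixes R :: "('r, 'x) ring_scheme" and N :: "('r, 'n, 'z) module_scheme"
  assumes noeth: "noetherian_ring R" and loc: "local_ring R \<mm>" and dim: "krull_dim R = enat d"
    and M: "fin_gen_module R M" and P: "projective_resolution R M P \<delta> \<epsilon>"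
    and P': "projective_resolution R M P' \<delta>' \<epsilon>'" and len: "\<And>i. i > n \<Longrightarrow> carrier (P' i) = {\<zero>\<^bsub>P' i\<^esub>}"
    and N: "fin_gen_module R N" and free: "locally_free_on_punctured_spectrum R \<mm> N"
  shows "finite_length R (hom_cohomology R P \<delta> N d)"
proof -
  have cr: "cring R" and \<mm>: "maximalideal \<mm> R" using loc by (simp_all add: local_ring_def)
  interpret cring R by (rule cr)
  have modM: "module R M" and modN: "module R N" using M N by (simp_all add: fin_gen_module_def)
  obtain m :: "nat \<Rightarrow> nat" and \<phi> \<eta> where F: "resolution R M (\<lambda>i. fvec R {..<m i}) \<phi> \<eta>"
    by (rule finite_free_resolution[OF cr noeth M])
  let ?F = "\<lambda>i. fvec R {..<m i}"
  note RF = resolutionD[OF F]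
  note RP = resolutionD[OF projective_resolution_resolution[OF P]]
  note RP' = resolutionD[OF projective_resolution_resolution[OF P']]
  have projP: "projective_module R (P i)" "projective_module R (P' i)" for i
    using P P' by (simp_all add: projective_resolution_def)
  \<comment> \<open>\<open>u\<close>, \<open>v\<close> and \<open>h\<close> relate the resolution
    \<open>P\<close>, of which no finiteness is known, to the finite free one; cohomology classes
    are transported along them.\<close>
  obtain u where u: "\<And>i. u i \<in> lin_maps R (P i) (?F i)" "\<And>x. x \<in> carrier (P 0) \<Longrightarrow> \<eta> (u 0 x) = \<epsilon> x"
    "\<And>i x. x \<in> carrier (P (Suc i)) \<Longrightarrow> \<phi> i (u (Suc i) x) = u i (\<delta> i x)"
    by (rule comparison[OF modM projective_resolution_resolution[OF P] F
          projective_module_lifts[OF projP(1) RF(1) modM RF(3)] projective_module_lifts[OF projP(1) RF(1) RF(1) RF(2)]]) (rule that, assumption+)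
  obtain v where v: "\<And>i. v i \<in> lin_maps R (?F i) (P i)" "\<And>x. x \<in> carrier (?F 0) \<Longrightarrow> \<epsilon> (v 0 x) = \<eta> x"
    "\<And>i x. x \<in> carrier (?F (Suc i)) \<Longrightarrow> \<delta> i (v (Suc i) x) = v i (\<phi> i x)"
    by (rule comparison[OF modM F projective_resolution_resolution[OF P]
          lifts_fvec[OF RP(1) modM RP(3) finite_lessThan] lifts_fvec[OF RP(1) RP(1) RP(2) finite_lessThan]]) (rule that, assumption+)
  obtain h where h: "\<And>i. h i \<in> lin_maps R (P i) (P (Suc i))"
    "\<And>x. x \<in> carrier (P 0) \<Longrightarrow> \<delta> 0 (h 0 x) = x \<ominus>\<^bsub>P 0\<^esub> v 0 (u 0 x)"
    "\<And>i x. x \<in> carrier (P (Suc i)) \<Longrightarrow>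
      \<delta> (Suc i) (h (Suc i) x) = (x \<ominus>\<^bsub>P (Suc i)\<^esub> v (Suc i) (u (Suc i) x)) \<ominus>\<^bsub>P (Suc i)\<^esub> h i (\<delta> i x)"
    by (rule comparison_homotopy[where A = P and a = \<delta> and \<alpha> = \<epsilon> and B = ?F and b = \<phi> and \<beta> = \<eta> and u = u and v = v,
          OF modM projective_resolution_resolution[OF P]
          projective_module_lifts[OF projP(1) RP(1) RP(1) RP(2)] u v]; (assumption | (rule that; assumption)))
  \<comment> \<open>The second comparison is with the bounded resolution \<open>P'\<close>. Its
    homotopy \<open>k\<close> lives on the free side, in contrast to \<open>h\<close>.\<close>
  obtain u' where u': "\<And>i. u' i \<in> lin_maps R (?F i) (P' i)" "\<And>x. x \<in> carrier (?F 0) \<Longrightarrow> \<epsilon>' (u' 0 x) = \<eta> x"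
    "\<And>i x. x \<in> carrier (?F (Suc i)) \<Longrightarrow> \<delta>' i (u' (Suc i) x) = u' i (\<phi> i x)"
    by (rule comparison[OF modM F projective_resolution_resolution[OF P']
          lifts_fvec[OF RP'(1) modM RP'(3) finite_lessThan] lifts_fvec[OF RP'(1) RP'(1) RP'(2) finite_lessThan]]) (rule that, assumption+)
  obtain v' where v': "\<And>i. v' i \<in> lin_maps R (P' i) (?F i)" "\<And>x. x \<in> carrier (P' 0) \<Longrightarrow> \<eta> (v' 0 x) = \<epsilon>' x"
    "\<And>i x. x \<in> carrier (P' (Suc i)) \<Longrightarrow> \<phi> i (v' (Suc i) x) = v' i (\<delta>' i x)"
    by (rule comparison[OF modM projective_resolution_resolution[OF P'] F
          projective_module_lifts[OF projP(2) RF(1) modM RF(3)] projective_module_lifts[OF projP(2) RF(1) RF(1) RF(2)]]) (rule that, assumption+)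
  obtain k where k: "\<And>i. k i \<in> lin_maps R (?F i) (?F (Suc i))"
    "\<And>x. x \<in> carrier (?F 0) \<Longrightarrow> \<phi> 0 (k 0 x) = x \<ominus>\<^bsub>?F 0\<^esub> v' 0 (u' 0 x)"
    "\<And>i x. x \<in> carrier (?F (Suc i)) \<Longrightarrow>
      \<phi> (Suc i) (k (Suc i) x) = (x \<ominus>\<^bsub>?F (Suc i)\<^esub> v' (Suc i) (u' (Suc i) x)) \<ominus>\<^bsub>?F (Suc i)\<^esub> k i (\<phi> i x)"
    by (rule comparison_homotopy[where A = ?F and a = \<phi> and \<alpha> = \<eta> and B = P' and b = \<delta>' and \<beta> = \<epsilon>' and u = u' and v = v',
          OF modM F lifts_fvec[OF RF(1) RF(1) RF(2) finite_lessThan] u' v']; (assumption | (rule that; assumption)))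
  \<comment> \<open>Beyond \<open>n\<close> the map \<open>v' u'\<close> passes through a zero
    module, so the homotopy identity expresses the identity of the free module through
    \<open>\<phi>\<close> and \<open>k\<close> alone.\<close>
  have split: "x = (\<lambda>j. \<phi> (Suc e) (k (Suc e) x) j \<oplus>\<^bsub>R\<^esub> k e (\<phi> e x) j)"
    if e: "e \<ge> n" and x: "x \<in> carrier (?F (Suc e))" for e x
  proof -
    interpret Fe: module R "?F (Suc e)" by (rule module_fvec)
    have "u' (Suc e) x = \<zero>\<^bsub>P' (Suc e)\<^esub>" using lin_closed[OF u'(1) x] len[of "Suc e"] e by simp
    then have z: "v' (Suc e) (u' (Suc e) x) = \<zero>\<^bsub>?F (Suc e)\<^esub>"
      using lin_zero[OF RP'(1) RF(1) v'(1)] by metis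
    have kx: "k e (\<phi> e x) \<in> carrier (?F (Suc e))" by (rule lin_closed[OF k(1) lin_closed[OF RF(2) x]])
    have "\<phi> (Suc e) (k (Suc e) x) = x \<ominus>\<^bsub>?F (Suc e)\<^esub> k e (\<phi> e x)"
      using k(3)[OF x] x Fe.M.minus_equality[of "\<zero>\<^bsub>?F (Suc e)\<^esub>" "\<zero>\<^bsub>?F (Suc e)\<^esub>"] unfolding z
      by (simp add: a_minus_def del: fvec_simps)
    then have "\<phi> (Suc e) (k (Suc e) x) \<oplus>\<^bsub>?F (Suc e)\<^esub> k e (\<phi> e x) = x"
      using x kx by (simp add: a_minus_def Fe.M.a_assoc Fe.M.l_neg del: fvec_simps)
    then show ?thesis by simp
  qed
  have "homotopy_retract R P \<delta> ?F \<phi> N u v h"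
    by (rule homotopy_retract.intro)
      (rule RP(1) RF(1) modN RP(2) RF(2) u(1) v(1) h(1) | erule RP(8) u(3) v(3) h(2) h(3))+
  then interpret hr: homotopy_retract R P \<delta> ?F \<phi> N u v h .
  let ?E = "hom_cohomology R P \<delta> N d"
  interpret HZ: module R "hr.HZ d" by (rule hr.module_HZ)
  note B = hr.submodule_coboundaries[of d]
  have E_def: "?E = quot_module (hr.HZ d) (hr.B d)" by (simp add: hom_cohomology_def)
  note Q = HZ.quot_module_simps[OF B, folded E_def]
  have modE: "module R ?E" unfolding E_def by (rule HZ.module_quot_module[OF B])
  show ?thesis
  proof (rule finite_length_of_torsion[OF modE noeth noetherian_cohomology[OF cr noeth hr.homotopy_retract_axioms N] \<mm>])
    fix p e assume p: "primeideal p R" "p \<noteq> \<mm>" and e: "e \<in> carrier ?E"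
    have fc: "free_complex R p (\<lambda>i. {..<m i}) \<phi>"
    proof (intro free_complex.intro free_complex_axioms.intro)
      show "cring R" "noetherian_ring R" "primeideal p R" by fact+
      show "\<phi> i (\<phi> (Suc i) x) = (\<lambda>_. \<zero>\<^bsub>R\<^esub>)" if "x \<in> carrier (fvec R {..<m (Suc (Suc i))})" for i x
        using RF(8)[OF that] by simp
      \<comment> \<open>The contraction works from \<open>n\<close> on and is wanted beyond an
        arbitrary \<open>n'\<close>; hence the place \<open>max n n'\<close>.\<close>
      show "\<exists>e\<ge>n'. \<exists>h\<in>lin_maps R (?F (Suc e)) (?F (Suc (Suc e))). \<exists>h'\<in>lin_maps R (?F e) (?F (Suc e)).
          \<forall>v\<in>carrier (?F (Suc e)). v = (\<lambda>j. \<phi> (Suc e) (h v) j \<oplus>\<^bsub>R\<^esub> h' (\<phi> e v) j)" for n'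
        using split[of "max n n'"] k(1)[of "max n n'"] k(1)[of "Suc (max n n')"]
        by (intro exI[of _ "max n n'"] conjI bexI[of _ "k (Suc (max n n'))"] bexI[of _ "k (max n n')"]) auto
    qed (use RF(2) in auto)
    interpret fc: free_complex R p "\<lambda>i. {..<m i}" \<phi> by (rule fc)
    have nochain: "\<not> chain_below R (saturation R p {\<zero>\<^bsub>R\<^esub>}) p d"
      by (rule no_long_chain_below[OF noeth loc dim p])
    have "d \<noteq> 0"
    proof
      assume "d = 0"
      have "prime_chain R 0 (\<lambda>_. p)" using p by (simp add: prime_chain_def)
      then have "chain_below R {} p 0" unfolding chain_below_def by blast
      then show False using no_long_chain_below[OF noeth loc dim p] \<open>d = 0\<close> by blast
    qed
    then obtain j where d: "d = Suc j" by (cases d) auto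
    obtain f where f: "f \<in> hr.Z d" "e = a_r_coset (hr.HZ d) (hr.B d) f" using e unfolding Q(1) by auto
    have fv: "(\<lambda>y. f (v d y)) \<in> lin_maps R (?F d) N" by (rule lin_comp[OF hr.cocyclesD(1)[OF f(1)] v(1)])
    have fv0: "f (v d (\<phi> d y)) = \<zero>\<^bsub>N\<^esub>" if y: "y \<in> carrier (?F (Suc d))" for y
      using hr.cocyclesD(2)[OF f(1) lin_closed[OF v(1) y]] v(3)[OF y] by simp
    have lf: "locally_free_at R N p" using free p unfolding locally_free_on_punctured_spectrum_def by blast
    have "\<exists>s\<in>carrier R - p. \<exists>g\<in>lin_maps R (?F j) N. \<forall>y\<in>carrier (?F (Suc j)). s \<odot>\<^bsub>N\<^esub> f (v d y) = g (\<phi> j y)"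
    proof (rule fc.locally_free_cocycle_is_coboundary[OF _ _ modN lf])
      show "x \<in> \<phi> (Suc i) ` carrier (?F (Suc (Suc i)))" if "x \<in> carrier (?F (Suc i))" "\<phi> i x = (\<lambda>_. \<zero>\<^bsub>R\<^esub>)" for i x
        using RF(6)[OF that(1)] that(2) by simp
      show "\<not> chain_below R (saturation R p {\<zero>\<^bsub>R\<^esub>}) p (Suc j)" using nochain d by simp
      show "(\<lambda>y. f (v d y)) \<in> lin_maps R (?F (Suc j)) N" using fv d by simp
      show "f (v d (\<phi> (Suc j) y)) = \<zero>\<^bsub>N\<^esub>" if "y \<in> carrier (?F (Suc (Suc j)))" for y using fv0[of y] that d by simp
    qed
    then obtain s g where s: "s \<in> carrier R - p" and g: "g \<in> lin_maps R (?F j) N"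
      and sg: "\<And>y. y \<in> carrier (?F (Suc j)) \<Longrightarrow> s \<odot>\<^bsub>N\<^esub> f (v d y) = g (\<phi> j y)" by blast
    have sc: "s \<in> carrier R" using s by auto
    have sf: "s \<odot>\<^bsub>hr.HZ d\<^esub> f \<in> hr.Z d" using HZ.smult_closed[OF sc, of f] f(1) by simp
    \<comment> \<open>The factorization through \<open>\<phi>\<close> found on the free side shows
      that \<open>s f\<close> is a coboundary on the original side.\<close>
    have "s \<odot>\<^bsub>hr.HZ d\<^esub> f \<in> hr.B (Suc j)"
    proof (rule hr.coboundary_of_factor[OF _ g])
      show "s \<odot>\<^bsub>hr.HZ d\<^esub> f \<in> hr.Z (Suc j)" using sf unfolding d .
      show "(s \<odot>\<^bsub>hr.HZ d\<^esub> f) (v (Suc j) y) = g (\<phi> j y)" if "y \<in> carrier (?F (Suc j))" for y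
        using sg[OF that] lin_closed[OF v(1) that] d by simp
    qed
    then have "s \<odot>\<^bsub>hr.HZ d\<^esub> f \<in> hr.B d" using d by simp
    then have "a_r_coset (hr.HZ d) (hr.B d) (s \<odot>\<^bsub>hr.HZ d\<^esub> f) = \<zero>\<^bsub>?E\<^esub>"
    proof -
      assume sB: "s \<odot>\<^bsub>hr.HZ d\<^esub> f \<in> hr.B d"
      have "a_r_coset (hr.HZ d) (hr.B d) (s \<odot>\<^bsub>hr.HZ d\<^esub> f) = a_r_coset (hr.HZ d) (hr.B d) \<zero>\<^bsub>hr.HZ d\<^esub>"
        using sB sf HZ.coset_eq_iff[OF B, of "s \<odot>\<^bsub>hr.HZ d\<^esub> f" "\<zero>\<^bsub>hr.HZ d\<^esub>"] HZ.M.zero_closed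
          HZ.submodule_minus[OF B sB HZ.submodule_zero[OF B]] by simp
      then show ?thesis using HZ.coset_zero[OF B] Q(2) by simp
    qed
    then have "s \<odot>\<^bsub>?E\<^esub> e = \<zero>\<^bsub>?E\<^esub>" using Q(4)[OF sc, of f] f by simp
    then show "\<exists>s\<in>carrier R - p. s \<odot>\<^bsub>?E\<^esub> e = \<zero>\<^bsub>?E\<^esub>" using s by blast
  qed
qed

theorem proposition3p10:
  fixes R :: "('r, 'x) ring_scheme" and \<mm> :: "'r set"
    and M :: "('r, 'm, 'y) module_scheme" and N :: "('r, 'n, 'z) module_scheme" and d :: nat
  assumes "noetherian_ring R"
    and "local_ring R \<mm>"
    and "krull_dim R = enat d"
    and "fin_gen_module R M"
    and "proj_dim R M < \<infinity>"
    and "fin_gen_module R N"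
    and "torsion_free_module R N"
    and "locally_free_on_punctured_spectrum R \<mm> N"
  shows "finite_length R (Ext R d M N)"
proof -
  let ?S = "{enat n | n. \<exists>(P :: nat \<Rightarrow> ('r, ('r, 'm) res_elem) module) \<delta> \<epsilon>.
    projective_resolution R M P \<delta> \<epsilon> \<and> (\<forall>i>n. carrier (P i) = {\<zero>\<^bsub>P i\<^esub>})}"
  \<comment> \<open>In \<open>enat\<close> the infimum of the empty set is
    \<open>\<infinity>\<close>, so finite projective dimension provides a bounded
    resolution.\<close>
  have "?S \<noteq> {}"
  proof
    assume "?S = {}"
    then have "proj_dim R M = Inf {}" unfolding proj_dim_def by (rule arg_cong)
    then show False using assms(5) by (simp add: top_enat_def)
  qed
  then obtain n and P' :: "nat \<Rightarrow> ('r, ('r, 'm) res_elem) module" and \<delta>' \<epsilon>'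
    where P': "projective_resolution R M P' \<delta>' \<epsilon>'" "\<forall>i>n. carrier (P' i) = {\<zero>\<^bsub>P' i\<^esub>}" by blast
  define P\<delta> where "P\<delta> = (SOME (P :: nat \<Rightarrow> ('r, ('r, 'm) res_elem) module, \<delta>). \<exists>\<epsilon>. projective_resolution R M P \<delta> \<epsilon>)"
  obtain P \<delta> where eq: "P\<delta> = (P, \<delta>)" by (cases P\<delta>) auto
  \<comment> \<open>The bounded resolution has the element type that \<open>Ext\<close> prescribes,
    so the choice made there ranges over a nonempty set and yields a genuine resolution, which may
    differ from \<open>P'\<close>.\<close>
  have "case P\<delta> of (P, \<delta>) \<Rightarrow> \<exists>\<epsilon>. projective_resolution R M P \<delta> \<epsilon>"
    unfolding P\<delta>_def by (rule someI[of _ "(P', \<delta>')"]) (use P'(1) in auto)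
  then obtain \<epsilon> where "projective_resolution R M P \<delta> \<epsilon>" unfolding eq by auto
  then have "finite_length R (hom_cohomology R P \<delta> N d)"
    using finite_length_hom_cohomology[OF assms(1-4) _ P'(1) _ assms(6,8)] P'(2) by blast
  moreover have "Ext R d M N = hom_cohomology R P \<delta> N d"
    unfolding Ext_def P\<delta>_def[symmetric] eq by simp
  ultimately show ?thesis by simp
qed

end
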